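(* Let $T[1,n]$ be a text over an alphabet of size $\sigma$ polynomial in $n$, let $k\ge0$ be a fixed integer, and let $\epsilon>0$ be any constant. For the cost of a partition $T=T_1T_2\cdots T_h$ into contiguous substrings defined as $\sum_i\mathrm{cost}(T_i)$, where $\mathrm{cost}$ is either the $k$-th order (non-adaptive) estimate or the $k$-th order adaptive estimate defined in the context, one can compute in $O(n\log_{1+\epsilon}n)$ time and $O(n)$ space a partition of $T$ whose cost is at most $(1+\epsilon)$ times the minimum cost over all partitions of $T$.
   Context: For a string $S$ of length $m$ with $m_c$ occurrences of symbol $c$: $H_0(S)=\frac1m\sum_c m_c\log\frac{m}{m_c}$ and $mH_0^a(S)=\log(m!)-\sum_c\log(m_c!)$ (adaptive). For a length-$k$ string $u$, $u_S$ is the string of symbols following the occurrences of $u$ in $S$, left to right; $H_k(S)=\frac1{|S|}\sum_{u\in\Sigma^k}|u_S|H_0(u_S)$ and $H_k^a(S)=\frac1{|S|}\sum_{u\in\Sigma^k}|u_S|H_0^a(u_S)$. The non-adaptive estimate is $\mathrm{cost}(S)=|S|H_k(S)+f_k(|S|,|\Sigma_S|)$, with $|\Sigma_S|$ the number of distinct symbols in $S$ and $f_k$ a function (model cost / compressor inefficiencies) computable in constant time; the adaptive estimate is $\mathrm{cost}(S)=|S|H_k^a(S)$ (possibly plus a term depending only on $\sigma$). The paper assumes the cost of a substring is positive and at most the cost of any substring of $T$ containing it. Computation is in the word-RAM model with constant-time arithmetic (including logarithms) on $O(\log n)$-bit values. *)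

theory Defs
  imports Complex_Main "HOL-Library.Sublist"
begin

section \<open>Empirical entropies\<close>

definition H0 :: "'a list \<Rightarrow> real" where
  "H0 S = (1 / real (length S)) *
     (\<Sum>c\<in>set S. real (count_list S c) * log 2 (real (length S) / real (count_list S c)))"

definition H0a :: "'a list \<Rightarrow> real" where
  "H0a S = (1 / real (length S)) *
     (log 2 (fact (length S)) - (\<Sum>c\<in>set S. log 2 (fact (count_list S c))))"

text \<open>The string \<open>u\<^sub>S\<close>. An occurrence of \<open>u\<close> that is a suffix of \<open>S\<close> contributes nothing;
  for \<open>u = []\<close> the result is \<open>S\<close> itself.\<close>

definition following :: "'a list \<Rightarrow> 'a list \<Rightarrow> 'a list" where
  "following u S = map (\<lambda>i. S ! (i + length u))
     (filter (\<lambda>i. take (length u) (drop i S) = u) [0..<length S - length u])"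

text \<open>The alphabet of size \<open>\<sigma>\<close> is \<open>{..<\<sigma>}\<close>.\<close>

definition contexts :: "nat \<Rightarrow> nat \<Rightarrow> nat list set" where
  "contexts \<sigma> k = {u. set u \<subseteq> {..<\<sigma>} \<and> length u = k}"

definition Hk :: "nat \<Rightarrow> nat \<Rightarrow> nat list \<Rightarrow> real" where
  "Hk \<sigma> k S = (1 / real (length S)) *
     (\<Sum>u\<in>contexts \<sigma> k. real (length (following u S)) * H0 (following u S))"

definition Hka :: "nat \<Rightarrow> nat \<Rightarrow> nat list \<Rightarrow> real" where
  "Hka \<sigma> k S = (1 / real (length S)) *
     (\<Sum>u\<in>contexts \<sigma> k. real (length (following u S)) * H0a (following u S))"


section \<open>Cost estimates and partitions\<close>

text \<open>\<open>NonAdaptive f\<close> carries the function \<open>f\<^sub>k\<close> of \<open>|S|\<close> and \<open>|\<Sigma>\<^sub>S|\<close>; \<open>Adaptive g\<close> carries the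
  additive term depending only on \<open>\<sigma>\<close>, absent when \<open>g = (\<lambda>_. 0)\<close>.\<close>

datatype estimate = NonAdaptive "nat \<Rightarrow> nat \<Rightarrow> real" | Adaptive "nat \<Rightarrow> real"

fun cost :: "nat \<Rightarrow> nat \<Rightarrow> estimate \<Rightarrow> nat list \<Rightarrow> real" where
  "cost \<sigma> k (NonAdaptive f) S = real (length S) * Hk \<sigma> k S + f (length S) (card (set S))"
| "cost \<sigma> k (Adaptive g) S = real (length S) * Hka \<sigma> k S + g \<sigma>"

text \<open>Costs are monotone on the nonempty substrings of \<open>T\<close>. They are required to be nonnegative
  rather than positive: the adaptive estimate without additive term vanishes on single symbols, so
  that positivity would exclude it.\<close>

definition admissible :: "(nat list \<Rightarrow> real) \<Rightarrow> nat list \<Rightarrow> bool" where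
  "admissible w T \<longleftrightarrow> (\<forall>S S'. S \<noteq> [] \<and> sublist S S' \<and> sublist S' T \<longrightarrow> 0 \<le> w S \<and> w S \<le> w S')"

definition is_partition :: "'a list \<Rightarrow> 'a list list \<Rightarrow> bool" where
  "is_partition T Q \<longleftrightarrow> concat Q = T \<and> [] \<notin> set Q"

definition partition_cost :: "('a list \<Rightarrow> real) \<Rightarrow> 'a list list \<Rightarrow> real" where
  "partition_cost w Q = sum_list (map w Q)"

definition min_partition_cost :: "('a list \<Rightarrow> real) \<Rightarrow> 'a list \<Rightarrow> real" where
  "min_partition_cost w T = Min (partition_cost w ` {Q. is_partition T Q})"

lemma length_le_length_concat: "[] \<notin> set Q \<Longrightarrow> length Q \<le> length (concat Q)"
proof (induction Q)
  case (Cons a Q)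
  then have "1 \<le> length a" by (cases a) auto
  with Cons show ?case by simp
qed simp

lemma finite_partitions: "finite {Q. is_partition T Q}"
proof (rule finite_subset)
  let ?B = "{S. set S \<subseteq> set T \<and> length S \<le> length T}"
  show "{Q. is_partition T Q} \<subseteq> {Q. set Q \<subseteq> ?B \<and> length Q \<le> length T}"
  proof
    fix Q assume "Q \<in> {Q. is_partition T Q}"
    then have Q: "concat Q = T" "[] \<notin> set Q" by (auto simp: is_partition_def)
    have "S \<in> ?B" if "S \<in> set Q" for S
    proof -
      from that obtain X Y where "Q = X @ S # Y" by (meson split_list)
      with Q(1) show ?thesis by auto
    qed
    with Q length_le_length_concat[OF Q(2)]
    show "Q \<in> {Q. set Q \<subseteq> ?B \<and> length Q \<le> length T}" by blast
  qed
  show "finite {Q. set Q \<subseteq> ?B \<and> length Q \<le> length T}"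
    by (intro finite_lists_length_le finite_subset[OF _ finite_lists_length_le[of "set T" "length T"]]) auto
qed

lemma ex_partition: "\<exists>Q. is_partition T Q"
  by (rule exI[of _ "map (\<lambda>x. [x]) T"]) (auto simp: is_partition_def)


section \<open>Word RAM\<close>

text \<open>A word RAM with word length \<open>w\<close> and \<open>M\<close> memory cells, programmed by structured commands.
  Registers and cells hold words, i.e. naturals below \<open>2 ^ w\<close>; arithmetic is modulo \<open>2 ^ w\<close>.
  All real quantities reach the program as words, in fixed-point form with a scale that is
  itself a word: the logarithm yields the integer part of \<open>b * log 2 a\<close>.\<close>

datatype binop = Add | Sub | Mul | Div | Mod | Log

fun apply_op :: "nat \<Rightarrow> binop \<Rightarrow> nat \<Rightarrow> nat \<Rightarrow> nat" where
  "apply_op w Add a b = (a + b) mod 2 ^ w"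
| "apply_op w Sub a b = (a + (2 ^ w - b)) mod 2 ^ w"
| "apply_op w Mul a b = (a * b) mod 2 ^ w"
| "apply_op w Div a b = (a div b) mod 2 ^ w"
| "apply_op w Mod a b = (a mod b) mod 2 ^ w"
| "apply_op w Log a b = nat \<lfloor>real b * log 2 (real a)\<rfloor> mod 2 ^ w"

text \<open>Two's complement encoding of the integer part, saturated at the ends of the range.\<close>

definition signed_word :: "nat \<Rightarrow> real \<Rightarrow> nat" where
  "signed_word w x = nat (max (- (2 ^ (w - 1))) (min (2 ^ (w - 1) - 1) \<lfloor>x\<rfloor>) mod 2 ^ w)"

datatype test = Eq nat nat | Less nat nat

datatype com =
    Skip
  | Const nat nat        \<comment> \<open>destination register, constant\<close>
  | Op binop nat nat nat \<comment> \<open>destination and operand registers\<close>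
  | Extra nat nat nat nat \<comment> \<open>destination, scale and two argument registers\<close>
  | Load nat nat         \<comment> \<open>destination register, register holding the address\<close>
  | Store nat nat        \<comment> \<open>register holding the address, source register\<close>
  | Seq com com
  | Cond test com com
  | Loop test com

text \<open>Registers and memory.\<close>

type_synonym state = "(nat \<Rightarrow> nat) \<times> (nat \<Rightarrow> nat)"

fun holds :: "test \<Rightarrow> state \<Rightarrow> bool" where
  "holds (Eq x y) (r, m) \<longleftrightarrow> r x = r y"
| "holds (Less x y) (r, m) \<longleftrightarrow> r x < r y"

text \<open>\<open>run F w M P s t s'\<close>: started in \<open>s\<close>, program \<open>P\<close> terminates in \<open>s'\<close> after \<open>t\<close> unit-cost steps,
  on a machine that evaluates \<open>F\<close> in constant time. Accessing an address outside \<open>{..<M}\<close> has no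
  transition, so \<open>M\<close> bounds the space.\<close>

inductive run ::
  "(nat \<Rightarrow> nat \<Rightarrow> real) \<Rightarrow> nat \<Rightarrow> nat \<Rightarrow> com \<Rightarrow> state \<Rightarrow> nat \<Rightarrow> state \<Rightarrow> bool"
  for F :: "nat \<Rightarrow> nat \<Rightarrow> real" and w :: nat and M :: nat where
  Skip: "run F w M Skip s 1 s"
| Const: "run F w M (Const x v) (r, m) 1 (r(x := v mod 2 ^ w), m)"
| Op: "run F w M (Op b x y z) (r, m) 1 (r(x := apply_op w b (r y) (r z)), m)"
| Extra: "run F w M (Extra x q y z) (r, m) 1
    (r(x := signed_word w (real (r q) * F (r y) (r z))), m)"
| Load: "r y < M \<Longrightarrow> run F w M (Load x y) (r, m) 1 (r(x := m (r y)), m)"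
| Store: "r x < M \<Longrightarrow> run F w M (Store x y) (r, m) 1 (r, m(r x := r y))"
| Seq: "run F w M c1 s t1 s' \<Longrightarrow> run F w M c2 s' t2 s'' \<Longrightarrow> run F w M (Seq c1 c2) s (t1 + t2) s''"
| CondT: "holds b s \<Longrightarrow> run F w M c1 s t s' \<Longrightarrow> run F w M (Cond b c1 c2) s (t + 1) s'"
| CondF: "\<not> holds b s \<Longrightarrow> run F w M c2 s t s' \<Longrightarrow> run F w M (Cond b c1 c2) s (t + 1) s'"
| LoopF: "\<not> holds b s \<Longrightarrow> run F w M (Loop b c) s 1 s"
| LoopT: "holds b s \<Longrightarrow> run F w M c s t1 s' \<Longrightarrow> run F w M (Loop b c) s' t2 s'' \<Longrightarrow>
    run F w M (Loop b c) s (t1 + t2 + 1) s''"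

inductive_cases run_elims:
  "run F w M Skip s t s'"
  "run F w M (Const x v) s t s'"
  "run F w M (Op b x y z) s t s'"
  "run F w M (Extra x q y z) s t s'"
  "run F w M (Load x y) s t s'"
  "run F w M (Store x y) s t s'"
  "run F w M (Seq c1 c2) s t s'"
  "run F w M (Cond b c1 c2) s t s'"
  "run F w M (Loop b c) s t s'"

lemma run_deterministic:
  "run F w M c s t s' \<Longrightarrow> run F w M c s u s'' \<Longrightarrow> u = t \<and> s'' = s'"
proof (induction arbitrary: u s'' rule: run.induct)
  case (Skip s)
  then show ?case by (rule run_elims(1)) simp
next
  case (Const x v r m)
  then show ?case by (rule run_elims(2)) simp
next
  case (Op b x y z r m)
  then show ?case by (rule run_elims(3)) simp
next
  case (Extra x q y z r m)
  then show ?case by (rule run_elims(4)) simp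
next
  case (Load r y x m)
  from Load(2) show ?case by (rule run_elims(5)) simp
next
  case (Store r x y m)
  from Store(2) show ?case by (rule run_elims(6)) simp
next
  case (Seq c1 s t1 s' c2 t2 sa)
  from Seq.prems show ?case by (rule run_elims(7)) (metis Seq.IH)
next
  case (CondT b s c1 t s' c2)
  from CondT.prems show ?case by (rule run_elims(8)) (auto dest: CondT.IH simp: CondT.hyps(1))
next
  case (CondF b s c2 t s' c1)
  from CondF.prems show ?case by (rule run_elims(8)) (auto dest: CondF.IH simp: CondF.hyps(1))
next
  case (LoopF b s c)
  from LoopF.prems show ?case by (rule run_elims(9)) (use LoopF.hyps in simp)+
next
  case (LoopT b s c t1 s' t2 sa)
  from LoopT.prems LoopT.hyps(1) obtain u1 u2 r
    where u: "u = u1 + u2 + 1" "run F w M c s u1 r" "run F w M (Loop b c) r u2 s''"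
    by (auto elim: run_elims(9))
  from LoopT.IH(1)[OF u(2)] have "u1 = t1" "r = s'" by auto
  with LoopT.IH(2)[of u2 s''] u show ?case by simp
qed

text \<open>The text occupies the first \<open>n\<close> cells; registers 0 and 1 hold \<open>n\<close> and \<open>\<sigma>\<close>.\<close>

definition input_state :: "nat \<Rightarrow> nat \<Rightarrow> nat list \<Rightarrow> state" where
  "input_state w \<sigma> T =
    ((\<lambda>_. 0)(0 := length T mod 2 ^ w, 1 := \<sigma> mod 2 ^ w),
     (\<lambda>i. if i < length T then T ! i mod 2 ^ w else 0))"

text \<open>On termination, register 0 holds the number of pieces and register 1 the address of the array
  of their lengths, in text order.\<close>

fun cut :: "nat list \<Rightarrow> 'a list \<Rightarrow> 'a list list" where
  "cut [] S = []"
| "cut (l # ls) S = take l S # cut ls (drop l S)"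

fun output_partition :: "nat list \<Rightarrow> state \<Rightarrow> nat list list" where
  "output_partition T (r, m) = cut (map m [r 1..<r 1 + r 0]) T"

fun output_in_memory :: "nat \<Rightarrow> state \<Rightarrow> bool" where
  "output_in_memory M (r, m) \<longleftrightarrow> r 1 + r 0 \<le> M"

text \<open>The additive term of an estimate, as made available to programs through \<open>Extra\<close>.\<close>

fun extra_term :: "estimate \<Rightarrow> nat \<Rightarrow> nat \<Rightarrow> real" where
  "extra_term (NonAdaptive f) x y = f x y"
| "extra_term (Adaptive g) x y = g x"

text \<open>Words of \<open>O(log n)\<close> bits; \<open>n + 1\<close> keeps the length positive for \<open>n = 1\<close>.\<close>

definition word_length :: "nat \<Rightarrow> nat \<Rightarrow> nat" where
  "word_length d n = d * nat \<lceil>log 2 (real n + 1)\<rceil>"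

end

theory Submission
  imports Defs
begin

text \<open>
  Since the cost is monotone, a cheapest path from \<open>0\<close> to \<open>n\<close> in the graph of all pieces is nearly
  preserved if each cost is rounded up to one of \<open>O(log n)\<close> geometrically growing classes and, for every
  position and class, only the longest piece within the class is kept: a suffix of a piece is not more
  expensive than the piece. The classes start at the cost of a single symbol and end at \<open>n\<close> times that
  cost, beyond which single symbols are better.

  For a fixed class the far ends are monotone in the start, so that a sliding window finds all of them in
  linear time. The entropy of a window is a difference of two sums over grams, \<open>\<Sum>\<^sub>u \<phi>(n\<^sub>u)\<close> over the
  \<open>k\<close>-grams minus the same sum over the \<open>(k + 1)\<close>-grams, where \<open>\<phi>(m)\<close> is \<open>m log m\<close> or \<open>log m!\<close>; it is
  maintained with counters once all grams have integer names, which radix sorting provides. Tables of all far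
  ends would take \<open>n log n\<close> words, but a monotone sequence takes \<open>2 n\<close> bits, and a word holds
  \<open>\<Omega>(log n)\<close> of them. The dynamic program runs from right to left and reads all these sequences
  simultaneously, moving each of its pointers only to the left.

  All weights are integers obtained by scaling with a word. Rounding errors are at most \<open>N = n + 1\<close> and are
  absorbed by choosing the scale so that a single symbol weighs much more than \<open>N\<close>.
\<close>

section \<open>A structured language over the word RAM\<close>

text \<open>The constant of the bounds is fixed before \<epsilon>, whereas the program, the word
  length and the length from which the bounds hold may depend on \<epsilon>. This shapes the
  storage: the number of classes grows like \<open>log n / log (1 + \<epsilon>)\<close>, and the far
  ends take linear space with a constant free of \<epsilon> only because the number of bits packed
  into one word grows by the same factor. The factor \<open>1 + \<epsilon>\<close> is written as
  \<open>q ^ 4\<close>. At most \<open>q ^ 2\<close> is spent on the ratio of consecutive classes,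
  which has to be rational to be computed with integers, \<open>q\<close> on all rounding errors,
  and \<open>q\<close> on replacing the cost by another weight. The replacement is needed because
  scaling requires a single symbol of reasonable positive cost. The entropy of one symbol is 0, so
  its cost is the additive term alone, which may vanish, or depend arbitrarily on \<sigma> and
  exceed every word. These cases are separated only at the end; everything before works with an
  abstract weight.\<close>

type_synonym vars = "nat \<Rightarrow> nat"
type_synonym arrays = "nat \<Rightarrow> nat \<Rightarrow> nat"

text \<open>\<open>Bin\<close> is arithmetic on naturals and comes with the obligation that nothing overflows;
  \<open>Raw\<close> is arithmetic modulo \<open>2 ^ w\<close>.\<close>

datatype expr =
    K nat
  | V nat
  | Bin binop expr expr
  | Raw binop expr expr
  | Ext expr expr expr
  | Arr nat expr

datatype tst = Lt expr expr | Eql expr expr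

datatype cmd =
    NOP
  | Set nat expr
  | Put nat expr expr
  | Sq cmd cmd (infixr ";;" 60)
  | If tst cmd cmd
  | While tst cmd

text \<open>Expressions are evaluated on a stack of registers growing upwards from \<open>d\<close>.
  Register 99 is constantly 0, so that adding it copies a variable, and register 98 holds the array
  length, by which an array index is multiplied to obtain a base address.\<close>

primrec expr_com :: "expr \<Rightarrow> nat \<Rightarrow> com" where
  "expr_com (K c) d = Const d c"
| "expr_com (V x) d = Op Add d x 99"
| "expr_com (Bin b e f) d = Seq (expr_com e d) (Seq (expr_com f (Suc d)) (Op b d d (Suc d)))"
| "expr_com (Raw b e f) d = Seq (expr_com e d) (Seq (expr_com f (Suc d)) (Op b d d (Suc d)))"
| "expr_com (Ext q y z) d = Seq (expr_com q d) (Seq (expr_com y (Suc d))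
     (Seq (expr_com z (Suc (Suc d))) (Extra d d (Suc d) (Suc (Suc d)))))"
| "expr_com (Arr a e) d = Seq (expr_com e d) (Seq (Const (Suc d) a)
     (Seq (Op Mul (Suc d) (Suc d) 98) (Seq (Op Add d d (Suc d)) (Load d d))))"

primrec expr_time :: "expr \<Rightarrow> nat" where
  "expr_time (K c) = 1"
| "expr_time (V x) = 1"
| "expr_time (Bin b e f) = expr_time e + expr_time f + 1"
| "expr_time (Raw b e f) = expr_time e + expr_time f + 1"
| "expr_time (Ext q y z) = expr_time q + expr_time y + expr_time z + 1"
| "expr_time (Arr a e) = expr_time e + 4"

fun tst_com :: "tst \<Rightarrow> com" where
  "tst_com (Lt e f) = Seq (expr_com e 100) (expr_com f 101)"
| "tst_com (Eql e f) = Seq (expr_com e 100) (expr_com f 101)"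

fun tst_test :: "tst \<Rightarrow> test" where
  "tst_test (Lt e f) = Less 100 101"
| "tst_test (Eql e f) = Eq 100 101"

fun tst_time :: "tst \<Rightarrow> nat" where
  "tst_time (Lt e f) = expr_time e + expr_time f"
| "tst_time (Eql e f) = expr_time e + expr_time f"

text \<open>A \<open>Loop\<close> can only compare registers. The operands of the test are therefore
  computed once before the loop and again at the end of every iteration.\<close>

primrec cmd_com :: "cmd \<Rightarrow> com" where
  "cmd_com NOP = Skip"
| "cmd_com (Set x e) = Seq (expr_com e 100) (Op Add x 100 99)"
| "cmd_com (Put a e f) = Seq (expr_com e 100) (Seq (Const 101 a) (Seq (Op Mul 101 101 98)
     (Seq (Op Add 100 100 101) (Seq (expr_com f 101) (Store 100 101)))))"
| "cmd_com (c1 ;; c2) = Seq (cmd_com c1) (cmd_com c2)"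
| "cmd_com (If b c1 c2) = Seq (tst_com b) (Cond (tst_test b) (cmd_com c1) (cmd_com c2))"
| "cmd_com (While b c) = Seq (tst_com b) (Loop (tst_test b) (Seq (cmd_com c) (tst_com b)))"

text \<open>The value 0 for loops is a dummy: this time is only used together with
  \<open>wp\<close>, which is \<open>False\<close> on loops.\<close>

primrec loopfree_time :: "cmd \<Rightarrow> nat" where
  "loopfree_time NOP = 1"
| "loopfree_time (Set x e) = expr_time e + 1"
| "loopfree_time (Put a e f) = expr_time e + expr_time f + 4"
| "loopfree_time (c1 ;; c2) = loopfree_time c1 + loopfree_time c2"
| "loopfree_time (If b c1 c2) = tst_time b + max (loopfree_time c1) (loopfree_time c2) + 1"
| "loopfree_time (While b c) = 0"

primrec mod_vars :: "cmd \<Rightarrow> nat set" where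
  "mod_vars NOP = {}"
| "mod_vars (Set x e) = {x}"
| "mod_vars (Put a e f) = {}"
| "mod_vars (c1 ;; c2) = mod_vars c1 \<union> mod_vars c2"
| "mod_vars (If b c1 c2) = mod_vars c1 \<union> mod_vars c2"
| "mod_vars (While b c) = mod_vars c"

primrec mod_arrays :: "cmd \<Rightarrow> nat set" where
  "mod_arrays NOP = {}"
| "mod_arrays (Set x e) = {}"
| "mod_arrays (Put a e f) = {a}"
| "mod_arrays (c1 ;; c2) = mod_arrays c1 \<union> mod_arrays c2"
| "mod_arrays (If b c1 c2) = mod_arrays c1 \<union> mod_arrays c2"
| "mod_arrays (While b c) = mod_arrays c"

fun checked_op :: "binop \<Rightarrow> nat \<Rightarrow> nat \<Rightarrow> nat" where
  "checked_op Add a b = a + b"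
| "checked_op Sub a b = a - b"
| "checked_op Mul a b = a * b"
| "checked_op Div a b = a div b"
| "checked_op Mod a b = a mod b"
| "checked_op Log a b = nat \<lfloor>real b * log 2 (real a)\<rfloor>"

definition words_ok :: "nat \<Rightarrow> (nat \<Rightarrow> nat) \<Rightarrow> bool" where
  "words_ok w r \<longleftrightarrow> (\<forall>x. r x < 2 ^ w)"

lemma apply_op_less: "apply_op w b x y < 2 ^ w"
  by (cases b) auto

lemma signed_word_less: "signed_word w x < 2 ^ w"
proof -
  have "0 < (2::int) ^ w" by simp
  then have "y mod 2 ^ w < (2::int) ^ w" for y :: int by (rule pos_mod_bound)
  then have "nat (y mod 2 ^ w) < 2 ^ w" for y :: int
    by (metis nat_less_iff nat_power_eq nat_numeral of_nat_numeral of_nat_power pos_mod_sign \<open>0 < (2::int) ^ w\<close>)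
  then show ?thesis unfolding signed_word_def .
qed

section \<open>Semantics of the structured language and correctness of its translation\<close>

locale machine =
  fixes F :: "nat \<Rightarrow> nat \<Rightarrow> real" and w M N :: nat
  assumes M_word: "M < 2 ^ w" and arrays_fit: "17 * N \<le> M" and w_large: "7 \<le> w"
begin

text \<open>Seventeen arrays of \<open>N\<close> cells, and an eighteenth one that takes the rest of the memory.\<close>

definition in_bounds :: "nat \<Rightarrow> nat \<Rightarrow> bool" where
  "in_bounds a i \<longleftrightarrow> (a < 17 \<and> i < N) \<or> (a = 17 \<and> 17 * N + i < M)"

fun op_ok :: "binop \<Rightarrow> nat \<Rightarrow> nat \<Rightarrow> bool" where
  "op_ok Add a b \<longleftrightarrow> a + b < 2 ^ w"
| "op_ok Sub a b \<longleftrightarrow> b \<le> a"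
| "op_ok Mul a b \<longleftrightarrow> a * b < 2 ^ w"
| "op_ok Div a b \<longleftrightarrow> True"
| "op_ok Mod a b \<longleftrightarrow> True"
| "op_ok Log a b \<longleftrightarrow> nat \<lfloor>real b * log 2 (real a)\<rfloor> < 2 ^ w"

primrec ev :: "expr \<Rightarrow> vars \<Rightarrow> arrays \<Rightarrow> nat" where
  "ev (K c) v A = c"
| "ev (V x) v A = v x"
| "ev (Bin b e f) v A = checked_op b (ev e v A) (ev f v A)"
| "ev (Raw b e f) v A = apply_op w b (ev e v A) (ev f v A)"
| "ev (Ext q y z) v A = signed_word w (real (ev q v A) * F (ev y v A) (ev z v A))"
| "ev (Arr a e) v A = A a (ev e v A)"

primrec ok :: "expr \<Rightarrow> vars \<Rightarrow> arrays \<Rightarrow> bool" where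
  "ok (K c) v A = (c < 2 ^ w)"
| "ok (V x) v A = (x < 98)"
| "ok (Bin b e f) v A = (ok e v A \<and> ok f v A \<and> op_ok b (ev e v A) (ev f v A))"
| "ok (Raw b e f) v A = (ok e v A \<and> ok f v A)"
| "ok (Ext q y z) v A = (ok q v A \<and> ok y v A \<and> ok z v A)"
| "ok (Arr a e) v A = (ok e v A \<and> in_bounds a (ev e v A))"

fun tev :: "tst \<Rightarrow> vars \<Rightarrow> arrays \<Rightarrow> bool" where
  "tev (Lt e f) v A \<longleftrightarrow> ev e v A < ev f v A"
| "tev (Eql e f) v A \<longleftrightarrow> ev e v A = ev f v A"

fun tok :: "tst \<Rightarrow> vars \<Rightarrow> arrays \<Rightarrow> bool" where
  "tok (Lt e f) v A \<longleftrightarrow> ok e v A \<and> ok f v A"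
| "tok (Eql e f) v A \<longleftrightarrow> ok e v A \<and> ok f v A"

definition upd :: "arrays \<Rightarrow> nat \<Rightarrow> nat \<Rightarrow> nat \<Rightarrow> arrays" where
  "upd A a i x = A(a := (A a)(i := x))"

lemma upd_same [simp]: "upd A a i x a = (A a)(i := x)"
  by (simp add: upd_def)

lemma upd_simp [simp]: "NO_MATCH a b \<Longrightarrow> upd A a i x b = (if b = a then (A a)(i := x) else A b)"
  by (auto simp: upd_def)

text \<open>The side conditions on overflow and array bounds are premises of the rules, so that an
  execution certifies them. Its time is the exact running time of the translated program.\<close>

inductive exec :: "cmd \<Rightarrow> vars \<Rightarrow> arrays \<Rightarrow> nat \<Rightarrow> vars \<Rightarrow> arrays \<Rightarrow> bool" where
  NOP: "exec NOP v A 1 v A"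
| Set: "ok e v A \<Longrightarrow> x < 98 \<Longrightarrow> exec (Set x e) v A (expr_time e + 1) (v(x := ev e v A)) A"
| Put: "ok e v A \<Longrightarrow> ok f v A \<Longrightarrow> in_bounds a (ev e v A) \<Longrightarrow>
    exec (Put a e f) v A (expr_time e + expr_time f + 4) v (upd A a (ev e v A) (ev f v A))"
| Sq: "exec c1 v A t1 v' A' \<Longrightarrow> exec c2 v' A' t2 v'' A'' \<Longrightarrow> exec (c1 ;; c2) v A (t1 + t2) v'' A''"
| IfT: "tok b v A \<Longrightarrow> tev b v A \<Longrightarrow> exec c1 v A t v' A' \<Longrightarrow>
    exec (If b c1 c2) v A (tst_time b + t + 1) v' A'"
| IfF: "tok b v A \<Longrightarrow> \<not> tev b v A \<Longrightarrow> exec c2 v A t v' A' \<Longrightarrow>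
    exec (If b c1 c2) v A (tst_time b + t + 1) v' A'"
| WhileF: "tok b v A \<Longrightarrow> \<not> tev b v A \<Longrightarrow> exec (While b c) v A (tst_time b + 1) v A"
| WhileT: "tok b v A \<Longrightarrow> tev b v A \<Longrightarrow> exec c v A t1 v' A' \<Longrightarrow> exec (While b c) v' A' t2 v'' A'' \<Longrightarrow>
    exec (While b c) v A (tst_time b + t1 + t2 + 1) v'' A''"

text \<open>Registers from 100 on are scratch space and remain unconstrained. Abstract arrays are
  total functions; only their entries in bounds correspond to memory cells.\<close>

definition rel :: "(nat \<Rightarrow> nat) \<Rightarrow> (nat \<Rightarrow> nat) \<Rightarrow> vars \<Rightarrow> arrays \<Rightarrow> bool" where
  "rel r m v A \<longleftrightarrow> (\<forall>x<98. r x = v x) \<and> r 98 = N \<and> r 99 = 0 \<and> words_ok w r \<and> words_ok w m \<and>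
     (\<forall>a i. in_bounds a i \<longrightarrow> m (a * N + i) = A a i)"

lemma in_bounds_address: "in_bounds a i \<Longrightarrow> a * N + i < M"
proof -
  assume "in_bounds a i"
  moreover have "a * N + i < 17 * N" if "a < 17" "i < N"
  proof -
    from that have "a * N + N \<le> 17 * N" using mult_le_mono1[of "Suc a" 17 N] by simp
    with that show ?thesis by linarith
  qed
  ultimately show ?thesis using arrays_fit unfolding in_bounds_def by fastforce
qed

lemma in_bounds_17: "in_bounds a i \<Longrightarrow> a \<le> 17"
  by (auto simp: in_bounds_def)

text \<open>An offset in any array but the last is below \<open>N\<close>, so the address ranges of
  the arrays follow each other without overlap. A store thus changes one abstract entry
  only.\<close>

lemma in_bounds_inj:
  assumes "in_bounds a i" "in_bounds b j"
  shows "a * N + i = b * N + j \<longleftrightarrow> a = b \<and> i = j"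
proof
  assume eq: "a * N + i = b * N + j"
  have less: "a' * N + i' < b' * N + j'"
    if "in_bounds a' i'" "in_bounds b' j'" "a' < b'" for a' b' i' j'
  proof -
    from that have "i' < N" by (auto simp: in_bounds_def)
    moreover have "a' * N + N \<le> b' * N" using mult_le_mono1[of "Suc a'" b' N] that by simp
    ultimately show ?thesis by linarith
  qed
  have "a = b"
    using less[OF assms] less[OF assms(2,1)] eq by (metis linorder_cases less_irrefl)
  with eq show "a = b \<and> i = j" by simp
qed simp

lemma checked_op:
  assumes "op_ok b x y" "x < 2 ^ w" "y < 2 ^ w"
  shows "apply_op w b x y = checked_op b x y"
proof (cases b)
  case Sub
  with assms have "x + (2 ^ w - y) = (x - y) + 2 ^ w" by auto
  moreover have "x - y < 2 ^ w" using assms by linarith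
  ultimately show ?thesis using Sub by simp
next
  case Div
  moreover have "x div y < 2 ^ w" using assms(2) div_le_dividend[of x y] by linarith
  ultimately show ?thesis by simp
next
  case Mod
  moreover have "x mod y < 2 ^ w" using assms(2) mod_less_eq_dividend[of x y] by linarith
  ultimately show ?thesis by simp
qed (use assms in auto)

lemma expr_com_witness:
  assumes "run F w M c (r, m) t (r', m)" "r' d = x" "\<And>y. y < d \<Longrightarrow> r' y = r y" "words_ok w r'" "t = u"
  shows "\<exists>r'. run F w M c (r, m) u (r', m) \<and> r' d = x \<and> (\<forall>x<d. r' x = r x) \<and> words_ok w r'"
  using assms by blast

lemma words_ok_upd: "words_ok w r \<Longrightarrow> x < 2 ^ w \<Longrightarrow> words_ok w (r(d := x))"
  by (simp add: words_ok_def)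

text \<open>That registers below \<open>d\<close> survive is what carries the induction: the left
  operand, held in \<open>d\<close>, is not destroyed while the right one is evaluated from
  \<open>Suc d\<close> on.\<close>

lemma expr_com_correct:
  assumes "rel r m v A" "ok e v A" "100 \<le> d"
  shows "\<exists>r'. run F w M (expr_com e d) (r, m) (expr_time e) (r', m) \<and> r' d = ev e v A \<and>
    (\<forall>x<d. r' x = r x) \<and> words_ok w r'"
  using assms
proof (induction e arbitrary: r d)
  case (K c)
  have "words_ok w (r(d := c mod 2 ^ w))" using K by (auto simp: rel_def words_ok_def)
  moreover have "(r(d := c mod 2 ^ w)) d = ev (K c) v A" using K by simp
  moreover have "\<forall>x<d. (r(d := c mod 2 ^ w)) x = r x" by simp
  ultimately show ?case using run.Const[of F w M d c r m] by (auto simp del: fun_upd_apply)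
next
  case (V x)
  let ?r = "r(d := apply_op w Add (r x) (r 99))"
  have "words_ok w ?r" using V by (auto simp: rel_def words_ok_def)
  moreover have "r x < 2 ^ w" "r x = v x" "r 99 = 0" using V unfolding rel_def words_ok_def by (blast | simp)+
  then have "?r d = ev (V x) v A" by simp
  moreover have "\<forall>x<d. ?r x = r x" by simp
  ultimately show ?case using run.Op[of F w M Add d x 99 r m]
    by (auto simp del: fun_upd_apply apply_op.simps)
next
  case (Bin b e f)
  from Bin.IH(1)[of r d] Bin.prems obtain r1 where
    r1: "run F w M (expr_com e d) (r, m) (expr_time e) (r1, m)" "r1 d = ev e v A"
      "\<forall>x<d. r1 x = r x" "words_ok w r1" by auto
  then have "rel r1 m v A" using Bin.prems by (auto simp: rel_def)
  with Bin.IH(2)[of r1 "Suc d"] Bin.prems obtain r2 where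
    r2: "run F w M (expr_com f (Suc d)) (r1, m) (expr_time f) (r2, m)" "r2 (Suc d) = ev f v A"
      "\<forall>x<Suc d. r2 x = r1 x" "words_ok w r2" by auto
  let ?r = "r2(d := apply_op w b (r2 d) (r2 (Suc d)))"
  have "run F w M (expr_com (Bin b e f) d) (r, m) (expr_time e + (expr_time f + 1)) (?r, m)"
    unfolding expr_com.simps by (intro run.Seq[OF r1(1)] run.Seq[OF r2(1)] run.Op)
  moreover have "ev e v A < 2 ^ w" "ev f v A < 2 ^ w"
    using r1(2,4) r2(2,4) unfolding words_ok_def by metis+
  then have "?r d = ev (Bin b e f) v A"
    using checked_op[of b "r2 d" "r2 (Suc d)"] Bin.prems r1 r2 by auto
  moreover have "words_ok w ?r" using r2 by (intro words_ok_upd apply_op_less) auto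
  ultimately show ?case using r1 r2
    by (intro expr_com_witness[of _ r m "expr_time e + (expr_time f + 1)" ?r]) auto
next
  case (Raw b e f)
  from Raw.IH(1)[of r d] Raw.prems obtain r1 where
    r1: "run F w M (expr_com e d) (r, m) (expr_time e) (r1, m)" "r1 d = ev e v A"
      "\<forall>x<d. r1 x = r x" "words_ok w r1" by auto
  then have "rel r1 m v A" using Raw.prems by (auto simp: rel_def)
  with Raw.IH(2)[of r1 "Suc d"] Raw.prems obtain r2 where
    r2: "run F w M (expr_com f (Suc d)) (r1, m) (expr_time f) (r2, m)" "r2 (Suc d) = ev f v A"
      "\<forall>x<Suc d. r2 x = r1 x" "words_ok w r2" by auto
  let ?r = "r2(d := apply_op w b (r2 d) (r2 (Suc d)))"
  have "run F w M (expr_com (Raw b e f) d) (r, m) (expr_time e + (expr_time f + 1)) (?r, m)"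
    unfolding expr_com.simps by (intro run.Seq[OF r1(1)] run.Seq[OF r2(1)] run.Op)
  moreover have "?r d = ev (Raw b e f) v A" using r1 r2 by simp
  moreover have "words_ok w ?r" using r2 by (intro words_ok_upd apply_op_less) auto
  ultimately show ?case using r1 r2
    by (intro expr_com_witness[of _ r m "expr_time e + (expr_time f + 1)" ?r]) auto
next
  case (Ext e f g)
  from Ext.IH(1)[of r d] Ext.prems obtain r1 where
    r1: "run F w M (expr_com e d) (r, m) (expr_time e) (r1, m)" "r1 d = ev e v A"
      "\<forall>x<d. r1 x = r x" "words_ok w r1" by auto
  then have "rel r1 m v A" using Ext.prems by (auto simp: rel_def)
  with Ext.IH(2)[of r1 "Suc d"] Ext.prems obtain r2 where
    r2: "run F w M (expr_com f (Suc d)) (r1, m) (expr_time f) (r2, m)" "r2 (Suc d) = ev f v A"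
      "\<forall>x<Suc d. r2 x = r1 x" "words_ok w r2" by auto
  then have "rel r2 m v A" using Ext.prems r1 by (auto simp: rel_def)
  with Ext.IH(3)[of r2 "Suc (Suc d)"] Ext.prems obtain r3 where
    r3: "run F w M (expr_com g (Suc (Suc d))) (r2, m) (expr_time g) (r3, m)"
      "r3 (Suc (Suc d)) = ev g v A" "\<forall>x<Suc (Suc d). r3 x = r2 x" "words_ok w r3" by auto
  let ?r = "r3(d := signed_word w (real (r3 d) * F (r3 (Suc d)) (r3 (Suc (Suc d)))))"
  have "run F w M (expr_com (Ext e f g) d) (r, m)
      (expr_time e + (expr_time f + (expr_time g + 1))) (?r, m)"
    unfolding expr_com.simps by (intro run.Seq[OF r1(1)] run.Seq[OF r2(1)] run.Seq[OF r3(1)] run.Extra)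
  moreover have "?r d = ev (Ext e f g) v A" using r1 r2 r3 by simp
  ultimately show ?case using r1 r2 r3
    by (intro expr_com_witness[of _ r m "expr_time e + (expr_time f + (expr_time g + 1))" ?r])
      (auto intro!: words_ok_upd signed_word_less)
next
  case (Arr a e)
  from Arr.IH(1)[of r d] Arr.prems obtain r1 where
    r1: "run F w M (expr_com e d) (r, m) (expr_time e) (r1, m)" "r1 d = ev e v A"
      "\<forall>x<d. r1 x = r x" "words_ok w r1" by auto
  have ib: "in_bounds a (ev e v A)" using Arr.prems by simp
  from in_bounds_address[OF ib] M_word have ad: "a * N + ev e v A < 2 ^ w" by linarith
  have "(2::nat) ^ 7 \<le> 2 ^ w" using w_large by (intro power_increasing) auto
  with in_bounds_17[OF ib] have a: "a < 2 ^ w" by simp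
  have N: "r1 98 = N" using r1 Arr.prems by (auto simp: rel_def)
  let ?r2 = "r1(Suc d := a mod 2 ^ w)"
  let ?r3 = "?r2(Suc d := apply_op w Mul (?r2 (Suc d)) (?r2 98))"
  let ?r4 = "?r3(d := apply_op w Add (?r3 d) (?r3 (Suc d)))"
  let ?r = "?r4(d := m (?r4 d))"
  have d4: "?r4 d = a * N + ev e v A" using ad a N Arr.prems r1 by (auto simp: add.commute)
  have "run F w M (expr_com (Arr a e) d) (r, m) (expr_time e + (1 + (1 + (1 + 1)))) (?r, m)"
    unfolding expr_com.simps
    by (intro run.Seq[OF r1(1)] run.Seq[OF run.Const] run.Seq[OF run.Op] run.Load)
      (use d4 in_bounds_address[OF ib] in simp)
  moreover have "?r d = ev (Arr a e) v A"
    using d4 ib Arr.prems by (auto simp: rel_def)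
  moreover have "words_ok w ?r" using r1 Arr.prems
    by (auto simp: words_ok_def apply_op_less rel_def)
  ultimately show ?case using r1
    by (intro expr_com_witness[of _ r m "expr_time e + (1 + (1 + (1 + 1)))" ?r]) auto
qed

lemma tst_com_correct:
  assumes "rel r m v A" "tok b v A"
  shows "\<exists>r'. run F w M (tst_com b) (r, m) (tst_time b) (r', m) \<and> rel r' m v A \<and>
    holds (tst_test b) (r', m) = tev b v A"
proof -
  have *: "\<exists>r'. run F w M (Seq (expr_com e 100) (expr_com f 101)) (r, m) (expr_time e + expr_time f) (r', m) \<and>
     rel r' m v A \<and> r' 100 = ev e v A \<and> r' 101 = ev f v A" if "ok e v A" "ok f v A" for e f
  proof -
    from expr_com_correct[OF assms(1) that(1), of 100] obtain r1 where
      r1: "run F w M (expr_com e 100) (r, m) (expr_time e) (r1, m)" "r1 100 = ev e v A"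
        "\<forall>x<100. r1 x = r x" "words_ok w r1" by auto
    then have rel1: "rel r1 m v A" using assms by (auto simp: rel_def)
    from expr_com_correct[OF this that(2), of 101] obtain r2 where
      r2: "run F w M (expr_com f 101) (r1, m) (expr_time f) (r2, m)" "r2 101 = ev f v A"
        "\<forall>x<101. r2 x = r1 x" "words_ok w r2" by auto
    then have "rel r2 m v A" using rel1 by (auto simp: rel_def)
    with r1 r2 show ?thesis by (auto intro!: exI[of _ r2] run.intros)
  qed
  show ?thesis
  proof (cases b)
    case (Lt e f)
    then show ?thesis using *[of e f] assms by fastforce
  next
    case (Eql e f)
    then show ?thesis using *[of e f] assms by fastforce
  qed
qed

lemma cmd_com_correct:
  "exec c v A t v' A' \<Longrightarrow> rel r m v A \<Longrightarrow>
    \<exists>r' m'. run F w M (cmd_com c) (r, m) t (r', m') \<and> rel r' m' v' A'"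
proof (induction arbitrary: r m rule: exec.induct)
  case (NOP v A)
  then show ?case using run.Skip by fastforce
next
  case (Set e v A x)
  from expr_com_correct[OF Set.prems Set.hyps(1), of 100] obtain r1 where
    r1: "run F w M (expr_com e 100) (r, m) (expr_time e) (r1, m)" "r1 100 = ev e v A"
      "\<forall>x<100. r1 x = r x" "words_ok w r1" by auto
  have "r1 99 = 0" "r1 100 < 2 ^ w" "ev e v A < 2 ^ w"
    using r1 Set.prems by (auto simp: rel_def words_ok_def simp flip: r1(2))
  then have "rel (r1(x := apply_op w Add (r1 100) (r1 99))) m (v(x := ev e v A)) A"
    using r1 Set.prems Set.hyps by (auto simp: rel_def words_ok_def)
  moreover have "run F w M (cmd_com (Set x e)) (r, m) (expr_time e + 1)
    (r1(x := apply_op w Add (r1 100) (r1 99)), m)"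
    unfolding cmd_com.simps by (intro run.Seq[OF r1(1)] run.Op)
  ultimately show ?case by blast
next
  case (Put e v A f a)
  from expr_com_correct[OF Put.prems Put.hyps(1), of 100] obtain r1 where
    r1: "run F w M (expr_com e 100) (r, m) (expr_time e) (r1, m)" "r1 100 = ev e v A"
      "\<forall>x<100. r1 x = r x" "words_ok w r1" by auto
  have ib: "in_bounds a (ev e v A)" using Put.hyps by simp
  from in_bounds_address[OF ib] M_word have ad: "a * N + ev e v A < 2 ^ w" by linarith
  have "(2::nat) ^ 7 \<le> 2 ^ w" using w_large by (intro power_increasing) auto
  with in_bounds_17[OF ib] have a: "a < 2 ^ w" by simp
  have N: "r1 98 = N" using r1 Put.prems by (auto simp: rel_def)
  let ?r2 = "r1(101 := a mod 2 ^ w)"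
  let ?r3 = "?r2(101 := apply_op w Mul (?r2 101) (?r2 98))"
  let ?r4 = "?r3(100 := apply_op w Add (?r3 100) (?r3 101))"
  have d4: "?r4 100 = a * N + ev e v A" using ad a N Put.prems r1 by (auto simp: add.commute)
  have rel4: "rel ?r4 m v A" using r1 Put.prems
    by (auto simp: rel_def words_ok_def)
  from expr_com_correct[OF this Put.hyps(2), of 101] obtain r5 where
    r5: "run F w M (expr_com f 101) (?r4, m) (expr_time f) (r5, m)" "r5 101 = ev f v A"
      "\<forall>x<101. r5 x = ?r4 x" "words_ok w r5" by auto
  have d5: "r5 100 = a * N + ev e v A" using r5(3) d4 by auto
  let ?m = "m(r5 100 := r5 101)"
  have "run F w M (cmd_com (Put a e f)) (r, m)
      (expr_time e + (1 + (1 + (1 + (expr_time f + 1))))) (r5, ?m)"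
    unfolding cmd_com.simps
    by (intro run.Seq[OF r1(1)] run.Seq[OF run.Const] run.Seq[OF run.Op] run.Seq[OF r5(1)] run.Store)
      (use d5 in_bounds_address[OF ib] in simp)
  moreover have "rel r5 ?m v (upd A a (ev e v A) (ev f v A))"
  proof -
    have "?m (b * N + i) = upd A a (ev e v A) (ev f v A) b i" if "in_bounds b i" for b i
      using in_bounds_inj[OF that ib] that Put.prems r5(2) d5 by (auto simp: rel_def upd_def)
    moreover have "words_ok w ?m" using r5(4) Put.prems by (auto simp: rel_def words_ok_def)
    ultimately show ?thesis using rel4 r5 by (auto simp: rel_def)
  qed
  moreover have "expr_time e + (1 + (1 + (1 + (expr_time f + 1)))) = expr_time e + expr_time f + 4"
    by simp
  ultimately show ?case by metis
next
  case (Sq c1 v A t1 v' A' c2 t2 v'' A'')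
  then show ?case by (metis cmd_com.simps(4) run.Seq)
next
  case (IfT b v A c1 t v' A' c2)
  from tst_com_correct[OF IfT.prems IfT.hyps(1)] obtain r1 where
    r1: "run F w M (tst_com b) (r, m) (tst_time b) (r1, m)" "rel r1 m v A"
      "holds (tst_test b) (r1, m)" using IfT.hyps by auto
  from IfT.IH[OF r1(2)] obtain r' m' where
    r': "run F w M (cmd_com c1) (r1, m) t (r', m')" "rel r' m' v' A'" by auto
  have "run F w M (cmd_com (If b c1 c2)) (r, m) (tst_time b + (t + 1)) (r', m')"
    unfolding cmd_com.simps by (intro run.Seq[OF r1(1)] run.CondT r1 r')
  with r' show ?case by (auto simp: algebra_simps)
next
  case (IfF b v A c2 t v' A' c1)
  from tst_com_correct[OF IfF.prems IfF.hyps(1)] obtain r1 where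
    r1: "run F w M (tst_com b) (r, m) (tst_time b) (r1, m)" "rel r1 m v A"
      "\<not> holds (tst_test b) (r1, m)" using IfF.hyps by auto
  from IfF.IH[OF r1(2)] obtain r' m' where
    r': "run F w M (cmd_com c2) (r1, m) t (r', m')" "rel r' m' v' A'" by auto
  have "run F w M (cmd_com (If b c1 c2)) (r, m) (tst_time b + (t + 1)) (r', m')"
    unfolding cmd_com.simps by (intro run.Seq[OF r1(1)] run.CondF r1 r')
  with r' show ?case by (auto simp: algebra_simps)
next
  case (WhileF b v A c)
  from tst_com_correct[OF WhileF.prems WhileF.hyps(1)] obtain r1 where
    r1: "run F w M (tst_com b) (r, m) (tst_time b) (r1, m)" "rel r1 m v A"
      "\<not> holds (tst_test b) (r1, m)" using WhileF.hyps by auto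
  have "run F w M (cmd_com (While b c)) (r, m) (tst_time b + 1) (r1, m)"
    unfolding cmd_com.simps by (intro run.Seq[OF r1(1)] run.LoopF r1)
  with r1 show ?case by auto
next
  case (WhileT b v A c t1 v' A' t2 v'' A'')
  from tst_com_correct[OF WhileT.prems WhileT.hyps(1)] obtain r1 where
    r1: "run F w M (tst_com b) (r, m) (tst_time b) (r1, m)" "rel r1 m v A"
      "holds (tst_test b) (r1, m)" using WhileT.hyps by auto
  from WhileT.IH(1)[OF r1(2)] obtain r2 m2 where
    r2: "run F w M (cmd_com c) (r1, m) t1 (r2, m2)" "rel r2 m2 v' A'" by auto
  from WhileT.IH(2)[OF r2(2)] obtain r3 m3 where
    r3: "run F w M (cmd_com (While b c)) (r2, m2) t2 (r3, m3)" "rel r3 m3 v'' A''" by auto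
  \<comment> \<open>The induction hypothesis speaks about the translation of the whole loop, which
    begins with an evaluation of the test. This evaluation is split off and becomes the end of the
    current iteration.\<close>
  from r3(1) obtain ta tb s4 where
    s: "t2 = ta + tb" "run F w M (tst_com b) (r2, m2) ta s4"
      "run F w M (Loop (tst_test b) (Seq (cmd_com c) (tst_com b))) s4 tb (r3, m3)"
    by (auto elim: run_elims(7))
  have "run F w M (cmd_com (While b c)) (r, m) (tst_time b + ((t1 + ta) + tb + 1)) (r3, m3)"
    unfolding cmd_com.simps
    by (intro run.Seq[OF r1(1)] run.LoopT[OF r1(3) run.Seq[OF r2(1) s(2)] s(3)])
  with r3 s show ?case by (auto simp: algebra_simps)
qed

section \<open>Total correctness with time bounds\<close>

lemma exec_frame:
  "exec c v A t v' A' \<Longrightarrow> (\<forall>x. x \<notin> mod_vars c \<longrightarrow> v' x = v x) \<and> (\<forall>a. a \<notin> mod_arrays c \<longrightarrow> A' a = A a)"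
  by (induction rule: exec.induct) (auto simp: upd_def)

definition ex :: "cmd \<Rightarrow> vars \<Rightarrow> arrays \<Rightarrow> nat \<Rightarrow> (vars \<Rightarrow> arrays \<Rightarrow> bool) \<Rightarrow> bool" where
  "ex c v A t Q \<longleftrightarrow> (\<exists>t' v' A'. exec c v A t' v' A' \<and> t' \<le> t \<and> Q v' A')"

text \<open>Specifications only need to mention what a command computes; everything else is
  inherited from the syntactic sets of modified variables and arrays.\<close>

lemma ex_frame:
  assumes "ex c v A t Q"
    and "\<And>v' A'. Q v' A' \<Longrightarrow> (\<And>x. x \<notin> mod_vars c \<Longrightarrow> v' x = v x) \<Longrightarrow>
      (\<And>a. a \<notin> mod_arrays c \<Longrightarrow> A' a = A a) \<Longrightarrow> R v' A'"
    and "t \<le> t'"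
  shows "ex c v A t' R"
proof -
  from assms(1) obtain u v' A' where e: "exec c v A u v' A'" "u \<le> t" "Q v' A'"
    unfolding ex_def by blast
  from exec_frame[OF e(1)] e(3) have "R v' A'" by (intro assms(2)) auto
  with e assms(3) show ?thesis unfolding ex_def by (meson le_trans)
qed

lemma ex_mono:
  "ex c v A t Q \<Longrightarrow> (\<And>v' A'. Q v' A' \<Longrightarrow> R v' A') \<Longrightarrow> t \<le> t' \<Longrightarrow> ex c v A t' R"
  unfolding ex_def by (meson le_trans)

lemma ex_Sq: "ex c1 v A t1 (\<lambda>v' A'. ex c2 v' A' t2 Q) \<Longrightarrow> t1 + t2 \<le> t \<Longrightarrow> ex (c1 ;; c2) v A t Q"
  unfolding ex_def by (meson exec.Sq add_mono order_trans)

lemma ex_If: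
  assumes "tok b v A" "tev b v A \<Longrightarrow> ex c1 v A t Q" "\<not> tev b v A \<Longrightarrow> ex c2 v A t Q" "tst_time b + t + 1 \<le> t'"
  shows "ex (If b c1 c2) v A t' Q"
proof (cases "tev b v A")
  case True
  with assms(2) obtain u v' A' where "exec c1 v A u v' A'" "u \<le> t" "Q v' A'" unfolding ex_def by auto
  with exec.IfT[OF assms(1) True this(1), of c2] assms(4) show ?thesis unfolding ex_def by force
next
  case False
  with assms(3) obtain u v' A' where "exec c2 v A u v' A'" "u \<le> t" "Q v' A'" unfolding ex_def by auto
  with exec.IfF[OF assms(1) False this(1), of c1] assms(4) show ?thesis unfolding ex_def by force
qed

primrec wp :: "cmd \<Rightarrow> (vars \<Rightarrow> arrays \<Rightarrow> bool) \<Rightarrow> vars \<Rightarrow> arrays \<Rightarrow> bool" where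
  "wp NOP Q v A = Q v A"
| "wp (Set x e) Q v A = (ok e v A \<and> x < 98 \<and> Q (v(x := ev e v A)) A)"
| "wp (Put a e f) Q v A = (ok e v A \<and> ok f v A \<and> in_bounds a (ev e v A) \<and>
     Q v (upd A a (ev e v A) (ev f v A)))"
| "wp (c1 ;; c2) Q v A = wp c1 (wp c2 Q) v A"
| "wp (If b c1 c2) Q v A = (tok b v A \<and> (if tev b v A then wp c1 Q v A else wp c2 Q v A))"
| "wp (While b c) Q v A = False"

lemma ex_wp: "wp c Q v A \<Longrightarrow> loopfree_time c \<le> t \<Longrightarrow> ex c v A t Q"
proof (induction c arbitrary: Q v A t)
  case NOP
  then show ?case unfolding ex_def using exec.NOP by fastforce
next
  case (Set x e)
  then show ?case unfolding ex_def using exec.Set[of e v A x] by fastforce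
next
  case (Put a e f)
  then show ?case unfolding ex_def using exec.Put[of e v A f a] by fastforce
next
  case (Sq c1 c2)
  have "ex c2 v' A' (loopfree_time c2) Q" if "wp c2 Q v' A'" for v' A'
    using Sq.IH(2) that by simp
  moreover have "ex c1 v A (loopfree_time c1) (wp c2 Q)" using Sq.IH(1) Sq.prems by simp
  ultimately have "ex c1 v A (loopfree_time c1) (\<lambda>v' A'. ex c2 v' A' (loopfree_time c2) Q)"
    unfolding ex_def by meson
  then show ?case using Sq.prems by (auto intro: ex_Sq)
next
  case (If b c1 c2)
  show ?case
    by (rule ex_If[where t = "max (loopfree_time c1) (loopfree_time c2)"])
      (use If in \<open>auto split: if_splits\<close>)
qed simp

text \<open>Amortized analysis: \<open>\<Phi>\<close> is a potential that pays for the remaining iterations.\<close>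

lemma ex_While:
  assumes "I v A"
    and "\<And>v A. I v A \<Longrightarrow> tok b v A"
    and "\<And>v A. I v A \<Longrightarrow> tev b v A \<Longrightarrow>
      \<exists>t. ex c v A t (\<lambda>v' A'. I v' A' \<and> \<Phi> v' A' + t + tst_time b + 1 \<le> \<Phi> v A)"
    and "\<And>v A. I v A \<Longrightarrow> \<not> tev b v A \<Longrightarrow> Q v A"
    and "\<Phi> v A + tst_time b + 1 \<le> t"
  shows "ex (While b c) v A t Q"
proof -
  have "I v A \<Longrightarrow> ex (While b c) v A (\<Phi> v A + tst_time b + 1) Q" for v A
  proof (induction "\<Phi> v A" arbitrary: v A rule: less_induct)
    case less
    show ?case
    proof (cases "tev b v A")
      case True
      with assms(3) less.prems obtain t where
        "ex c v A t (\<lambda>v' A'. I v' A' \<and> \<Phi> v' A' + t + tst_time b + 1 \<le> \<Phi> v A)" by blast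
      then obtain t' v' A' where c: "exec c v A t' v' A'" "t' \<le> t" "I v' A'"
        "\<Phi> v' A' + t + tst_time b + 1 \<le> \<Phi> v A" unfolding ex_def by blast
      then have "ex (While b c) v' A' (\<Phi> v' A' + tst_time b + 1) Q" by (intro less.hyps) auto
      then obtain t2 v2 A2 where
        "exec (While b c) v' A' t2 v2 A2" "t2 \<le> \<Phi> v' A' + tst_time b + 1" "Q v2 A2"
        unfolding ex_def by blast
      with exec.WhileT[OF assms(2)[OF less.prems] True c(1) this(1)] c show ?thesis
        unfolding ex_def by (intro exI conjI) auto
    next
      case False
      with exec.WhileF[OF assms(2)[OF less.prems] False, of c] assms(4)[OF less.prems] show ?thesis
        unfolding ex_def by (intro exI conjI) auto
    qed
  qed
  with assms(1,5) show ?thesis unfolding ex_def by (meson le_trans)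
qed

end

section \<open>Naming the symbols and grams of the text\<close>

abbreviation (input) "plus1 e \<equiv> Bin Add e (K 1)"

abbreviation (input) "vn \<equiv> 0::nat"
abbreviation (input) "vQ \<equiv> 2::nat"
abbreviation (input) "vG \<equiv> 3::nat"
abbreviation (input) "vth \<equiv> 4::nat"
abbreviation (input) "vprev \<equiv> 5::nat"
abbreviation (input) "vblk \<equiv> 6::nat"
abbreviation (input) "vi \<equiv> 7::nat"
abbreviation (input) "vj \<equiv> 8::nat"
abbreviation (input) "vHA \<equiv> 9::nat"
abbreviation (input) "vHB \<equiv> 10::nat"
abbreviation (input) "vds \<equiv> 11::nat"
abbreviation (input) "vHA' \<equiv> 12::nat"
abbreviation (input) "vHB' \<equiv> 13::nat"
abbreviation (input) "vds' \<equiv> 14::nat"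
abbreviation (input) "vflag \<equiv> 15::nat"
abbreviation (input) "vp \<equiv> 16::nat"
abbreviation (input) "vB \<equiv> 17::nat"
abbreviation (input) "vZ \<equiv> 18::nat"
abbreviation (input) "vcap \<equiv> 19::nat"
abbreviation (input) "vx \<equiv> 20::nat"
abbreviation (input) "vstamp \<equiv> 21::nat"
abbreviation (input) "vfresh \<equiv> 22::nat"
abbreviation (input) "vy \<equiv> 23::nat"
abbreviation (input) "vpw \<equiv> 24::nat"
abbreviation (input) "vbest \<equiv> 25::nat"
abbreviation (input) "vbch \<equiv> 26::nat"
abbreviation (input) "vJ \<equiv> 27::nat"
abbreviation (input) "vacc \<equiv> 28::nat"
abbreviation (input) "vN \<equiv> 29::nat"

abbreviation (input) "aT \<equiv> 0::nat"
abbreviation (input) "aId \<equiv> 16::nat"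
abbreviation (input) "aHead \<equiv> 2::nat"
abbreviation (input) "aNext \<equiv> 3::nat"
abbreviation (input) "aMark \<equiv> 4::nat"
abbreviation (input) "aName \<equiv> 5::nat"
abbreviation (input) "aSym \<equiv> 6::nat"
abbreviation (input) "aCtx \<equiv> 7::nat"
abbreviation (input) "aPow \<equiv> 8::nat"
abbreviation (input) "aCS \<equiv> 9::nat"
abbreviation (input) "aCC \<equiv> 10::nat"
abbreviation (input) "aCP \<equiv> 11::nat"
abbreviation (input) "aX \<equiv> 12::nat"
abbreviation (input) "aD \<equiv> 13::nat"
abbreviation (input) "aCh \<equiv> 14::nat"
abbreviation (input) "aLen \<equiv> 15::nat"
abbreviation (input) "aTail \<equiv> 17::nat"

section \<open>One pass of radix sorting\<close>

definition push_body :: cmd where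
  "push_body =
     Put aNext (V vp) (Arr aHead (Arr aId (V vp))) ;;
     Put aHead (Arr aId (V vp)) (plus1 (V vp)) ;;
     Set vp (plus1 (V vp))"

text \<open>An iteration either removes one position or moves on to the next list. One loop of at
  most \<open>N + n\<close> iterations thus replaces two nested ones.\<close>

definition pop_body :: "nat \<Rightarrow> cmd" where
  "pop_body m =
     Set vp (Arr aHead (V vx)) ;;
     If (Eql (V vp) (K 0))
       (Set vx (plus1 (V vx)) ;; Set vstamp (plus1 (V vstamp)))
       (Set vp (Bin Sub (V vp) (K 1)) ;;
        Put aHead (V vx) (Arr aNext (V vp)) ;;
        Set vy (K 0) ;;
        If (Lt (Bin Add (V vp) (K m)) (V vn))
          (Set vy (Bin Mod (Bin Div (Arr aT (Bin Add (V vp) (K m))) (V vpw)) (V vN))) NOP ;;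
        If (Eql (Arr aMark (V vy)) (V vstamp)) NOP
          (Put aMark (V vy) (V vstamp) ;; Put aName (V vy) (V vfresh) ;;
           Set vfresh (plus1 (V vfresh))) ;;
        Put aId (V vp) (Arr aName (V vy)))"

text \<open>Renames positions by the pair of their old name and a digit of the symbol at distance \<open>m\<close>.
  Positions are grouped by old name in linked lists (positions are stored with offset 1, so that 0
  ends a list); within a group the table of digits is valid where its mark is the current stamp.\<close>

definition refine :: "nat \<Rightarrow> cmd" where
  "refine m =
     Set vp (K 0) ;;
     While (Lt (V vp) (V vn)) push_body ;;
     Set vfresh (K 0) ;; Set vx (K 0) ;;
     While (Lt (V vx) (V vN)) (pop_body m)"

text \<open>The linked lists in functional form: the last position before \<open>b\<close> with name
  \<open>x\<close>, increased by 1, or 0 if there is none. It is the head of list \<open>x\<close>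
  after pushing the positions below \<open>b\<close>, and the link stored at position
  \<open>b\<close> if \<open>x\<close> is the name of \<open>b\<close>.\<close>

primrec prev_same :: "(nat \<Rightarrow> nat) \<Rightarrow> nat \<Rightarrow> nat \<Rightarrow> nat" where
  "prev_same f x 0 = 0"
| "prev_same f x (Suc b) = (if f b = x then Suc b else prev_same f x b)"

lemma prev_same_0: "prev_same f x b = 0 \<longleftrightarrow> (\<forall>q<b. f q \<noteq> x)"
  by (induction b) (auto simp: less_Suc_eq)

lemma prev_same_Suc: "prev_same f x b = Suc p \<Longrightarrow> p < b \<and> f p = x \<and> (\<forall>q. p < q \<and> q < b \<longrightarrow> f q \<noteq> x)"
  by (induction b) (auto simp: less_Suc_eq split: if_splits)

context machine
begin

lemma ex_then:
  assumes "ex c1 v A t1 P" "\<And>v' A'. P v' A' \<Longrightarrow> ex c2 v' A' t2 Q" "t1 + t2 \<le> t"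
  shows "ex (c1 ;; c2) v A t Q"
  by (rule ex_Sq[OF ex_mono[OF assms(1,2)] assms(3)]) simp_all

lemma ex_step:
  assumes "ex c1 v A t1 P" "\<And>v' A'. P v' A' \<Longrightarrow> ex c2 v' A' (t - t1) Q" "t1 \<le> t"
  shows "ex (c1 ;; c2) v A t Q"
  by (rule ex_then[OF assms(1,2)]) (use assms(3) in simp_all)

lemma ex_Set_step:
  assumes "ok e v A" "x < 98" "ex c (v(x := ev e v A)) A (t - (expr_time e + 1)) Q" "expr_time e + 1 \<le> t"
  shows "ex (Set x e ;; c) v A t Q"
  using ex_Sq[OF ex_wp[OF _ order_refl], of "Set x e" c "t - (expr_time e + 1)" Q v A t] assms by simp

lemma ex_Set_then:
  assumes "ok e v A" "x < 98" "ex c (v(x := ev e v A)) A t Q" "expr_time e + 1 + t \<le> t'"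
  shows "ex (Set x e ;; c) v A t' Q"
  using ex_Sq[OF ex_wp[OF _ order_refl], of "Set x e" c t Q v A t'] assms by simp

end

definition cells :: "nat list \<Rightarrow> nat" where "cells T = Suc (length T)"

locale text_machine = machine F w M "cells T" for F w M and T :: "nat list" +
  fixes k :: nat
  assumes T_nonempty: "T \<noteq> []" and k_word: "2 * cells T + k < 2 ^ w"
begin

abbreviation "n \<equiv> length T"
abbreviation "N \<equiv> cells T"

lemma n_pos: "0 < n" using T_nonempty by simp

lemma N_pos [simp]: "0 < N" by (simp add: cells_def)

lemma n_less_N [simp]: "n < N" by (simp add: cells_def)

lemma small_word_text: "x \<le> 2 * n + 2 + k \<Longrightarrow> x < 2 ^ w"
  using k_word by (simp add: cells_def)

lemma less_N: "p < N \<longleftrightarrow> p \<le> n" by (auto simp: cells_def)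

text \<open>Grams are named at all positions, also where they stick out of the text, hence the
  default 0. It agrees with the memory cell behind the text, and windows only count grams that lie
  inside them.\<close>

definition sym :: "nat \<Rightarrow> nat" where "sym q = (if q < n then T ! q else 0)"

lemma N_word: "17 * N < 2 ^ w" using arrays_fit M_word by linarith

lemma in_bounds_simps [simp]:
  "a < 17 \<Longrightarrow> in_bounds a i \<longleftrightarrow> i < N"
  "in_bounds 17 i \<longleftrightarrow> 17 * N + i < M"
  by (auto simp: in_bounds_def)

lemma two_word [simp]: "Suc 0 < 2 ^ w" "2 < (2::nat) ^ w"
proof -
  have "(2::nat) ^ 7 \<le> 2 ^ w" using w_large by (intro power_increasing) auto
  then show "Suc 0 < 2 ^ w" "2 < (2::nat) ^ w" by auto
qed

text \<open>\<open>W\<close> is a power of \<open>N\<close>. Symbols are bounded by a polynomial in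
  \<open>N\<close>, so that constantly many digits in base \<open>N\<close> determine them.\<close>

definition digit_of :: "nat \<Rightarrow> nat \<Rightarrow> nat \<Rightarrow> nat" where
  "digit_of m W p = sym (p + m) div W mod N"

definition naming_base :: "vars \<Rightarrow> arrays \<Rightarrow> bool" where
  "naming_base v A \<longleftrightarrow> v vn = n \<and> v vN = N \<and> A aT = sym \<and>
     (\<forall>x<N. A aHead x = 0) \<and> (\<forall>y<N. A aMark y < v vstamp)"

definition names :: "(nat \<Rightarrow> nat) \<Rightarrow> (nat \<Rightarrow> nat \<Rightarrow> bool) \<Rightarrow> bool" where
  "names f R \<longleftrightarrow> (\<forall>q<n. f q < N) \<and> (\<forall>q<n. \<forall>q'<n. f q = f q' \<longleftrightarrow> R q q')"

context
  fixes old :: "nat \<Rightarrow> nat" and m W s0 :: nat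
  assumes old_less: "\<And>p. p < n \<Longrightarrow> old p < N" and m_le: "m \<le> k"
    and stamp_word: "s0 + N < 2 ^ w"
begin

abbreviation "digit \<equiv> digit_of m W"

lemma digit_less: "digit p < N"
  unfolding digit_of_def by (simp add: cells_def)

definition push_inv :: "vars \<Rightarrow> arrays \<Rightarrow> bool" where
  "push_inv v A \<longleftrightarrow> v vn = n \<and> v vp \<le> n \<and> (\<forall>q<n. A aId q = old q) \<and>
     (\<forall>x<N. A aHead x = prev_same old x (v vp)) \<and>
     (\<forall>q<v vp. A aNext q = prev_same old (old q) q)"

lemma push_loop:
  assumes "v vn = n" "v vp = 0" "\<And>q. q < n \<Longrightarrow> A aId q = old q" "\<And>x. x < N \<Longrightarrow> A aHead x = 0"
  shows "ex (While (Lt (V vp) (V vn)) push_body) v A (40 * n + 10)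
    (\<lambda>v' A'. (\<forall>x<N. A' aHead x = prev_same old x n) \<and> (\<forall>q<n. A' aNext q = prev_same old (old q) q))"
proof (rule ex_While[where I = push_inv and \<Phi> = "\<lambda>v A. 40 * (n - v vp)"])
  show "push_inv v A" using assms by (simp add: push_inv_def)
next
  fix v A assume I: "push_inv v A" and b: "tev (Lt (V vp) (V vn)) v A"
  then have p: "v vp < n" "v vn = n" "v vp < N" "Suc (v vp) < 2 ^ w" "A aId (v vp) = old (v vp)"
    "old (v vp) < N"
    using old_less N_word by (auto simp: push_inv_def less_N) (auto simp: cells_def)
  define A1 where "A1 = upd (upd A aNext (v vp) (A aHead (old (v vp)))) aHead (old (v vp)) (Suc (v vp))"
  have "push_inv (v(vp := Suc (v vp))) A1"
    using I p unfolding push_inv_def by (simp add: A1_def less_Suc_eq)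
  moreover have "wp push_body (\<lambda>v' A'. v' = v(vp := Suc (v vp)) \<and> A' = A1) v A"
    using p by (simp add: push_body_def A1_def)
  ultimately have "wp push_body (\<lambda>v' A'. push_inv v' A' \<and> v' vp = Suc (v vp)) v A"
    by (simp add: push_body_def)
  then have "ex push_body v A 35 (\<lambda>v' A'. push_inv v' A' \<and> v' vp = Suc (v vp))"
    by (rule ex_wp) (simp add: push_body_def)
  moreover have e: "n - v vp = Suc (n - Suc (v vp))" using p by simp
  ultimately have "ex push_body v A 35 (\<lambda>v' A'. push_inv v' A' \<and>
      40 * (n - v' vp) + 35 + tst_time (Lt (V vp) (V vn)) + 1 \<le> 40 * (n - v vp))"
    by (elim ex_mono) simp_all
  then show "\<exists>t. ex push_body v A t (\<lambda>v' A'. push_inv v' A' \<and>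
      40 * (n - v' vp) + t + tst_time (Lt (V vp) (V vn)) + 1 \<le> 40 * (n - v vp))" by (rule exI[where x = 35])
next
  fix v A assume I: "push_inv v A" and b: "\<not> tev (Lt (V vp) (V vn)) v A"
  then have "v vp = n" by (simp add: push_inv_def)
  with I show "(\<forall>x<N. A aHead x = prev_same old x n) \<and> (\<forall>q<n. A aNext q = prev_same old (old q) q)"
    unfolding push_inv_def by metis
qed (simp_all add: assms)

text \<open>Each list releases its positions from right to left. The positions renamed so far are
  therefore those with a smaller old name and, in the current list, those from \<open>b\<close>
  on.\<close>

definition popped :: "nat \<Rightarrow> nat \<Rightarrow> nat \<Rightarrow> bool" where
  "popped x b q \<longleftrightarrow> old q < x \<or> (old q = x \<and> b \<le> q)"

text \<open>New names overwrite the old ones in place, since the lists preserve the grouping by old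
  names. Bounding \<open>vfresh\<close> by the number of renamed positions keeps the new names below
  \<open>N\<close>. The last two clauses say that the marked digits are exactly those met so far in
  the current list, and that the table holds their new names.\<close>

definition pop_inv :: "vars \<Rightarrow> arrays \<Rightarrow> nat \<Rightarrow> bool" where
  "pop_inv v A b \<longleftrightarrow> v vn = n \<and> v vN = N \<and> A aT = sym \<and> v vpw = W \<and> v vx \<le> N \<and> b \<le> n \<and>
     (\<forall>x<N. A aHead x = (if x < v vx then 0 else if x = v vx then prev_same old x b else prev_same old x n)) \<and>
     (\<forall>q<n. A aNext q = prev_same old (old q) q) \<and>
     v vstamp = s0 + v vx \<and> (\<forall>y<N. A aMark y \<le> v vstamp) \<and> (v vx = N \<longrightarrow> (\<forall>y<N. A aMark y < v vstamp)) \<and>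
     v vfresh \<le> card {q. q < n \<and> popped (v vx) b q} \<and>
     (\<forall>q<n. popped (v vx) b q \<longrightarrow> A aId q < v vfresh) \<and>
     (\<forall>q<n. \<forall>q'<n. popped (v vx) b q \<longrightarrow> popped (v vx) b q' \<longrightarrow>
        (A aId q = A aId q' \<longleftrightarrow> old q = old q' \<and> digit q = digit q')) \<and>
     (\<forall>y<N. A aMark y = v vstamp \<longrightarrow>
        (\<exists>q<n. popped (v vx) b q \<and> old q = v vx \<and> digit q = y \<and> A aId q = A aName y)) \<and>
     (\<forall>q<n. popped (v vx) b q \<longrightarrow> old q = v vx \<longrightarrow> A aMark (digit q) = v vstamp)"

definition unpopped :: "nat \<Rightarrow> nat \<Rightarrow> nat set" where
  "unpopped x b = {q. q < n \<and> \<not> popped x b q}"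

lemma pop_step:
  assumes I: "pop_inv v A b" and x: "v vx < N"
  shows "ex (pop_body m) v A 100 (\<lambda>v' A'. \<exists>b'. pop_inv v' A' b' \<and>
    (N - v' vx) + card (unpopped (v' vx) b') < (N - v vx) + card (unpopped (v vx) b))"
proof (cases "prev_same old (v vx) b")
  case 0
  then have none: "\<forall>q<b. old q \<noteq> v vx" by (simp add: prev_same_0)
  have pop: "q < n \<Longrightarrow> popped (Suc (v vx)) n q = popped (v vx) b q" for q
    using none by (auto simp: popped_def less_Suc_eq) (meson not_le)
  then have c: "{q. q < n \<and> popped (Suc (v vx)) n q} = {q. q < n \<and> popped (v vx) b q}"
    "unpopped (Suc (v vx)) n = unpopped (v vx) b" by (auto simp: unpopped_def)
  have s: "Suc (s0 + v vx) < 2 ^ w" "Suc (v vx) < 2 ^ w" using stamp_word x N_word by auto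
  have h: "A aHead (v vx) = 0" using I x 0 by (simp add: pop_inv_def)
  let ?v = "v(vp := 0, vx := Suc (v vx), vstamp := Suc (v vstamp))"
  \<comment> \<open>The next list is still complete, hence the bound \<open>n\<close>. Raising the
    stamp invalidates all marks at once.\<close>
  have "pop_inv ?v A n"
    unfolding pop_inv_def
  proof (intro conjI allI impI)
    fix y assume y: "y < N" "A aMark y = ?v vstamp"
    from y(1) have "A aMark y \<le> v vstamp" using I unfolding pop_inv_def by blast
    with y(2) show "\<exists>q<n. popped (?v vx) n q \<and> old q = ?v vx \<and> digit q = y \<and> A aId q = A aName y"
      by simp
  next
    fix q assume "q < n" "popped (?v vx) n q" "old q = ?v vx"
    then show "A aMark (digit q) = ?v vstamp" by (simp add: popped_def)
  next
    fix x assume "x < N"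
    then show "A aHead x = (if x < ?v vx then 0 else if x = ?v vx then prev_same old x n else prev_same old x n)"
      using I 0 by (auto simp: pop_inv_def less_Suc_eq)
  qed (use I x in \<open>auto simp: pop_inv_def c pop less_Suc_eq_le le_Suc_eq\<close>)
  moreover have "wp (pop_body m) (\<lambda>v' A'. v' = ?v \<and> A' = A) v A"
    using I x s h by (simp add: pop_body_def pop_inv_def)
  ultimately have "wp (pop_body m) (\<lambda>v' A'. pop_inv v' A' n \<and> v' vx = Suc (v vx)) v A"
    using x s h by (simp add: pop_body_def)
  then show ?thesis
    by (rule ex_mono[OF ex_wp[OF _ order_refl]])
      (use x c in \<open>auto simp: pop_body_def intro!: exI[of _ n]\<close>)
next
  case (Suc p)
  from prev_same_Suc[OF this] have p: "p < b" "old p = v vx" "\<And>q. p < q \<Longrightarrow> q < b \<Longrightarrow> old q \<noteq> v vx"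
    by auto
  then have pn: "p < n" "p < N" using I by (auto simp: pop_inv_def less_N)
  have np: "\<not> popped (v vx) b p" using p by (auto simp: popped_def)
  have pop: "popped (v vx) p q \<longleftrightarrow> popped (v vx) b q \<or> q = p" for q
    using p by (auto simp: popped_def) (metis le_neq_implies_less not_le)
  then have c: "{q. q < n \<and> popped (v vx) p q} = insert p {q. q < n \<and> popped (v vx) b q}"
    using pn by auto
  have c1: "card {q. q < n \<and> popped (v vx) p q} = Suc (card {q. q < n \<and> popped (v vx) b q})"
    unfolding c using np by (subst card_insert_disjoint) auto
  have "unpopped (v vx) b = insert p (unpopped (v vx) p)" using pn pop np by (auto simp: unpopped_def)
  moreover have "p \<notin> unpopped (v vx) p" "finite (unpopped (v vx) p)" by (auto simp: unpopped_def pop)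
  ultimately have c2: "card (unpopped (v vx) b) = Suc (card (unpopped (v vx) p))" by simp
  have "card {q. q < n \<and> popped (v vx) b q} \<le> card {..<n}" by (rule card_mono) auto
  then have fr: "v vfresh \<le> n" using I by (auto simp: pop_inv_def)
  have h: "A aHead (v vx) = Suc p" "A aNext p = prev_same old (v vx) p"
    using I x Suc p pn by (auto simp: pop_inv_def)
  have pm: "p + m < 2 ^ w" "v vfresh + 1 < 2 ^ w" "m < 2 ^ w" using pn m_le k_word fr by (auto simp: cells_def)
  have y: "(if p + m < n then sym (p + m) div W mod N else 0) = digit p"
    by (auto simp: digit_of_def sym_def)
  note dl = digit_less[of p]
  define A1 where "A1 = upd A aHead (v vx) (A aNext p)"
  define old_mark where "old_mark \<longleftrightarrow> A aMark (digit p) = v vstamp"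
  define A2 where "A2 = (if old_mark then A1 else upd (upd A1 aMark (digit p) (v vstamp)) aName (digit p) (v vfresh))"
  define fr2 where "fr2 = (if old_mark then v vfresh else Suc (v vfresh))"
  define A3 where "A3 = upd A2 aId p (A2 aName (digit p))"
  have nm: "old_mark \<Longrightarrow> \<exists>q<n. popped (v vx) b q \<and> old q = v vx \<and> digit q = digit p \<and> A aId q = A aName (digit p)"
    using I dl by (auto simp: pop_inv_def old_mark_def)
  have inv: "pop_inv (v(vp := p, vy := digit p, vfresh := fr2)) A3 p"
  proof -
    let ?P = "popped (v vx) b" and ?P' = "popped (v vx) p"
    have same: "A3 aT = sym" "A3 aNext = A aNext"
      using I by (auto simp: A3_def A2_def A1_def pop_inv_def)
    have head: "A3 aHead x = (if x < v vx then 0 else if x = v vx then prev_same old x p else prev_same old x n)"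
      if "x < N" for x
      using I that h by (auto simp: A3_def A2_def A1_def pop_inv_def)
    have mark: "A3 aMark = (A aMark)(digit p := v vstamp)"
      by (auto simp: A3_def A2_def A1_def old_mark_def)
    have nam: "A3 aName = (if old_mark then A aName else (A aName)(digit p := v vfresh))"
      by (auto simp: A3_def A2_def A1_def)
    have id: "A3 aId = (A aId)(p := A3 aName (digit p))"
      by (auto simp: A3_def A2_def A1_def)
    have fresh: "q < n \<Longrightarrow> ?P q \<Longrightarrow> A aId q < v vfresh" for q using I by (auto simp: pop_inv_def)
    have idp: "A3 aId p < fr2"
      using nm fresh by (auto simp: id nam fr2_def) metis
    \<comment> \<open>If the digit is marked, an earlier position of the same list and digit lends
      its new name. Otherwise the fresh name is larger than all names given so far, and an equal
      pair of old name and digit would have left a mark.\<close>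
    have pair: "A3 aId p = A aId q \<longleftrightarrow> old p = old q \<and> digit p = digit q" if q: "q < n" "?P q" for q
    proof (cases old_mark)
      case True
      then obtain q0 where q0: "q0 < n" "?P q0" "old q0 = v vx" "digit q0 = digit p" "A aId q0 = A aName (digit p)"
        using nm by blast
      moreover have "A aId q0 = A aId q \<longleftrightarrow> old q0 = old q \<and> digit q0 = digit q"
        using I q0(1,2) q unfolding pop_inv_def by blast
      ultimately show ?thesis using p True by (simp add: id nam)
    next
      case False
      then have "A3 aId p = v vfresh" by (simp add: id nam)
      moreover have "A aId q < v vfresh" using fresh q by simp
      moreover have "\<not> (old p = old q \<and> digit p = digit q)"
      proof
        assume eq: "old p = old q \<and> digit p = digit q"
        then have "old q = v vx" using p by simp
        then have "A aMark (digit q) = v vstamp" using I q unfolding pop_inv_def by blast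
        with eq False show False by (simp add: old_mark_def)
      qed
      ultimately show ?thesis by simp
    qed
    have idq: "q \<noteq> p \<Longrightarrow> A3 aId q = A aId q" for q by (simp add: id)
    have names: "A3 aId q = A3 aId q' \<longleftrightarrow> old q = old q' \<and> digit q = digit q'"
      if "q < n" "q' < n" "?P' q" "?P' q'" for q q'
    proof -
      have "?P q \<or> q = p" "?P q' \<or> q' = p" using that(3,4) unfolding pop by simp_all
      then consider "q = p" "q' = p" | "q = p" "q' \<noteq> p" "?P q'" | "q \<noteq> p" "q' = p" "?P q"
        | "q \<noteq> p" "q' \<noteq> p" "?P q" "?P q'" by blast
      then show ?thesis
      proof cases
        case 2
        with pair[of q'] idq[of q'] that show ?thesis by simp
      next
        case 3
        with pair[of q] idq[of q] that have "A3 aId q' = A3 aId q \<longleftrightarrow> old q' = old q \<and> digit q' = digit q"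
          by simp
        then show ?thesis by metis
      next
        case 4
        then have "A aId q = A aId q' \<longleftrightarrow> old q = old q' \<and> digit q = digit q'"
          using I that(1,2) unfolding pop_inv_def by blast
        with 4 idq show ?thesis by simp
      qed simp
    qed
    have less: "A3 aId q < fr2" if "q < n" "?P' q" for q
      using that idp fresh[of q] idq[of q] unfolding pop by (cases "q = p") (auto simp: fr2_def)
    have marks: "\<exists>q<n. ?P' q \<and> old q = v vx \<and> digit q = y \<and> A3 aId q = A3 aName y"
      if "y < N" "A3 aMark y = v vstamp" for y
    proof (cases "y = digit p")
      case True
      then show ?thesis using pn p by (intro exI[of _ p]) (auto simp: pop id)
    next
      case False
      then have y: "A aMark y = v vstamp" using that by (simp add: mark)
      have all: "\<forall>y<N. A aMark y = v vstamp \<longrightarrow>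
          (\<exists>q<n. ?P q \<and> old q = v vx \<and> digit q = y \<and> A aId q = A aName y)"
        using I unfolding pop_inv_def by (elim conjE)
      have "\<exists>q<n. ?P q \<and> old q = v vx \<and> digit q = y \<and> A aId q = A aName y"
        by (rule all[rule_format, OF that(1) y])
      then obtain q where q: "q < n" "?P q" "old q = v vx" "digit q = y" "A aId q = A aName y"
        by (elim exE conjE)
      have "q \<noteq> p" using q(2) np by blast
      then have "A3 aId q = A3 aName y" "?P' q" using q False by (simp_all add: id nam pop)
      with q show ?thesis by blast
    qed
    have marked: "A3 aMark (digit q) = v vstamp" if "q < n" "?P' q" "old q = v vx" for q
    proof (cases "?P q")
      case True
      then have "A aMark (digit q) = v vstamp" using I that unfolding pop_inv_def by blast
      then show ?thesis by (simp add: mark)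
    next
      case False
      with that(2) have "q = p" unfolding pop by simp
      then show ?thesis by (simp add: mark)
    qed
    have "fr2 \<le> card {q. q < n \<and> ?P' q}" using I unfolding c1 by (auto simp: fr2_def pop_inv_def)
    moreover have "A3 aMark y \<le> v vstamp" if "y < N" for y
    proof -
      have "\<forall>y<N. A aMark y \<le> v vstamp" using I unfolding pop_inv_def by (elim conjE)
      then show ?thesis using that by (simp add: mark)
    qed
    moreover have "v vn = n" "v vN = N" "v vpw = W" "v vstamp = s0 + v vx"
      "\<forall>q<n. A aNext q = prev_same old (old q) q"
      using I by (simp_all add: pop_inv_def)
    ultimately show ?thesis
      using pn x same head names less marks marked unfolding pop_inv_def by simp
  qed
  have vW: "v vn = n" "v vN = N" "A aT = sym" "v vpw = W" "\<forall>y<N. A aMark y \<le> v vstamp" "v vx \<le> N" "v vx < N"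
    using I x by (auto simp: pop_inv_def)
  have "wp (pop_body m) (\<lambda>v' A'. v' = v(vp := p, vy := digit p, vfresh := fr2) \<and> A' = A3) v A"
    using vW pn pm h dl y less_imp_le[of "p + m" n, folded less_N]
    by (auto simp: pop_body_def A3_def A2_def A1_def old_mark_def fr2_def upd_def fun_upd_twist split: if_splits)
  then have "ex (pop_body m) v A 100 (\<lambda>v' A'. v' = v(vp := p, vy := digit p, vfresh := fr2) \<and> A' = A3)"
    by (rule ex_wp) (simp add: pop_body_def)
  then show ?thesis
    by (rule ex_mono) (use inv c2 x in \<open>auto intro!: exI[of _ p]\<close>)
qed

lemma pop_loop:
  assumes "pop_inv v A n" "v vx = 0"
  shows "ex (While (Lt (V vx) (V vN)) (pop_body m)) v A (250 * N)
    (\<lambda>v' A'. pop_inv v' A' n \<and> v' vx = N)"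
\<comment> \<open>The bound \<open>b\<close> is a ghost that the state does not determine. The
  potential is therefore the least value over all \<open>b\<close> that satisfy the
  invariant.\<close>
proof (rule ex_While[where I = "\<lambda>v A. \<exists>b. pop_inv v A b"
      and \<Phi> = "\<lambda>v A. 110 * (LEAST c. \<exists>b. pop_inv v A b \<and> c = (N - v vx) + card (unpopped (v vx) b))"])
  show "\<exists>b. pop_inv v A b" using assms by blast
next
  fix v A assume "\<exists>b. pop_inv v A b" and b: "tev (Lt (V vx) (V vN)) v A"
  define P where "P = (\<lambda>v A c. \<exists>b. pop_inv v A b \<and> c = (N - v vx) + card (unpopped (v vx) b))"
  from \<open>\<exists>b. pop_inv v A b\<close> have "\<exists>c. P v A c" by (auto simp: P_def)
  then have "P v A (LEAST c. P v A c)" by (rule LeastI_ex)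
  then obtain b where I: "pop_inv v A b"
    and L: "(LEAST c. P v A c) = (N - v vx) + card (unpopped (v vx) b)" by (auto simp: P_def)
  have "v vx < N" using b I by (simp add: pop_inv_def)
  from pop_step[OF I this] have "ex (pop_body m) v A 100 (\<lambda>v' A'. (\<exists>b. pop_inv v' A' b) \<and>
      110 * (LEAST c. P v' A' c) + 100 + tst_time (Lt (V vx) (V vN)) + 1 \<le> 110 * (LEAST c. P v A c))"
  proof (rule ex_mono)
    fix v' A' assume "\<exists>b'. pop_inv v' A' b' \<and>
      (N - v' vx) + card (unpopped (v' vx) b') < (N - v vx) + card (unpopped (v vx) b)"
    then obtain b' where b': "pop_inv v' A' b'"
      "(N - v' vx) + card (unpopped (v' vx) b') < (LEAST c. P v A c)" unfolding L by blast
    then have "P v' A' ((N - v' vx) + card (unpopped (v' vx) b'))" by (auto simp: P_def)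
    then have "(LEAST c. P v' A' c) \<le> (N - v' vx) + card (unpopped (v' vx) b')" by (rule Least_le)
    with b' show "(\<exists>b. pop_inv v' A' b) \<and>
      110 * (LEAST c. P v' A' c) + 100 + tst_time (Lt (V vx) (V vN)) + 1 \<le> 110 * (LEAST c. P v A c)"
      by auto
  qed simp
  then show "\<exists>t. ex (pop_body m) v A t (\<lambda>v' A'. (\<exists>b. pop_inv v' A' b) \<and>
      110 * (LEAST c. \<exists>b. pop_inv v' A' b \<and> c = (N - v' vx) + card (unpopped (v' vx) b)) + t
        + tst_time (Lt (V vx) (V vN)) + 1
      \<le> 110 * (LEAST c. \<exists>b. pop_inv v A b \<and> c = (N - v vx) + card (unpopped (v vx) b)))"
    unfolding P_def by (rule exI[where x = 100])
next
  fix v A assume "\<exists>b. pop_inv v A b" and b: "\<not> tev (Lt (V vx) (V vN)) v A"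
  then obtain b where I: "pop_inv v A b" by blast
  with b have x: "v vx = N" by (simp add: pop_inv_def)
  then have "popped (v vx) b q = popped (v vx) n q" if "q < n" for q
    using old_less[OF that] by (auto simp: popped_def)
  then have e: "{q. q < n \<and> popped (v vx) b q} = {q. q < n \<and> popped (v vx) n q}" by auto
  have c: "q < n \<Longrightarrow> popped (v vx) b q \<and> popped (v vx) n q" for q
    using old_less x by (simp add: popped_def)
  have "pop_inv v A n"
    using I c x unfolding pop_inv_def e by (simp cong: conj_cong imp_cong)
  with x show "pop_inv v A n \<and> v vx = N" by blast
next
  have "card (unpopped (v vx) n) \<le> card {..<n}" by (rule card_mono) (auto simp: unpopped_def)
  then have "(LEAST c. \<exists>b. pop_inv v A b \<and> c = (N - v vx) + card (unpopped (v vx) b)) \<le> N + n"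
    using assms by (intro order_trans[OF Least_le]) auto
  then show "110 * (LEAST c. \<exists>b. pop_inv v A b \<and> c = (N - v vx) + card (unpopped (v vx) b))
    + tst_time (Lt (V vx) (V vN)) + 1 \<le> 250 * N" by (simp add: cells_def)
qed auto

lemma refine_old:
  assumes "naming_base v A" "\<And>q. q < n \<Longrightarrow> A aId q = old q" "v vpw = W" "v vstamp = s0"
  shows "ex (refine m) v A (300 * N + 30) (\<lambda>v' A'. naming_base v' A' \<and> v' vstamp = s0 + N \<and> v' vpw = W \<and>
    names (A' aId) (\<lambda>q q'. old q = old q' \<and> digit q = digit q'))"
proof -
  let ?v0 = "v(vp := 0)"
  let ?P1 = "\<lambda>v' A'. (\<forall>x<N. A' aHead x = prev_same old x n) \<and> (\<forall>q<n. A' aNext q = prev_same old (old q) q) \<and>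
      (\<forall>x. x \<noteq> vp \<longrightarrow> v' x = v x) \<and> (\<forall>a. a \<noteq> aHead \<and> a \<noteq> aNext \<longrightarrow> A' a = A a)"
  have 1: "ex (While (Lt (V vp) (V vn)) push_body) ?v0 A (40 * n + 10) ?P1"
    by (rule ex_frame[OF push_loop]) (use assms in \<open>auto simp: naming_base_def push_body_def\<close>)
  have 2: "ex (Set vfresh (K 0) ;; Set vx (K 0) ;; While (Lt (V vx) (V vN)) (pop_body m)) v1 A1 (250 * N + 4)
     (\<lambda>v' A'. pop_inv v' A' n \<and> v' vx = N)" if "?P1 v1 A1" for v1 A1
  proof -
    let ?v1 = "v1(vfresh := 0, vx := 0)"
    have np: "\<not> popped 0 n q" if "q < n" for q using that by (simp add: popped_def)
    have "pop_inv ?v1 A1 n"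
      using \<open>?P1 v1 A1\<close> assms np unfolding pop_inv_def naming_base_def by (auto simp: less_imp_le)
    from pop_loop[OF this] have
      3: "ex (While (Lt (V vx) (V vN)) (pop_body m)) ?v1 A1 (250 * N) (\<lambda>v' A'. pop_inv v' A' n \<and> v' vx = N)"
      by simp
    show ?thesis
      by (rule ex_Set_then, simp, simp, rule ex_Set_then, simp, simp, unfold ev.simps, rule 3, rule order_refl, simp)
  qed
  have fin: "naming_base v' A' \<and> v' vstamp = s0 + N \<and> v' vpw = W \<and>
      names (A' aId) (\<lambda>q q'. old q = old q' \<and> digit q = digit q')" if "pop_inv v' A' n" "v' vx = N" for v' A'
  proof -
    have c: "popped N n q" if "q < n" for q using old_less that by (simp add: popped_def)
    have "card {q. q < n \<and> popped N n q} \<le> card {..<n}" by (rule card_mono) auto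
    with that have fr: "v' vfresh \<le> n" by (simp add: pop_inv_def)
    have "A' aId q < N" if "q < n" for q
      using \<open>pop_inv v' A' n\<close> c[OF that] \<open>v' vx = N\<close> that fr
      by (auto simp: pop_inv_def less_N intro: less_imp_le less_le_trans)
    have "\<forall>y<N. A' aMark y < v' vstamp"
      using that unfolding pop_inv_def by (elim conjE) simp
    moreover have "A' aId q = A' aId q' \<longleftrightarrow> old q = old q' \<and> digit q = digit q'" if "q < n" "q' < n" for q q'
      using \<open>pop_inv v' A' n\<close> c[OF that(1)] c[OF that(2)] \<open>v' vx = N\<close> that unfolding pop_inv_def
      by (elim conjE) simp
    moreover have "v' vn = n" "v' vN = N" "A' aT = sym" "v' vpw = W" "\<forall>x<N. A' aHead x = 0" "v' vstamp = s0 + N"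
      using that unfolding pop_inv_def by (simp_all del: One_nat_def)
    ultimately show ?thesis using \<open>\<And>q. q < n \<Longrightarrow> A' aId q < N\<close> unfolding naming_base_def names_def
      by (intro conjI) simp_all
  qed
  show ?thesis unfolding refine_def
    by (rule ex_Set_then, simp, simp, rule ex_then[OF _ ex_mono[OF 2]], unfold ev.simps, rule 1)
      (use fin in \<open>auto simp: cells_def\<close>)
qed

end
end

section \<open>Names of grams from passes over single digits\<close>

primrec passes :: "nat \<Rightarrow> nat \<Rightarrow> cmd" where
  "passes m 0 = NOP"
| "passes m (Suc d) = passes m d ;; refine m ;; Set vpw (Bin Mul (V vpw) (V vN))"

definition append_symbol :: "nat \<Rightarrow> nat \<Rightarrow> cmd" where
  "append_symbol d m = Set vpw (K 1) ;; passes m d"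

primrec name_grams :: "nat \<Rightarrow> nat \<Rightarrow> cmd" where
  "name_grams d 0 = NOP"
| "name_grams d (Suc m) = name_grams d m ;; append_symbol d m"

definition fill :: "nat \<Rightarrow> expr \<Rightarrow> cmd" where
  "fill a e = Set vp (K 0) ;; While (Lt (V vp) (V vn)) (Put a (V vp) e ;; Set vp (plus1 (V vp)))"

text \<open>The names of the \<open>k\<close>-grams are copied before one more symbol refines them
  to names of \<open>(k + 1)\<close>-grams, which stay in \<open>aId\<close>. The stamp keeps
  growing through all passes, so that the marks are never cleared.\<close>

definition naming :: "nat \<Rightarrow> nat \<Rightarrow> cmd" where
  "naming d k =
     Set vstamp (K 1) ;; append_symbol d 0 ;; fill aSym (Arr aId (V vp)) ;;
     fill aId (K 0) ;; name_grams d k ;; fill aCtx (Arr aId (V vp)) ;; append_symbol d k"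

text \<open>Residues modulo a product can be compared digit by digit; this is why passes over single
  digits add up to a comparison of symbols.\<close>

lemma mod_mult_eq_iff:
  fixes x y b c :: nat
  shows "x mod (b * c) = y mod (b * c) \<longleftrightarrow> x mod b = y mod b \<and> x div b mod c = y div b mod c"
proof
  assume *: "x mod (b * c) = y mod (b * c)"
  then have "x mod (b * c) mod b = y mod (b * c) mod b" by simp
  then have 1: "x mod b = y mod b" by (simp add: mod_mod_cancel)
  with * have "b * (x div b mod c) = b * (y div b mod c)" by (simp add: mod_mult2_eq)
  with 1 show "x mod b = y mod b \<and> x div b mod c = y div b mod c" by (cases "b = 0") auto
qed (simp add: mod_mult2_eq)

context text_machine
begin

definition same_gram :: "nat \<Rightarrow> nat \<Rightarrow> nat \<Rightarrow> bool" where
  "same_gram m q q' \<longleftrightarrow> (\<forall>l<m. sym (q + l) = sym (q' + l))"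

definition named :: "nat \<Rightarrow> (nat \<Rightarrow> nat \<Rightarrow> bool) \<Rightarrow> vars \<Rightarrow> arrays \<Rightarrow> bool" where
  "named s R v A \<longleftrightarrow> naming_base v A \<and> v vstamp = s \<and> names (A aId) R"

lemma named_upd [simp]: "x \<notin> {vn, vN, vstamp} \<Longrightarrow> named s R (v(x := y)) A = named s R v A"
  by (simp add: named_def naming_base_def)

lemma named_cong:
  assumes "named s R v A" "\<And>q q'. q < n \<Longrightarrow> q' < n \<Longrightarrow> R q q' = R' q q'" "s = s'"
  shows "named s' R' v A"
  using assms by (simp add: named_def names_def)

lemma refine:
  assumes "named s R v A" "m \<le> k" "s + N < 2 ^ w" "v vpw = W"
  shows "ex (refine m) v A (300 * N + 30) (\<lambda>v' A'.
    named (s + N) (\<lambda>q q'. R q q' \<and> sym (q + m) div W mod N = sym (q' + m) div W mod N) v' A' \<and> v' vpw = W)"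
proof -
  have "ex (refine m) v A (300 * N + 30) (\<lambda>v' A'. naming_base v' A' \<and> v' vstamp = s + N \<and> v' vpw = W \<and>
    names (A' aId) (\<lambda>q q'. A aId q = A aId q' \<and> digit_of m W q = digit_of m W q'))"
    by (rule refine_old) (use assms in \<open>simp_all add: named_def names_def\<close>)
  moreover have "names f (\<lambda>q q'. A aId q = A aId q' \<and> digit_of m W q = digit_of m W q') \<Longrightarrow>
      names f (\<lambda>q q'. R q q' \<and> digit_of m W q = digit_of m W q')" for f
    using assms(1) by (simp add: named_def names_def)
  ultimately show ?thesis
    unfolding digit_of_def by (elim ex_mono) (simp_all add: named_def)
qed

lemma passes:
  assumes "named s R v A" "m \<le> k" "s + d * N < 2 ^ w" "v vpw = 1" "N ^ d < 2 ^ w"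
  shows "ex (passes m d) v A (d * (300 * N + 40) + 1) (\<lambda>v' A'.
    named (s + d * N) (\<lambda>q q'. R q q' \<and> sym (q + m) mod N ^ d = sym (q' + m) mod N ^ d) v' A' \<and> v' vpw = N ^ d)"
  using assms
proof (induction d)
  case 0
  then show ?case by (intro ex_wp) (auto elim!: named_cong)
next
  case (Suc d)
  have "N ^ d \<le> N ^ Suc d" by (intro power_increasing) (auto simp: cells_def)
  then have "N ^ d < 2 ^ w" using Suc.prems by linarith
  then have w: "N ^ d < 2 ^ w" "s + d * N < 2 ^ w" "(s + d * N) + N < 2 ^ w" "N ^ d * N < 2 ^ w"
    using Suc.prems by (auto simp: algebra_simps intro: le_less_trans)
  have dm: "x mod N ^ Suc d = y mod N ^ Suc d \<longleftrightarrow>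
      x mod N ^ d = y mod N ^ d \<and> x div N ^ d mod N = y div N ^ d mod N" for x y
    by (simp only: power_Suc2 mod_mult_eq_iff)
  have step: "ex (refine m ;; Set vpw (Bin Mul (V vpw) (V vN))) v1 A1 (300 * N + 34) (\<lambda>v' A'.
      named (s + Suc d * N) (\<lambda>q q'. R q q' \<and> sym (q + m) mod N ^ Suc d = sym (q' + m) mod N ^ Suc d) v' A' \<and>
      v' vpw = N ^ Suc d)"
    if *: "named (s + d * N) (\<lambda>q q'. R q q' \<and> sym (q + m) mod N ^ d = sym (q' + m) mod N ^ d) v1 A1 \<and> v1 vpw = N ^ d"
    for v1 A1
  proof (rule ex_then[OF refine])
    fix v' A' assume **: "named (s + d * N + N) (\<lambda>q q'. (R q q' \<and> sym (q + m) mod N ^ d = sym (q' + m) mod N ^ d) \<and>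
        sym (q + m) div N ^ d mod N = sym (q' + m) div N ^ d mod N) v' A' \<and> v' vpw = N ^ d"
    then have "named (s + Suc d * N) (\<lambda>q q'. R q q' \<and> sym (q + m) mod N ^ Suc d = sym (q' + m) mod N ^ Suc d) v' A'"
      by (elim named_cong[OF conjunct1]) (auto simp: dm simp del: power_Suc)
    then have "named (s + Suc d * N) (\<lambda>q q'. R q q' \<and> sym (q + m) mod N ^ Suc d = sym (q' + m) mod N ^ Suc d)
        (v'(vpw := N ^ Suc d)) A'" by simp
    moreover have "v' vN = N" using ** by (simp add: named_def naming_base_def)
    ultimately show "ex (Set vpw (Bin Mul (V vpw) (V vN))) v' A' 4 (\<lambda>v' A'.
        named (s + Suc d * N) (\<lambda>q q'. R q q' \<and> sym (q + m) mod N ^ Suc d = sym (q' + m) mod N ^ Suc d) v' A' \<and>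
        v' vpw = N ^ Suc d)"
      using ** w by (intro ex_wp) (simp_all add: mult.commute)
  qed (use * Suc.prems w in auto)
  show ?case unfolding passes.simps
    by (rule ex_then[OF Suc.IH step]) (use Suc.prems w in auto)
qed

context
  fixes d :: nat
  assumes d_word: "N ^ d < 2 ^ w" and sym_less: "\<And>q. sym q < N ^ d"
    and stamps_word: "1 + (k + 2) * (d * N) < 2 ^ w"
begin

lemma append_symbol:
  assumes "named s R v A" "m \<le> k" "s + d * N < 2 ^ w"
  shows "ex (append_symbol d m) v A (d * (300 * N + 40) + 3)
    (named (s + d * N) (\<lambda>q q'. R q q' \<and> sym (q + m) = sym (q' + m)))"
  unfolding append_symbol_def
proof (rule ex_Set_then)
  have "ex (passes m d) (v(vpw := 1)) A (d * (300 * N + 40) + 1) (\<lambda>v' A'.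
    named (s + d * N) (\<lambda>q q'. R q q' \<and> sym (q + m) mod N ^ d = sym (q' + m) mod N ^ d) v' A' \<and> v' vpw = N ^ d)"
    by (rule passes) (use assms d_word in \<open>auto simp: named_def naming_base_def\<close>)
  then show "ex (passes m d) (v(vpw := ev (K 1) v A)) A (d * (300 * N + 40) + 1)
    (named (s + d * N) (\<lambda>q q'. R q q' \<and> sym (q + m) = sym (q' + m)))"
    unfolding ev.simps by (elim ex_mono) (use sym_less in \<open>auto elim!: named_cong\<close>)
qed auto

lemma name_grams:
  assumes "named s (same_gram 0) v A" "m \<le> k" "s + m * (d * N) < 2 ^ w"
  shows "ex (name_grams d m) v A (m * (d * (300 * N + 40) + 3) + 1) (named (s + m * (d * N)) (same_gram m))"
  using assms
proof (induction m)
  case 0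
  then show ?case by (intro ex_wp) auto
next
  case (Suc m)
  have "ex (name_grams d m) v A (m * (d * (300 * N + 40) + 3) + 1) (named (s + m * (d * N)) (same_gram m))"
    using Suc by simp
  moreover have "ex (append_symbol d m) v' A' (d * (300 * N + 40) + 3)
      (named (s + Suc m * (d * N)) (same_gram (Suc m)))"
    if "named (s + m * (d * N)) (same_gram m) v' A'" for v' A'
    by (rule ex_mono[OF append_symbol[OF that]])
      (use Suc.prems in \<open>auto elim!: named_cong simp: same_gram_def less_Suc_eq\<close>)
  ultimately show ?case unfolding name_grams.simps by (rule ex_then) (assumption, simp)
qed

lemma fill:
  assumes "v vn = n" "a < 17" "expr_time e \<le> 10"
    and e: "\<And>v' A'. v' vp < n \<Longrightarrow> A' a = (\<lambda>q. if q < v' vp then f q else A a q) \<Longrightarrow>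
      (\<And>x. x \<noteq> vp \<Longrightarrow> v' x = v x) \<Longrightarrow> (\<And>b. b \<noteq> a \<Longrightarrow> A' b = A b) \<Longrightarrow> ok e v' A' \<and> ev e v' A' = f (v' vp)"
  shows "ex (fill a e) v A (40 * N) (\<lambda>v' A'. v' = v(vp := n) \<and> A' = A(a := \<lambda>q. if q < n then f q else A a q))"
  unfolding fill_def
proof (rule ex_Set_then)
  let ?I = "\<lambda>v' A'. v' vp \<le> n \<and> v' = v(vp := v' vp) \<and> A' = A(a := \<lambda>q. if q < v' vp then f q else A a q)"
  show "ex (While (Lt (V vp) (V vn)) (Put a (V vp) e ;; Set vp (plus1 (V vp)))) (v(vp := ev (K 0) v A)) A (30 * n + 3)
     (\<lambda>v' A'. v' = v(vp := n) \<and> A' = A(a := \<lambda>q. if q < n then f q else A a q))"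
  proof (rule ex_While[where I = ?I and \<Phi> = "\<lambda>v A. 30 * (n - v vp)"])
    fix v' A' assume I: "?I v' A'" and b: "tev (Lt (V vp) (V vn)) v' A'"
    have vx: "v' x = v x" if "x \<noteq> vp" for x using I that by (metis fun_upd_other)
    have Ab: "A' b = A b" if "b \<noteq> a" for b using I that by (metis fun_upd_other)
    have p: "v' vp < n" using b vx[of vn] assms(1) by simp
    have Aa: "A' a = (\<lambda>q. if q < v' vp then f q else A a q)" using I by (metis fun_upd_same)
    from e[OF p Aa vx Ab] have e': "ok e v' A'" "ev e v' A' = f (v' vp)" by auto
    have pN: "v' vp < N" "Suc (v' vp) < 2 ^ w" using p k_word by (auto simp: cells_def)
    have Q: "?I (v'(vp := Suc (v' vp))) (upd A' a (v' vp) (f (v' vp)))"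
    proof (intro conjI)
      show "v'(vp := Suc (v' vp)) = v(vp := (v'(vp := Suc (v' vp))) vp)" using vx by (auto simp: fun_eq_iff)
      show "upd A' a (v' vp) (f (v' vp)) = A(a := \<lambda>q. if q < (v'(vp := Suc (v' vp))) vp then f q else A a q)"
        using Ab Aa by (auto simp: fun_eq_iff upd_def less_Suc_eq)
    qed (use p in simp)
    have "ex (Put a (V vp) e ;; Set vp (plus1 (V vp))) v' A' 20
      (\<lambda>v2 A2. v2 = v'(vp := Suc (v' vp)) \<and> A2 = upd A' a (v' vp) (f (v' vp)))"
      by (rule ex_wp) (use e' pN assms in simp_all)
    then have "ex (Put a (V vp) e ;; Set vp (plus1 (V vp))) v' A' 20 (\<lambda>v2 A2. ?I v2 A2 \<and>
        30 * (n - v2 vp) + 20 + tst_time (Lt (V vp) (V vn)) + 1 \<le> 30 * (n - v' vp))"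
    proof (rule ex_mono)
      fix v2 A2 assume *: "v2 = v'(vp := Suc (v' vp)) \<and> A2 = upd A' a (v' vp) (f (v' vp))"
      have "30 * (n - v2 vp) + 20 + tst_time (Lt (V vp) (V vn)) + 1 \<le> 30 * (n - v' vp)" using * p by simp
      with Q * show "?I v2 A2 \<and> 30 * (n - v2 vp) + 20 + tst_time (Lt (V vp) (V vn)) + 1 \<le> 30 * (n - v' vp)"
        by blast
    qed simp
    then show "\<exists>t. ex (Put a (V vp) e ;; Set vp (plus1 (V vp))) v' A' t (\<lambda>v2 A2. ?I v2 A2 \<and>
        30 * (n - v2 vp) + t + tst_time (Lt (V vp) (V vn)) + 1 \<le> 30 * (n - v' vp))" by (rule exI[where x = 20])
  next
    fix v' A' assume I: "?I v' A'" and b: "\<not> tev (Lt (V vp) (V vn)) v' A'"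
    have "v' vn = v vn" using I by (metis fun_upd_other zero_neq_numeral)
    with b assms have "n \<le> v' vp" by simp
    with I have "v' vp = n" by linarith
    with I show "v' = v(vp := n) \<and> A' = A(a := \<lambda>q. if q < n then f q else A a q)" by simp
  qed auto
next
  show "expr_time (K 0) + 1 + (30 * n + 3) \<le> 40 * N" using n_less_N unfolding expr_time.simps by linarith
qed auto

lemma naming:
  assumes "v vn = n" "v vN = N" "A aT = sym" "\<And>a. 1 \<le> a \<Longrightarrow> a \<le> 17 \<Longrightarrow> A a = (\<lambda>_. 0)"
  shows "ex (naming d k) v A ((k + 2) * (d * (300 * N + 40) + 3) + 200 * N) (\<lambda>v' A'.
    names (A' aSym) (same_gram 1) \<and> names (A' aCtx) (same_gram k) \<and> names (A' aId) (same_gram (k + 1)))"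
proof -
  let ?t = "d * (300 * N + 40) + 3"
  have stamp: "1 + d * N < 2 ^ w" "1 + d * N + k * (d * N) < 2 ^ w" "1 + d * N + k * (d * N) + d * N < 2 ^ w"
    using stamps_word by (auto simp: algebra_simps)
  have 0: "named 1 (\<lambda>q q'. True) (v(vstamp := 1)) A"
    using assms by (simp add: named_def naming_base_def names_def)
  have copy: "ex (fill a (Arr aId (V vp))) v1 A1 (40 * N) (\<lambda>v' A'. named s R v' A' \<and> (\<forall>q<n. A' a q = A1 aId q) \<and>
      (\<forall>b. b \<noteq> a \<longrightarrow> A' b = A1 b))"
    if "named s R v1 A1" "a \<in> {aSym, aCtx}" for v1 A1 a s R
    by (rule ex_mono[OF fill[where f = "A1 aId"]])
      (use that in \<open>auto simp: named_def naming_base_def less_N\<close>)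
  have reset: "ex (fill aId (K 0)) v1 A1 (40 * N) (\<lambda>v' A'. named s (same_gram 0) v' A' \<and> (\<forall>b. b \<noteq> aId \<longrightarrow> A' b = A1 b))"
    if "named s R v1 A1" for v1 A1 s R
    by (rule ex_mono[OF fill[where f = "\<lambda>_. 0"]])
      (use that in \<open>auto simp: named_def naming_base_def names_def same_gram_def\<close>)
  have names_cong: "names f R \<Longrightarrow> \<forall>q<n. g q = f q \<Longrightarrow> names g R" for f g R by (simp add: names_def)
  have mod_a: "mod_arrays (append_symbol d m) \<subseteq> {aHead, aNext, aMark, aName, aId}" for m
  proof -
    have "mod_arrays (passes m e) \<subseteq> {aHead, aNext, aMark, aName, aId}" for e
      by (induction e) (auto simp: refine_def push_body_def pop_body_def)
    then show ?thesis by (simp add: append_symbol_def)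
  qed
  have mod_n: "mod_arrays (name_grams d m) \<subseteq> {aHead, aNext, aMark, aName, aId}" for m
    by (induction m) (use mod_a in auto)
  have frame: "ex c v1 A1 t (\<lambda>v' A'. Q v' A' \<and> A' aSym = A1 aSym \<and> A' aCtx = A1 aCtx)"
    if "ex c v1 A1 t Q" "mod_arrays c \<subseteq> {aHead, aNext, aMark, aName, aId}" for c v1 A1 t Q
    by (rule ex_frame[OF that(1)]) (use subsetD[OF that(2), of aSym] subsetD[OF that(2), of aCtx] in auto)
  show ?thesis unfolding naming_def
  proof (rule ex_Set_then)
    have 1: "ex (append_symbol d 0) (v(vstamp := 1)) A ?t (named (1 + d * N) (same_gram 1))"
      by (rule ex_mono[OF append_symbol[OF 0]]) (use stamp in \<open>auto elim!: named_cong simp: same_gram_def\<close>)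
    show "ex (append_symbol d 0 ;; fill aSym (Arr aId (V vp)) ;; fill aId (K 0) ;; name_grams d k ;;
      fill aCtx (Arr aId (V vp)) ;; append_symbol d k) (v(vstamp := ev (K 1) v A)) A ((k + 2) * ?t + 121 * N)
      (\<lambda>v' A'. names (A' aSym) (same_gram 1) \<and> names (A' aCtx) (same_gram k) \<and> names (A' aId) (same_gram (k + 1)))"
      unfolding ev.simps
    proof (rule ex_step[OF 1], rule ex_step[OF copy], assumption, simp, elim conjE, rule ex_step[OF reset], assumption, elim conjE,
        rule ex_step[OF frame[OF name_grams mod_n]], assumption, simp, rule stamp, elim conjE,
        rule ex_step[OF copy], assumption, simp, elim conjE, rule ex_mono[OF frame[OF append_symbol mod_a]], assumption)
      fix v1 A1 v2 A2 v3 A3 v4 A4 v5 A5 v6 A6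
      assume *: "named (1 + d * N) (same_gram 1) v1 A1" "\<forall>q<n. A2 aSym q = A1 aId q"
        "\<forall>b. b \<noteq> aId \<longrightarrow> A3 b = A2 b" "named (1 + d * N + k * (d * N)) (same_gram k) v4 A4"
        "A4 aSym = A3 aSym" "\<forall>q<n. A5 aCtx q = A4 aId q" "\<forall>b. b \<noteq> aCtx \<longrightarrow> A5 b = A4 b"
        "named (1 + d * N + k * (d * N) + d * N) (\<lambda>q q'. same_gram k q q' \<and> sym (q + k) = sym (q' + k)) v6 A6 \<and>
         A6 aSym = A5 aSym \<and> A6 aCtx = A5 aCtx"
      have "names (A6 aId) (same_gram (k + 1))" using *(8)
        by (auto simp: named_def names_def same_gram_def less_Suc_eq)
      moreover have "names (A6 aSym) (same_gram 1)"
        by (rule names_cong[of "A1 aId"]) (use * in \<open>simp_all add: named_def\<close>)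
      moreover have "names (A6 aCtx) (same_gram k)"
        by (rule names_cong[of "A4 aId"]) (use * in \<open>simp_all add: named_def\<close>)
      ultimately show "names (A6 aSym) (same_gram 1) \<and> names (A6 aCtx) (same_gram k) \<and> names (A6 aId) (same_gram (k + 1))"
        by simp
    qed (use stamp N_pos in \<open>simp_all add: algebra_simps Suc_le_eq\<close>)
  next
    show "expr_time (K 1) + 1 + ((k + 2) * ?t + 121 * N) \<le> (k + 2) * ?t + 200 * N"
      using N_pos unfolding expr_time.simps by linarith
  qed auto
qed

end
end

section \<open>Costs of a sliding window\<close>

definition occ :: "(nat \<Rightarrow> nat) \<Rightarrow> nat \<Rightarrow> nat \<Rightarrow> nat \<Rightarrow> nat" where
  "occ f i e x = card {q. i \<le> q \<and> q < e \<and> f q = x}"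

lemma occ_empty: "e \<le> i \<Longrightarrow> occ f i e x = 0"
  unfolding occ_def by (auto intro!: card_eq_0_iff[THEN iffD2])

lemma occ_Suc_right: "i \<le> e \<Longrightarrow> occ f i (Suc e) x = occ f i e x + (if f e = x then 1 else 0)"
proof -
  assume "i \<le> e"
  then have "{q. i \<le> q \<and> q < Suc e \<and> f q = x} =
      (if f e = x then insert e {q. i \<le> q \<and> q < e \<and> f q = x} else {q. i \<le> q \<and> q < e \<and> f q = x})"
    by (auto simp: less_Suc_eq)
  then show ?thesis unfolding occ_def by simp
qed

lemma occ_Suc_left: "i < e \<Longrightarrow> occ f i e x = occ f (Suc i) e x + (if f i = x then 1 else 0)"
proof -
  assume "i < e"
  then have "{q. i \<le> q \<and> q < e \<and> f q = x} =
      (if f i = x then insert i {q. Suc i \<le> q \<and> q < e \<and> f q = x} else {q. Suc i \<le> q \<and> q < e \<and> f q = x})"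
    by (auto simp: Suc_le_eq le_less)
  then show ?thesis unfolding occ_def by simp
qed

lemma occ_le: "occ f i e x \<le> e - i"
proof -
  have "card {q. i \<le> q \<and> q < e \<and> f q = x} \<le> card {i..<e}" by (intro card_mono) auto
  then show ?thesis by (simp add: occ_def)
qed

lemma occ_pos_iff: "0 < occ f i e x \<longleftrightarrow> x \<in> f ` {i..<e}"
  unfolding occ_def by (subst card_gt_0_iff) auto

definition occ_sum :: "(nat \<Rightarrow> nat) \<Rightarrow> nat \<Rightarrow> (nat \<Rightarrow> nat) \<Rightarrow> nat \<Rightarrow> nat \<Rightarrow> nat" where
  "occ_sum X N f i e = (\<Sum>x<N. X (occ f i e x))"

text \<open>Only the counter of \<open>y\<close> changes, hence only one summand. The equation is
  additive because the terms are naturals and \<open>X\<close> is not assumed monotone.\<close>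

lemma occ_sum_change:
  assumes "y < N" "\<And>x. x \<noteq> y \<Longrightarrow> occ f i e x = occ f i' e' x"
  shows "occ_sum X N f i e + X (occ f i' e' y) = occ_sum X N f i' e' + X (occ f i e y)"
proof -
  have "(\<Sum>x\<in>{..<N} - {y}. X (occ f i e x)) = (\<Sum>x\<in>{..<N} - {y}. X (occ f i' e' x))"
    using assms by (intro sum.cong) auto
  then show ?thesis unfolding occ_sum_def using assms(1) by (simp add: sum.remove[of _ y])
qed

lemma occ_sum_right:
  "i \<le> e \<Longrightarrow> f e < N \<Longrightarrow>
    occ_sum X N f i (Suc e) + X (occ f i e (f e)) = occ_sum X N f i e + X (Suc (occ f i e (f e)))"
  using occ_sum_change[of "f e" N f i "Suc e" i e X] by (simp add: occ_Suc_right)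

lemma occ_sum_left:
  "i < e \<Longrightarrow> f i < N \<Longrightarrow>
    occ_sum X N f i e + X (occ f (Suc i) e (f i)) = occ_sum X N f (Suc i) e + X (Suc (occ f (Suc i) e (f i)))"
  using occ_sum_change[of "f i" N f i e "Suc i" e X] by (simp add: occ_Suc_left)

lemma occ_sum_empty: "e \<le> i \<Longrightarrow> X 0 = 0 \<Longrightarrow> occ_sum X N f i e = 0"
  by (simp add: occ_sum_def occ_empty)

text \<open>The counters of a window add up to at most \<open>n\<close>, whatever the number of
  names. This keeps the maintained sums within a word.\<close>

lemma occ_sum_le:
  assumes "\<And>m. X m \<le> m * b" "e \<le> n"
  shows "occ_sum X N f i e \<le> n * b"
proof -
  have "(\<Sum>x<N. occ f i e x) = card (\<Union>x<N. {q. i \<le> q \<and> q < e \<and> f q = x})"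
    unfolding occ_def by (subst card_UN_disjoint) auto
  also have "\<dots> \<le> card {..<n}" using assms(2) by (intro card_mono) auto
  finally have "(\<Sum>x<N. occ f i e x) * b \<le> n * b" by simp
  moreover have "occ_sum X N f i e \<le> (\<Sum>x<N. occ f i e x * b)"
    unfolding occ_sum_def by (intro sum_mono assms(1))
  ultimately show ?thesis by (simp add: sum_distrib_right)
qed

text \<open>The extension by the symbol at \<open>vj\<close> is only tried: the primed variables
  receive the new values, and the counters change only if the extension is accepted. The arithmetic
  is \<open>Raw\<close> because the additive term may be negative, in two's complement. The summand
  \<open>vN\<close> absorbs the rounding error of the estimate.\<close>

definition test_block :: "expr \<Rightarrow> nat \<Rightarrow> cmd" where
  "test_block fe k =
     Set vflag (K 0) ;;
     If (Lt (V vj) (V vn))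
       (Set vHA' (V vHA) ;; Set vHB' (V vHB) ;;
        If (Lt (V vj) (Bin Add (V vi) (K k))) NOP
          (Set vx (Arr aCtx (Bin Sub (V vj) (K k))) ;;
           Set vHA' (Bin Sub (Bin Add (V vHA) (Arr aX (plus1 (Arr aCC (V vx))))) (Arr aX (Arr aCC (V vx)))) ;;
           Set vx (Arr aId (Bin Sub (V vj) (K k))) ;;
           Set vHB' (Bin Sub (Bin Add (V vHB) (Arr aX (plus1 (Arr aCP (V vx))))) (Arr aX (Arr aCP (V vx))))) ;;
        Set vds' (V vds) ;;
        If (Eql (Arr aCS (Arr aSym (V vj))) (K 0)) (Set vds' (plus1 (V vds))) NOP ;;
        If (Lt (V vth) (Bin Add (Raw Sub (Raw Add (V vHA') fe) (V vHB')) (V vN))) NOP (Set vflag (K 1)))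
       NOP"

text \<open>Every iteration increases \<open>vi + vj\<close> by 1 and so owns one bit of the class:
  an advance of the right end writes 1, an advance of the left end leaves 0.\<close>

definition add_block :: "nat \<Rightarrow> cmd" where
  "add_block k =
     If (Lt (V vj) (Bin Add (V vi) (K k))) NOP
       (Set vx (Arr aCtx (Bin Sub (V vj) (K k))) ;; Put aCC (V vx) (plus1 (Arr aCC (V vx))) ;;
        Set vx (Arr aId (Bin Sub (V vj) (K k))) ;; Put aCP (V vx) (plus1 (Arr aCP (V vx)))) ;;
     Set vx (Arr aSym (V vj)) ;; Put aCS (V vx) (plus1 (Arr aCS (V vx))) ;;
     Set vHA (V vHA') ;; Set vHB (V vHB') ;; Set vds (V vds') ;;
     Set vx (Bin Add (V vi) (V vj)) ;;
     Set vy (Bin Add (plus1 (V vblk)) (Bin Div (V vx) (V vB))) ;;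
     Put aTail (V vy) (Bin Add (Arr aTail (V vy)) (Arr aPow (Bin Mod (V vx) (V vB)))) ;;
     Set vj (plus1 (V vj))"

definition remove_block :: "nat \<Rightarrow> cmd" where
  "remove_block k =
     If (Lt (Bin Add (V vi) (K k)) (V vj))
       (Set vx (Arr aCtx (V vi)) ;; Put aCC (V vx) (Bin Sub (Arr aCC (V vx)) (K 1)) ;;
        Set vHA (Bin Sub (Bin Add (V vHA) (Arr aX (Arr aCC (V vx)))) (Arr aX (plus1 (Arr aCC (V vx))))) ;;
        Set vx (Arr aId (V vi)) ;; Put aCP (V vx) (Bin Sub (Arr aCP (V vx)) (K 1)) ;;
        Set vHB (Bin Sub (Bin Add (V vHB) (Arr aX (Arr aCP (V vx)))) (Arr aX (plus1 (Arr aCP (V vx))))))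
       NOP ;;
     Set vx (Arr aSym (V vi)) ;; Put aCS (V vx) (Bin Sub (Arr aCS (V vx)) (K 1)) ;;
     If (Eql (Arr aCS (V vx)) (K 0)) (Set vds (Bin Sub (V vds) (K 1))) NOP ;;
     Set vi (plus1 (V vi))"

definition sweep_body :: "expr \<Rightarrow> nat \<Rightarrow> cmd" where
  "sweep_body fe k = test_block fe k ;; If (Eql (V vflag) (K 1)) (add_block k) (remove_block k)"

definition sweep :: "expr \<Rightarrow> nat \<Rightarrow> cmd" where
  "sweep fe k =
     Set vi (K 0) ;; Set vj (K 0) ;; Set vHA (K 0) ;; Set vHB (K 0) ;; Set vds (K 0) ;;
     While (Lt (V vi) (V vn)) (sweep_body fe k) ;;
     Put aTail (V vblk) (V vn)"

text \<open>The expression \<open>fe\<close> is evaluated while an extension is tried. It therefore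
  refers to the window that already includes position \<open>vj\<close>, which has length
  \<open>Suc vj - vi\<close> and \<open>vds'\<close> distinct symbols.\<close>

locale cost_machine = text_machine F w M T k
  for F w M and T :: "nat list" and k +
  fixes X :: "nat \<Rightarrow> nat" and Fv :: "nat \<Rightarrow> nat \<Rightarrow> nat" and fe :: expr and Q0 G0 XB B :: nat
    and f1 f2 f3 :: "nat \<Rightarrow> nat"
  assumes X0: "X 0 = 0" and X_le: "\<And>m. X m \<le> m * XB" and XB_word: "4 * cells T * XB < 2 ^ w"
    and fe: "\<And>v A. v vn = length T \<Longrightarrow> v vN = cells T \<Longrightarrow> v vQ = Q0 \<Longrightarrow> v vG = G0 \<Longrightarrow>
      v vi \<le> v vj \<Longrightarrow> v vj < length T \<Longrightarrow>
      machine.ok F w M (cells T) fe v A \<and> machine.ev F w fe v A = Fv (Suc (v vj) - v vi) (v vds')"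
    and fe_time: "expr_time fe \<le> 40"
    and B: "0 < B" "B < w" "B \<le> cells T"
    and f_less: "\<And>q. q < length T \<Longrightarrow> f1 q < cells T" "\<And>q. q < length T \<Longrightarrow> f2 q < cells T"
      "\<And>q. q < length T \<Longrightarrow> f3 q < cells T"
begin

section \<open>Window sums and their updates\<close>

text \<open>\<open>f1\<close>, \<open>f2\<close>, \<open>f3\<close> name the symbols, the \<open>k\<close>-grams and the \<open>k+1\<close>-grams.\<close>

definition base :: "vars \<Rightarrow> arrays \<Rightarrow> bool" where
  "base v A \<longleftrightarrow> v vn = n \<and> v vN = N \<and> v vQ = Q0 \<and> v vG = G0 \<and> v vB = B \<and>
     (\<forall>q<n. A aSym q = f1 q) \<and> (\<forall>q<n. A aCtx q = f2 q) \<and> (\<forall>q<n. A aId q = f3 q) \<and>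
     (\<forall>m\<le>n. A aX m = X m) \<and> (\<forall>b<B. A aPow b = 2 ^ b)"

text \<open>A \<open>k\<close>-gram contributes to some string of followers only if the window
  contains a symbol after it. Both sums therefore range over starting positions below
  \<open>j - k\<close>.\<close>

definition HA :: "nat \<Rightarrow> nat \<Rightarrow> nat" where "HA i j = occ_sum X N f2 i (j - k)"
definition HB :: "nat \<Rightarrow> nat \<Rightarrow> nat" where "HB i j = occ_sum X N f3 i (j - k)"
definition DS :: "nat \<Rightarrow> nat \<Rightarrow> nat" where "DS i j = card (f1 ` {i..<j})"

definition estim :: "nat \<Rightarrow> nat \<Rightarrow> nat" where
  "estim i j = apply_op w Sub (apply_op w Add (HA i j) (Fv (j - i) (DS i j))) (HB i j)"

definition window :: "nat \<Rightarrow> nat \<Rightarrow> vars \<Rightarrow> arrays \<Rightarrow> bool" where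
  "window i j v A \<longleftrightarrow> v vi = i \<and> v vj = j \<and> v vHA = HA i j \<and> v vHB = HB i j \<and> v vds = DS i j \<and>
     (\<forall>x<N. A aCS x = occ f1 i j x) \<and> (\<forall>x<N. A aCC x = occ f2 i (j - k) x) \<and>
     (\<forall>x<N. A aCP x = occ f3 i (j - k) x)"

lemma small_word: "x \<le> 2 * n + 2 + k \<Longrightarrow> x < 2 ^ w"
  using k_word by (simp add: cells_def)

lemma H_le: "j \<le> n \<Longrightarrow> HA i j \<le> n * XB" "j \<le> n \<Longrightarrow> HB i j \<le> n * XB"
  unfolding HA_def HB_def by (intro occ_sum_le X_le; simp)+

lemma H_word: "j \<le> n \<Longrightarrow> m \<le> n \<Longrightarrow> HA i j + X m < 2 ^ w" "j \<le> n \<Longrightarrow> m \<le> n \<Longrightarrow> HB i j + X m < 2 ^ w"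
proof -
  have "n * XB \<le> N * XB" by (intro mult_le_mono) (simp_all add: less_imp_le)
  then have le: "2 * (n * XB) < 2 ^ w" using XB_word by linarith
  have Xm: "X m \<le> n * XB" if "m \<le> n" for m
    using X_le[of m] mult_le_mono1[OF that, of XB] by linarith
  show "HA i j + X m < 2 ^ w" if "j \<le> n" "m \<le> n" using le H_le(1)[OF that(1), of i] Xm[OF that(2)] by linarith
  show "HB i j + X m < 2 ^ w" if "j \<le> n" "m \<le> n" using le H_le(2)[OF that(1), of i] Xm[OF that(2)] by linarith
qed

lemma H_short: "j \<le> i + k \<Longrightarrow> HA i j = 0" "j \<le> i + k \<Longrightarrow> HB i j = 0"
  unfolding HA_def HB_def by (intro occ_sum_empty X0; simp)+

text \<open>The two inequalities make the subtractions exact, which is the obligation attached to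
  \<open>Sub\<close>.\<close>

lemma H_right:
  assumes "i + k \<le> j" "j < n"
  shows "HA i (Suc j) = HA i j + X (Suc (occ f2 i (j - k) (f2 (j - k)))) - X (occ f2 i (j - k) (f2 (j - k)))"
    "HB i (Suc j) = HB i j + X (Suc (occ f3 i (j - k) (f3 (j - k)))) - X (occ f3 i (j - k) (f3 (j - k)))"
    "X (occ f2 i (j - k) (f2 (j - k))) \<le> HA i j + X (Suc (occ f2 i (j - k) (f2 (j - k))))"
    "X (occ f3 i (j - k) (f3 (j - k))) \<le> HB i j + X (Suc (occ f3 i (j - k) (f3 (j - k))))"
proof -
  have ik: "i \<le> j - k" "j - k < n" "Suc j - k = Suc (j - k)" using assms by auto
  note r = occ_sum_right[where f = f2 and X = X, OF ik(1) f_less(2)[OF ik(2)]]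
    occ_sum_right[where f = f3 and X = X, OF ik(1) f_less(3)[OF ik(2)]]
  show "HA i (Suc j) = HA i j + X (Suc (occ f2 i (j - k) (f2 (j - k)))) - X (occ f2 i (j - k) (f2 (j - k)))"
    "X (occ f2 i (j - k) (f2 (j - k))) \<le> HA i j + X (Suc (occ f2 i (j - k) (f2 (j - k))))"
    unfolding HA_def ik(3) using r(1) by linarith+
  show "HB i (Suc j) = HB i j + X (Suc (occ f3 i (j - k) (f3 (j - k)))) - X (occ f3 i (j - k) (f3 (j - k)))"
    "X (occ f3 i (j - k) (f3 (j - k))) \<le> HB i j + X (Suc (occ f3 i (j - k) (f3 (j - k))))"
    unfolding HB_def ik(3) using r(2) by linarith+
qed

lemma H_left:
  assumes "i + k < j" "j \<le> n"
  shows "HA (Suc i) j = HA i j + X (occ f2 (Suc i) (j - k) (f2 i)) - X (Suc (occ f2 (Suc i) (j - k) (f2 i)))"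
    "HB (Suc i) j = HB i j + X (occ f3 (Suc i) (j - k) (f3 i)) - X (Suc (occ f3 (Suc i) (j - k) (f3 i)))"
    "X (Suc (occ f2 (Suc i) (j - k) (f2 i))) \<le> HA i j + X (occ f2 (Suc i) (j - k) (f2 i))"
    "X (Suc (occ f3 (Suc i) (j - k) (f3 i))) \<le> HB i j + X (occ f3 (Suc i) (j - k) (f3 i))"
proof -
  have ik: "i < j - k" "i < n" using assms by auto
  note r = occ_sum_left[where f = f2 and X = X, OF ik(1) f_less(2)[OF ik(2)]]
    occ_sum_left[where f = f3 and X = X, OF ik(1) f_less(3)[OF ik(2)]]
  show "HA (Suc i) j = HA i j + X (occ f2 (Suc i) (j - k) (f2 i)) - X (Suc (occ f2 (Suc i) (j - k) (f2 i)))"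
    "X (Suc (occ f2 (Suc i) (j - k) (f2 i))) \<le> HA i j + X (occ f2 (Suc i) (j - k) (f2 i))"
    unfolding HA_def using r(1) by linarith+
  show "HB (Suc i) j = HB i j + X (occ f3 (Suc i) (j - k) (f3 i)) - X (Suc (occ f3 (Suc i) (j - k) (f3 i)))"
    "X (Suc (occ f3 (Suc i) (j - k) (f3 i))) \<le> HB i j + X (occ f3 (Suc i) (j - k) (f3 i))"
    unfolding HB_def using r(2) by linarith+
qed

lemma DS_right: "i \<le> j \<Longrightarrow> DS i (Suc j) = (if occ f1 i j (f1 j) = 0 then Suc (DS i j) else DS i j)"
  using occ_pos_iff[of f1 i j "f1 j"]
  by (auto simp: DS_def atLeastLessThanSuc card_insert_if)

lemma DS_left: "i < j \<Longrightarrow> DS (Suc i) j = (if occ f1 (Suc i) j (f1 i) = 0 then DS i j - 1 else DS i j)"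
proof -
  assume "i < j"
  then have "{i..<j} = insert i {Suc i..<j}" by auto
  then show ?thesis
    using occ_pos_iff[of f1 "Suc i" j "f1 i"] by (auto simp: DS_def card_insert_if)
qed

lemma DS_le: "j \<le> n \<Longrightarrow> DS i j \<le> n"
  unfolding DS_def by (rule order_trans[OF card_image_le]) auto

lemma test_block:
  assumes b: "base v A" and W: "window i j v A" and ij: "i \<le> j" "j \<le> n"
    and V: "j < n \<Longrightarrow> estim i (Suc j) + N < 2 ^ w"
  shows "ex (test_block fe k) v A 400 (\<lambda>v' A'. A' = A \<and>
    (\<forall>x. x \<notin> {vflag, vHA', vHB', vx, vds'} \<longrightarrow> v' x = v x) \<and>
    (v' vflag = 1 \<longleftrightarrow> j < n \<and> estim i (Suc j) + N \<le> v vth) \<and>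
    (j < n \<longrightarrow> v' vHA' = HA i (Suc j) \<and> v' vHB' = HB i (Suc j) \<and> v' vds' = DS i (Suc j)))"
proof (cases "j < n")
  case False
  then show ?thesis
    by (intro ex_wp) (use b W fe_time in \<open>auto simp: test_block_def base_def window_def\<close>)
next
  case True
  have base': "v vn = n" "v vN = N" "v vQ = Q0" "v vG = G0" "A aSym j = f1 j"
    "A aX m = X m" if "m \<le> n" for m
    using b True that by (auto simp: base_def)
  have win': "v vi = i" "v vj = j" "v vHA = HA i j" "v vHB = HB i j" "v vds = DS i j"
    "A aCS (f1 j) = occ f1 i j (f1 j)"
    using W f_less[OF True] by (auto simp: window_def)
  have len: "f1 j < N" "j < N" "j - k < N" "i + k < 2 ^ w" "k < 2 ^ w" "Suc (DS i j) < 2 ^ w"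
    using f_less[OF True] True ij DS_le[of j i] by (simp_all add: less_N small_word)
  let ?ds = "if occ f1 i j (f1 j) = 0 then Suc (DS i j) else DS i j"
  have fe': "ok fe v' A \<and> ev fe v' A = Fv (Suc j - i) (v' vds')" if "\<And>x. x \<in> {vn, vN, vQ, vG, vi, vj} \<Longrightarrow> v' x = v x" for v'
    using fe[of v' A] that base'[of 0] win' ij True by simp
  have E: "estim i (Suc j) = apply_op w Sub (apply_op w Add (HA i (Suc j)) (Fv (Suc j - i) ?ds)) (HB i (Suc j))"
    using DS_right[OF ij(1)] by (simp add: estim_def)
  define rest where "rest = (Set vds' (V vds) ;;
        If (Eql (Arr aCS (Arr aSym (V vj))) (K 0)) (Set vds' (plus1 (V vds))) NOP ;;
        If (Lt (V vth) (Bin Add (Raw Sub (Raw Add (V vHA') fe) (V vHB')) (V vN))) NOP (Set vflag (K 1)))"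
  have rest: "wp rest (\<lambda>v' A'. A' = A \<and>
    (\<forall>x. x \<notin> {vflag, vHA', vHB', vx, vds'} \<longrightarrow> v' x = v x) \<and>
    (v' vflag = 1 \<longleftrightarrow> j < n \<and> estim i (Suc j) + N \<le> v vth) \<and>
    (j < n \<longrightarrow> v' vHA' = HA i (Suc j) \<and> v' vHB' = HB i (Suc j) \<and> v' vds' = DS i (Suc j))) v' A"
    if v': "\<And>x. x \<notin> {vflag, vHA', vHB', vx, vds'} \<Longrightarrow> v' x = v x" "v' vHA' = HA i (Suc j)" "v' vHB' = HB i (Suc j)"
      "v' vflag = 0" for v'
  proof -
    have v'': "v' vn = n" "v' vN = N" "v' vj = j" "v' vds = DS i j" "v' vth = v vth"
      using v' base'[of 0] win' by auto
    have fe1: "ok fe (v'(vds' := d)) A \<and> ev fe (v'(vds' := d)) A = Fv (Suc j - i) d" for d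
    proof -
      have "(v'(vds' := d)) x = v x" if "x \<in> {vn, vN, vQ, vG, vi, vj}" for x using that v'(1)[of x] by auto
      with fe'[of "v'(vds' := d)"] show ?thesis by (metis fun_upd_same)
    qed
    have fe2: "ok fe (v'(vds' := c, vds' := d)) A \<and> ev fe (v'(vds' := c, vds' := d)) A = Fv (Suc j - i) d" for c d
      using fe1 by simp
    show ?thesis
      unfolding rest_def using V[OF True] v'' base'[of 0] win' len fe1 True E DS_right[OF ij(1)] v'
      by (simp del: apply_op.simps) (auto simp del: apply_op.simps)
  qed
  have "wp (test_block fe k) (\<lambda>v' A'. A' = A \<and>
    (\<forall>x. x \<notin> {vflag, vHA', vHB', vx, vds'} \<longrightarrow> v' x = v x) \<and>
    (v' vflag = 1 \<longleftrightarrow> j < n \<and> estim i (Suc j) + N \<le> v vth) \<and>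
    (j < n \<longrightarrow> v' vHA' = HA i (Suc j) \<and> v' vHB' = HB i (Suc j) \<and> v' vds' = DS i (Suc j))) v A"
  proof (cases "j < i + k")
    case short: True
    then have z: "HA i (Suc j) = 0" "HB i (Suc j) = 0" "HA i j = 0" "HB i j = 0" using H_short by auto
    have "wp rest (\<lambda>v' A'. A' = A \<and>
      (\<forall>x. x \<notin> {vflag, vHA', vHB', vx, vds'} \<longrightarrow> v' x = v x) \<and>
      (v' vflag = 1 \<longleftrightarrow> j < n \<and> estim i (Suc j) + N \<le> v vth) \<and>
      (j < n \<longrightarrow> v' vHA' = HA i (Suc j) \<and> v' vHB' = HB i (Suc j) \<and> v' vds' = DS i (Suc j)))
      (v(vflag := 0, vHA' := HA i j, vHB' := HB i j)) A"
      by (rule rest) (use z in auto)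
    then show ?thesis
      unfolding test_block_def rest_def[symmetric] wp.simps tok.simps tev.simps ok.simps ev.simps
      using short True base'[of 0] win' len by simp
  next
    case long: False
    then have ij': "i + k \<le> j" by simp
    let ?c2 = "occ f2 i (j - k) (f2 (j - k))" and ?c3 = "occ f3 i (j - k) (f3 (j - k))"
    have cc: "A aCtx (j - k) = f2 (j - k)" "A aId (j - k) = f3 (j - k)" "f2 (j - k) < N" "f3 (j - k) < N"
      "A aCC (f2 (j - k)) = ?c2" "A aCP (f3 (j - k)) = ?c3"
      using b W True f_less[of "j - k"] by (auto simp: base_def window_def)
    have le: "?c2 < n" "?c3 < n"
      using occ_le[of f2 i "j - k" "f2 (j - k)"] occ_le[of f3 i "j - k" "f3 (j - k)"] True by linarith+
    then have X': "A aX ?c2 = X ?c2" "A aX (Suc ?c2) = X (Suc ?c2)" "A aX ?c3 = X ?c3" "A aX (Suc ?c3) = X (Suc ?c3)"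
      "?c2 < N" "?c3 < N" "Suc ?c2 < N" "Suc ?c3 < N" "Suc ?c2 < 2 ^ w" "Suc ?c3 < 2 ^ w"
      "HA i j + X (Suc ?c2) < 2 ^ w" "HB i j + X (Suc ?c3) < 2 ^ w"
      using base'(6) ij by (simp_all add: less_N Suc_le_eq H_word small_word less_imp_le)
    note H = H_right[OF ij' True]
    have "wp rest (\<lambda>v' A'. A' = A \<and>
      (\<forall>x. x \<notin> {vflag, vHA', vHB', vx, vds'} \<longrightarrow> v' x = v x) \<and>
      (v' vflag = 1 \<longleftrightarrow> j < n \<and> estim i (Suc j) + N \<le> v vth) \<and>
      (j < n \<longrightarrow> v' vHA' = HA i (Suc j) \<and> v' vHB' = HB i (Suc j) \<and> v' vds' = DS i (Suc j)))
      (v(vflag := 0, vHA' := HA i j, vHB' := HB i j, vx := f2 (j - k), vHA' := HA i (Suc j), vx := f3 (j - k),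
        vHB' := HB i (Suc j))) A"
      by (rule rest) auto
    then show ?thesis
      unfolding test_block_def rest_def[symmetric]
      using long ij' True base'[of 0] win' len cc X' H by simp
  qed
  then show ?thesis by (rule ex_wp) (use fe_time in \<open>simp add: test_block_def\<close>)
qed

text \<open>The block of a class starts at \<open>blk\<close>: one cell, followed by a bit array with \<open>B\<close> bits per cell.\<close>

definition bit_at :: "(nat \<Rightarrow> nat) \<Rightarrow> nat \<Rightarrow> nat \<Rightarrow> bool" where
  "bit_at t blk s \<longleftrightarrow> bit (t (blk + 1 + s div B)) (s mod B)"

definition bits_in :: "(nat \<Rightarrow> nat) \<Rightarrow> nat \<Rightarrow> bool" where
  "bits_in t blk \<longleftrightarrow> (\<forall>s. t (blk + 1 + s div B) < 2 ^ B)"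

lemma set_bit_at:
  assumes "bits_in t blk" "\<not> bit_at t blk s"
  defines "y \<equiv> blk + 1 + s div B"
  defines "t' \<equiv> t(y := t y + 2 ^ (s mod B))"
  shows "bits_in t' blk" "bit_at t' blk s' \<longleftrightarrow> bit_at t blk s' \<or> s' = s" "t y + 2 ^ (s mod B) < 2 ^ w"
proof -
  have m: "s mod B < B" using B by simp
  \<comment> \<open>The bit is 0, so the addition produces no carry and merely sets it.\<close>
  have eq: "t y + 2 ^ (s mod B) = set_bit (s mod B) (t y)"
    using assms(2) by (simp add: set_bit_eq bit_at_def y_def)
  have tB: "take_bit B (t y) = t y"
    using assms(1) by (simp add: bits_in_def y_def take_bit_nat_eq_self_iff)
  have "take_bit B (set_bit (s mod B) (t y)) = set_bit (s mod B) (t y)"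
    using m tB by (simp add: take_bit_set_bit_eq)
  then have less: "t y + 2 ^ (s mod B) < 2 ^ B" unfolding eq by (simp add: take_bit_nat_eq_self_iff)
  then show "bits_in t' blk" using assms(1) by (auto simp: bits_in_def t'_def y_def)
  have "(2::nat) ^ B \<le> 2 ^ w" using B by (intro power_increasing) auto
  with less show "t y + 2 ^ (s mod B) < 2 ^ w" by linarith
  show "bit_at t' blk s' \<longleftrightarrow> bit_at t blk s' \<or> s' = s"
  proof (cases "s' div B = s div B")
    case True
    moreover have "s' = s \<longleftrightarrow> s' mod B = s mod B"
      using True by (metis div_mult_mod_eq)
    ultimately show ?thesis
      unfolding bit_at_def t'_def y_def fun_upd_apply eq[unfolded y_def]
      by (auto simp: bit_set_bit_iff)
  next
    case False
    then show ?thesis by (auto simp: bit_at_def t'_def y_def)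
  qed
qed

lemma add_block:
  assumes b: "base v A" and W: "window i j v A" and ij: "i \<le> j" "j < n" "i < n"
    and H': "v vHA' = HA i (Suc j)" "v vHB' = HB i (Suc j)" "v vds' = DS i (Suc j)"
    and blk: "17 * N + (v vblk + 1 + (i + j) div B) < M"
    and bits: "bits_in (A aTail) (v vblk)" "\<not> bit_at (A aTail) (v vblk) (i + j)"
  shows "ex (add_block k) v A 300 (\<lambda>v' A'. window i (Suc j) v' A' \<and>
    A' aTail = (let y = v vblk + 1 + (i + j) div B in (A aTail)(y := A aTail y + 2 ^ ((i + j) mod B))))"
proof -
  have base': "v vn = n" "v vN = N" "v vB = B" "A aSym j = f1 j" "A aPow ((i + j) mod B) = 2 ^ ((i + j) mod B)"
    using b ij B by (auto simp: base_def)
  have win': "v vi = i" "v vj = j" "A aCS (f1 j) = occ f1 i j (f1 j)"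
    using W f_less[OF ij(2)] by (auto simp: window_def)
  have "(i + j) mod B < B" using B by simp
  then have len: "f1 j < N" "j < N" "j - k < N" "i + k < 2 ^ w" "k < 2 ^ w" "i + j < 2 ^ w" "(i + j) mod B < N"
    "Suc j < 2 ^ w" "Suc (occ f1 i j (f1 j)) < 2 ^ w"
    using f_less[OF ij(2)] ij B(3)[unfolded cells_def] occ_le[of f1 i j "f1 j"]
    by (simp_all add: less_N small_word)
  define y where "y = v vblk + 1 + (i + j) div B"
  have y: "Suc (v vblk + (i + j) div B) = y" "Suc (v vblk) + (i + j) div B = y" "17 * N + y < M" "y < 2 ^ w" "Suc (v vblk) < 2 ^ w"
    "v vblk < 2 ^ w" "A aTail y + 2 ^ ((i + j) mod B) < 2 ^ w"
    using blk M_word set_bit_at(3)[OF bits] by (simp_all add: y_def)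
  have f1s: "x \<noteq> f1 j \<Longrightarrow> occ f1 i (Suc j) x = occ f1 i j x" "occ f1 i (Suc j) (f1 j) = Suc (occ f1 i j (f1 j))" for x
    using occ_Suc_right[OF ij(1), of f1] by auto
  show ?thesis
  proof (cases "j < i + k")
    case short: True
    then have z: "occ f2 i (j - k) x = 0" "occ f2 i (Suc j - k) x = 0" "occ f3 i (j - k) x = 0" "occ f3 i (Suc j - k) x = 0"
      for x by (auto intro!: occ_empty)
    show ?thesis
      by (rule ex_wp) (use short base' win' len y H' W f1s z in
          \<open>simp_all add: add_block_def window_def y_def[symmetric] Let_def\<close>)
  next
    case long: False
    then have ij': "i \<le> j - k" "j - k < n" "Suc j - k = Suc (j - k)" using ij by auto
    let ?c2 = "occ f2 i (j - k) (f2 (j - k))" and ?c3 = "occ f3 i (j - k) (f3 (j - k))"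
    have cc: "A aCtx (j - k) = f2 (j - k)" "A aId (j - k) = f3 (j - k)" "f2 (j - k) < N" "f3 (j - k) < N"
      "A aCC (f2 (j - k)) = ?c2" "A aCP (f3 (j - k)) = ?c3"
      using b W ij' f_less[of "j - k"] by (auto simp: base_def window_def)
    have "?c2 < n" "?c3 < n"
      using occ_le[of f2 i "j - k" "f2 (j - k)"] occ_le[of f3 i "j - k" "f3 (j - k)"] ij by linarith+
    then have le: "Suc ?c2 < 2 ^ w" "Suc ?c3 < 2 ^ w" by (simp_all add: small_word)
    have f2s: "x \<noteq> f2 (j - k) \<Longrightarrow> occ f2 i (Suc j - k) x = occ f2 i (j - k) x" "occ f2 i (Suc j - k) (f2 (j - k)) = Suc ?c2"
      "x \<noteq> f3 (j - k) \<Longrightarrow> occ f3 i (Suc j - k) x = occ f3 i (j - k) x" "occ f3 i (Suc j - k) (f3 (j - k)) = Suc ?c3" for x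
      using occ_Suc_right[OF ij'(1)] ij'(3) by auto
    show ?thesis
      by (rule ex_wp) (use long base' win' len y H' W f1s f2s cc le in
          \<open>simp_all add: add_block_def window_def y_def[symmetric] Let_def\<close>)
  qed
qed

lemma remove_block:
  assumes b: "base v A" and W: "window i j v A" and ij: "i < j" "j \<le> n"
  shows "ex (remove_block k) v A 300 (\<lambda>v' A'. window (Suc i) j v' A')"
proof -
  have i: "i < n" using ij by simp
  have base': "v vn = n" "v vN = N" "A aSym i = f1 i" and aX: "A aX m = X m" if "m \<le> n" for m
    using b that i by (auto simp: base_def)
  have o1: "occ f1 i j x = occ f1 (Suc i) j x + (if f1 i = x then 1 else 0)" for x
    using occ_Suc_left[OF ij(1)] .
  have win': "v vi = i" "v vj = j" "v vHA = HA i j" "v vHB = HB i j" "v vds = DS i j"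
    "A aCS (f1 i) = Suc (occ f1 (Suc i) j (f1 i))"
    using W f_less[OF i] o1 by (auto simp: window_def)
  have "DS i j > 0" using ij by (auto simp: DS_def card_gt_0_iff)
  then have len: "f1 i < N" "i < N" "i + k < 2 ^ w" "k < 2 ^ w" "Suc i < 2 ^ w" "Suc 0 \<le> DS i j"
    using f_less[OF i] i by (simp_all add: less_N small_word)
  have f1s: "x \<noteq> f1 i \<Longrightarrow> occ f1 i j x = occ f1 (Suc i) j x" for x
    using o1 by auto
  note DS = DS_left[OF ij(1)]
  show ?thesis
  proof (cases "i + k < j")
    case short: False
    then have z: "occ f2 i (j - k) x = 0" "occ f2 (Suc i) (j - k) x = 0" "occ f3 i (j - k) x = 0" "occ f3 (Suc i) (j - k) x = 0"
      for x by (auto intro!: occ_empty)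
    have H: "HA i j = 0" "HB i j = 0" "HA (Suc i) j = 0" "HB (Suc i) j = 0" using short by (auto intro!: H_short)
    show ?thesis
      by (rule ex_wp) (use short base'[of 0] win' len W f1s z H DS in \<open>simp_all add: remove_block_def window_def\<close>)
  next
    case long: True
    then have ij': "i < j - k" by simp
    let ?c2 = "occ f2 (Suc i) (j - k) (f2 i)" and ?c3 = "occ f3 (Suc i) (j - k) (f3 i)"
    have o2: "occ f2 i (j - k) x = occ f2 (Suc i) (j - k) x + (if f2 i = x then 1 else 0)"
      "occ f3 i (j - k) x = occ f3 (Suc i) (j - k) x + (if f3 i = x then 1 else 0)" for x
      using occ_Suc_left[OF ij'] by auto
    have cc: "A aCtx i = f2 i" "A aId i = f3 i" "f2 i < N" "f3 i < N"
      "A aCC (f2 i) = Suc ?c2" "A aCP (f3 i) = Suc ?c3"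
      using b W i f_less[of i] o2 by (auto simp: base_def window_def)
    have "?c2 < n" "?c3 < n"
      using occ_le[of f2 "Suc i" "j - k" "f2 i"] occ_le[of f3 "Suc i" "j - k" "f3 i"] ij by linarith+
    then have le: "A aX ?c2 = X ?c2" "A aX (Suc ?c2) = X (Suc ?c2)" "A aX ?c3 = X ?c3" "A aX (Suc ?c3) = X (Suc ?c3)"
      "?c2 < N" "?c3 < N" "Suc ?c2 < N" "Suc ?c3 < N" "Suc ?c2 < 2 ^ w" "Suc ?c3 < 2 ^ w"
      "HA i j + X ?c2 < 2 ^ w" "HB i j + X ?c3 < 2 ^ w"
      using aX ij by (simp_all add: less_N Suc_le_eq H_word small_word less_imp_le)
    have f2s: "x \<noteq> f2 i \<Longrightarrow> occ f2 i (j - k) x = occ f2 (Suc i) (j - k) x"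
      "x \<noteq> f3 i \<Longrightarrow> occ f3 i (j - k) x = occ f3 (Suc i) (j - k) x" for x
      using o2 by auto
    note H = H_left[OF long ij(2)]
    show ?thesis
      by (rule ex_wp) (use long base'[of 0] win' len W f1s f2s cc le H DS in
          \<open>simp_all add: remove_block_def window_def\<close>)
  qed
qed
end

section \<open>The sweep for one cost class\<close>

definition block_size :: "nat \<Rightarrow> nat \<Rightarrow> nat" where "block_size n B = 2 + 2 * n div B"

context cost_machine
begin

lemma base_frame:
  assumes "base v A" "\<And>x. x \<in> {vn, vN, vQ, vG, vB} \<Longrightarrow> v' x = v x"
    "\<And>a. a \<in> {aSym, aCtx, aId, aX, aPow} \<Longrightarrow> A' a = A a"
  shows "base v' A'"
  using assms by (simp add: base_def)

lemma mod_sweep: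
  "mod_vars (test_block fe k) = {vflag, vHA', vHB', vx, vds'}" "mod_arrays (test_block fe k) = {}"
  "mod_vars (add_block k) = {vx, vHA, vHB, vds, vy, vj}" "mod_arrays (add_block k) = {aCC, aCP, aCS, aTail}"
  "mod_vars (remove_block k) = {vx, vHA, vHB, vds, vi}" "mod_arrays (remove_block k) = {aCC, aCP, aCS}"
  by (auto simp: test_block_def add_block_def remove_block_def)

text \<open>\<open>e i\<close> is the far end of the window of threshold \<open>th\<close> that starts at \<open>i\<close>. As \<open>e\<close> is monotone, it
  is stored as a lattice path of \<open>2 n\<close> bits, in which the positions \<open>i + e i\<close> are 0.\<close>

definition stairs :: "(nat \<Rightarrow> nat \<Rightarrow> real) \<Rightarrow> nat \<Rightarrow> (nat \<Rightarrow> nat) \<Rightarrow> nat \<Rightarrow> nat \<Rightarrow> bool" where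
  "stairs W th e i j \<longleftrightarrow>
     (\<forall>i'<i. i' < e i' \<and> e i' \<le> j \<and> W i' (e i') \<le> th \<and>
       (\<forall>j'. i' < j' \<longrightarrow> j' \<le> n \<longrightarrow> W i' j' + 2 * N \<le> th \<longrightarrow> j' \<le> e i')) \<and>
     (\<forall>i1 i2. i1 \<le> i2 \<longrightarrow> i2 < i \<longrightarrow> e i1 \<le> e i2)"

definition coded :: "(nat \<Rightarrow> nat) \<Rightarrow> nat \<Rightarrow> (nat \<Rightarrow> nat) \<Rightarrow> nat \<Rightarrow> nat \<Rightarrow> bool" where
  "coded t blk e i j \<longleftrightarrow> (\<forall>s. bit_at t blk s \<longleftrightarrow> s < i + j \<and> (\<forall>i'<i. s \<noteq> i' + e i'))"

abbreviation "Z \<equiv> block_size n B"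

lemma cell_less_Z: "s < 2 * n \<Longrightarrow> 1 + s div B < Z"
  using div_le_mono[of s "2 * n" B] by (simp add: block_size_def)

context
  fixes W :: "nat \<Rightarrow> nat \<Rightarrow> real" and th blk :: nat and t0 :: "nat \<Rightarrow> nat"
  assumes unit: "\<And>i. i < n \<Longrightarrow> estim i (Suc i) + N \<le> th"
    and estim_word: "\<And>i j. i < j \<Longrightarrow> j \<le> n \<Longrightarrow> estim i j + N < 2 ^ w"
    and sound: "\<And>i j. i < j \<Longrightarrow> j \<le> n \<Longrightarrow> estim i j + N \<le> th \<Longrightarrow> W i j \<le> th"
    and complete: "\<And>i j. i < j \<Longrightarrow> j \<le> n \<Longrightarrow> th < estim i j + N \<Longrightarrow> th < W i j + 2 * N"
    and W_mono: "\<And>i j. Suc i < j \<Longrightarrow> j \<le> n \<Longrightarrow> W (Suc i) j \<le> W i j"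
    and W_mono2: "\<And>i j j'. i < j \<Longrightarrow> j \<le> j' \<Longrightarrow> j' \<le> n \<Longrightarrow> W i j \<le> W i j'"
    and blk_fits: "17 * N + blk + Z \<le> M"
begin

definition sweep_inv :: "nat \<Rightarrow> nat \<Rightarrow> (nat \<Rightarrow> nat) \<Rightarrow> vars \<Rightarrow> arrays \<Rightarrow> bool" where
  "sweep_inv i j e v A \<longleftrightarrow> base v A \<and> window i j v A \<and> i \<le> j \<and> j \<le> n \<and> v vth = th \<and> v vblk = blk \<and>
     (i < j \<longrightarrow> W i j \<le> th) \<and> stairs W th e i j \<and> bits_in (A aTail) blk \<and> coded (A aTail) blk e i j \<and>
     (\<forall>y. y < blk \<or> blk + Z \<le> y \<longrightarrow> A aTail y = t0 y)"

text \<open>The estimates need not be monotone; only the true weight \<open>W\<close> is. If the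
  left end advances, the extension by one symbol was rejected or the text has ended. A rejected
  window has \<open>W\<close> above \<open>th - 2 * N\<close>, hence so has every longer one with
  the same start. The window that remains after dropping its first symbol is no heavier than before,
  so it is never re-examined.\<close>

lemma sweep_step:
  assumes I: "sweep_inv i j e v A" and i: "i < n"
  shows "ex (sweep_body fe k) v A 750 (\<lambda>v' A'. \<exists>i' j' e'. sweep_inv i' j' e' v' A' \<and> i' + j' = Suc (i + j))"
proof -
  from I have b: "base v A" and win: "window i j v A" and ij: "i \<le> j" "j \<le> n"
    and v: "v vth = th" "v vblk = blk" and Wij: "i < j \<longrightarrow> W i j \<le> th"
    and st: "stairs W th e i j" and bi: "bits_in (A aTail) blk" and co: "coded (A aTail) blk e i j"
    and tl: "\<forall>y. y < blk \<or> blk + Z \<le> y \<longrightarrow> A aTail y = t0 y"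
    unfolding sweep_inv_def by simp_all
  have ew: "j < n \<Longrightarrow> estim i (Suc j) + N < 2 ^ w" using estim_word[of i "Suc j"] ij by simp
  let ?P = "\<lambda>v' A'. A' = A \<and> (\<forall>x. x \<notin> {vflag, vHA', vHB', vx, vds'} \<longrightarrow> v' x = v x) \<and>
    (v' vflag = 1 \<longleftrightarrow> j < n \<and> estim i (Suc j) + N \<le> v vth) \<and>
    (j < n \<longrightarrow> v' vHA' = HA i (Suc j) \<and> v' vHB' = HB i (Suc j) \<and> v' vds' = DS i (Suc j))"
  let ?Q = "\<lambda>v' A'. \<exists>i' j' e'. sweep_inv i' j' e' v' A' \<and> i' + j' = Suc (i + j)"
  show ?thesis unfolding sweep_body_def
  proof (rule ex_then[OF test_block[OF b win ij ew]])
    fix v1 A1 assume P: "?P v1 A1"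
    then have A1: "A1 = A" and v1: "x \<notin> {vflag, vHA', vHB', vx, vds'} \<Longrightarrow> v1 x = v x" for x by auto
    have b1: "base v1 A1" by (rule base_frame[OF b]) (use A1 v1 in auto)
    have win1: "window i j v1 A1" using win A1 v1 by (simp add: window_def)
    have v1': "v1 vth = th" "v1 vblk = blk" using v1 v by auto
    show "ex (If (Eql (V vflag) (K 1)) (add_block k) (remove_block k)) v1 A1 310 ?Q"
    proof (rule ex_If[where t = 300])
      assume "tev (Eql (V vflag) (K 1)) v1 A1"
      then have j: "j < n" "estim i (Suc j) + N \<le> th" and
        H: "v1 vHA' = HA i (Suc j)" "v1 vHB' = HB i (Suc j)" "v1 vds' = DS i (Suc j)"
        using P v by auto
      have s: "i + j < 2 * n" using i j by simp
      from cell_less_Z[OF s] have cell: "1 + (i + j) div B < Z" .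
      then have fits: "17 * N + (v1 vblk + 1 + (i + j) div B) < M" using blk_fits v1' by simp
      have nb: "\<not> bit_at (A1 aTail) (v1 vblk) (i + j)" using co A1 v1' by (simp add: coded_def)
      have bi1: "bits_in (A1 aTail) (v1 vblk)" using bi A1 v1' by simp
      note S = set_bit_at[OF bi1 nb]
      show "ex (add_block k) v1 A1 300 ?Q"
      proof (rule ex_frame[OF add_block[OF b1 win1 ij(1) j(1) i H fits bi1 nb]])
        fix v2 A2
        assume 2: "window i (Suc j) v2 A2 \<and> A2 aTail = (let y = v1 vblk + 1 + (i + j) div B in
           (A1 aTail)(y := A1 aTail y + 2 ^ ((i + j) mod B)))"
          and fr: "\<And>x. x \<notin> mod_vars (add_block k) \<Longrightarrow> v2 x = v1 x"
            "\<And>a. a \<notin> mod_arrays (add_block k) \<Longrightarrow> A2 a = A1 a"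
        from 2 have A2: "A2 aTail = (A1 aTail)(v1 vblk + 1 + (i + j) div B :=
            A1 aTail (v1 vblk + 1 + (i + j) div B) + 2 ^ ((i + j) mod B))" and win2: "window i (Suc j) v2 A2"
          by (auto simp: Let_def)
        have b2: "base v2 A2" by (rule base_frame[OF b1]) (use fr in \<open>auto simp: mod_sweep\<close>)
        have v2: "v2 vth = th" "v2 vblk = blk" using fr v1' by (auto simp: mod_sweep)
        have "W i (Suc j) \<le> th" using sound[of i "Suc j"] j ij by simp
        moreover have "stairs W th e i (Suc j)" using st by (auto simp: stairs_def)
        moreover have "bits_in (A2 aTail) blk" using S(1) unfolding A2 v1' .
        moreover have "coded (A2 aTail) blk e i (Suc j)"
          unfolding coded_def
        proof
          fix s
          have "bit_at (A2 aTail) blk s \<longleftrightarrow> bit_at (A aTail) blk s \<or> s = i + j"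
            using S(2)[of s] unfolding A2 v1' A1 .
          \<comment> \<open>The zeros recorded so far lie at \<open>i' + e i'\<close> with
            \<open>i' < i\<close> and \<open>e i' \<le> j\<close>, strictly below the new one-bit at
            \<open>i + j\<close>.\<close>
          also have "\<dots> \<longleftrightarrow> s < i + Suc j \<and> (\<forall>i'<i. s \<noteq> i' + e i')"
            using co st by (fastforce simp: coded_def stairs_def less_Suc_eq)
          finally show "bit_at (A2 aTail) blk s \<longleftrightarrow> s < i + Suc j \<and> (\<forall>i'<i. s \<noteq> i' + e i')" .
        qed
        moreover have "A2 aTail y = t0 y" if "y < blk \<or> blk + Z \<le> y" for y
          using tl that cell unfolding A2 v1' A1 by auto
        ultimately have "sweep_inv i (Suc j) e v2 A2"
          using b2 win2 v2 ij j unfolding sweep_inv_def by simp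
        then show "?Q v2 A2" by (intro exI[of _ i] exI[of _ "Suc j"] exI[of _ e]) simp
      qed simp
    next
      assume "\<not> tev (Eql (V vflag) (K 1)) v1 A1"
      then have stop: "j < n \<Longrightarrow> th < estim i (Suc j) + N" using P v by auto
      \<comment> \<open>A window of one symbol always passes the test, so the left end never
        overtakes the right end.\<close>
      have lt: "i < j"
      proof (rule ccontr)
        assume "\<not> i < j"
        then have "i = j" using ij by simp
        then show False using stop unit[OF i] i by simp
      qed
      show "ex (remove_block k) v1 A1 300 ?Q"
      proof (rule ex_frame[OF remove_block[OF b1 win1 lt ij(2)]])
        fix v2 A2
        assume win2: "window (Suc i) j v2 A2"
          and fr: "\<And>x. x \<notin> mod_vars (remove_block k) \<Longrightarrow> v2 x = v1 x"
            "\<And>a. a \<notin> mod_arrays (remove_block k) \<Longrightarrow> A2 a = A1 a"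
        have b2: "base v2 A2" by (rule base_frame[OF b1]) (use fr in \<open>auto simp: mod_sweep\<close>)
        have v2: "v2 vth = th" "v2 vblk = blk" "A2 aTail = A aTail" using fr v1' A1 by (auto simp: mod_sweep)
        let ?e = "e(i := j)"
        have "W (Suc i) j \<le> th" if "Suc i < j" using W_mono[OF that ij(2)] Wij lt by simp
        moreover have "stairs W th ?e (Suc i) j"
          unfolding stairs_def
        proof (intro conjI allI impI)
          fix i' assume "i' < Suc i"
          then show "i' < ?e i'" "?e i' \<le> j" "W i' (?e i') \<le> th"
            using st lt Wij by (auto simp: stairs_def less_Suc_eq)
        next
          fix i' j' assume *: "i' < Suc i" "i' < j'" "j' \<le> n" "W i' j' + 2 * N \<le> th"
          show "j' \<le> ?e i'"
          proof (cases "i' = i")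
            case True
            show ?thesis
            proof (rule ccontr)
              assume "\<not> j' \<le> ?e i'"
              then have jj: "Suc j \<le> j'" "j < n" using True * by auto
              have "th < W i (Suc j) + 2 * N" using complete[of i "Suc j"] stop jj lt by simp
              moreover have "W i (Suc j) \<le> W i j'" using W_mono2[of i "Suc j" j'] jj lt * by simp
              ultimately show False using * True by simp
            qed
          next
            case False
            then show ?thesis using st * by (auto simp: stairs_def)
          qed
        next
          fix i1 i2 assume "i1 \<le> i2" "i2 < Suc i"
          then show "?e i1 \<le> ?e i2" using st by (auto simp: stairs_def less_Suc_eq)
        qed
        moreover have "coded (A2 aTail) blk ?e (Suc i) j"
          using co unfolding coded_def v2 by (auto simp: less_Suc_eq)
        ultimately have "sweep_inv (Suc i) j ?e v2 A2"
          using b2 win2 v2 ij lt bi tl unfolding sweep_inv_def by simp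
        then show "?Q v2 A2" by (intro exI[of _ "Suc i"] exI[of _ j] exI[of _ ?e]) simp
      qed simp
    qed auto
  qed simp_all
qed

lemma sweep:
  assumes b: "base v A" and v: "v vth = th" "v vblk = blk"
    and zero: "\<And>x a. x < N \<Longrightarrow> a \<in> {aCS, aCC, aCP} \<Longrightarrow> A a x = 0"
    and tail0: "\<And>y. blk \<le> y \<Longrightarrow> A aTail y = 0" and tail: "A aTail = t0"
  shows "ex (sweep fe k) v A (1700 * n + 30) (\<lambda>v' A'. (\<exists>e. stairs W th e n n \<and> coded (A' aTail) blk e n n) \<and>
    A' aTail blk = n \<and> (\<forall>y. y < blk \<or> blk + Z \<le> y \<longrightarrow> A' aTail y = t0 y) \<and>
    (\<forall>x<N. \<forall>a\<in>{aCS, aCC, aCP}. A' a x = 0) \<and> base v' A' \<and> v' vth = th \<and> v' vblk = blk)"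
proof -
  let ?v = "v(vi := 0, vj := 0, vHA := 0, vHB := 0, vds := 0)"
  have 0: "sweep_inv 0 0 (\<lambda>_. 0) ?v A"
  proof -
    have "base ?v A" by (rule base_frame[OF b]) auto
    moreover have "window 0 0 ?v A" using zero by (simp add: window_def HA_def HB_def DS_def occ_sum_empty X0 occ_empty)
    ultimately show ?thesis using v tail tail0
      by (simp add: sweep_inv_def stairs_def coded_def bits_in_def bit_at_def)
  qed
  let ?Q = "\<lambda>v A. \<exists>e. sweep_inv n n e v A"
  have 1: "ex (While (Lt (V vi) (V vn)) (sweep_body fe k)) ?v A (1600 * n + 5) ?Q"
  proof (rule ex_While[where I = "\<lambda>v A. \<exists>i j e. sweep_inv i j e v A" and \<Phi> = "\<lambda>v A. 800 * (2 * n - (v vi + v vj))"])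
    fix v A assume "\<exists>i j e. sweep_inv i j e v A" and t: "tev (Lt (V vi) (V vn)) v A"
    then obtain i j e where I: "sweep_inv i j e v A" by blast
    then have vi: "v vi = i" "v vj = j" "v vn = n" "j \<le> n" by (auto simp: sweep_inv_def window_def base_def)
    with t have i: "i < n" by simp
    have "ex (sweep_body fe k) v A 750 (\<lambda>v' A'. (\<exists>i j e. sweep_inv i j e v' A') \<and>
        800 * (2 * n - (v' vi + v' vj)) + 750 + tst_time (Lt (V vi) (V vn)) + 1 \<le> 800 * (2 * n - (v vi + v vj)))"
    proof (rule ex_mono[OF sweep_step[OF I i]])
      fix v' A' assume "\<exists>i' j' e'. sweep_inv i' j' e' v' A' \<and> i' + j' = Suc (i + j)"
      then obtain i' j' e' where I': "sweep_inv i' j' e' v' A'" "i' + j' = Suc (i + j)" by blast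
      then have "v' vi = i'" "v' vj = j'" by (auto simp: sweep_inv_def window_def)
      with I' vi i have "800 * (2 * n - (v' vi + v' vj)) + 750 + tst_time (Lt (V vi) (V vn)) + 1 \<le> 800 * (2 * n - (v vi + v vj))"
        by simp
      with I'(1) show "(\<exists>i j e. sweep_inv i j e v' A') \<and>
        800 * (2 * n - (v' vi + v' vj)) + 750 + tst_time (Lt (V vi) (V vn)) + 1 \<le> 800 * (2 * n - (v vi + v vj))" by blast
    qed simp
    then show "\<exists>t. ex (sweep_body fe k) v A t (\<lambda>v' A'. (\<exists>i j e. sweep_inv i j e v' A') \<and>
        800 * (2 * n - (v' vi + v' vj)) + t + tst_time (Lt (V vi) (V vn)) + 1 \<le> 800 * (2 * n - (v vi + v vj)))"
      by (rule exI[where x = 750])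
  next
    fix v A assume "\<exists>i j e. sweep_inv i j e v A" and t: "\<not> tev (Lt (V vi) (V vn)) v A"
    then obtain i j e where I: "sweep_inv i j e v A" by blast
    then have "v vi = i" "v vn = n" "i \<le> j" "j \<le> n" by (auto simp: sweep_inv_def window_def base_def)
    with t have "i = n" "j = n" by auto
    with I show "\<exists>e. sweep_inv n n e v A" by blast
  qed (use 0 in auto)
  \<comment> \<open>The first cell of the block becomes the pointer of the class in the dynamic
    program, which starts at the right end of the text.\<close>
  have 2: "ex (Put aTail (V vblk) (V vn)) v' A' 6 (\<lambda>v' A'. (\<exists>e. stairs W th e n n \<and> coded (A' aTail) blk e n n) \<and>
    A' aTail blk = n \<and> (\<forall>y. y < blk \<or> blk + Z \<le> y \<longrightarrow> A' aTail y = t0 y) \<and>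
    (\<forall>x<N. \<forall>a\<in>{aCS, aCC, aCP}. A' a x = 0) \<and> base v' A' \<and> v' vth = th \<and> v' vblk = blk)" if "?Q v' A'" for v' A'
  proof -
    from that obtain e where I: "sweep_inv n n e v' A'" by blast
    then have b: "base v' A'" and win: "window n n v' A'" and v: "v' vth = th" "v' vblk = blk"
      and st: "stairs W th e n n" and co: "coded (A' aTail) blk e n n"
      and tl: "\<forall>y. y < blk \<or> blk + Z \<le> y \<longrightarrow> A' aTail y = t0 y"
      unfolding sweep_inv_def by simp_all
    from b have vn: "v' vn = n" by (simp add: base_def)
    have "coded (upd A' aTail blk n aTail) blk e n n" using co by (simp add: coded_def bit_at_def)
    moreover have "base v' (upd A' aTail blk n)" by (rule base_frame[OF b]) auto
    \<comment> \<open>The final window is empty, so that all counters are zero again when the next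
      class begins.\<close>
    moreover have "\<forall>x<N. \<forall>a\<in>{aCS, aCC, aCP}. upd A' aTail blk n a x = 0"
      using win by (simp add: window_def occ_empty)
    moreover have "\<forall>y. y < blk \<or> blk + Z \<le> y \<longrightarrow> upd A' aTail blk n aTail y = t0 y" using tl by (auto simp: block_size_def)
    moreover have "17 * N + blk < M" using blk_fits by (simp add: block_size_def)
    ultimately show ?thesis using st v vn by (intro ex_wp) auto
  qed
  show ?thesis unfolding sweep_def
    by (rule ex_Set_step, simp, simp, unfold ev.simps, rule ex_Set_step, simp, simp, unfold ev.simps,
        rule ex_Set_step, simp, simp, unfold ev.simps, rule ex_Set_step, simp, simp, unfold ev.simps,
        rule ex_Set_step, simp, simp, unfold ev.simps, rule ex_step[OF 1], rule ex_mono[OF 2], assumption)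
      auto
qed

end
end

section \<open>Dynamic programming over cost classes\<close>

text \<open>Adding 1 after the integer division makes up for the floor, so that the thresholds grow
  at least by the factor \<open>p / r\<close> in each step and exceed it by at most 1.\<close>

primrec threshold :: "nat \<Rightarrow> nat \<Rightarrow> nat \<Rightarrow> nat \<Rightarrow> nat" where
  "threshold t p r 0 = t"
| "threshold t p r (Suc c) = threshold t p r c * p div r + 1"

text \<open>The loops over the classes compare the preceding threshold with the cap. In this way the
  first threshold at or above the cap is still processed, and the default 0 admits the first
  class.\<close>

fun previous :: "(nat \<Rightarrow> nat) \<Rightarrow> nat \<Rightarrow> nat" where
  "previous f 0 = 0"
| "previous f (Suc c) = f c"

text \<open>A single symbol weighs at most \<open>G0 + 1\<close>, its estimate may be off by
  \<open>N\<close>, and the test adds another \<open>N\<close>. Starting at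
  \<open>G0 + 3 * N\<close> therefore lets every single symbol pass.\<close>

definition first_class :: cmd where
  "first_class = Set vth (Bin Add (V vG) (Bin Mul (K 3) (V vN))) ;; Set vprev (K 0) ;; Set vblk (K 0)"

definition next_class :: "nat \<Rightarrow> nat \<Rightarrow> cmd" where
  "next_class p r =
     Set vprev (V vth) ;; Set vth (plus1 (Bin Div (Bin Mul (V vth) (K p)) (K r))) ;;
     Set vblk (Bin Add (V vblk) (V vZ))"

definition sweeps :: "expr \<Rightarrow> nat \<Rightarrow> nat \<Rightarrow> nat \<Rightarrow> cmd" where
  "sweeps fe k p r = first_class ;; While (Lt (V vprev) (V vcap)) (sweep fe k ;; next_class p r)"

definition bit_expr :: expr where
  "bit_expr = Bin Mod (Bin Div
     (Arr aTail (Bin Add (plus1 (V vblk)) (Bin Div (Bin Add (V vi) (V vJ)) (V vB))))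
     (Arr aPow (Bin Mod (Bin Add (V vi) (V vJ)) (V vB)))) (K 2)"

definition jump_loop :: cmd where
  "jump_loop = While (Eql bit_expr (K 1)) (Set vJ (Bin Sub (V vJ) (K 1)))"

definition relax :: cmd where
  "relax = Put aTail (V vblk) (V vJ) ;; Set vy (Bin Add (V vth) (Arr aD (V vJ))) ;;
     If (Lt (V vy) (V vbest)) (Set vbest (V vy) ;; Set vbch (Bin Sub (V vJ) (V vi))) NOP"

definition class_step :: "nat \<Rightarrow> nat \<Rightarrow> cmd" where
  "class_step p r = Set vJ (Arr aTail (V vblk)) ;; jump_loop ;; relax ;; next_class p r"

text \<open>The initial choice, a single symbol at the price of the first class, bounds the value at
  position \<open>q\<close> by \<open>(n - q)\<close> times that price. No value exceeds the cap,
  and sums with a threshold fit into a word.\<close>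

definition dp_body :: "nat \<Rightarrow> nat \<Rightarrow> cmd" where
  "dp_body p r =
     (Set vi (Bin Sub (V vi) (K 1)) ;; first_class ;;
      Set vbest (Bin Add (V vth) (Arr aD (plus1 (V vi)))) ;; Set vbch (K 1)) ;;
     While (Lt (V vprev) (V vcap)) (class_step p r) ;;
     Put aD (V vi) (V vbest) ;; Put aCh (V vi) (V vbch)"

definition dp :: "nat \<Rightarrow> nat \<Rightarrow> cmd" where
  "dp p r = Set vi (V vn) ;; While (Lt (K 0) (V vi)) (dp_body p r)"

definition out_body :: cmd where
  "out_body = Put aLen (V vx) (Arr aCh (V vp)) ;; Set vp (Bin Add (V vp) (Arr aCh (V vp))) ;; Set vx (plus1 (V vx))"

text \<open>Variables 0 and 1 are the output registers. The array \<open>aLen\<close> has index 15,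
  so it starts at address \<open>15 * N\<close>.\<close>

definition out :: cmd where
  "out = Set vp (K 0) ;; Set vx (K 0) ;; While (Lt (V vp) (V vn)) out_body ;;
     Set 0 (V vx) ;; Set 1 (Bin Mul (K 15) (V vN))"

primrec piece_sum :: "(nat \<Rightarrow> nat \<Rightarrow> real) \<Rightarrow> nat \<Rightarrow> nat list \<Rightarrow> real" where
  "piece_sum W p [] = 0"
| "piece_sum W p (l # ls) = W p (p + l) + piece_sum W (p + l) ls"

lemma piece_sum_snoc: "piece_sum W p (ls @ [l]) = piece_sum W p ls + W (p + sum_list ls) (p + sum_list ls + l)"
  by (induction ls arbitrary: p) (auto simp: algebra_simps)

definition level :: "nat \<Rightarrow> nat \<Rightarrow> nat \<Rightarrow> nat \<Rightarrow> nat \<Rightarrow> nat" where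
  "level G N p r = threshold (G + 3 * N) p r"

locale class_machine = cost_machine F w M T k X Fv fe Q0 G0 XB B f1 f2 f3
  for F w M T k X Fv fe Q0 G0 XB B f1 f2 f3 +
  fixes W :: "nat \<Rightarrow> nat \<Rightarrow> real" and p r L :: nat
  assumes pr: "0 < r" "r \<le> p" "p < 2 ^ w"
    and unit: "\<And>i. i < length T \<Longrightarrow> estim i (Suc i) + cells T \<le> level G0 (cells T) p r 0"
    and estim_word: "\<And>i j. i < j \<Longrightarrow> j \<le> length T \<Longrightarrow> estim i j + cells T < 2 ^ w"
    and sound: "\<And>i j c. c < L \<Longrightarrow> i < j \<Longrightarrow> j \<le> length T \<Longrightarrow> estim i j + cells T \<le> level G0 (cells T) p r c \<Longrightarrow> W i j \<le> level G0 (cells T) p r c"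
    and complete: "\<And>i j c. c < L \<Longrightarrow> i < j \<Longrightarrow> j \<le> length T \<Longrightarrow> level G0 (cells T) p r c < estim i j + cells T \<Longrightarrow>
      level G0 (cells T) p r c < W i j + 2 * cells T"
    and W_mono: "\<And>i j. Suc i < j \<Longrightarrow> j \<le> length T \<Longrightarrow> W (Suc i) j \<le> W i j"
    and W_mono2: "\<And>i j j'. i < j \<Longrightarrow> j \<le> j' \<Longrightarrow> j' \<le> length T \<Longrightarrow> W i j \<le> W i j'"
    and L: "\<And>c. c < L \<Longrightarrow> previous (level G0 (cells T) p r) c < length T * level G0 (cells T) p r 0" "length T * level G0 (cells T) p r 0 \<le> previous (level G0 (cells T) p r) L"
    and L_pos: "0 < L"
    and tail_fits: "17 * cells T + L * block_size (length T) B \<le> M"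
    and thr_word: "\<And>c. c < L \<Longrightarrow> level G0 (cells T) p r c * p + 1 < 2 ^ w" "\<And>c. c < L \<Longrightarrow> length T * level G0 (cells T) p r 0 + level G0 (cells T) p r c < 2 ^ w"
begin

section \<open>Thresholds of the classes and their blocks in memory\<close>

abbreviation "thr \<equiv> level G0 N p r"

abbreviation "cap \<equiv> length T * thr 0"

lemma base_upd [simp]: "x \<notin> {vn, vN, vQ, vG, vB} \<Longrightarrow> base (v(x := y)) A = base v A"
  by (simp add: base_def)

lemma thr_0: "thr 0 = G0 + 3 * N" by (simp add: level_def)

lemma thr_Suc: "thr (Suc c) = thr c * p div r + 1" by (simp add: level_def)

lemma thr_mono: "thr 0 \<le> thr c"
proof (induction c)
  case (Suc c)
  have "thr c * r div r \<le> thr c * p div r" using pr by (intro div_le_mono mult_le_mono) auto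
  then show ?case using Suc pr by (simp add: thr_Suc)
qed simp

lemma thr_less: "c \<le> L \<Longrightarrow> thr c < 2 ^ w"
proof (cases c)
  case 0
  then show ?thesis using thr_word(2)[OF L_pos] by simp
next
  case (Suc c')
  assume "c \<le> L"
  then have "thr c' * p + 1 < 2 ^ w" using Suc thr_word(1)[of c'] by simp
  moreover have "thr c' * p div r \<le> thr c' * p" by (rule div_le_dividend)
  ultimately have "thr (Suc c') < 2 ^ w" unfolding thr_Suc by linarith
  then show ?thesis using Suc by simp
qed

lemma Z_pos: "0 < Z" by (simp add: block_size_def)

lemma block_fits: "c < L \<Longrightarrow> 17 * N + c * Z + Z \<le> M"
  using tail_fits mult_le_mono1[of "Suc c" L Z] by simp

lemma block_word:
  assumes "c \<le> L" shows "c * Z < 2 ^ w"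
  using tail_fits M_word mult_le_mono1[OF assms, of Z] by linarith

definition at_class :: "nat \<Rightarrow> vars \<Rightarrow> bool" where
  "at_class c v \<longleftrightarrow> c \<le> L \<and> v vth = thr c \<and> v vprev = previous thr c \<and> v vblk = c * Z \<and> v vcap = cap \<and> v vZ = Z"

lemma first_class:
  assumes "base v A" "v vcap = cap" "v vZ = Z"
  shows "wp first_class (\<lambda>v' A'. v' = v(vth := thr 0, vprev := 0, vblk := 0) \<and> A' = A) v A"
    "at_class 0 (v(vth := thr 0, vprev := 0, vblk := 0))"
proof -
  have "3 < (2::nat) ^ w" "3 * N < 2 ^ w" using N_word N_pos by linarith+
  then show "wp first_class (\<lambda>v' A'. v' = v(vth := thr 0, vprev := 0, vblk := 0) \<and> A' = A) v A"
    "at_class 0 (v(vth := thr 0, vprev := 0, vblk := 0))"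
    using assms thr_less[of 0] by (simp_all add: first_class_def at_class_def base_def thr_0)
qed

lemma next_class:
  assumes "at_class c v" "c < L"
  shows "wp (next_class p r) (\<lambda>v' A'. at_class (Suc c) v' \<and> A' = A \<and> (\<forall>x. x \<notin> {vth, vprev, vblk} \<longrightarrow> v' x = v x)) v A"
proof -
  have "thr c * p + 1 < 2 ^ w" "thr (Suc c) < 2 ^ w" "c * Z + Z < 2 ^ w" "r < 2 ^ w"
    using thr_word(1)[of c] thr_less[of "Suc c"] block_word[of "Suc c"] assms pr by auto
  then show ?thesis using assms pr by (simp add: next_class_def at_class_def thr_Suc add.commute)
qed

lemma at_class_test: "at_class c v \<Longrightarrow> tev (Lt (V vprev) (V vcap)) v A \<longleftrightarrow> c < L"
  using L by (auto simp: at_class_def) (metis le_neq_implies_less not_le)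

text \<open>The bound on \<open>s\<close> confines the condition to the cells of one block. In
  contrast, \<open>coded\<close> also speaks about all cells further right, which later sweeps
  fill.\<close>

definition coded_block :: "(nat \<Rightarrow> nat) \<Rightarrow> nat \<Rightarrow> (nat \<Rightarrow> nat) \<Rightarrow> bool" where
  "coded_block t blk e \<longleftrightarrow> (\<forall>s<2 * n. bit_at t blk s \<longleftrightarrow> (\<forall>i<n. s \<noteq> i + e i))"

lemma coded_block_cong:
  assumes "coded_block t blk e" "\<And>y. blk < y \<Longrightarrow> y < blk + Z \<Longrightarrow> t' y = t y"
  shows "coded_block t' blk e"
proof -
  have "t' (blk + 1 + s div B) = t (blk + 1 + s div B)" if "s < 2 * n" for s
    using cell_less_Z[OF that] by (intro assms(2)) auto
  then show ?thesis using assms(1) by (auto simp: coded_block_def bit_at_def)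
qed

definition class_ok :: "nat \<Rightarrow> (nat \<Rightarrow> nat) \<Rightarrow> (nat \<Rightarrow> nat) \<Rightarrow> bool" where
  "class_ok c e t \<longleftrightarrow> stairs W (thr c) e n n \<and> coded_block t (c * Z) e"

lemma block_disjoint: "c' < c \<Longrightarrow> y < c' * Z + Z \<Longrightarrow> y < c * Z"
  using mult_le_mono1[of "Suc c'" c Z] by simp

lemma class_ok_cong:
  assumes "class_ok c' e t" "\<And>y. y < c * Z \<or> c * Z + Z \<le> y \<Longrightarrow> t' y = t y" "c' \<noteq> c"
  shows "class_ok c' e t'"
proof -
  have "t' y = t y" if "c' * Z < y" "y < c' * Z + Z" for y
  proof (rule assms(2))
    show "y < c * Z \<or> c * Z + Z \<le> y"
    proof (cases "c' < c")
      case True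
      then show ?thesis using block_disjoint that by blast
    next
      case False
      then have "Suc c * Z \<le> c' * Z" using assms(3) by (intro mult_le_mono1) simp
      then show ?thesis using that by simp
    qed
  qed
  then show ?thesis using assms(1) by (auto simp: class_ok_def intro: coded_block_cong)
qed

definition sweeps_inv :: "nat \<Rightarrow> vars \<Rightarrow> arrays \<Rightarrow> bool" where
  "sweeps_inv c v A \<longleftrightarrow> base v A \<and> at_class c v \<and> (\<forall>x<N. \<forall>a\<in>{aCS, aCC, aCP}. A a x = 0) \<and>
     (\<forall>y\<ge>c * Z. A aTail y = 0) \<and> (\<forall>c'<c. A aTail (c' * Z) = n \<and> (\<exists>e. class_ok c' e (A aTail)))"

lemma mod_sweep': "mod_vars (sweep fe k) \<subseteq> {vflag, vHA', vHB', vx, vds', vHA, vHB, vds, vy, vi, vj}"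
  by (auto simp: sweep_def sweep_body_def mod_sweep)

lemma sweeps_step:
  assumes I: "sweeps_inv c v A" and c: "c < L"
  shows "ex (sweep fe k ;; next_class p r) v A (1700 * n + 50) (sweeps_inv (Suc c))"
proof -
  from I have b: "base v A" and at: "at_class c v" and z: "\<forall>x<N. \<forall>a\<in>{aCS, aCC, aCP}. A a x = 0"
    and tl: "\<forall>y\<ge>c * Z. A aTail y = 0" and old: "\<forall>c'<c. A aTail (c' * Z) = n \<and> (\<exists>e. class_ok c' e (A aTail))"
    unfolding sweeps_inv_def by simp_all
  have v: "v vth = thr c" "v vblk = c * Z" using at by (auto simp: at_class_def)
  let ?P = "\<lambda>v' A'. (\<exists>e. stairs W (thr c) e n n \<and> coded (A' aTail) (c * Z) e n n) \<and>
    A' aTail (c * Z) = n \<and> (\<forall>y. y < c * Z \<or> c * Z + Z \<le> y \<longrightarrow> A' aTail y = A aTail y) \<and>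
    (\<forall>x<N. \<forall>a\<in>{aCS, aCC, aCP}. A' a x = 0) \<and> base v' A' \<and> v' vth = thr c \<and> v' vblk = c * Z"
  have 1: "ex (sweep fe k) v A (1700 * n + 30) ?P"
  proof (rule sweep[where W = W])
    show "estim i (Suc i) + N \<le> thr c" if "i < n" for i using unit[OF that] thr_mono[of c] by simp
    show "W i j \<le> thr c" if "i < j" "j \<le> n" "estim i j + N \<le> thr c" for i j using sound[OF c that] .
    show "thr c < W i j + 2 * N" if "i < j" "j \<le> n" "thr c < estim i j + N" for i j using complete[OF c that] by simp
  qed (use estim_word W_mono W_mono2 block_fits[OF c] b v z tl in auto)
  show ?thesis
  proof (rule ex_then[where P = "\<lambda>v' A'. ?P v' A' \<and> at_class c v'" and ?t1.0 = "1700 * n + 30", OF ex_frame[OF 1]])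
    fix v' A' assume "?P v' A'" and fr: "\<And>x. x \<notin> mod_vars (sweep fe k) \<Longrightarrow> v' x = v x"
    moreover have "v' x = v x" if "x \<in> {vprev, vcap, vZ}" for x
      using mod_sweep' that by (intro fr) auto
    then have "v' vprev = v vprev" "v' vcap = v vcap" "v' vZ = v vZ" by auto
    ultimately show "?P v' A' \<and> at_class c v'" using at by (simp add: at_class_def)
  next
    fix v1 A1 assume P: "?P v1 A1 \<and> at_class c v1"
    then obtain e where e: "stairs W (thr c) e n n" "coded (A1 aTail) (c * Z) e n n" by blast
    then have new: "class_ok c e (A1 aTail)" by (auto simp: class_ok_def coded_block_def coded_def)
    have "A1 aTail (c' * Z) = n \<and> (\<exists>e. class_ok c' e (A1 aTail))" if "c' < Suc c" for c'
    proof (cases "c' = c")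
      case True
      then show ?thesis using P new by auto
    next
      case False
      with that have c': "c' < c" by simp
      then have "A1 aTail (c' * Z) = A aTail (c' * Z)" using P block_disjoint[OF c', of "c' * Z"] Z_pos by simp
      moreover obtain e' where "class_ok c' e' (A aTail)" using old c' by blast
      then have "class_ok c' e' (A1 aTail)" by (rule class_ok_cong[where c = c]) (use P c' in auto)
      ultimately show ?thesis using old c' by auto
    qed
    moreover have "\<forall>y\<ge>Suc c * Z. A1 aTail y = 0" using P tl by simp
    ultimately have all: "(\<forall>c'<Suc c. A1 aTail (c' * Z) = n \<and> (\<exists>e. class_ok c' e (A1 aTail))) \<and>
      (\<forall>y\<ge>Suc c * Z. A1 aTail y = 0)" by blast
    have inv: "sweeps_inv (Suc c) v2 A1" if "at_class (Suc c) v2" "\<forall>x. x \<notin> {vth, vprev, vblk} \<longrightarrow> v2 x = v1 x" for v2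
    proof -
      have "base v2 A1" by (rule base_frame[of v1 A1]) (use P that in auto)
      with P that all show ?thesis unfolding sweeps_inv_def by simp
    qed
    show "ex (next_class p r) v1 A1 20 (sweeps_inv (Suc c))"
      by (rule ex_mono[OF ex_wp[OF next_class[of c v1 A1] order_refl]])
        (use P c inv in \<open>auto simp: next_class_def\<close>)
  qed simp_all
qed

text \<open>The potentials of the class loops are functions of the state; they recover the number of
  the class from the block address.\<close>

lemma at_class_inj: "at_class c v \<Longrightarrow> v vblk div Z = c"
  using Z_pos by (simp add: at_class_def)

lemma sweeps:
  assumes "base v A" "v vcap = cap" "v vZ = Z" "\<forall>x<N. \<forall>a\<in>{aCS, aCC, aCP}. A a x = 0" "A aTail = (\<lambda>_. 0)"
  shows "ex (sweeps fe k p r) v A (L * (1700 * n + 60) + 20) (sweeps_inv L)"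
proof -
  let ?v = "v(vth := thr 0, vprev := 0, vblk := 0)"
  have 0: "sweeps_inv 0 ?v A"
    using assms first_class(2)[OF assms(1-3)] unfolding sweeps_inv_def by simp
  have "ex (While (Lt (V vprev) (V vcap)) (sweep fe k ;; next_class p r)) ?v A (L * (1700 * n + 60) + 3) (sweeps_inv L)"
  proof (rule ex_While[where I = "\<lambda>v A. \<exists>c. sweeps_inv c v A" and \<Phi> = "\<lambda>v A. (L - v vblk div Z) * (1700 * n + 60)"])
    fix v A assume "\<exists>c. sweeps_inv c v A" and t: "tev (Lt (V vprev) (V vcap)) v A"
    then obtain c where I: "sweeps_inv c v A" by blast
    then have at: "at_class c v" by (simp add: sweeps_inv_def)
    with t have c: "c < L" using at_class_test by blast
    have "ex (sweep fe k ;; next_class p r) v A (1700 * n + 50) (\<lambda>v' A'. (\<exists>c. sweeps_inv c v' A') \<and>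
        (L - v' vblk div Z) * (1700 * n + 60) + (1700 * n + 50) + tst_time (Lt (V vprev) (V vcap)) + 1
        \<le> (L - v vblk div Z) * (1700 * n + 60))"
    proof (rule ex_mono[OF sweeps_step[OF I c]])
      fix v' A' assume I': "sweeps_inv (Suc c) v' A'"
      then have "v' vblk div Z = Suc c" "v vblk div Z = c"
        using at_class_inj at by (auto simp: sweeps_inv_def)
      moreover have "L - c = Suc (L - Suc c)" using c by simp
      ultimately have "(L - v' vblk div Z) * (1700 * n + 60) + (1700 * n + 50) + tst_time (Lt (V vprev) (V vcap)) + 1
        \<le> (L - v vblk div Z) * (1700 * n + 60)" by (simp only: mult_Suc tst_time.simps expr_time.simps)
      with I' show "(\<exists>c. sweeps_inv c v' A') \<and>
        (L - v' vblk div Z) * (1700 * n + 60) + (1700 * n + 50) + tst_time (Lt (V vprev) (V vcap)) + 1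
        \<le> (L - v vblk div Z) * (1700 * n + 60)" by blast
    qed simp
    then show "\<exists>t. ex (sweep fe k ;; next_class p r) v A t (\<lambda>v' A'. (\<exists>c. sweeps_inv c v' A') \<and>
        (L - v' vblk div Z) * (1700 * n + 60) + t + tst_time (Lt (V vprev) (V vcap)) + 1
        \<le> (L - v vblk div Z) * (1700 * n + 60))" by (rule exI[where x = "1700 * n + 50"])
  next
    fix v A assume "\<exists>c. sweeps_inv c v A" and t: "\<not> tev (Lt (V vprev) (V vcap)) v A"
    then obtain c where I: "sweeps_inv c v A" by blast
    then have "at_class c v" by (simp add: sweeps_inv_def)
    with t have "\<not> c < L" "c \<le> L" using at_class_test by (blast, simp add: at_class_def)
    with I show "sweeps_inv L v A" by simp
  qed (use 0 in auto)
  then show ?thesis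
    unfolding sweeps_def
    by (intro ex_then[OF ex_wp[OF first_class(1)[OF assms(1-3)] order_refl]])
      (auto simp: first_class_def)
qed

section \<open>The dynamic program and its left-moving pointers\<close>

context
  fixes E :: "nat \<Rightarrow> nat \<Rightarrow> nat"
begin

definition tail_ok :: "(nat \<Rightarrow> nat) \<Rightarrow> bool" where
  "tail_ok t \<longleftrightarrow> (\<forall>c<L. class_ok c (E c) t)"

text \<open>The value \<open>n\<close> at the right end is the initial pointer, from which the far
  end of the last position is searched.\<close>

definition jump_from :: "nat \<Rightarrow> nat \<Rightarrow> nat" where
  "jump_from c i = (if i < n then E c i else n)"

lemma jump_from_le: "tail_ok t \<Longrightarrow> c < L \<Longrightarrow> jump_from c i \<le> n"
  by (auto simp: tail_ok_def class_ok_def stairs_def jump_from_def)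

lemma jump_from_greater: "tail_ok t \<Longrightarrow> c < L \<Longrightarrow> i < n \<Longrightarrow> i < jump_from c i"
  by (auto simp: tail_ok_def class_ok_def stairs_def jump_from_def)

lemma jump_from_mono: "tail_ok t \<Longrightarrow> c < L \<Longrightarrow> i \<le> i' \<Longrightarrow> jump_from c i \<le> jump_from c i'"
  by (auto simp: tail_ok_def class_ok_def stairs_def jump_from_def)

text \<open>For \<open>J\<close> between two consecutive far ends, a zero at \<open>i + J\<close>
  can only belong to \<open>i\<close> itself: starts up to \<open>i\<close> have their zeros at or
  below \<open>i + jump_from c i\<close>, later ones at or above
  \<open>Suc i + jump_from c (Suc i)\<close>. Moving left over ones thus stops exactly at the far
  end of \<open>i\<close>.\<close>

lemma bit_jump:
  assumes "tail_ok t" "c < L" "i < n" "jump_from c i \<le> J" "J \<le> jump_from c (Suc i)"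
  shows "bit_at t (c * Z) (i + J) \<longleftrightarrow> jump_from c i < J"
proof -
  have J: "J \<le> n" using assms(5) jump_from_le[OF assms(1,2), of "Suc i"] by simp
  have e: "E c i' = jump_from c i'" if "i' < n" for i' using that by (simp add: jump_from_def)
  have "bit_at t (c * Z) (i + J) \<longleftrightarrow> (\<forall>i'<n. i + J \<noteq> i' + E c i')"
    using assms J by (auto simp: tail_ok_def class_ok_def coded_block_def)
  also have "\<dots> \<longleftrightarrow> jump_from c i < J"
  proof
    assume *: "jump_from c i < J"
    show "\<forall>i'<n. i + J \<noteq> i' + E c i'"
    proof (intro allI impI)
      fix i' assume i': "i' < n"
      show "i + J \<noteq> i' + E c i'"
      proof (cases "i' \<le> i")
        case True
        then show ?thesis using jump_from_mono[OF assms(1,2) True] * e[OF i'] by simp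
      next
        case False
        then show ?thesis using jump_from_mono[OF assms(1,2), of "Suc i" i'] assms(5) e[OF i'] by simp
      qed
    qed
  next
    assume "\<forall>i'<n. i + J \<noteq> i' + E c i'"
    then have "i + J \<noteq> i + E c i" using assms(3) by blast
    then show "jump_from c i < J" using e[OF assms(3)] assms(4) by simp
  qed
  finally show ?thesis .
qed

lemma jump_loop:
  assumes "base v A" "at_class c v" "c < L" "v vi = i" "i < n" "tail_ok (A aTail)"
    "v vJ = jump_from c (Suc i)"
  shows "ex jump_loop v A (60 * (jump_from c (Suc i) - jump_from c i) + 50)
    (\<lambda>v' A'. v' = v(vJ := jump_from c i) \<and> A' = A)"
proof -
  let ?I = "\<lambda>v' A'. A' = A \<and> v' = v(vJ := v' vJ) \<and> jump_from c i \<le> v' vJ \<and> v' vJ \<le> jump_from c (Suc i)"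
  have *: "tok (Eql bit_expr (K 1)) v' A' \<and> (tev (Eql bit_expr (K 1)) v' A' \<longleftrightarrow> jump_from c i < v' vJ)" if I: "?I v' A'" for v' A'
  proof -
    define J where "J = v' vJ"
    have vx: "v' x = v x" if "x \<noteq> vJ" for x using I that by (metis fun_upd_other)
    have J: "jump_from c i \<le> J" "J \<le> jump_from c (Suc i)" using I by (auto simp: J_def)
    then have Jn: "J \<le> n" using jump_from_le[OF assms(6,3), of "Suc i"] by simp
    have "i + J < 2 * n" using Jn assms(5) by simp
    then have cell: "1 + (i + J) div B < Z" by (rule cell_less_Z)
    have fits: "17 * N + (c * Z + 1 + (i + J) div B) < M" using block_fits[OF assms(3)] cell by simp
    have m: "(i + J) mod B < B" using B by simp
    have v': "v' vi = i" "v' vB = B" "v' vblk = c * Z" "A' aPow ((i + J) mod B) = 2 ^ ((i + J) mod B)" "v' vJ = J"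
      using vx assms I m by (auto simp: base_def at_class_def J_def)
    have w: "i + J < 2 ^ w" "(i + J) mod B \<le> n" "c * Z + 1 < 2 ^ w" "c * Z + 1 + (i + J) div B < 2 ^ w"
      using Jn assms(5) m B(3)[unfolded cells_def] fits M_word by (simp_all add: small_word)
    have "ev bit_expr v' A' = A aTail (c * Z + 1 + (i + J) div B) div 2 ^ ((i + J) mod B) mod 2"
      using v' I by (simp add: bit_expr_def)
    moreover have "\<dots> = 1 \<longleftrightarrow> bit_at (A aTail) (c * Z) (i + J)"
      by (simp add: bit_at_def bit_iff_odd odd_iff_mod_2_eq_one)
    moreover have "ok bit_expr v' A'" using v' w fits two_word by (simp add: bit_expr_def less_N)
    ultimately show ?thesis using bit_jump[OF assms(6,3,5) J] by (simp add: J_def)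
  qed
  show ?thesis unfolding jump_loop_def
  proof (rule ex_While[where I = ?I and \<Phi> = "\<lambda>v' A'. 60 * (v' vJ - jump_from c i)"])
    have "v = v(vJ := v vJ)" by simp
    moreover have "jump_from c i \<le> v vJ" "v vJ \<le> jump_from c (Suc i)"
      using assms jump_from_mono[OF assms(6,3), of i "Suc i"] by simp_all
    ultimately show "?I v A" by blast
  next
    fix v' A' assume "?I v' A'" then show "tok (Eql bit_expr (K 1)) v' A'" using * by blast
  next
    fix v' A' assume I: "?I v' A'" and t: "tev (Eql bit_expr (K 1)) v' A'"
    then have gt: "jump_from c i < v' vJ" using * by blast
    have "wp (Set vJ (Bin Sub (V vJ) (K 1))) (\<lambda>v2 A2. v2 = v'(vJ := v' vJ - 1) \<and> A2 = A') v' A'" using gt by simp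
    then have "ex (Set vJ (Bin Sub (V vJ) (K 1))) v' A' 10 (\<lambda>v2 A2. v2 = v'(vJ := v' vJ - 1) \<and> A2 = A')"
      by (rule ex_wp) simp
    then have "ex (Set vJ (Bin Sub (V vJ) (K 1))) v' A' 10 (\<lambda>v2 A2. ?I v2 A2 \<and>
       60 * (v2 vJ - jump_from c i) + 10 + tst_time (Eql bit_expr (K 1)) + 1 \<le> 60 * (v' vJ - jump_from c i))"
    proof (rule ex_mono)
      fix v2 A2 assume 2: "v2 = v'(vJ := v' vJ - 1) \<and> A2 = A'"
      have "v' vJ - 1 \<le> jump_from c (Suc i)" "jump_from c i \<le> v' vJ - 1" using I gt by linarith+
      moreover from 2 have "v2 vJ = v' vJ - 1" by simp
      moreover have "v2 = v(vJ := v2 vJ)" using 2 I by (metis fun_upd_upd fun_upd_same)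
      ultimately show "?I v2 A2 \<and> 60 * (v2 vJ - jump_from c i) + 10 + tst_time (Eql bit_expr (K 1)) + 1 \<le> 60 * (v' vJ - jump_from c i)"
        using 2 I gt by (intro conjI) (simp_all add: bit_expr_def)
    qed simp
    then show "\<exists>t. ex (Set vJ (Bin Sub (V vJ) (K 1))) v' A' t (\<lambda>v2 A2. ?I v2 A2 \<and>
       60 * (v2 vJ - jump_from c i) + t + tst_time (Eql bit_expr (K 1)) + 1 \<le> 60 * (v' vJ - jump_from c i))"
      by (rule exI[where x = 10])
  next
    fix v' A' assume I: "?I v' A'" and t: "\<not> tev (Eql bit_expr (K 1)) v' A'"
    then have "v' vJ = jump_from c i" using *[OF I] by simp
    with I show "v' = v(vJ := jump_from c i) \<and> A' = A" by metis
  qed (use assms in \<open>simp add: bit_expr_def\<close>)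
qed

definition chosen :: "nat \<Rightarrow> nat \<Rightarrow> (nat \<Rightarrow> nat) \<Rightarrow> nat \<Rightarrow> nat \<Rightarrow> bool" where
  "chosen i c D best ch \<longleftrightarrow>
     (best = thr 0 + D (Suc i) \<and> ch = 1 \<or> (\<exists>c'<c. best = thr c' + D (jump_from c' i) \<and> ch = jump_from c' i - i)) \<and>
     best \<le> thr 0 + D (Suc i) \<and> (\<forall>c'<c. best \<le> thr c' + D (jump_from c' i))"

definition dp_ok :: "nat \<Rightarrow> arrays \<Rightarrow> bool" where
  "dp_ok i A \<longleftrightarrow> A aD n = 0 \<and> (\<forall>q. i \<le> q \<and> q < n \<longrightarrow> chosen q L (A aD) (A aD q) (A aCh q)) \<and>
     (\<forall>q. i \<le> q \<and> q \<le> n \<longrightarrow> A aD q \<le> (n - q) * thr 0)"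

definition dp_inv :: "nat \<Rightarrow> vars \<Rightarrow> arrays \<Rightarrow> bool" where
  "dp_inv i v A \<longleftrightarrow> base v A \<and> v vi = i \<and> i \<le> n \<and> v vcap = cap \<and> v vZ = Z \<and> tail_ok (A aTail) \<and>
     (\<forall>c<L. A aTail (c * Z) = jump_from c i) \<and> dp_ok i A"

definition class_inv :: "nat \<Rightarrow> nat \<Rightarrow> vars \<Rightarrow> arrays \<Rightarrow> bool" where
  "class_inv i c v A \<longleftrightarrow> base v A \<and> v vi = i \<and> i < n \<and> at_class c v \<and> tail_ok (A aTail) \<and>
     (\<forall>c'<L. A aTail (c' * Z) = jump_from c' (if c' < c then i else Suc i)) \<and> dp_ok (Suc i) A \<and>
     chosen i c (A aD) (v vbest) (v vbch)"

text \<open>The cell that holds the pointer lies in front of the bit array, so moving the pointer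
  leaves the encoded far ends intact.\<close>

lemma tail_ok_head:
  assumes "tail_ok t" "c < L"
  shows "tail_ok (t(c * Z := x))"
  unfolding tail_ok_def
proof (intro allI impI)
  fix c' assume c': "c' < L"
  then have ok: "class_ok c' (E c') t" using assms by (simp add: tail_ok_def)
  show "class_ok c' (E c') (t(c * Z := x))"
  proof (cases "c' = c")
    case True
    then show ?thesis using ok by (auto simp: class_ok_def intro: coded_block_cong)
  next
    case False
    show ?thesis by (rule class_ok_cong[OF ok _ False]) (use Z_pos in auto)
  qed
qed

lemma D_le_cap: "dp_ok i A \<Longrightarrow> i \<le> q \<Longrightarrow> q \<le> n \<Longrightarrow> A aD q \<le> cap"
  unfolding dp_ok_def by (meson diff_le_self le_trans mult_le_mono1)

lemma class_step:
  assumes I: "class_inv i c v A" and c: "c < L"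
  shows "ex (class_step p r) v A (60 * (jump_from c (Suc i) - jump_from c i) + 120) (class_inv i (Suc c))"
proof -
  from I have b: "base v A" and vi: "v vi = i" and i: "i < n" and at: "at_class c v" and tl: "tail_ok (A aTail)"
    and hd: "\<forall>c'<L. A aTail (c' * Z) = jump_from c' (if c' < c then i else Suc i)" and D: "dp_ok (Suc i) A"
    and ch: "chosen i c (A aD) (v vbest) (v vbch)"
    unfolding class_inv_def by simp_all
  let ?J = "jump_from c i"
  have hdc: "A aTail (c * Z) = jump_from c (Suc i)" using hd c by simp
  have fits: "17 * N + c * Z < M" using block_fits[OF c] Z_pos by simp
  have blk: "v vblk = c * Z" "v vth = thr c" using at by (auto simp: at_class_def)
  have J: "i < ?J" "?J \<le> n" using jump_from_greater[OF tl c i] jump_from_le[OF tl c] by auto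
  have DJ: "thr c + A aD ?J < 2 ^ w" using D_le_cap[OF D, of ?J] J thr_word(2)[OF c] by simp
  let ?v1 = "v(vJ := jump_from c (Suc i))" and ?v2 = "v(vJ := ?J)"
  have at1: "at_class c ?v1" "at_class c ?v2" using at by (simp_all add: at_class_def)
  have "ex jump_loop ?v1 A (60 * (jump_from c (Suc i) - ?J) + 50) (\<lambda>v' A'. v' = ?v1(vJ := ?J) \<and> A' = A)"
    by (rule jump_loop) (use b vi i tl c at1 in auto)
  then have 1: "ex jump_loop ?v1 A (60 * (jump_from c (Suc i) - ?J) + 50) (\<lambda>v' A'. v' = ?v2 \<and> A' = A)" by simp
  define best where "best = min (v vbest) (thr c + A aD ?J)"
  define bch where "bch = (if thr c + A aD ?J < v vbest then ?J - i else v vbch)"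
  let ?v3 = "?v2(vy := thr c + A aD ?J, vbest := best, vbch := bch)" and ?A3 = "upd A aTail (c * Z) ?J"
  have 2: "wp relax (\<lambda>v' A'. v' = ?v3 \<and> A' = ?A3) ?v2 A"
    using blk fits J DJ vi
    by (auto simp: relax_def less_N best_def bch_def min_def fun_eq_iff)
  have inv: "class_inv i (Suc c) v4 ?A3" if "at_class (Suc c) v4" "\<forall>x. x \<notin> {vth, vprev, vblk} \<longrightarrow> v4 x = ?v3 x" for v4
  proof -
    have "base v4 ?A3" by (rule base_frame[OF b]) (use that(2) in auto)
    moreover have "v4 vi = i" "v4 vbest = best" "v4 vbch = bch" using that(2) vi by auto
    moreover have "tail_ok (?A3 aTail)" using tail_ok_head[OF tl c] by simp
    moreover have "?A3 aTail (c' * Z) = jump_from c' (if c' < Suc c then i else Suc i)" if "c' < L" for c'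
      using hd that Z_pos by (auto simp: less_Suc_eq)
    moreover have "dp_ok (Suc i) ?A3" using D by (simp add: dp_ok_def)
    moreover have "chosen i (Suc c) (?A3 aD) best bch"
      using ch unfolding chosen_def best_def bch_def by (auto simp: less_Suc_eq min_def)
    ultimately show ?thesis using that i unfolding class_inv_def by simp
  qed
  have 3: "ex (next_class p r) ?v3 ?A3 20 (class_inv i (Suc c))"
  proof (rule ex_mono[OF ex_wp[OF next_class[of c ?v3 ?A3] order_refl]])
    show "at_class c ?v3" using at by (simp add: at_class_def)
    fix v' A' assume "at_class (Suc c) v' \<and> A' = ?A3 \<and> (\<forall>x. x \<notin> {vth, vprev, vblk} \<longrightarrow> v' x = ?v3 x)"
    then show "class_inv i (Suc c) v' A'" using inv by blast
  qed (use c in \<open>auto simp: next_class_def\<close>)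
  have 4: "ex (relax ;; next_class p r) ?v2 A 60 (class_inv i (Suc c))"
    by (rule ex_then[OF ex_wp[OF 2 order_refl]]) (use 3 in \<open>auto simp: relax_def\<close>)
  have 5: "ex (jump_loop ;; relax ;; next_class p r) ?v1 A (60 * (jump_from c (Suc i) - ?J) + 110) (class_inv i (Suc c))"
    by (rule ex_then[OF 1]) (use 4 in auto)
  show ?thesis unfolding class_step_def
    by (rule ex_Set_then[where t = "60 * (jump_from c (Suc i) - ?J) + 110"])
      (use blk fits hdc 5 in \<open>simp_all\<close>)
qed

end
end

definition solve :: "expr \<Rightarrow> nat \<Rightarrow> nat \<Rightarrow> nat \<Rightarrow> cmd" where
  "solve fe k p r = sweeps fe k p r ;; dp p r ;; out"

context class_machine
begin

context
  fixes E :: "nat \<Rightarrow> nat \<Rightarrow> nat"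
begin

lemma dp_body:
  assumes I: "dp_inv E (Suc i) v A"
  shows "ex (dp_body p r) v A (L * 140 + 60 * (\<Sum>c<L. jump_from E c (Suc i) - jump_from E c i) + 100) (dp_inv E i)"
proof -
  from I have b: "base v A" and vi: "v vi = Suc i" and i: "i < n" and vc: "v vcap = cap" "v vZ = Z"
    and tl: "tail_ok E (A aTail)" and hd: "\<forall>c<L. A aTail (c * Z) = jump_from E c (Suc i)" and D: "dp_ok E (Suc i) A"
    unfolding dp_inv_def by simp_all
  let ?d = "\<lambda>c. jump_from E c (Suc i) - jump_from E c i"
  have DS: "A aD (Suc i) \<le> cap" using D_le_cap[OF D] i by simp
  then have w: "thr 0 + A aD (Suc i) < 2 ^ w" using thr_word(2)[OF L_pos] by simp
  have bi: "base (v(vi := i)) A" using b by simp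
  note fc = first_class[OF bi]
  let ?v0 = "v(vi := i, vth := thr 0, vprev := 0, vblk := 0, vbest := thr 0 + A aD (Suc i), vbch := 1)"
  have fc1: "wp first_class (\<lambda>v' A'. v' = v(vi := i, vth := thr 0, vprev := 0, vblk := 0) \<and> A' = A) (v(vi := i)) A"
    using fc(1) vc by simp
  have at0: "at_class 0 ?v0" using fc(2) vc by (simp add: at_class_def)
  have 1: "ex (Set vi (Bin Sub (V vi) (K 1)) ;; first_class ;;
      Set vbest (Bin Add (V vth) (Arr aD (plus1 (V vi)))) ;; Set vbch (K 1)) v A 40 (\<lambda>v' A'. v' = ?v0 \<and> A' = A)"
  proof (rule ex_Set_then)
    have "ex first_class (v(vi := i)) A 20 (\<lambda>v' A'. v' = v(vi := i, vth := thr 0, vprev := 0, vblk := 0) \<and> A' = A)"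
      by (rule ex_wp[OF fc1]) (simp add: first_class_def)
    moreover have "ex (Set vbest (Bin Add (V vth) (Arr aD (plus1 (V vi)))) ;; Set vbch (K 1)) v' A' 12 (\<lambda>v' A'. v' = ?v0 \<and> A' = A)"
      if "v' = v(vi := i, vth := thr 0, vprev := 0, vblk := 0) \<and> A' = A" for v' A'
      using that w i by (intro ex_wp) (simp_all add: less_N small_word)
    ultimately have "ex (first_class ;; Set vbest (Bin Add (V vth) (Arr aD (plus1 (V vi)))) ;; Set vbch (K 1))
      (v(vi := i)) A 35 (\<lambda>v' A'. v' = ?v0 \<and> A' = A)" by (rule ex_then) simp_all
    then show "ex (first_class ;; Set vbest (Bin Add (V vth) (Arr aD (plus1 (V vi)))) ;; Set vbch (K 1))
      (v(vi := ev (Bin Sub (V vi) (K 1)) v A)) A 35 (\<lambda>v' A'. v' = ?v0 \<and> A' = A)" using vi by simp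
  qed (use vi in auto)
  have inv0: "class_inv E i 0 ?v0 A"
    using b i at0 tl hd D by (simp add: class_inv_def chosen_def)
  let ?\<Phi> = "\<lambda>v. \<Sum>c\<in>{v vblk div Z..<L}. 60 * ?d c + 130"
  have 2: "ex (While (Lt (V vprev) (V vcap)) (class_step p r)) ?v0 A (60 * (\<Sum>c<L. ?d c) + L * 130 + 5) (class_inv E i L)"
  proof (rule ex_While[where I = "\<lambda>v A. \<exists>c. class_inv E i c v A" and \<Phi> = "\<lambda>v A. ?\<Phi> v"])
    fix v A assume "\<exists>c. class_inv E i c v A" and t: "tev (Lt (V vprev) (V vcap)) v A"
    then obtain c where I: "class_inv E i c v A" by blast
    then have at: "at_class c v" by (simp add: class_inv_def)
    with t have c: "c < L" using at_class_test by blast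
    have "ex (class_step p r) v A (60 * ?d c + 120) (\<lambda>v' A'. (\<exists>c. class_inv E i c v' A') \<and>
        ?\<Phi> v' + (60 * ?d c + 120) + tst_time (Lt (V vprev) (V vcap)) + 1 \<le> ?\<Phi> v)"
    proof (rule ex_mono[OF class_step[OF I c]])
      fix v' A' assume I': "class_inv E i (Suc c) v' A'"
      then have "v' vblk div Z = Suc c" "v vblk div Z = c"
        using at_class_inj at by (auto simp: class_inv_def)
      then have "?\<Phi> v' + (60 * ?d c + 120) + tst_time (Lt (V vprev) (V vcap)) + 1 \<le> ?\<Phi> v"
        using c by (simp add: sum.atLeast_Suc_lessThan)
      with I' show "(\<exists>c. class_inv E i c v' A') \<and>
        ?\<Phi> v' + (60 * ?d c + 120) + tst_time (Lt (V vprev) (V vcap)) + 1 \<le> ?\<Phi> v" by blast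
    qed simp
    then show "\<exists>t. ex (class_step p r) v A t (\<lambda>v' A'. (\<exists>c. class_inv E i c v' A') \<and>
        ?\<Phi> v' + t + tst_time (Lt (V vprev) (V vcap)) + 1 \<le> ?\<Phi> v)" by (rule exI[where x = "60 * ?d c + 120"])
  next
    fix v A assume "\<exists>c. class_inv E i c v A" and t: "\<not> tev (Lt (V vprev) (V vcap)) v A"
    then obtain c where I: "class_inv E i c v A" by blast
    then have "at_class c v" by (simp add: class_inv_def)
    with t have "\<not> c < L" "c \<le> L" using at_class_test by (blast, simp add: at_class_def)
    with I show "class_inv E i L v A" by simp
  next
    show "?\<Phi> ?v0 + tst_time (Lt (V vprev) (V vcap)) + 1 \<le> 60 * (\<Sum>c<L. ?d c) + L * 130 + 5"
      by (simp add: sum.distrib sum_distrib_left lessThan_atLeast0)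
  qed (use inv0 in auto)
  have 3: "ex (Put aD (V vi) (V vbest) ;; Put aCh (V vi) (V vbch)) v' A' 20 (dp_inv E i)" if C: "class_inv E i L v' A'" for v' A'
  proof (rule ex_wp)
    from C have b: "base v' A'" and vi: "v' vi = i" and at: "at_class L v'" and tl: "tail_ok E (A' aTail)"
      and hd: "\<forall>c'<L. A' aTail (c' * Z) = jump_from E c' i" and D: "dp_ok E (Suc i) A'"
      and ch: "chosen E i L (A' aD) (v' vbest) (v' vbch)"
      unfolding class_inv_def by simp_all
    let ?A = "upd (upd A' aD i (v' vbest)) aCh i (v' vbch)"
    have gt: "c < L \<Longrightarrow> q < n \<Longrightarrow> q < jump_from E c q" for c q using jump_from_greater[OF tl] .
    \<comment> \<open>The choice at \<open>q\<close> only looks at values strictly to the right of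
      \<open>q\<close>, hence never at the entry that is being written.\<close>
    have same: "chosen E q L (?A aD) x y \<longleftrightarrow> chosen E q L (A' aD) x y" if "i \<le> q" "q < n" for q x y
    proof -
      have "?A aD (jump_from E c q) = A' aD (jump_from E c q)" if "c < L" for c
        using gt[OF that \<open>q < n\<close>] \<open>i \<le> q\<close> by simp
      moreover have "?A aD (Suc q) = A' aD (Suc q)" using that by simp
      ultimately show ?thesis unfolding chosen_def by (metis (no_types, lifting))
    qed
    have "dp_ok E i ?A"
      unfolding dp_ok_def
    proof (intro conjI allI impI)
      show "?A aD n = 0" using D i by (simp add: dp_ok_def)
      fix q assume q: "i \<le> q \<and> q < n"
      show "chosen E q L (?A aD) (?A aD q) (?A aCh q)"
        using same[of q] q ch D by (cases "q = i") (auto simp: dp_ok_def)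
    next
      fix q assume q: "i \<le> q \<and> q \<le> n"
      show "?A aD q \<le> (n - q) * thr 0"
      proof (cases "q = i")
        case True
        have "v' vbest \<le> thr 0 + A' aD (Suc i)" using ch by (simp add: chosen_def)
        also have "A' aD (Suc i) \<le> (n - Suc i) * thr 0" using D i by (simp add: dp_ok_def)
        also have "thr 0 + (n - Suc i) * thr 0 = Suc (n - Suc i) * thr 0" by simp
        also have "Suc (n - Suc i) = n - i" using i by simp
        finally show ?thesis using True by simp
      next
        case False
        then show ?thesis using D q by (simp add: dp_ok_def)
      qed
    qed
    moreover have "base v' ?A" by (rule base_frame[OF b]) auto
    ultimately have "dp_inv E i v' ?A" using vi i at tl hd by (simp add: dp_inv_def at_class_def)
    then show "wp (Put aD (V vi) (V vbest) ;; Put aCh (V vi) (V vbch)) (dp_inv E i) v' A'"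
      using vi i by (simp add: less_N)
  qed simp
  have 4: "ex (While (Lt (V vprev) (V vcap)) (class_step p r) ;; Put aD (V vi) (V vbest) ;; Put aCh (V vi) (V vbch)) ?v0 A
      (60 * (\<Sum>c<L. ?d c) + L * 130 + 25) (dp_inv E i)"
    by (rule ex_then[OF 2 3]) auto
  show ?thesis unfolding dp_body_def
    by (rule ex_then[OF 1, where ?t2.0 = "60 * (\<Sum>c<L. ?d c) + L * 130 + 25"]) (use 4 in auto)
qed

text \<open>The pointer moves telescope: each class has one pointer, which only moves left over a
  distance of at most \<open>n\<close>. The sum of the pointers serves as potential, so all jump
  loops together cost \<open>O(L * n)\<close>.\<close>

lemma dp_loop:
  assumes "dp_inv E n v A"
  shows "ex (While (Lt (K 0) (V vi)) (dp_body p r)) v A (n * (L * 200 + 110) + 10) (dp_inv E 0)"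
proof (rule ex_While[where I = "\<lambda>v A. \<exists>i. dp_inv E i v A"
      and \<Phi> = "\<lambda>v A. v vi * (L * 140 + 110) + 60 * (\<Sum>c<L. jump_from E c (v vi))"])
  fix v A assume "\<exists>i. dp_inv E i v A" and t: "tev (Lt (K 0) (V vi)) v A"
  then obtain i where I: "dp_inv E (Suc i) v A"
    by (auto simp: dp_inv_def) (metis Suc_pred)
  have vi: "v vi = Suc i" using I by (simp add: dp_inv_def)
  let ?t = "L * 140 + 60 * (\<Sum>c<L. jump_from E c (Suc i) - jump_from E c i) + 100"
  have "(\<Sum>c<L. jump_from E c (Suc i) - jump_from E c i) + (\<Sum>c<L. jump_from E c i) = (\<Sum>c<L. jump_from E c (Suc i))"
    unfolding sum.distrib[symmetric]
  proof (rule sum.cong)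
    fix c assume "c \<in> {..<L}"
    moreover have "tail_ok E (A aTail)" using I by (simp add: dp_inv_def)
    ultimately have "jump_from E c i \<le> jump_from E c (Suc i)" by (intro jump_from_mono) auto
    then show "jump_from E c (Suc i) - jump_from E c i + jump_from E c i = jump_from E c (Suc i)" by simp
  qed simp
  then have pay: "i * (L * 140 + 110) + 60 * (\<Sum>c<L. jump_from E c i) + ?t + tst_time (Lt (K 0) (V vi)) + 1
      \<le> Suc i * (L * 140 + 110) + 60 * (\<Sum>c<L. jump_from E c (Suc i))" by (simp add: algebra_simps)
  have "ex (dp_body p r) v A ?t (\<lambda>v' A'. (\<exists>i. dp_inv E i v' A') \<and>
      v' vi * (L * 140 + 110) + 60 * (\<Sum>c<L. jump_from E c (v' vi)) + ?t + tst_time (Lt (K 0) (V vi)) + 1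
      \<le> v vi * (L * 140 + 110) + 60 * (\<Sum>c<L. jump_from E c (v vi)))"
  proof (rule ex_mono[OF dp_body[OF I]])
    fix v' A' assume I': "dp_inv E i v' A'"
    then have "v' vi = i" by (simp add: dp_inv_def)
    with I' pay vi show "(\<exists>i. dp_inv E i v' A') \<and>
      v' vi * (L * 140 + 110) + 60 * (\<Sum>c<L. jump_from E c (v' vi)) + ?t + tst_time (Lt (K 0) (V vi)) + 1
      \<le> v vi * (L * 140 + 110) + 60 * (\<Sum>c<L. jump_from E c (v vi))" by metis
  qed simp
  then show "\<exists>t. ex (dp_body p r) v A t (\<lambda>v' A'. (\<exists>i. dp_inv E i v' A') \<and>
      v' vi * (L * 140 + 110) + 60 * (\<Sum>c<L. jump_from E c (v' vi)) + t + tst_time (Lt (K 0) (V vi)) + 1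
      \<le> v vi * (L * 140 + 110) + 60 * (\<Sum>c<L. jump_from E c (v vi)))" by (rule exI[where x = ?t])
next
  fix v A assume "\<exists>i. dp_inv E i v A" and t: "\<not> tev (Lt (K 0) (V vi)) v A"
  then show "dp_inv E 0 v A" by (auto simp: dp_inv_def)
next
  have "(\<Sum>c<L. jump_from E c n) = L * n" by (simp add: jump_from_def)
  moreover have "v vi = n" using assms by (simp add: dp_inv_def)
  ultimately show "v vi * (L * 140 + 110) + 60 * (\<Sum>c<L. jump_from E c (v vi)) + tst_time (Lt (K 0) (V vi)) + 1
    \<le> n * (L * 200 + 110) + 10" by (simp add: algebra_simps)
qed (use assms in auto)

section \<open>Meaning of the computed values and output of the partition\<close>

context
  fixes v A
  assumes final: "dp_inv E 0 v A"
begin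

lemma final_tail: "tail_ok E (A aTail)" and final_dp: "dp_ok E 0 A"
  using final by (simp_all add: dp_inv_def)

lemma final_chosen: "q < n \<Longrightarrow> chosen E q L (A aD) (A aD q) (A aCh q)"
  using final_dp by (simp add: dp_ok_def)

text \<open>The price paid for a piece is a threshold that its weight does not exceed: a jump ends
  at a far end of its class, and a single symbol passes the test of the first class.\<close>

lemma choice:
  assumes "q < n"
  shows "1 \<le> A aCh q" "q + A aCh q \<le> n" "W q (q + A aCh q) + A aD (q + A aCh q) \<le> A aD q"
proof -
  from final_chosen[OF assms] consider "A aD q = thr 0 + A aD (Suc q)" "A aCh q = 1"
    | c where "c < L" "A aD q = thr c + A aD (jump_from E c q)" "A aCh q = jump_from E c q - q"
    by (auto simp: chosen_def)
  then have "1 \<le> A aCh q \<and> q + A aCh q \<le> n \<and> W q (q + A aCh q) + A aD (q + A aCh q) \<le> A aD q"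
  proof cases
    case 1
    have "W q (Suc q) \<le> thr 0" using sound[OF L_pos _ _ unit] assms by simp
    with 1 assms show ?thesis by simp
  next
    case 2
    have "W q (E c q) \<le> thr c" using final_tail 2(1) assms by (auto simp: tail_ok_def class_ok_def stairs_def)
    moreover have "jump_from E c q = E c q" using assms by (simp add: jump_from_def)
    ultimately show ?thesis
      using 2 jump_from_greater[OF final_tail 2(1) assms] jump_from_le[OF final_tail 2(1), of q] by simp
  qed
  then show "1 \<le> A aCh q" "q + A aCh q \<le> n" "W q (q + A aCh q) + A aD (q + A aCh q) \<le> A aD q" by blast+
qed

text \<open>If the best choice at \<open>i\<close> is a jump of class \<open>c\<close>, the same
  class reaches at least as far from \<open>Suc i\<close>, for the same price. Its target lies
  further right, where monotonicity is already known. The induction is on the length of the suffix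
  considered.\<close>

lemma D_antimono: "i \<le> j \<Longrightarrow> j \<le> n \<Longrightarrow> A aD j \<le> A aD i"
proof -
  have "\<forall>i j. n - d \<le> i \<longrightarrow> i \<le> j \<longrightarrow> j \<le> n \<longrightarrow> A aD j \<le> A aD i" for d
  proof (induction d)
    case (Suc d)
    have step: "A aD (Suc i) \<le> A aD i" if i: "n - Suc d = i" "i < n" for i
    proof -
      from i have IH: "Suc i \<le> a \<Longrightarrow> a \<le> b \<Longrightarrow> b \<le> n \<Longrightarrow> A aD b \<le> A aD a" for a b
        using Suc.IH by auto
      from final_chosen[OF i(2)] consider "A aD i = thr 0 + A aD (Suc i)"
        | c where "c < L" "A aD i = thr c + A aD (jump_from E c i)" by (auto simp: chosen_def)
      then show ?thesis
      proof cases
        case 2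
        show ?thesis
        proof (cases "Suc i < n")
          case True
          have "A aD (Suc i) \<le> thr c + A aD (jump_from E c (Suc i))"
            using final_chosen[OF True] 2(1) by (simp add: chosen_def)
          also have "A aD (jump_from E c (Suc i)) \<le> A aD (jump_from E c i)"
            using jump_from_greater[OF final_tail 2(1) i(2)] jump_from_mono[OF final_tail 2(1), of i "Suc i"]
              jump_from_le[OF final_tail 2(1)] by (intro IH) auto
          finally show ?thesis using 2 by simp
        next
          case False
          then have "Suc i = n" using i by simp
          then show ?thesis using final_dp by (simp add: dp_ok_def)
        qed
      qed simp
    qed
    show ?case
    proof (intro allI impI)
      fix i j assume ij: "n - Suc d \<le> i" "i \<le> j" "j \<le> n"
      show "A aD j \<le> A aD i"
      proof (cases "n - d \<le> i \<or> i = j")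
        case True
        then show ?thesis using Suc.IH ij by auto
      next
        case False
        then have i: "n - Suc d = i" "i < n" "n - d \<le> Suc i" "Suc i \<le> j" using ij by auto
        then have "A aD j \<le> A aD (Suc i)" using Suc.IH ij by blast
        then show ?thesis using step[OF i(1,2)] by simp
      qed
    qed
  next
    case 0
    show ?case by (metis diff_zero le_antisym le_trans order_refl)
  qed
  from this[of n] show "i \<le> j \<Longrightarrow> j \<le> n \<Longrightarrow> A aD j \<le> A aD i" by simp
qed

text \<open>The longest piece of class \<open>c\<close> from \<open>i\<close> ends at
  \<open>j\<close> or later, and ending later can only decrease the remaining value.\<close>

lemma D_complete:
  assumes "c < L" "i < j" "j \<le> n" "W i j + 2 * N \<le> thr c"
  shows "A aD i \<le> thr c + A aD j"
proof -
  have i: "i < n" using assms by simp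
  have "j \<le> E c i" using final_tail assms i by (auto simp: tail_ok_def class_ok_def stairs_def)
  then have "j \<le> jump_from E c i" using i by (simp add: jump_from_def)
  then have "A aD (jump_from E c i) \<le> A aD j" using jump_from_le[OF final_tail assms(1)] by (rule D_antimono)
  moreover have "A aD i \<le> thr c + A aD (jump_from E c i)" using final_chosen[OF i] assms(1) by (simp add: chosen_def)
  ultimately show ?thesis by simp
qed

definition out_inv :: "nat list \<Rightarrow> vars \<Rightarrow> arrays \<Rightarrow> bool" where
  "out_inv ls v' A' \<longleftrightarrow> v' vn = n \<and> v' vN = N \<and> A' aCh = A aCh \<and> v' vp = sum_list ls \<and> v' vx = length ls \<and>
     sum_list ls \<le> n \<and> 0 \<notin> set ls \<and> (\<forall>i<length ls. A' aLen i = ls ! i) \<and>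
     piece_sum W 0 ls + A aD (sum_list ls) \<le> A aD 0"

lemma length_le_sum_list: "0 \<notin> set ls \<Longrightarrow> length ls \<le> sum_list ls" for ls :: "nat list"
  by (induction ls) auto

lemma out:
  "ex out v A (80 * N) (\<lambda>v' A'. \<exists>ls. sum_list ls = n \<and> 0 \<notin> set ls \<and> (\<forall>i<length ls. A' aLen i = ls ! i) \<and>
     piece_sum W 0 ls \<le> A aD 0 \<and> v' 0 = length ls \<and> v' 1 = 15 * N \<and> length ls \<le> n)"
proof -
  have b: "v vn = n" "v vN = N" using final by (simp_all add: dp_inv_def base_def)
  let ?v = "v(vp := 0, vx := 0)"
  have "out_inv [] ?v A" using b by (simp add: out_inv_def)
  then have 1: "ex (While (Lt (V vp) (V vn)) out_body) ?v A (50 * n + 5) (\<lambda>v' A'. \<exists>ls. out_inv ls v' A' \<and> sum_list ls = n)"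
  proof (rule ex_While[where I = "\<lambda>v' A'. \<exists>ls. out_inv ls v' A'" and \<Phi> = "\<lambda>v' A'. 50 * (n - v' vp)", OF exI])
    fix v' A' assume "\<exists>ls. out_inv ls v' A'" and t: "tev (Lt (V vp) (V vn)) v' A'"
    then obtain ls where I: "out_inv ls v' A'" by blast
    then have v': "v' vn = n" "v' vN = N" "A' aCh = A aCh" "v' vp = sum_list ls" "v' vx = length ls" "0 \<notin> set ls"
      "\<forall>i<length ls. A' aLen i = ls ! i" and ps: "piece_sum W 0 ls + A aD (sum_list ls) \<le> A aD 0"
      by (simp_all add: out_inv_def)
    let ?q = "sum_list ls"
    have q: "?q < n" using t v' by simp
    note ch = choice[OF q]
    have len: "length ls < n" using length_le_sum_list[OF v'(6)] q by simp
    let ?v' = "v'(vp := ?q + A aCh ?q, vx := Suc (length ls))" and ?A' = "upd A' aLen (length ls) (A aCh ?q)"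
    have "out_inv (ls @ [A aCh ?q]) ?v' ?A'"
      using v' ch ps by (auto simp: out_inv_def piece_sum_snoc nth_append less_Suc_eq)
    moreover have "wp out_body (\<lambda>v2 A2. v2 = ?v' \<and> A2 = ?A') v' A'"
      using v' q len ch by (simp add: out_body_def less_N small_word)
    ultimately have "ex out_body v' A' 45 (\<lambda>v2 A2. (\<exists>ls. out_inv ls v2 A2) \<and>
        50 * (n - v2 vp) + 45 + tst_time (Lt (V vp) (V vn)) + 1 \<le> 50 * (n - v' vp))"
      using v' q ch by (intro ex_mono[OF ex_wp[OF _ order_refl]]) (auto simp: out_body_def)
    then show "\<exists>t. ex out_body v' A' t (\<lambda>v2 A2. (\<exists>ls. out_inv ls v2 A2) \<and>
        50 * (n - v2 vp) + t + tst_time (Lt (V vp) (V vn)) + 1 \<le> 50 * (n - v' vp))" by (rule exI[where x = 45])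
  qed (auto simp: out_inv_def)
  have 2: "ex (Set 0 (V vx) ;; Set 1 (Bin Mul (K 15) (V vN))) v' A' 10 (\<lambda>v' A'. \<exists>ls. sum_list ls = n \<and> 0 \<notin> set ls \<and>
      (\<forall>i<length ls. A' aLen i = ls ! i) \<and> piece_sum W 0 ls \<le> A aD 0 \<and> v' 0 = length ls \<and> v' 1 = 15 * N \<and> length ls \<le> n)"
    if "\<exists>ls. out_inv ls v' A' \<and> sum_list ls = n" for v' A'
  proof -
    from that obtain ls where I: "out_inv ls v' A'" "sum_list ls = n" by blast
    have "15 < (2::nat) ^ w" "15 * N < 2 ^ w" using N_word N_pos by linarith+
    moreover have "piece_sum W 0 ls \<le> A aD 0" using I by (simp add: out_inv_def)
    ultimately show ?thesis using I length_le_sum_list[of ls]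
      by (intro ex_wp) (auto simp: out_inv_def intro!: exI[of _ ls])
  qed
  have "5 + (50 * n + 15) \<le> 80 * N" using n_less_N by linarith
  then show ?thesis unfolding out_def
    by (intro ex_Set_then[where t = "50 * n + 17"] ex_Set_then[where t = "50 * n + 15"] ex_then[OF _ 2]) (use 1 in auto)
qed

end
end

text \<open>The values \<open>D\<close> are exported as a certificate: an upper bound for the output
  and at the same time a potential that no sufficiently light piece can beat. The comparison with an
  optimal partition then needs no further knowledge of the program.\<close>

theorem solve:
  assumes "base v A" "v vcap = cap" "v vZ = Z" "\<forall>x<N. \<forall>a\<in>{aCS, aCC, aCP}. A a x = 0" "A aTail = (\<lambda>_. 0)" "A aD n = 0"
  shows "ex (solve fe k p r) v A (2500 * (L + 1) * N) (\<lambda>v' A'. \<exists>ls D.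
     sum_list ls = n \<and> 0 \<notin> set ls \<and> (\<forall>i<length ls. A' aLen i = ls ! i) \<and>
     piece_sum W 0 ls \<le> D 0 \<and> D n = (0::nat) \<and>
     (\<forall>i j c. c < L \<longrightarrow> i < j \<longrightarrow> j \<le> n \<longrightarrow> W i j + 2 * N \<le> thr c \<longrightarrow> D i \<le> thr c + D j) \<and>
     v' 0 = length ls \<and> v' 1 = 15 * N \<and> length ls \<le> n)" (is "ex _ _ _ _ ?Q")
proof -
  have 1: "ex (sweeps fe k p r) v A (L * (1700 * n + 60) + 20) (\<lambda>v' A'. sweeps_inv L v' A' \<and> A' aD = A aD)"
    by (rule ex_frame[OF sweeps[OF assms(1-5)]])
      (auto simp: sweeps_def sweep_def sweep_body_def mod_sweep first_class_def next_class_def)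
  have 2: "ex (dp p r ;; out) v' A' (n * (L * 200 + 110) + 80 * N + 20) ?Q"
    if I: "sweeps_inv L v' A' \<and> A' aD = A aD" for v' A'
  proof -
    have "\<forall>c<L. \<exists>e. class_ok c e (A' aTail)" using I by (simp add: sweeps_inv_def)
    then obtain E where E: "\<And>c. c < L \<Longrightarrow> class_ok c (E c) (A' aTail)" by metis
    have b: "base v' A'" "v' vn = n" "v' vcap = cap" "v' vZ = Z" using I by (auto simp: sweeps_inv_def at_class_def base_def)
    have "dp_ok E n A'" using I assms(6) by (auto simp: dp_ok_def dest: le_antisym)
    then have "dp_inv E n (v'(vi := n)) A'"
      using I E b assms(6) by (simp add: dp_inv_def sweeps_inv_def tail_ok_def jump_from_def)
    from dp_loop[OF this]
    have dp: "ex (dp p r) v' A' (n * (L * 200 + 110) + 15) (dp_inv E 0)"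
      unfolding dp_def by (intro ex_Set_then) (use b in auto)
    show ?thesis
    proof (rule ex_then[OF dp])
      fix v2 A2 assume fin: "dp_inv E 0 v2 A2"
      then have "A2 aD n = 0" by (simp add: dp_inv_def dp_ok_def)
      with D_complete[OF fin] show "ex out v2 A2 (80 * N) ?Q"
        by (intro ex_mono[OF out[OF fin]]) (auto intro!: exI[of _ "A2 aD"])
    qed simp
  qed
  have le: "L * (1700 * n + 60) + 20 + (n * (L * 200 + 110) + 80 * N + 20) \<le> 2500 * (L + 1) * N"
  proof -
    have "N = n + 1" by (simp add: cells_def)
    then show ?thesis by (simp add: algebra_simps)
  qed
  show ?thesis unfolding solve_def by (rule ex_then[OF 1 2 le])
qed

end

section \<open>The complete program\<close>

text \<open>The accumulator passes the preceding entry to \<open>xe\<close>. Logarithms of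
  factorials are computed from it by adding one logarithm.\<close>

definition table :: "expr \<Rightarrow> cmd" where
  "table xe = Set vp (K 0) ;; Set vacc (K 0) ;;
     While (Lt (V vp) (V vN)) (Set vacc xe ;; Put aX (V vp) (V vacc) ;; Set vp (plus1 (V vp)))"

definition powers :: cmd where
  "powers = Set vp (K 0) ;; Set vy (K 1) ;;
     While (Lt (V vp) (V vB)) (Put aPow (V vp) (V vy) ;; Set vy (Bin Add (V vy) (V vy)) ;; Set vp (plus1 (V vp)))"

definition constants :: "nat \<Rightarrow> cmd" where
  "constants b =
     Set vB (Bin Mul (K b) (Bin Log (V vN) (K 1))) ;;
     If (Lt (V vN) (V vB)) (Set vB (V vN)) NOP ;;
     Set vZ (Bin Add (K 2) (Bin Div (Bin Mul (K 2) (V vn)) (V vB))) ;;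
     Set vcap (Bin Mul (V vn) (Bin Add (V vG) (Bin Mul (K 3) (V vN))))"

definition whole :: "cmd \<Rightarrow> expr \<Rightarrow> expr \<Rightarrow> nat \<Rightarrow> nat \<Rightarrow> nat \<Rightarrow> nat \<Rightarrow> nat \<Rightarrow> cmd" where
  "whole gi xe fe k d b p r =
     Set vN (plus1 (V vn)) ;; naming d k ;; (gi ;; constants b) ;; table xe ;; powers ;; solve fe k p r"

definition program_com :: "cmd \<Rightarrow> expr \<Rightarrow> expr \<Rightarrow> nat \<Rightarrow> nat \<Rightarrow> nat \<Rightarrow> nat \<Rightarrow> nat \<Rightarrow> com" where
  "program_com gi xe fe k d b p r =
     Seq (Const 97 1) (Seq (Op Add 98 0 97) (cmd_com (whole gi xe fe k d b p r)))"

text \<open>The minimum makes the table of powers of two fit into an array of \<open>N\<close>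
  cells; for long texts it is the second argument that counts.\<close>

definition pack_bits :: "nat \<Rightarrow> nat \<Rightarrow> nat" where
  "pack_bits b N = min N (b * nat \<lfloor>log 2 (real N)\<rfloor>)"

context text_machine
begin

section \<open>From names back to grams\<close>

definition gram :: "nat \<Rightarrow> nat \<Rightarrow> nat list" where
  "gram m q = map (\<lambda>l. sym (q + l)) [0..<m]"

lemma gram_eq_iff: "gram m q = gram m q' \<longleftrightarrow> same_gram m q q'"
  by (auto simp: gram_def same_gram_def)

definition gram_sum :: "(nat \<Rightarrow> nat) \<Rightarrow> nat \<Rightarrow> nat \<Rightarrow> nat \<Rightarrow> nat" where
  "gram_sum X m i e = (\<Sum>u\<in>gram m ` {i..<e}. X (card {q. i \<le> q \<and> q < e \<and> gram m q = u}))"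

text \<open>On the window, names and grams correspond one to one, via arbitrary representatives.
  Names that do not occur contribute \<open>X 0 = 0\<close>.\<close>

lemma occ_sum_gram_sum:
  assumes "names f (same_gram m)" "X 0 = 0" "e \<le> n"
  shows "occ_sum X N f i e = gram_sum X m i e"
proof -
  have fN: "f q < N" if "q < n" for q using assms(1) that unfolding names_def by simp
  have f: "f q = f q' \<longleftrightarrow> gram m q = gram m q'" if "i \<le> q" "q < e" "i \<le> q'" "q' < e" for q q'
    using assms(1,3) that unfolding names_def gram_eq_iff by simp
  have "occ_sum X N f i e = (\<Sum>x\<in>f ` {i..<e}. X (occ f i e x))"
    unfolding occ_sum_def
  proof (rule sum.mono_neutral_right)
    show "f ` {i..<e} \<subseteq> {..<N}" using fN assms(3) by fastforce
    show "\<forall>x\<in>{..<N} - f ` {i..<e}. X (occ f i e x) = 0"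
      using occ_pos_iff[of f i e] assms(2) by (metis DiffD2 gr_zeroI)
  qed simp
  also have "\<dots> = gram_sum X m i e"
    unfolding gram_sum_def
  proof (rule sum.reindex_bij_witness[of _ "\<lambda>u. f (SOME q. q \<in> {i..<e} \<and> gram m q = u)"
        "\<lambda>x. gram m (SOME q. q \<in> {i..<e} \<and> f q = x)"])
    fix x assume "x \<in> f ` {i..<e}"
    then have "\<exists>q. q \<in> {i..<e} \<and> f q = x" by auto
    then have s: "(SOME q. q \<in> {i..<e} \<and> f q = x) \<in> {i..<e} \<and> f (SOME q. q \<in> {i..<e} \<and> f q = x) = x" by (rule someI_ex)
    define s where "s = (SOME q. q \<in> {i..<e} \<and> f q = x)"
    have s': "i \<le> s" "s < e" "f s = x" using s unfolding s_def by auto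
    then show "gram m (SOME q. q \<in> {i..<e} \<and> f q = x) \<in> gram m ` {i..<e}" unfolding s_def[symmetric] by auto
    have "\<exists>q. q \<in> {i..<e} \<and> gram m q = gram m s" using s' by auto
    then have t: "(SOME q. q \<in> {i..<e} \<and> gram m q = gram m s) \<in> {i..<e} \<and> gram m (SOME q. q \<in> {i..<e} \<and> gram m q = gram m s) = gram m s"
      by (rule someI_ex)
    then show "f (SOME q. q \<in> {i..<e} \<and> gram m q = gram m (SOME q. q \<in> {i..<e} \<and> f q = x)) = x"
      unfolding s_def[symmetric] using f[of s "SOME q. q \<in> {i..<e} \<and> gram m q = gram m s"] s' by simp
    have "{q. i \<le> q \<and> q < e \<and> gram m q = gram m s} = {q. i \<le> q \<and> q < e \<and> f q = x}"
      using f[of _ s] s' by auto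
    then show "X (card {q. i \<le> q \<and> q < e \<and> gram m q = gram m (SOME q. q \<in> {i..<e} \<and> f q = x)}) = X (occ f i e x)"
      unfolding s_def[symmetric] occ_def by simp
  next
    fix u assume "u \<in> gram m ` {i..<e}"
    then have "\<exists>q. q \<in> {i..<e} \<and> gram m q = u" by auto
    then have s: "(SOME q. q \<in> {i..<e} \<and> gram m q = u) \<in> {i..<e} \<and> gram m (SOME q. q \<in> {i..<e} \<and> gram m q = u) = u" by (rule someI_ex)
    define s where "s = (SOME q. q \<in> {i..<e} \<and> gram m q = u)"
    have s': "i \<le> s" "s < e" "gram m s = u" using s unfolding s_def by auto
    then show "f (SOME q. q \<in> {i..<e} \<and> gram m q = u) \<in> f ` {i..<e}" unfolding s_def[symmetric] by auto
    have "\<exists>q. q \<in> {i..<e} \<and> f q = f s" using s' by auto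
    then have t: "(SOME q. q \<in> {i..<e} \<and> f q = f s) \<in> {i..<e} \<and> f (SOME q. q \<in> {i..<e} \<and> f q = f s) = f s"
      by (rule someI_ex)
    then show "gram m (SOME q. q \<in> {i..<e} \<and> f q = f (SOME q. q \<in> {i..<e} \<and> gram m q = u)) = u"
      unfolding s_def[symmetric] using f[of s "SOME q. q \<in> {i..<e} \<and> f q = f s"] s' by simp
  qed
  finally show ?thesis .
qed

lemma card_names:
  assumes "names f (same_gram 1)" "j \<le> n"
  shows "card (f ` {i..<j}) = card (sym ` {i..<j})"
proof -
  have f: "f q = f q' \<longleftrightarrow> sym q = sym q'" if "q < n" "q' < n" for q q'
    using assms(1) that unfolding names_def same_gram_def by simp
  have "bij_betw (\<lambda>x. sym (SOME q. q \<in> {i..<j} \<and> f q = x)) (f ` {i..<j}) (sym ` {i..<j})"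
  proof (rule bij_betw_byWitness[where f' = "\<lambda>x. f (SOME q. q \<in> {i..<j} \<and> sym q = x)"])
    have S: "(SOME q'. q' \<in> {i..<j} \<and> g q' = g q) \<in> {i..<j} \<and> g (SOME q'. q' \<in> {i..<j} \<and> g q' = g q) = g q"
      if "q \<in> {i..<j}" for q and g :: "nat \<Rightarrow> nat" using that by (intro someI[of "\<lambda>q'. q' \<in> {i..<j} \<and> g q' = g q"]) auto
    show "(\<lambda>x. sym (SOME q. q \<in> {i..<j} \<and> f q = x)) ` (f ` {i..<j}) \<subseteq> sym ` {i..<j}" using S[of _ f] by blast
    show "(\<lambda>x. f (SOME q. q \<in> {i..<j} \<and> sym q = x)) ` (sym ` {i..<j}) \<subseteq> f ` {i..<j}" using S[of _ sym] by blast
    have eq: "sym (SOME q'. q' \<in> {i..<j} \<and> f q' = f q) = sym q" "f (SOME q'. q' \<in> {i..<j} \<and> sym q' = sym q) = f q"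
      if "q \<in> {i..<j}" for q using S[OF that, of f] S[OF that, of sym] f that assms(2) by auto
    show "\<forall>x\<in>f ` {i..<j}. f (SOME q. q \<in> {i..<j} \<and> sym q = sym (SOME q. q \<in> {i..<j} \<and> f q = x)) = x"
      using eq by simp
    show "\<forall>x\<in>sym ` {i..<j}. sym (SOME q. q \<in> {i..<j} \<and> f q = f (SOME q. q \<in> {i..<j} \<and> sym q = x)) = x"
      using eq by simp
  qed
  then show ?thesis by (rule bij_betw_same_card)
qed

end

lemma piece_sum_cut:
  assumes "\<And>i j. W i j = c * wt (take (j - i) (drop i T))"
  shows "piece_sum W i ls = c * partition_cost wt (cut ls (drop i T))"
  by (induction ls arbitrary: i) (simp_all add: assms partition_cost_def distrib_left add.commute)

lemma cut_is_partition:
  assumes "sum_list ls = length T" "0 \<notin> set ls"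
  shows "is_partition T (cut ls T)"
  using assms
proof (induction ls arbitrary: T)
  case (Cons l ls)
  then have "is_partition (drop l T) (cut ls (drop l T))" by simp
  with Cons.prems show ?case by (auto simp: is_partition_def)
qed (simp add: is_partition_def)

text \<open>The estimate of a piece has two admissible outcomes: it is within \<open>N\<close> of
  the scaled weight, or both are so large that the piece belongs to no class. The second one
  accounts for saturated words. \<open>Big\<close> separates the two, as it lies above all
  thresholds.\<close>

locale program = text_machine F w M T k for F w M T k +
  fixes X :: "nat \<Rightarrow> nat" and Fv :: "nat \<Rightarrow> nat \<Rightarrow> nat" and fe xe :: expr and gi :: cmd
    and \<sigma> Q0 G0 XB b d p r L Big :: nat and wt :: "nat list \<Rightarrow> real"
  assumes X0: "X 0 = 0" and X_le: "\<And>m. X m \<le> m * XB" and XB_word: "4 * cells T * XB < 2 ^ w"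
    and fe: "\<And>v A. v vn = length T \<Longrightarrow> v vN = cells T \<Longrightarrow> v vQ = Q0 \<Longrightarrow> v vG = G0 \<Longrightarrow>
      v vi \<le> v vj \<Longrightarrow> v vj < length T \<Longrightarrow> ok fe v A \<and> ev fe v A = Fv (Suc (v vj) - v vi) (v vds')"
    and fe_time: "expr_time fe \<le> 40"
    and xe: "\<And>v A. v vn = length T \<Longrightarrow> v vN = cells T \<Longrightarrow> v vQ = Q0 \<Longrightarrow> v vp \<le> length T \<Longrightarrow>
      v vacc = (if v vp = 0 then 0 else X (v vp - 1)) \<Longrightarrow> ok xe v A \<and> ev xe v A = X (v vp)"
    and xe_time: "expr_time xe \<le> 40"
    and gi: "\<And>v A. v vn = length T \<Longrightarrow> v vN = cells T \<Longrightarrow> v 1 = \<sigma> \<Longrightarrow>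
      wp gi (\<lambda>v' A'. A' = A \<and> v' vQ = Q0 \<and> v' vG = G0 \<and> (\<forall>x. x \<notin> {vQ, vG, vx, vy} \<longrightarrow> v' x = v x)) v A"
    and gi_time: "loopfree_time gi \<le> 100"
    and b_word: "0 < b" "b * nat \<lfloor>log 2 (real (cells T))\<rfloor> < w"
    and sigma: "set T \<subseteq> {..<\<sigma>}" "\<sigma> \<le> cells T ^ d" "\<sigma> < 2 ^ w"
    and d_word: "cells T ^ d < 2 ^ w" "1 + (k + 2) * (d * cells T) < 2 ^ w"
    and pr: "0 < r" "r \<le> p" "p < 2 ^ w"
    and estimate: "\<And>i j. i < j \<Longrightarrow> j \<le> length T \<Longrightarrow>
      (let g = apply_op w Sub (apply_op w Add (gram_sum X k i (j - k)) (Fv (j - i) (card (sym ` {i..<j}))))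
         (gram_sum X (k + 1) i (j - k)); x = real Q0 * wt (take (j - i) (drop i T))
       in g + cells T < 2 ^ w \<and> (\<bar>real g - x\<bar> \<le> cells T \<or> Big \<le> g \<and> Big \<le> x + cells T))"
    and Big: "\<And>c. c < L \<Longrightarrow> level G0 (cells T) p r c < Big"
    and wt: "admissible wt T" and Q0: "0 < Q0"
    and wt_unit: "\<And>x. x \<in> set T \<Longrightarrow> real G0 \<le> Q0 * wt [x] \<and> Q0 * wt [x] \<le> G0 + 1"
    and L: "\<And>c. c < L \<Longrightarrow> previous (level G0 (cells T) p r) c < length T * level G0 (cells T) p r 0"
      "length T * level G0 (cells T) p r 0 \<le> previous (level G0 (cells T) p r) L"
    and L_pos: "0 < L"
    and M: "M = 17 * cells T + L * block_size (length T) (pack_bits b (cells T))"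
    and level_word: "\<And>c. c < L \<Longrightarrow> level G0 (cells T) p r c * p + 1 < 2 ^ w"
      "\<And>c. c < L \<Longrightarrow> length T * level G0 (cells T) p r 0 + level G0 (cells T) p r c < 2 ^ w"
begin

section \<open>Running the complete program\<close>

abbreviation "B \<equiv> pack_bits b N"

definition W :: "nat \<Rightarrow> nat \<Rightarrow> real" where "W i j = Q0 * wt (take (j - i) (drop i T))"

lemma N_ge_2: "2 \<le> N" using n_pos by (simp add: cells_def Suc_le_eq del: length_greater_0_conv)

lemma log_N: "1 \<le> nat \<lfloor>log 2 (real N)\<rfloor>"
  using N_ge_2 by (simp add: le_nat_iff le_floor_iff)

lemma B: "0 < B" "B < w" "B \<le> N"
proof -
  have "0 < b * nat \<lfloor>log 2 (real N)\<rfloor>" using log_N b_word(1) by (intro mult_pos_pos) linarith+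
  then show "0 < B" using N_pos unfolding pack_bits_def by linarith
  show "B < w" "B \<le> N" using b_word unfolding pack_bits_def by auto
qed

lemma W_mono2:
  assumes "i < j" "j \<le> j'" "j' \<le> n" shows "W i j \<le> W i j'"
proof -
  let ?S = "take (j - i) (drop i T)" and ?S' = "take (j' - i) (drop i T)"
  have "take (j - i) ?S' = ?S" using assms by (simp add: min_def)
  then have "sublist ?S ?S'" by (metis sublist_take)
  moreover have "sublist ?S' T" by (meson sublist_drop sublist_order.order_trans sublist_take)
  moreover have "?S \<noteq> []" using assms by simp
  ultimately have "wt ?S \<le> wt ?S'" using wt unfolding admissible_def by blast
  then show ?thesis unfolding W_def by (intro mult_left_mono) auto
qed

lemma W_mono:
  assumes "Suc i < j" "j \<le> n" shows "W (Suc i) j \<le> W i j"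
proof -
  let ?S = "take (j - Suc i) (drop (Suc i) T)" and ?S' = "take (j - i) (drop i T)"
  have "drop 1 ?S' = ?S" using assms by (simp add: drop_take)
  then have "sublist ?S ?S'" by (metis sublist_drop)
  moreover have "sublist ?S' T" by (meson sublist_drop sublist_order.order_trans sublist_take)
  moreover have "?S \<noteq> []" using assms by simp
  ultimately have "wt ?S \<le> wt ?S'" using wt unfolding admissible_def by blast
  then show ?thesis unfolding W_def by (intro mult_left_mono) auto
qed

lemma W_unit:
  assumes "i < n" shows "W i (Suc i) \<le> G0 + 1"
proof -
  have "take 1 (drop i T) = [T ! i]" using assms by (simp add: take_Suc_conv_app_nth[of 0, simplified] hd_drop_conv_nth take_Suc)
  then show ?thesis using wt_unit[of "T ! i"] assms by (simp add: W_def)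
qed

lemma level_0: "level G0 N p r 0 = G0 + 3 * N" by (simp add: level_def)

lemma class_machine:
  assumes "names f1 (same_gram 1)" "names f2 (same_gram k)" "names f3 (same_gram (k + 1))"
  shows "class_machine F w M T k X Fv fe Q0 G0 XB B f1 f2 f3 W p r L"
proof -
  interpret cost_machine F w M T k X Fv fe Q0 G0 XB B f1 f2 f3
    by unfold_locales (use X0 X_le XB_word fe fe_time B assms in \<open>auto simp: names_def\<close>)
  let ?thr = "level G0 N p r"
  have est: "estim i j + N < 2 ^ w \<and> (\<bar>real (estim i j) - W i j\<bar> \<le> N \<or> Big \<le> estim i j \<and> Big \<le> W i j + N)"
    if "i < j" "j \<le> n" for i j
  proof -
    have "HA i j = gram_sum X k i (j - k)" "HB i j = gram_sum X (k + 1) i (j - k)"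
      unfolding HA_def HB_def using assms X0 that by (intro occ_sum_gram_sum; simp)+
    moreover have "DS i j = card (sym ` {i..<j})" unfolding DS_def using assms that by (intro card_names) auto
    ultimately show ?thesis using estimate[OF that] unfolding estim_def W_def Let_def by simp
  qed
  show ?thesis
  proof unfold_locales
    fix i assume i: "i < n"
    from est[of i "Suc i"] i have "\<bar>real (estim i (Suc i)) - W i (Suc i)\<bar> \<le> N \<or> Big \<le> W i (Suc i) + N" by auto
    \<comment> \<open>This excludes the second outcome for single symbols, whose weight plus
      \<open>N\<close> stays below the first threshold.\<close>
    moreover have "real (?thr 0) < Big" using Big[OF L_pos] by simp
    ultimately have "real (estim i (Suc i)) \<le> G0 + 1 + N"
      using W_unit[OF i] N_ge_2 unfolding level_0 by auto
    then have "estim i (Suc i) \<le> G0 + 1 + N" by linarith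
    then show "estim i (Suc i) + N \<le> ?thr 0" using N_ge_2 unfolding level_0 by linarith
  next
    fix i j c assume *: "c < L" "i < j" "j \<le> n" "estim i j + N \<le> ?thr c"
    then show "W i j \<le> ?thr c" using est[OF *(2,3)] Big[OF *(1)] by linarith
  next
    fix i j c assume *: "c < L" "i < j" "j \<le> n" "?thr c < estim i j + N"
    then show "?thr c < W i j + 2 * N" using est[OF *(2,3)] Big[OF *(1)] by (auto simp: abs_le_iff)
  qed (use est pr W_mono W_mono2 L L_pos M level_word in auto)
qed

lemma table:
  assumes "v vn = n" "v vN = N" "v vQ = Q0"
  shows "ex (table xe) v A (80 * N + 10) (\<lambda>v' A'. \<forall>m\<le>n. A' aX m = X m)"
proof -
  let ?I = "\<lambda>v' A'. v' vn = n \<and> v' vN = N \<and> v' vQ = Q0 \<and> v' vp \<le> N \<and> (\<forall>m<v' vp. A' aX m = X m) \<and>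
    v' vacc = (if v' vp = 0 then 0 else X (v' vp - 1))"
  let ?b = "Set vacc xe ;; Put aX (V vp) (V vacc) ;; Set vp (plus1 (V vp))"
  have "ex (While (Lt (V vp) (V vN)) ?b) (v(vp := 0, vacc := 0)) A (80 * N + 5) (\<lambda>v' A'. \<forall>m\<le>n. A' aX m = X m)"
  proof (rule ex_While[where I = ?I and \<Phi> = "\<lambda>v A. 80 * (N - v vp)"])
    fix v' A' assume I: "?I v' A'" and t: "tev (Lt (V vp) (V vN)) v' A'"
    have p: "v' vp < N" "v' vp \<le> n" "Suc (v' vp) < 2 ^ w" using t I by (auto simp: less_N intro!: small_word_text)
    have xe': "ok xe v' A'" "ev xe v' A' = X (v' vp)" using xe[of v' A'] I p by auto
    have "wp ?b (\<lambda>v2 A2. ?I v2 A2 \<and> v2 vp = Suc (v' vp)) v' A'"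
      using I p xe' by (auto simp: less_Suc_eq)
    then have "ex ?b v' A' 70 (\<lambda>v2 A2. ?I v2 A2 \<and> v2 vp = Suc (v' vp))"
      by (rule ex_wp) (use xe_time in simp)
    then have "ex ?b v' A' 70 (\<lambda>v2 A2. ?I v2 A2 \<and> 80 * (N - v2 vp) + 70 + tst_time (Lt (V vp) (V vN)) + 1 \<le> 80 * (N - v' vp))"
      by (rule ex_mono) (use p in auto)
    then show "\<exists>t. ex ?b v' A' t (\<lambda>v2 A2. ?I v2 A2 \<and> 80 * (N - v2 vp) + t + tst_time (Lt (V vp) (V vN)) + 1 \<le> 80 * (N - v' vp))"
      by (rule exI[where x = 70])
  next
    fix v' A' assume I: "?I v' A'" and t: "\<not> tev (Lt (V vp) (V vN)) v' A'"
    then have "v' vp = N" by simp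
    with I show "\<forall>m\<le>n. A' aX m = X m" by (simp add: less_N)
  qed (use assms in auto)
  then show ?thesis unfolding table_def
    by (intro ex_Set_then[where t = "80 * N + 7"] ex_Set_then[where t = "80 * N + 5"]) auto
qed

lemma powers:
  assumes "v vB = B"
  shows "ex powers v A (80 * N + 10) (\<lambda>v' A'. \<forall>c<B. A' aPow c = 2 ^ c)"
proof -
  let ?I = "\<lambda>v' A'. v' vB = B \<and> v' vp \<le> B \<and> v' vy = 2 ^ v' vp \<and> (\<forall>c<v' vp. A' aPow c = 2 ^ c)"
  let ?b = "Put aPow (V vp) (V vy) ;; Set vy (Bin Add (V vy) (V vy)) ;; Set vp (plus1 (V vp))"
  have "ex (While (Lt (V vp) (V vB)) ?b) (v(vp := 0, vy := 1)) A (80 * B + 5) (\<lambda>v' A'. \<forall>c<B. A' aPow c = 2 ^ c)"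
  proof (rule ex_While[where I = ?I and \<Phi> = "\<lambda>v A. 80 * (B - v vp)"])
    fix v' A' assume I: "?I v' A'" and t: "tev (Lt (V vp) (V vB)) v' A'"
    have p: "v' vp < B" "v' vp < N" using t I B by auto
    then have "Suc (v' vp) < 2 ^ w" by (simp add: less_N small_word_text)
    \<comment> \<open>The last doubling produces \<open>2 ^ B\<close>, which still fits because
      \<open>B < w\<close>.\<close>
    moreover have "(2::nat) ^ Suc (v' vp) < 2 ^ w" using p B by (intro power_strict_increasing) auto
    ultimately have "wp ?b (\<lambda>v2 A2. ?I v2 A2 \<and> v2 vp = Suc (v' vp)) v' A'"
      using I p by (auto simp: less_Suc_eq mult_2)
    then have "ex ?b v' A' 70 (\<lambda>v2 A2. ?I v2 A2 \<and> v2 vp = Suc (v' vp))"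
      by (rule ex_wp) simp
    then have "ex ?b v' A' 70 (\<lambda>v2 A2. ?I v2 A2 \<and> 80 * (B - v2 vp) + 70 + tst_time (Lt (V vp) (V vB)) + 1 \<le> 80 * (B - v' vp))"
      by (rule ex_mono) (use p in auto)
    then show "\<exists>t. ex ?b v' A' t (\<lambda>v2 A2. ?I v2 A2 \<and> 80 * (B - v2 vp) + t + tst_time (Lt (V vp) (V vB)) + 1 \<le> 80 * (B - v' vp))"
      by (rule exI[where x = 70])
  qed (use assms in auto)
  then show ?thesis unfolding powers_def
    by (intro ex_Set_then[where t = "80 * N + 7"] ex_Set_then[where t = "80 * B + 5"]) (use B in auto)
qed

lemma constants:
  assumes "v vn = n" "v vN = N" "v 1 = \<sigma>"
  shows "ex (gi ;; constants b) v A 200 (\<lambda>v' A'. A' = A \<and> v' vn = n \<and> v' vN = N \<and> v' vQ = Q0 \<and> v' vG = G0 \<and>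
    v' vB = B \<and> v' vZ = block_size n B \<and> v' vcap = n * level G0 N p r 0)"
proof (rule ex_then[OF ex_wp[OF gi[OF assms] order_refl]])
  fix v' A' assume *: "A' = A \<and> v' vQ = Q0 \<and> v' vG = G0 \<and> (\<forall>x. x \<notin> {vQ, vG, vx, vy} \<longrightarrow> v' x = v x)"
  then have v': "v' vn = n" "v' vN = N" "v' vQ = Q0" "v' vG = G0" using assms by auto
  let ?lg = "nat \<lfloor>log 2 (real N)\<rfloor>"
  have "w < 2 ^ w" by simp
  then have w: "b * ?lg < 2 ^ w" "?lg < 2 ^ w" "b < 2 ^ w"
  proof -
    show 1: "b * ?lg < 2 ^ w" using b_word(2) \<open>w < 2 ^ w\<close> by linarith
    have "?lg \<le> b * ?lg" "b \<le> b * ?lg" using b_word(1) log_N by auto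
    with 1 show "?lg < 2 ^ w" "b < 2 ^ w" by linarith+
  qed
  have lw: "n * level G0 N p r 0 < 2 ^ w" "G0 + 3 * N < 2 ^ w" "3 < (2::nat) ^ w" "3 * N < 2 ^ w"
    using level_word(2)[OF L_pos] N_word N_pos unfolding level_0 by linarith+
  have "block_size n B \<le> L * block_size n B" using L_pos by simp
  then have bs: "block_size n B < 2 ^ w" using M M_word by linarith
  have n2: "2 * n < 2 ^ w" by (simp add: small_word_text)
  show "ex (constants b) v' A' 100 (\<lambda>v' A'. A' = A \<and> v' vn = n \<and> v' vN = N \<and> v' vQ = Q0 \<and> v' vG = G0 \<and>
    v' vB = B \<and> v' vZ = block_size n B \<and> v' vcap = n * level G0 N p r 0)"
  proof (rule ex_wp)
    have Bif: "B = (if N < b * ?lg then N else b * ?lg)" by (auto simp: pack_bits_def)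
    show "wp (constants b) (\<lambda>v' A'. A' = A \<and> v' vn = n \<and> v' vN = N \<and> v' vQ = Q0 \<and> v' vG = G0 \<and>
      v' vB = B \<and> v' vZ = block_size n B \<and> v' vcap = n * level G0 N p r 0) v' A'"
      using v' * w lw bs n2 unfolding level_0 Bif
      by (cases "N < b * ?lg") (simp_all add: constants_def block_size_def)
  qed (simp add: constants_def)
qed (use gi_time in simp)

lemma mod_naming:
  "mod_vars (naming d k) \<subseteq> {vp, vx, vstamp, vfresh, vy, vpw}"
  "mod_arrays (naming d k) \<subseteq> {aHead, aNext, aMark, aName, aId, aSym, aCtx}"
proof -
  have p: "mod_vars (passes m e) \<subseteq> {vp, vx, vstamp, vfresh, vy, vpw}"
    "mod_arrays (passes m e) \<subseteq> {aHead, aNext, aMark, aName, aId, aSym, aCtx}" for m e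
    by (induction e) (auto simp: refine_def push_body_def pop_body_def)
  have g: "mod_vars (name_grams d m) \<subseteq> {vp, vx, vstamp, vfresh, vy, vpw}"
    "mod_arrays (name_grams d m) \<subseteq> {aHead, aNext, aMark, aName, aId, aSym, aCtx}" for m
    by (induction m) (simp_all add: append_symbol_def p)
  show "mod_vars (naming d k) \<subseteq> {vp, vx, vstamp, vfresh, vy, vpw}"
    "mod_arrays (naming d k) \<subseteq> {aHead, aNext, aMark, aName, aId, aSym, aCtx}"
    by (simp_all add: naming_def append_symbol_def fill_def p g)
qed

definition result :: "vars \<Rightarrow> arrays \<Rightarrow> bool" where
  "result v' A' \<longleftrightarrow> (\<exists>ls D. sum_list ls = n \<and> 0 \<notin> set ls \<and> (\<forall>i<length ls. A' aLen i = ls ! i) \<and>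
     piece_sum W 0 ls \<le> D 0 \<and> D n = (0::nat) \<and>
     (\<forall>i j c. c < L \<longrightarrow> i < j \<longrightarrow> j \<le> n \<longrightarrow> W i j + 2 * N \<le> level G0 N p r c \<longrightarrow> D i \<le> level G0 N p r c + D j) \<and>
     v' 0 = length ls \<and> v' 1 = 15 * N \<and> length ls \<le> n)"

text \<open>The naming takes about \<open>(k + 2) * d\<close> linear passes, the sweeps and the
  dynamic program take \<open>L\<close> of them. The product is a crude bound for their sum.\<close>

definition time_bound :: nat where "time_bound = 4000 * (k + 3) * (d + 1) * (L + 1) * N"

lemma sym_less: "sym q < N ^ d"
proof (cases "q < n")
  case True
  then have "T ! q < \<sigma>" using sigma(1) nth_mem[OF True] by blast
  then show ?thesis using sigma(2) True by (simp add: sym_def)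
qed (simp add: sym_def)

lemma whole:
  assumes "v vn = n" "v 1 = \<sigma>" "A aT = sym" "\<And>a. 1 \<le> a \<Longrightarrow> a \<le> 17 \<Longrightarrow> A a = (\<lambda>_. 0)"
  shows "ex (whole gi xe fe k d b p r) v A (time_bound - 2) result"
proof -
  let ?tn = "(k + 2) * (d * (300 * N + 40) + 3) + 200 * N"
  let ?v0 = "v(vN := N)"
  let ?P1 = "\<lambda>v1 A1. names (A1 aSym) (same_gram 1) \<and> names (A1 aCtx) (same_gram k) \<and> names (A1 aId) (same_gram (k + 1)) \<and>
    (\<forall>x\<in>{vn, 1, vN}. v1 x = ?v0 x) \<and> (\<forall>a\<in>{aPow, aCS, aCC, aCP, aX, aD, aTail}. A1 a = A a)"
  have 1: "ex (naming d k) ?v0 A ?tn ?P1"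
  proof (rule ex_frame[OF naming[OF d_word(1) sym_less d_word(2)]])
    fix v' A' assume "names (A' aSym) (same_gram 1) \<and> names (A' aCtx) (same_gram k) \<and> names (A' aId) (same_gram (k + 1))"
      and "\<And>x. x \<notin> mod_vars (naming d k) \<Longrightarrow> v' x = ?v0 x" and "\<And>a. a \<notin> mod_arrays (naming d k) \<Longrightarrow> A' a = A a"
    moreover have "x \<notin> mod_vars (naming d k)" if "x \<in> {vn, 1, vN}" for x using mod_naming that by auto
    moreover have "a \<notin> mod_arrays (naming d k)" if "a \<in> {aPow, aCS, aCC, aCP, aX, aD, aTail}" for a using mod_naming that by auto
    ultimately show "?P1 v' A'" by blast
  qed (use assms in auto)
  have 2: "ex ((gi ;; constants b) ;; table xe ;; powers ;; solve fe k p r) v1 A1 (200 + (80 * N + 10) + (80 * N + 10) + 2500 * (L + 1) * N) result"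
    if P1: "?P1 v1 A1" for v1 A1
  proof -
    let ?C = "\<lambda>v2. v2 vn = n \<and> v2 vN = N \<and> v2 vQ = Q0 \<and> v2 vG = G0 \<and>
      v2 vB = B \<and> v2 vZ = block_size n B \<and> v2 vcap = n * level G0 N p r 0"
    interpret c: class_machine F w M T k X Fv fe Q0 G0 XB B "A1 aSym" "A1 aCtx" "A1 aId" W p r L
      using P1 by (intro class_machine) auto
    have C: "ex (gi ;; constants b) v1 A1 200 (\<lambda>v2 A2. A2 = A1 \<and> ?C v2)"
      by (rule constants) (use P1 assms in auto)
    have T: "ex (table xe) v2 A1 (80 * N + 10) (\<lambda>v3 A3. ?C v3 \<and> (\<forall>m\<le>n. A3 aX m = X m) \<and> (\<forall>a. a \<noteq> aX \<longrightarrow> A3 a = A1 a))"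
      if "?C v2" for v2
      by (rule ex_frame[OF table]) (use that in \<open>auto simp: table_def\<close>)
    have R: "ex powers v3 A3 (80 * N + 10) (\<lambda>v4 A4. ?C v4 \<and> (\<forall>m\<le>n. A4 aX m = X m) \<and> (\<forall>c<B. A4 aPow c = 2 ^ c) \<and>
        (\<forall>a. a \<noteq> aX \<longrightarrow> a \<noteq> aPow \<longrightarrow> A4 a = A1 a))"
      if "?C v3 \<and> (\<forall>m\<le>n. A3 aX m = X m) \<and> (\<forall>a. a \<noteq> aX \<longrightarrow> A3 a = A1 a)" for v3 A3
      by (rule ex_frame[OF powers]) (use that in \<open>auto simp: powers_def\<close>)
    have S: "ex (solve fe k p r) v4 A4 (2500 * (L + 1) * N) result"
      if "?C v4 \<and> (\<forall>m\<le>n. A4 aX m = X m) \<and> (\<forall>c<B. A4 aPow c = 2 ^ c) \<and>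
        (\<forall>a. a \<noteq> aX \<longrightarrow> a \<noteq> aPow \<longrightarrow> A4 a = A1 a)" for v4 A4
    proof -
      have zero: "A4 a = (\<lambda>_. 0)" if "a \<in> {aCS, aCC, aCP, aD, aTail}" for a
      proof -
        have "A4 a = A1 a" using \<open>?C v4 \<and> _\<close> that by auto
        also have "\<dots> = A a" using P1 that by auto
        also have "\<dots> = (\<lambda>_. 0)" using that by (intro assms(4)) auto
        finally show ?thesis .
      qed
      have "c.base v4 A4" using that unfolding c.base_def by simp
      moreover have "?C v4" using that by blast
      ultimately show ?thesis unfolding result_def using zero by (intro c.solve) auto
    qed
    show ?thesis
    proof (rule ex_then[OF C, where ?t2.0 = "(80 * N + 10) + (80 * N + 10) + 2500 * (L + 1) * N"])
      fix v2 A2 assume "A2 = A1 \<and> ?C v2"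
      then have 2: "A2 = A1" "?C v2" by blast+
      show "ex (table xe ;; powers ;; solve fe k p r) v2 A2 ((80 * N + 10) + (80 * N + 10) + 2500 * (L + 1) * N) result"
        unfolding 2(1)
        by (rule ex_then[OF T[OF 2(2)], where ?t2.0 = "(80 * N + 10) + 2500 * (L + 1) * N"], rule ex_then[OF R S]) simp_all
    qed simp
  qed
  have "ex (naming d k ;; (gi ;; constants b) ;; table xe ;; powers ;; solve fe k p r) (v(vN := N)) A
      (?tn + (200 + (80 * N + 10) + (80 * N + 10) + 2500 * (L + 1) * N)) result"
    by (rule ex_then[OF 1 2]) simp_all
  moreover have "4 + (?tn + (200 + (80 * N + 10) + (80 * N + 10) + 2500 * (L + 1) * N)) \<le> time_bound - 2"
  proof -
    let ?U = "(k + 3) * (d + 1) * N"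
    have U: "N \<le> ?U" by simp
    have "(k + 2) * (d * (300 * N + 40) + 3) \<le> (k + 3) * ((d + 1) * (343 * N))"
    proof (intro mult_le_mono)
      have "d * (300 * N + 40) + 3 \<le> d * (343 * N) + 343 * N" using N_ge_2 by (intro add_mono mult_le_mono) auto
      then show "d * (300 * N + 40) + 3 \<le> (d + 1) * (343 * N)" by simp
    qed simp
    also have "\<dots> = 343 * ?U" by (simp only: mult.assoc mult.left_commute)
    finally have "?tn + (4 + 200 + (80 * N + 10) + (80 * N + 10)) + 2 \<le> 900 * ?U" using U N_ge_2 by linarith
    moreover have "?U \<le> (L + 1) * ?U" by simp
    moreover have "(L + 1) * N \<le> (L + 1) * ?U" using U by (rule mult_le_mono2)
    moreover have "time_bound = 4000 * ((L + 1) * ?U)" unfolding time_bound_def by (simp only: mult.assoc mult.left_commute mult.commute)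
    ultimately show ?thesis by linarith
  qed
  moreover have "Suc n = N" by (simp add: cells_def)
  ultimately show ?thesis unfolding whole_def
    by (intro ex_Set_then[where t = "?tn + (200 + (80 * N + 10) + (80 * N + 10) + 2500 * (L + 1) * N)"])
      (use assms n_less_N in \<open>auto simp: small_word_text\<close>)
qed

definition good_output :: "nat list list \<Rightarrow> bool" where
  "good_output Q \<longleftrightarrow> is_partition T Q \<and> (\<exists>D. Q0 * partition_cost wt Q \<le> D 0 \<and> D n = (0::nat) \<and>
     (\<forall>i j c. c < L \<longrightarrow> i < j \<longrightarrow> j \<le> n \<longrightarrow> W i j + 2 * N \<le> level G0 N p r c \<longrightarrow> D i \<le> level G0 N p r c + D j))"

lemma run_program:
  "\<exists>t s. run F w M (program_com gi xe fe k d b p r) (input_state w \<sigma> T) t s \<and> t \<le> time_bound \<and>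
     output_in_memory M s \<and> good_output (output_partition T s)"
proof -
  let ?r0 = "(\<lambda>_::nat. 0::nat)(0 := length T mod 2 ^ w, 1 := \<sigma> mod 2 ^ w)"
  let ?m = "\<lambda>i::nat. if i < length T then T ! i mod 2 ^ w else 0"
  let ?r1 = "?r0(97 := 1 mod 2 ^ w)"
  let ?r2 = "?r1(98 := apply_op w Add (?r1 0) (?r1 97))"
  let ?A = "\<lambda>a. if a = aT then sym else (\<lambda>_. 0)"
  have nw: "n < 2 ^ w" "Suc n < 2 ^ w" by (simp_all add: small_word_text)
  have Tw: "T ! i < 2 ^ w" if "i < n" for i using sym_less[of i] that d_word(1) by (simp add: sym_def)
  have "rel ?r2 ?m ?r2 ?A"
    unfolding rel_def
  proof (intro conjI allI impI)
    show "?r2 98 = N" using nw w_large by (simp add: cells_def)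
    show "words_ok w ?r2" "words_ok w ?m" unfolding words_ok_def using apply_op_less by auto
    fix a i assume ib: "in_bounds a i"
    show "?m (a * N + i) = ?A a i"
    proof (cases "a = 0")
      case True
      then show ?thesis using Tw by (simp add: sym_def)
    next
      case False
      then have "N \<le> a * N" by simp
      then have "\<not> a * N + i < n" using n_less_N by linarith
      then show ?thesis using False by simp
    qed
  qed auto
  moreover have "ex (whole gi xe fe k d b p r) ?r2 ?A (time_bound - 2) result"
    by (rule whole) (use nw sigma in auto)
  then obtain t v' A' where e: "exec (whole gi xe fe k d b p r) ?r2 ?A t v' A'" "t \<le> time_bound - 2" "result v' A'"
    unfolding ex_def by blast
  ultimately obtain r' m' where rm: "run F w M (cmd_com (whole gi xe fe k d b p r)) (?r2, ?m) t (r', m')" "rel r' m' v' A'"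
    using cmd_com_correct by blast
  have run: "run F w M (program_com gi xe fe k d b p r) (input_state w \<sigma> T) (1 + (1 + t)) (r', m')"
    unfolding program_com_def input_state_def by (intro run.Seq[OF run.Const] run.Seq[OF run.Op] rm)
  from e(3) obtain ls D where ls: "sum_list ls = n" "0 \<notin> set ls" "\<forall>i<length ls. A' aLen i = ls ! i"
     "piece_sum W 0 ls \<le> D 0" "D n = (0::nat)"
     "\<forall>i j c. c < L \<longrightarrow> i < j \<longrightarrow> j \<le> n \<longrightarrow> W i j + 2 * N \<le> level G0 N p r c \<longrightarrow> D i \<le> level G0 N p r c + D j"
     "v' 0 = length ls" "v' 1 = 15 * N" "length ls \<le> n"
    unfolding result_def by blast
  have r': "r' 0 = length ls" "r' 1 = 15 * N" using rm(2) ls by (auto simp: rel_def)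
  have "m' (15 * N + i) = ls ! i" if "i < length ls" for i
  proof -
    have "in_bounds aLen i" using that ls(9) by (simp add: less_N)
    then show ?thesis using rm(2) ls(3) that by (auto simp: rel_def)
  qed
  then have "map m' [r' 1..<r' 1 + r' 0] = ls"
    unfolding r' by (intro nth_equalityI) auto
  then have out: "output_partition T (r', m') = cut ls T" by simp
  have "Q0 * partition_cost wt (cut ls T) = piece_sum W 0 ls"
    using piece_sum_cut[of W Q0 wt T 0 ls] by (simp add: W_def)
  then have "good_output (cut ls T)"
    unfolding good_output_def using ls cut_is_partition[of ls T] by (intro conjI exI[of _ D]) auto
  moreover have "output_in_memory M (r', m')"
  proof -
    have "15 * N + length ls \<le> M" using ls(9) arrays_fit n_less_N by linarith
    then show ?thesis using r' by simp
  qed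
  moreover have "1 + (1 + t) \<le> time_bound"
  proof -
    have "N \<le> time_bound" unfolding time_bound_def by simp
    then have "2 \<le> time_bound" using N_ge_2 by linarith
    then show ?thesis using e(2) by linarith
  qed
  ultimately show ?thesis using run out by metis
qed

section \<open>The approximation ratio\<close>

context
  fixes \<rho> \<eta> :: real
  assumes \<rho>: "\<rho> = p / r" and \<eta>: "0 \<le> \<eta>" "3 * N \<le> \<eta> * G0"
begin

lemma \<rho>_ge_1: "1 \<le> \<rho>" using pr by (simp add: \<rho>)

text \<open>The least level that covers \<open>y\<close> is the first one or has a predecessor below
  \<open>y\<close>; in the latter case the recursion yields at most \<open>\<rho> * y + 1\<close>.
  The cap guarantees that some level covers \<open>y\<close>.\<close>

lemma level_cover:
  fixes y :: real
  assumes "y \<le> n * level G0 N p r 0"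
  obtains c where "c < L" "y \<le> level G0 N p r c"
    "level G0 N p r c \<le> level G0 N p r 0 \<or> level G0 N p r c \<le> \<rho> * y + 1"
proof -
  let ?P = "\<lambda>c. y \<le> level G0 N p r c"
  obtain L' where L': "L = Suc L'" using L_pos by (cases L) auto
  have "?P L'" using L(2) assms unfolding L' previous.simps
    by (meson of_nat_mono order_trans)
  then have c: "?P (LEAST c. ?P c)" "(LEAST c. ?P c) \<le> L'" by (rule LeastI, rule Least_le)
  define c where "c = (LEAST c. ?P c)"
  show thesis
  proof (rule that[of c])
    show "c < L" "y \<le> level G0 N p r c" using c L' unfolding c_def by auto
    show "level G0 N p r c \<le> level G0 N p r 0 \<or> level G0 N p r c \<le> \<rho> * y + 1"
    proof (cases c)
      case (Suc c')
      have "\<not> ?P c'" using not_less_Least[of c' ?P] Suc unfolding c_def by simp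
      then have "\<rho> * level G0 N p r c' \<le> \<rho> * y" using \<rho>_ge_1 by (intro mult_left_mono) auto
      moreover have "real (level G0 N p r c' * p div r) \<le> \<rho> * level G0 N p r c'"
        using of_nat_div_le_of_nat[of "level G0 N p r c' * p" r] by (simp add: \<rho> mult.commute)
      moreover have "level G0 N p r c = level G0 N p r c' * p div r + 1" using Suc by (simp add: level_def)
      ultimately show ?thesis by simp
    qed simp
  qed
qed

lemma wt_piece:
  assumes "S \<noteq> []" "sublist S T" shows "G0 \<le> Q0 * wt S"
proof -
  from assms have "sublist [hd S] S" by (cases S) (auto simp: sublist_def intro: exI[of _ "[]"])
  then have "wt [hd S] \<le> wt S" using wt assms unfolding admissible_def by blast
  moreover have "hd S \<in> set T" using assms by (meson hd_in_set set_mono_sublist subsetD)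
  ultimately show ?thesis using wt_unit[of "hd S"] Q0 by (smt (verit) mult_left_mono of_nat_0_le_iff)
qed

text \<open>Each piece of the competing partition is charged the first level above its scaled weight
  plus \<open>2 * N\<close>. Choosing the level costs the factor \<rho>. The additive losses,
  \<open>2 * N\<close> from the incomplete acceptance of windows and 1 from rounding the levels, are
  at most \<open>3 * N \<le> \<eta> * G0\<close>. Every piece weighs at least \<open>G0\<close>, so
  they amount to a factor \<open>1 + \<eta>\<close>.\<close>

lemma D_bound:
  assumes "concat P = drop i T" "[] \<notin> set P" "i \<le> n" "\<And>S. S \<in> set P \<Longrightarrow> Q0 * wt S + 2 * N \<le> n * level G0 N p r 0"
    and D: "D n = (0::nat)" "\<And>i j c. c < L \<Longrightarrow> i < j \<Longrightarrow> j \<le> n \<Longrightarrow> W i j + 2 * N \<le> level G0 N p r c \<Longrightarrow>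
      D i \<le> level G0 N p r c + D j"
  shows "D i \<le> \<rho> * (1 + \<eta>) * Q0 * partition_cost wt P"
  using assms(1-4)
proof (induction P arbitrary: i)
  case Nil
  then have "i = n" by simp
  then show ?case using D(1) by (simp add: partition_cost_def)
next
  case (Cons S P)
  let ?j = "i + length S"
  have S: "S = take (length S) (drop i T)" "concat P = drop (length S) (drop i T)"
    using Cons.prems(1) by (metis append_eq_conv_conj concat.simps(2))+
  have Sne: "S \<noteq> []" using Cons.prems(2) by auto
  have "length S \<le> n - i" using S(1) by (metis length_drop length_take min.cobounded1 min.commute)
  then have j: "i < ?j" "?j \<le> n" using Sne Cons.prems(3) by auto
  have "sublist S T" using S(1) by (metis sublist_drop sublist_order.order_trans sublist_take)
  note G = wt_piece[OF Sne this]
  have WS: "W i ?j = Q0 * wt S" using S(1) by (simp add: W_def)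
  obtain c where c: "c < L" "Q0 * wt S + 2 * N \<le> level G0 N p r c"
    "level G0 N p r c \<le> level G0 N p r 0 \<or> level G0 N p r c \<le> \<rho> * (Q0 * wt S + 2 * N) + 1"
    using level_cover[of "real Q0 * wt S + 2 * real N"] Cons.prems(4)[of S] by auto
  have x: "0 \<le> Q0 * wt S" using G by linarith
  have "real (level G0 N p r c) \<le> \<rho> * (Q0 * wt S + 3 * N)"
    using c(3)
  proof
    assume "level G0 N p r c \<le> level G0 N p r 0"
    then have "real (level G0 N p r c) \<le> Q0 * wt S + 3 * N" using G unfolding level_0 by linarith
    also have "\<dots> \<le> \<rho> * (Q0 * wt S + 3 * N)" using \<rho>_ge_1 x by (simp add: mult_le_cancel_right1)
    finally show ?thesis .
  next
    assume "level G0 N p r c \<le> \<rho> * (Q0 * wt S + 2 * N) + 1"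
    also have "1 \<le> \<rho> * N" using \<rho>_ge_1 N_ge_2 mult_mono[of 1 \<rho> 1 "real N"] by simp
    finally show ?thesis by (simp add: algebra_simps)
  qed
  also have "\<dots> \<le> \<rho> * ((1 + \<eta>) * (Q0 * wt S))"
  proof (intro mult_left_mono)
    have "\<eta> * G0 \<le> \<eta> * (Q0 * wt S)" using G \<eta> by (intro mult_left_mono) auto
    then show "Q0 * wt S + 3 * N \<le> (1 + \<eta>) * (Q0 * wt S)" using \<eta>(2) by (simp add: algebra_simps)
  qed (use \<rho>_ge_1 in simp)
  finally have lc: "real (level G0 N p r c) \<le> \<rho> * (1 + \<eta>) * Q0 * wt S" by (simp add: algebra_simps)
  have "D i \<le> level G0 N p r c + D ?j" using c(2) WS by (intro D(2)[OF c(1) j]) simp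
  then have "real (D i) \<le> level G0 N p r c + D ?j" by linarith
  moreover have "D ?j \<le> \<rho> * (1 + \<eta>) * Q0 * partition_cost wt P"
    using Cons.prems j S(2) by (intro Cons.IH) (auto simp: add.commute)
  ultimately show ?case using lc by (simp add: partition_cost_def algebra_simps)
qed

lemma good_output_bound:
  assumes "good_output Q"
  shows "partition_cost wt Q \<le> \<rho> * (1 + \<eta>) * min_partition_cost wt T"
proof -
  from assms obtain D where D: "Q0 * partition_cost wt Q \<le> D 0" "D n = (0::nat)"
     "\<And>i j c. c < L \<Longrightarrow> i < j \<Longrightarrow> j \<le> n \<Longrightarrow> W i j + 2 * N \<le> level G0 N p r c \<Longrightarrow> D i \<le> level G0 N p r c + D j"
    unfolding good_output_def by blast
  let ?C = "partition_cost wt ` {P. is_partition T P}"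
  have fin: "finite ?C" "?C \<noteq> {}" using finite_partitions[of T] ex_partition[of T] by auto
  from Min_in[OF fin] obtain P where P: "is_partition T P" "min_partition_cost wt T = partition_cost wt P"
    unfolding min_partition_cost_def by auto
  have sub: "S \<noteq> [] \<and> sublist S T" if "S \<in> set P" for S
  proof -
    from that obtain X Y where "P = X @ S # Y" by (meson split_list)
    with P(1) that show ?thesis by (auto simp: is_partition_def sublist_def)
  qed
  \<comment> \<open>An optimal partition has no piece beyond the cap: such a piece alone would cost
    more than all single symbols together.\<close>
  have Sle: "Q0 * wt S + 2 * N \<le> n * level G0 N p r 0" if S: "S \<in> set P" for S
  proof (rule ccontr)
    assume bad: "\<not> ?thesis"
    let ?U = "map (\<lambda>x. [x]) T"
    have "is_partition T ?U" by (auto simp: is_partition_def)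
    then have "min_partition_cost wt T \<le> partition_cost wt ?U"
      unfolding min_partition_cost_def using fin by (intro Min_le) auto
    moreover have "Q0 * partition_cost wt ?U = sum_list (map (\<lambda>x. Q0 * wt [x]) T)"
      by (simp add: partition_cost_def sum_list_const_mult o_def)
    moreover have "sum_list (map (\<lambda>x. Q0 * wt [x]) T) \<le> sum_list (map (\<lambda>x. real G0 + 1) T)"
      using wt_unit by (intro sum_list_mono) (simp add: add.commute)
    moreover have "sum_list (map (\<lambda>x. real G0 + 1) T) = n * (G0 + 1)" by (simp add: sum_list_triv algebra_simps)
    moreover have "wt S \<le> partition_cost wt P"
      unfolding partition_cost_def using S sub wt by (intro member_le_sum_list) (auto simp: admissible_def)
    ultimately have "Q0 * wt S \<le> n * (G0 + 1)" using P(2) Q0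
      by (smt (verit, best) mult_left_mono of_nat_0_le_iff)
    moreover have "n * (G0 + 1) + 2 * N \<le> n * level G0 N p r 0"
    proof -
      have "n + 2 * N \<le> n * N + 2 * (n * N)" using n_pos N_ge_2 by (intro add_mono) (simp_all add: Suc_le_eq)
      then show ?thesis unfolding level_0 by (simp add: algebra_simps)
    qed
    then have "real (n * (G0 + 1)) + 2 * N \<le> n * level G0 N p r 0"
      by (metis of_nat_add of_nat_mono of_nat_mult of_nat_numeral)
    ultimately show False using bad by simp
  qed
  have "real (D 0) \<le> \<rho> * (1 + \<eta>) * Q0 * partition_cost wt P"
    by (rule D_bound) (use P(1) Sle D in \<open>auto simp: is_partition_def\<close>)
  with D(1) have "Q0 * partition_cost wt Q \<le> Q0 * (\<rho> * (1 + \<eta>) * partition_cost wt P)" by (simp add: algebra_simps)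
  then show ?thesis using Q0 P(2) by simp
qed

end
end

section \<open>Entropies as sums over grams\<close>

text \<open>The common form of both estimates without their additive terms:
  \<open>\<phi> m = m * log 2 m\<close> yields \<open>|S| * H_k\<close>, and
  \<open>\<phi> m = log 2 (fact m)\<close> yields its adaptive counterpart.\<close>

definition block_entropy :: "(nat \<Rightarrow> real) \<Rightarrow> nat \<Rightarrow> nat \<Rightarrow> nat list \<Rightarrow> real" where
  "block_entropy \<phi> \<sigma> k S = (\<Sum>u\<in>contexts \<sigma> k. \<phi> (length (following u S)) -
     (\<Sum>c\<in>set (following u S). \<phi> (count_list (following u S) c)))"

lemma length_H0: "real (length u) * H0 u =
  length u * log 2 (length u) - (\<Sum>c\<in>set u. count_list u c * log 2 (count_list u c))"
proof (cases "u = []")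
  case False
  have "count_list u c * log 2 (length u / count_list u c) =
      count_list u c * log 2 (length u) - count_list u c * log 2 (count_list u c)" if "c \<in> set u" for c
  proof -
    have "0 < count_list u c" using that by (metis count_list_0_iff gr_zeroI)
    then show ?thesis using False by (simp add: log_divide right_diff_distrib)
  qed
  then have "(\<Sum>c\<in>set u. count_list u c * log 2 (length u / count_list u c)) =
      (\<Sum>c\<in>set u. real (count_list u c)) * log 2 (length u) - (\<Sum>c\<in>set u. count_list u c * log 2 (count_list u c))"
    by (simp add: sum_subtractf sum_distrib_right)
  also have "(\<Sum>c\<in>set u. real (count_list u c)) = length u" by (simp add: sum_count_set flip: of_nat_sum)
  finally show ?thesis using False by (simp add: H0_def)
qed simp

lemma length_Hk:
  assumes "S \<noteq> []"
  shows "real (length S) * Hk \<sigma> k S = block_entropy (\<lambda>m. m * log 2 m) \<sigma> k S"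
  using assms unfolding Hk_def block_entropy_def by (simp add: length_H0)

lemma length_Hka:
  assumes "S \<noteq> []"
  shows "real (length S) * Hka \<sigma> k S = block_entropy (\<lambda>m. log 2 (fact m)) \<sigma> k S"
proof -
  have "real (length u) * H0a u = log 2 (fact (length u)) - (\<Sum>c\<in>set u. log 2 (fact (count_list u c)))" for u :: "nat list"
    by (cases "u = []") (simp_all add: H0a_def)
  then show ?thesis using assms unfolding Hka_def block_entropy_def by simp
qed

text \<open>Hence a single symbol costs just the additive term, which is the same for all symbols.
  This is what makes one first threshold suffice.\<close>

lemma block_entropy_single: "block_entropy \<phi> \<sigma> k [x] = 0" if "\<phi> 0 = 0"
proof (cases k)
  case 0
  have "contexts \<sigma> 0 = {[]}" by (auto simp: contexts_def)
  moreover have "following [] [x] = [x]" by (simp add: following_def)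
  ultimately show ?thesis using 0 by (simp add: block_entropy_def)
next
  case (Suc k')
  have "following u [x] = []" if "u \<in> contexts \<sigma> k" for u using that Suc by (simp add: following_def contexts_def)
  then show ?thesis using that by (simp add: block_entropy_def)
qed

lemma prod_fact_dvd: "finite A \<Longrightarrow> (\<Prod>c\<in>A. fact (f c)) dvd (fact (\<Sum>c\<in>A. f c) :: nat)"
proof (induction A rule: finite_induct)
  case (insert x A)
  then have "fact (f x) * (\<Prod>c\<in>A. fact (f c)) dvd fact (f x) * (fact (\<Sum>c\<in>A. f c) :: nat)" by (intro mult_dvd_mono) auto
  also have "\<dots> dvd fact (f x + (\<Sum>c\<in>A. f c))" by (rule fact_fact_dvd_fact)
  finally show ?case using insert by simp
qed simp

text \<open>The difference is the binary logarithm of a multinomial coefficient, which is a positive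
  integer.\<close>

lemma H0a_gap:
  fixes u :: "'a list"
  defines "t \<equiv> log 2 (fact (length u)) - (\<Sum>c\<in>set u. log 2 (fact (count_list u c)))"
  shows "t = 0 \<or> 1 \<le> t"
proof -
  let ?P = "\<Prod>c\<in>set u. fact (count_list u c) :: nat"
  have "?P dvd fact (length u)" using prod_fact_dvd[of "set u" "count_list u"] by (simp add: sum_count_set)
  then obtain m where m: "fact (length u) = ?P * m" by (auto elim: dvdE)
  have P: "0 < ?P" by (simp add: prod_pos)
  then have m0: "0 < m" using m by (metis fact_nonzero gr_zeroI mult_0_right)
  have "real (fact (length u)) = real ?P * real m" using m by (metis of_nat_mult)
  then have "log 2 (fact (length u)) = log 2 (real ?P) + log 2 m" using P m0 by (simp add: log_mult)
  moreover have "log 2 (real ?P) = (\<Sum>c\<in>set u. log 2 (fact (count_list u c)))"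
    by (simp add: log_def ln_prod sum_divide_distrib)
  ultimately have t: "t = log 2 m" by (simp add: t_def)
  show ?thesis
  proof (cases "m = 1")
    case False
    then have "2 \<le> real m" using m0 by linarith
    then show ?thesis unfolding t by (simp add: le_log_iff)
  qed (simp add: t)
qed

lemma finite_contexts: "finite (contexts \<sigma> k)"
  unfolding contexts_def by (rule finite_lists_length_eq) simp

text \<open>A multinomial coefficient is 1 or at least 2. So pieces of nonzero adaptive entropy are not cheap,
  however small the additive term is.\<close>

lemma adaptive_entropy_gap: "block_entropy (\<lambda>m. log 2 (fact m)) \<sigma> k S = 0 \<or> 1 \<le> block_entropy (\<lambda>m. log 2 (fact m)) \<sigma> k S"
proof -
  let ?t = "\<lambda>u. log 2 (fact (length (following u S))) - (\<Sum>c\<in>set (following u S). log 2 (fact (count_list (following u S) c)))"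
  have t: "?t u = 0 \<or> 1 \<le> ?t u" for u by (rule H0a_gap)
  have nn: "0 \<le> ?t u" for u using t[of u] by (rule disjE) linarith+
  show ?thesis
  proof (cases "\<forall>u\<in>contexts \<sigma> k. ?t u = 0")
    case True
    then show ?thesis by (simp add: block_entropy_def)
  next
    case False
    then obtain u where u: "u \<in> contexts \<sigma> k" "1 \<le> ?t u" using t by blast
    have "?t u \<le> sum ?t (contexts \<sigma> k)" by (rule member_le_sum) (use u nn finite_contexts in auto)
    then show ?thesis using u unfolding block_entropy_def by linarith
  qed
qed

lemma H0_nonneg: "0 \<le> H0 u"
  unfolding H0_def
proof (intro mult_nonneg_nonneg sum_nonneg)
  fix c assume "c \<in> set u"
  then have "0 < count_list u c" by (metis count_list_0_iff gr_zeroI)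
  moreover have "count_list u c \<le> length u" by (rule count_le_length)
  ultimately have "1 \<le> real (length u) / real (count_list u c)" by (simp add: le_divide_eq)
  then show "0 \<le> log 2 (real (length u) / real (count_list u c))" by (subst zero_le_log_cancel_iff) linarith+
qed auto

lemma Hk_nonneg: "0 \<le> Hk \<sigma> k S"
  unfolding Hk_def by (intro mult_nonneg_nonneg sum_nonneg H0_nonneg) auto

text \<open>Here \<open>a\<close> and \<open>b\<close> are the two window sums, \<open>h\<close> the
  scaled entropy and \<open>y\<close> the scaled additive term. If \<open>y\<close> is not
  saturated, the exact value of \<open>a + y - b\<close>, with \<open>y\<close> rounded down, lies
  between 0 and \<open>2 ^ w - N\<close>, so that computing modulo \<open>2 ^ w\<close> is harmless
  even if an intermediate result wraps around. If \<open>y\<close> is saturated from above, both the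
  word and the true value are at least \<open>2 ^ (w - 2)\<close>, up to \<open>N\<close>.\<close>

lemma estimate_word:
  fixes a b n N :: nat and h y :: real
  assumes w: "7 \<le> w" and ab: "\<bar>real a - real b - h\<bar> \<le> n" and h: "0 \<le> h" and N: "N = Suc n"
    and a: "4 * a < 2 ^ w" and N_word: "16 * N \<le> 2 ^ w" and hy: "3 * N \<le> h + y"
  defines "g \<equiv> apply_op w Sub (apply_op w Add a (signed_word w y)) b"
  shows "g + N < 2 ^ w \<and> (\<bar>real g - (h + y)\<bar> \<le> N \<or> 2 ^ (w - 2) \<le> g \<and> 2 ^ (w - 2) \<le> h + y + N)"
proof -
  define u where "u = w - 2"
  have wu: "w = Suc (Suc u)" using w by (simp add: u_def)
  define qw :: int where "qw = 2 ^ u"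
  have W: "(2::int) ^ w = 4 * qw" "(2::int) ^ (w - 1) = 2 * qw" "(2::nat) ^ (w - 2) = nat qw" "(2::real) ^ (w - 2) = qw"
    "(2::nat) ^ w = nat (4 * qw)" "0 < qw" by (simp_all add: wu qw_def nat_power_eq nat_mult_distrib)
  have a': "int a < qw" and N': "4 * int N \<le> qw" using a N_word W(5,6) by linarith+
  define s where "s = max (- (2 * qw)) (min (2 * qw - 1) \<lfloor>y\<rfloor>)"
  define v where "v = int a + s - int b"
  have sw: "signed_word w y = nat (s mod (4 * qw))" unfolding signed_word_def W s_def by simp
  \<comment> \<open>Since \<open>h + y\<close> is at least \<open>3 * N\<close> and \<open>h\<close>
    is at most \<open>a + n\<close>, the additive term is no less than \<open>- a\<close>.
    Saturation from below is thus impossible.\<close>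
  have ylow: "- qw \<le> \<lfloor>y\<rfloor>"
  proof -
    have "h \<le> real a + n" using ab by linarith
    then have "- real a \<le> y" using hy N by simp
    then have "- int a \<le> \<lfloor>y\<rfloor>" by (simp add: le_floor_iff)
    then show ?thesis using a' by linarith
  qed
  have key: "0 \<le> v \<and> v + int N < 4 * qw \<and> (\<bar>real_of_int v - (h + y)\<bar> \<le> N \<or> qw \<le> v \<and> qw \<le> h + y + N)"
  proof (cases "\<lfloor>y\<rfloor> \<le> 2 * qw - 1")
    case True
    then have s: "s = \<lfloor>y\<rfloor>" unfolding s_def using ylow W(6) by linarith
    have v: "\<bar>real_of_int v - (h + y)\<bar> \<le> N" unfolding v_def s using ab N by simp linarith
    moreover have "0 \<le> real_of_int v" using v hy by linarith
    moreover have "v + int N < 4 * qw" unfolding v_def s using True a' N' by linarith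
    ultimately show ?thesis by simp
  next
    case False
    then have s: "s = 2 * qw - 1" unfolding s_def using W(6) by linarith
    have "- real n \<le> real a - real b" using ab h by linarith
    then have ban: "int b - int a \<le> int n" by linarith
    then have v: "qw \<le> v" unfolding v_def s using N' N W(6) by linarith
    have "2 * qw \<le> \<lfloor>y\<rfloor>" using False by linarith
    then have "real_of_int (2 * qw) \<le> y" by (simp add: le_floor_iff)
    then have "qw \<le> h + y + N" using h W(6) by simp
    moreover have "v + int N < 4 * qw" unfolding v_def s using a' N' by linarith
    ultimately show ?thesis using v W(6) by simp
  qed
  have "int g = v"
  proof -
    have b4: "int b \<le> 4 * qw"
    proof -
      have "int b \<le> int a + s" using key unfolding v_def by linarith
      moreover have "s \<le> 2 * qw - 1" unfolding s_def using W(6) by linarith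
      ultimately show ?thesis using a' by linarith
    qed
    have p: "int (2 ^ w) = 4 * qw" using W(1) by simp
    have "int (signed_word w y) = s mod (4 * qw)" unfolding sw using W(6) by simp
    then have 1: "int (apply_op w Add a (signed_word w y)) = (int a + s) mod (4 * qw)"
      by (simp add: zmod_int p mod_add_right_eq flip: p)
    have "b \<le> 2 ^ w" using b4 unfolding p[symmetric] by (simp only: of_nat_le_iff)
    then have "int (2 ^ w - b) = 4 * qw - int b" unfolding p[symmetric] by (rule of_nat_diff)
    then have "int g = ((int a + s) mod (4 * qw) + (4 * qw - int b)) mod (4 * qw)"
      unfolding g_def apply_op.simps(2) zmod_int of_nat_add 1 p by simp
    also have "\<dots> = (int a + s + (4 * qw - int b)) mod (4 * qw)" by (rule mod_add_left_eq)
    also have "int a + s + (4 * qw - int b) = v + 4 * qw" by (simp add: v_def)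
    also have "(v + 4 * qw) mod (4 * qw) = v" using key by simp
    finally show ?thesis .
  qed
  then have g: "real g = real_of_int v" "g = nat v" by linarith+
  have "g + N < 2 ^ w" unfolding W(5) using key g(2) by linarith
  moreover have "2 ^ (w - 2) \<le> g" if "qw \<le> v" unfolding W(3) using that g(2) by simp
  ultimately show ?thesis unfolding g(1) W(4) using key by blast
qed

context text_machine
begin

section \<open>The entropy of a window in terms of its grams\<close>

definition gram_val :: "(nat \<Rightarrow> real) \<Rightarrow> nat \<Rightarrow> nat \<Rightarrow> nat \<Rightarrow> real" where
  "gram_val \<phi> m i e = (\<Sum>u\<in>gram m ` {i..<e}. \<phi> (card {q. i \<le> q \<and> q < e \<and> gram m q = u}))"

lemma gram_Suc: "gram (k + 1) q = gram k q @ [sym (q + k)]"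
  by (simp add: gram_def)

lemma following_window:
  assumes "i < j" "j \<le> n" "length u = k"
  shows "following u (take (j - i) (drop i T)) = map (\<lambda>q. sym (q + k)) (filter (\<lambda>q. gram k q = u) [i..<j - k])"
proof -
  let ?S = "take (j - i) (drop i T)"
  have len: "length ?S = j - i" using assms by simp
  have nth: "?S ! x = sym (i + x)" if "x < j - i" for x
  proof -
    have "i + x < n" using that assms by simp
    then show ?thesis using that by (simp add: sym_def)
  qed
  have gr: "take k (drop x ?S) = gram k (x + i)" if "x < j - i - k" for x
  proof (rule nth_equalityI)
    show "length (take k (drop x ?S)) = length (gram k (x + i))" using that assms by (simp add: gram_def)
    fix l assume "l < length (take k (drop x ?S))"
    then have l: "l < k" "i + (x + l) < n" using that assms by simp_all
    have "take k (drop x ?S) ! l = T ! (i + (x + l))" using that l assms by (simp add: nth_take)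
    then show "take k (drop x ?S) ! l = gram k (x + i) ! l" using l by (simp add: gram_def sym_def ac_simps)
  qed
  have up: "map (\<lambda>x. x + i) [0..<j - i - k] = [i..<j - k]"
  proof (cases "i + k \<le> j")
    case True
    then have "j - i - k + i = j - k" by simp
    then show ?thesis using map_add_upt[of i "j - i - k"] by simp
  qed simp
  have "following u ?S = map (\<lambda>x. ?S ! (x + k)) (filter (\<lambda>x. take k (drop x ?S) = u) [0..<j - i - k])"
    
    unfolding following_def len assms(3) ..
  also have "filter (\<lambda>x. take k (drop x ?S) = u) [0..<j - i - k] = filter (\<lambda>x. gram k (x + i) = u) [0..<j - i - k]"
    by (rule filter_cong) (use gr in auto)
  also have "map (\<lambda>x. ?S ! (x + k)) (filter (\<lambda>x. gram k (x + i) = u) [0..<j - i - k]) =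
      map (\<lambda>x. sym (x + i + k)) (filter (\<lambda>x. gram k (x + i) = u) [0..<j - i - k])"
    by (rule map_cong) (auto simp: nth ac_simps simp del: nth_take)
  also have "\<dots> = map (\<lambda>q. sym (q + k)) (filter (\<lambda>q. gram k q = u) (map (\<lambda>x. x + i) [0..<j - i - k]))"
    by (simp add: filter_map o_def)
  finally show ?thesis unfolding up .
qed

text \<open>The number of symbols that follow \<open>u\<close> is the number of occurrences of
  \<open>u\<close> with a successor in the window, and the number of symbols \<open>c\<close> among
  them is the number of occurrences of \<open>u @ [c]\<close>. Splitting off the last symbol
  therefore matches pairs of context and follower with \<open>(k + 1)\<close>-grams.\<close>

lemma block_entropy_window:
  assumes ij: "i < j" "j \<le> n" and \<sigma>: "set T \<subseteq> {..<\<sigma>}" and \<phi>: "\<phi> 0 = 0"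
  shows "block_entropy \<phi> \<sigma> k (take (j - i) (drop i T)) = gram_val \<phi> k i (j - k) - gram_val \<phi> (k + 1) i (j - k)"
proof -
  let ?S = "take (j - i) (drop i T)" and ?I = "{i..<j - k}"
  let ?c = "\<lambda>u c. card {q \<in> ?I. gram k q = u \<and> sym (q + k) = c}"
  have len: "length (following u ?S) = card {q. i \<le> q \<and> q < j - k \<and> gram k q = u}" if "length u = k" for u
  proof -
    have "length (filter (\<lambda>q. gram k q = u) [i..<j - k]) = card (set (filter (\<lambda>q. gram k q = u) [i..<j - k]))"
      by (rule distinct_card[symmetric]) simp
    then show ?thesis using following_window[OF ij that] by (simp add: conj_assoc)
  qed
  have cnt: "count_list (following u ?S) c = ?c u c" if "length u = k" for u c
  proof -
    have "count_list (following u ?S) c = length (filter (\<lambda>q. sym (q + k) = c) (filter (\<lambda>q. gram k q = u) [i..<j - k]))"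
      unfolding following_window[OF ij that] count_list_eq_length_filter by (simp add: filter_map o_def eq_commute)
    also have "\<dots> = card (set (filter (\<lambda>q. sym (q + k) = c) (filter (\<lambda>q. gram k q = u) [i..<j - k])))"
      by (rule distinct_card[symmetric]) simp
    finally show ?thesis by (simp add: conj_assoc conj_commute)
  qed
  have st: "set (following u ?S) = (\<lambda>q. sym (q + k)) ` {q \<in> ?I. gram k q = u}" if "length u = k" for u
    using following_window[OF ij that] by auto
  have sub: "gram k ` ?I \<subseteq> contexts \<sigma> k"
  proof -
    have "sym (q + l) < \<sigma>" if "q \<in> ?I" "l < k" for q l
    proof -
      have "q + k < j" using that(1) by (simp add: less_diff_conv)
      then have ql: "q + l < n" using that(2) ij by linarith
      then have "T ! (q + l) \<in> {..<\<sigma>}" using \<sigma> nth_mem by blast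
      then show ?thesis using ql by (simp add: sym_def)
    qed
    then show ?thesis by (auto simp: contexts_def gram_def)
  qed
  have zero: "{q \<in> ?I. gram k q = u} = {}" if "u \<notin> gram k ` ?I" for u using that by blast
  let ?t = "\<lambda>u. \<phi> (card {q. i \<le> q \<and> q < j - k \<and> gram k q = u}) - (\<Sum>c\<in>(\<lambda>q. sym (q + k)) ` {q \<in> ?I. gram k q = u}. \<phi> (?c u c))"
  have "block_entropy \<phi> \<sigma> k ?S = (\<Sum>u\<in>contexts \<sigma> k. ?t u)"
    unfolding block_entropy_def
  proof (rule sum.cong)
    fix u assume "u \<in> contexts \<sigma> k"
    then have "length u = k" by (simp add: contexts_def)
    then show "\<phi> (length (following u ?S)) - (\<Sum>c\<in>set (following u ?S). \<phi> (count_list (following u ?S) c)) = ?t u"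
      by (simp only: len cnt st)
  qed simp
  \<comment> \<open>A context that does not occur contributes \<open>\<phi> 0 = 0\<close>.\<close>
  also have "\<dots> = (\<Sum>u\<in>gram k ` ?I. ?t u)"
  proof (rule sum.mono_neutral_right[OF finite_contexts sub], rule ballI)
    fix u assume "u \<in> contexts \<sigma> k - gram k ` ?I"
    then have "{q \<in> ?I. gram k q = u} = {}" using zero by blast
    moreover from this have "{q. i \<le> q \<and> q < j - k \<and> gram k q = u} = {}" by auto
    ultimately show "?t u = 0" using \<phi> by (simp only: card.empty image_empty sum.empty)
  qed
  also have "\<dots> = gram_val \<phi> k i (j - k) - (\<Sum>u\<in>gram k ` ?I. \<Sum>c\<in>(\<lambda>q. sym (q + k)) ` {q \<in> ?I. gram k q = u}. \<phi> (?c u c))"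
    by (simp only: sum_subtractf gram_val_def)
  also have "(\<Sum>u\<in>gram k ` ?I. \<Sum>c\<in>(\<lambda>q. sym (q + k)) ` {q \<in> ?I. gram k q = u}. \<phi> (?c u c)) =
      (\<Sum>(u, c)\<in>Sigma (gram k ` ?I) (\<lambda>u. (\<lambda>q. sym (q + k)) ` {q \<in> ?I. gram k q = u}). \<phi> (?c u c))"
    by (rule sum.Sigma) auto
  also have "\<dots> = gram_val \<phi> (k + 1) i (j - k)"
    unfolding gram_val_def
  proof (rule sum.reindex_bij_witness[where i = "\<lambda>v. (butlast v, last v)" and j = "\<lambda>(u, c). u @ [c]"])
    fix v assume "v \<in> gram (k + 1) ` ?I"
    then show "(butlast v, last v) \<in> Sigma (gram k ` ?I) (\<lambda>u. (\<lambda>q. sym (q + k)) ` {q \<in> ?I. gram k q = u})"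
      unfolding gram_Suc by auto
    show "(case (butlast v, last v) of (u, c) \<Rightarrow> u @ [c]) = v" using \<open>v \<in> _\<close> unfolding gram_Suc by auto
  next
    fix x assume x: "x \<in> Sigma (gram k ` ?I) (\<lambda>u. (\<lambda>q. sym (q + k)) ` {q \<in> ?I. gram k q = u})"
    then obtain q where q: "q \<in> ?I" "x = (gram k q, sym (q + k))" by auto
    then show "(case x of (u, c) \<Rightarrow> u @ [c]) \<in> gram (k + 1) ` ?I" unfolding gram_Suc by auto
    show "(butlast (case x of (u, c) \<Rightarrow> u @ [c]), last (case x of (u, c) \<Rightarrow> u @ [c])) = x" using q by simp
    have "{q'. i \<le> q' \<and> q' < j - k \<and> gram (k + 1) q' = gram k q @ [sym (q + k)]} =
        {q' \<in> ?I. gram k q' = gram k q \<and> sym (q' + k) = sym (q + k)}" unfolding gram_Suc by auto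
    then show "\<phi> (card {q. i \<le> q \<and> q < j - k \<and> gram (k + 1) q = (case x of (u, c) \<Rightarrow> u @ [c])}) = (case x of (u, c) \<Rightarrow> \<phi> (?c u c))"
      using q by simp
  qed
  finally show ?thesis .
qed

lemma sum_card_grams: "(\<Sum>u\<in>gram m ` {i..<e}. card {q. i \<le> q \<and> q < e \<and> gram m q = u}) = e - i"
proof -
  have "(\<Sum>q\<in>{i..<e}. 1) = (\<Sum>u\<in>gram m ` {i..<e}. \<Sum>q\<in>{q \<in> {i..<e}. gram m q = u}. (1::nat))"
    by (rule sum.image_gen) simp
  then show ?thesis by (simp add: conj_assoc)
qed

lemma gram_sum_le:
  assumes "\<And>m. X m \<le> m * b"
  shows "gram_sum X m i e \<le> (e - i) * b"
proof -
  have "gram_sum X m i e \<le> (\<Sum>u\<in>gram m ` {i..<e}. card {q. i \<le> q \<and> q < e \<and> gram m q = u} * b)"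
    unfolding gram_sum_def by (intro sum_mono assms)
  then show ?thesis by (simp only: sum_card_grams flip: sum_distrib_right)
qed

text \<open>An error of \<open>m\<close> is tolerated for a gram with \<open>m\<close> occurrences.
  This admits the roundings accumulated in logarithms of factorials, and still the total error is at
  most the number of positions.\<close>

lemma gram_sum_approx:
  assumes "\<And>m. m \<le> n \<Longrightarrow> real (X m) \<le> Q * \<phi> m \<and> Q * \<phi> m \<le> X m + m" "e \<le> n"
  shows "gram_sum X m i e \<le> Q * gram_val \<phi> m i e" "Q * gram_val \<phi> m i e \<le> gram_sum X m i e + n"
proof -
  let ?c = "\<lambda>u. card {q. i \<le> q \<and> q < e \<and> gram m q = u}"
  have cn: "?c u \<le> n" for u
  proof -
    have "?c u \<le> card {..<n}" using assms(2) by (intro card_mono) auto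
    then show ?thesis by simp
  qed
  show "gram_sum X m i e \<le> Q * gram_val \<phi> m i e"
    unfolding gram_sum_def gram_val_def of_nat_sum sum_distrib_left using assms(1)[OF cn] by (intro sum_mono) blast
  have "Q * \<phi> (?c u) \<le> real (X (?c u)) + real (?c u)" for u
    using conjunct2[OF assms(1)[OF cn[of u]]] by (simp only: of_nat_add)
  then have "Q * gram_val \<phi> m i e \<le> (\<Sum>u\<in>gram m ` {i..<e}. real (X (?c u)) + real (?c u))"
    unfolding gram_val_def sum_distrib_left by (intro sum_mono)
  also have "\<dots> = gram_sum X m i e + real (e - i)"
    unfolding sum.distrib gram_sum_def by (simp only: sum_card_grams flip: of_nat_sum)
  finally show "Q * gram_val \<phi> m i e \<le> gram_sum X m i e + n" using assms(2) by simp
qed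

lemma window_estimate:
  assumes ij: "i < j" "j \<le> n" and \<sigma>: "set T \<subseteq> {..<\<sigma>}" and \<phi>: "\<phi> 0 = 0"
    and X: "\<And>m. m \<le> n \<Longrightarrow> real (X m) \<le> Q * \<phi> m \<and> Q * \<phi> m \<le> X m + m" "\<And>m. X m \<le> m * XB"
    and h: "0 \<le> Q * block_entropy \<phi> \<sigma> k (take (j - i) (drop i T))"
    and words: "4 * (n * XB) < 2 ^ w" "16 * N \<le> 2 ^ w"
    and y: "3 * N \<le> Q * block_entropy \<phi> \<sigma> k (take (j - i) (drop i T)) + y"
  defines "g \<equiv> apply_op w Sub (apply_op w Add (gram_sum X k i (j - k)) (signed_word w y)) (gram_sum X (k + 1) i (j - k))"
  shows "g + N < 2 ^ w \<and> (\<bar>real g - (Q * block_entropy \<phi> \<sigma> k (take (j - i) (drop i T)) + y)\<bar> \<le> N \<or>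
    2 ^ (w - 2) \<le> g \<and> 2 ^ (w - 2) \<le> Q * block_entropy \<phi> \<sigma> k (take (j - i) (drop i T)) + y + N)"
  unfolding g_def
proof (rule estimate_word[OF w_large _ h _ _ words(2) y])
  have e: "j - k \<le> n" using ij by simp
  \<comment> \<open>Both sums are rounded down by at most \<open>n\<close>, so their difference is
    off by at most \<open>n\<close> in either direction.\<close>
  show "\<bar>real (gram_sum X k i (j - k)) - real (gram_sum X (k + 1) i (j - k)) - Q * block_entropy \<phi> \<sigma> k (take (j - i) (drop i T))\<bar> \<le> n"
    unfolding block_entropy_window[where \<phi> = \<phi>, OF ij \<sigma> \<phi>] right_diff_distrib
    using gram_sum_approx[OF X(1) e, of k i] gram_sum_approx[OF X(1) e, of "k + 1" i] by linarith
  show "N = Suc n" by (simp add: cells_def)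
  have "gram_sum X k i (j - k) \<le> (j - k - i) * XB" using X(2) by (rule gram_sum_le)
  also have "\<dots> \<le> n * XB" using e by (intro mult_le_mono1) simp
  finally show "4 * gram_sum X k i (j - k) < 2 ^ w" using words(1) by linarith
qed

lemma set_window: "i < j \<Longrightarrow> j \<le> n \<Longrightarrow> set (take (j - i) (drop i T)) = sym ` {i..<j}"
proof (intro set_eqI iffI)
  fix x assume ij: "i < j" "j \<le> n"
  {
    assume "x \<in> set (take (j - i) (drop i T))"
    then obtain l where "l < j - i" "x = T ! (i + l)" using ij by (auto simp: in_set_conv_nth)
    then show "x \<in> sym ` {i..<j}" using ij by (intro image_eqI[of _ _ "i + l"]) (auto simp: sym_def)
  next
    assume "x \<in> sym ` {i..<j}"
    then obtain l where l: "i \<le> l" "l < j" "x = T ! l" using ij by (auto simp: sym_def)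
    then have "take (j - i) (drop i T) ! (l - i) = x" "l - i < length (take (j - i) (drop i T))" using ij by simp_all
    then show "x \<in> set (take (j - i) (drop i T))" by (metis nth_mem)
  }
qed

end

section \<open>Time and space bounds\<close>

text \<open>What the pieces of program that depend on the estimate have to compute. Costs are scaled by the
  word \<open>Q0\<close>; \<open>G0\<close> is the scaled cost of a single symbol. \<open>X m\<close> is the scaled contribution of a gram
  with \<open>m\<close> occurrences, and \<open>Fv\<close> the scaled additive term as a word in two's complement. A word above
  \<open>2 ^ (w - 2)\<close> need not be accurate, since no class is that expensive.\<close>

locale implementation =
  fixes X :: "nat \<Rightarrow> nat" and Fv :: "nat \<Rightarrow> nat \<Rightarrow> nat" and Q0 G0 XB :: nat and F :: "nat \<Rightarrow> nat \<Rightarrow> real"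
    and gi :: cmd and fe xe :: expr and k H e :: nat and \<eta> :: real and w \<sigma> :: nat and T :: "nat list"
    and wt :: "nat list \<Rightarrow> real"
  assumes X0: "X 0 = 0" and X_le: "\<And>m. X m \<le> m * XB"
    and XB_le: "XB \<le> H * cells T ^ e" and G0_le: "G0 \<le> H * cells T ^ e" and Q0_pos: "0 < Q0"
    and G0_large: "3 * real (cells T) \<le> \<eta> * real G0" and wt_admissible: "admissible wt T"
    and wt_unit: "\<And>x. x \<in> set T \<Longrightarrow> real G0 \<le> real Q0 * wt [x] \<and> real Q0 * wt [x] \<le> real G0 + 1"
    and fe: "\<And>M v A. machine w M (cells T) \<Longrightarrow> v vn = length T \<Longrightarrow> v vN = cells T \<Longrightarrow> v vQ = Q0 \<Longrightarrow>
      v vG = G0 \<Longrightarrow> v vi \<le> v vj \<Longrightarrow> v vj < length T \<Longrightarrow>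
      machine.ok F w M (cells T) fe v A \<and> machine.ev F w fe v A = Fv (Suc (v vj) - v vi) (v vds')"
    and xe: "\<And>M v A. machine w M (cells T) \<Longrightarrow> v vn = length T \<Longrightarrow> v vN = cells T \<Longrightarrow> v vQ = Q0 \<Longrightarrow>
      v vp \<le> length T \<Longrightarrow> v vacc = (if v vp = 0 then 0 else X (v vp - 1)) \<Longrightarrow>
      machine.ok F w M (cells T) xe v A \<and> machine.ev F w xe v A = X (v vp)"
    and gi: "\<And>M v A. machine w M (cells T) \<Longrightarrow> v vn = length T \<Longrightarrow> v vN = cells T \<Longrightarrow> v 1 = \<sigma> \<Longrightarrow>
      machine.wp F w M (cells T) gi (\<lambda>v' A'. A' = A \<and> v' vQ = Q0 \<and> v' vG = G0 \<and>
        (\<forall>x. x \<notin> {vQ, vG, vx, vy} \<longrightarrow> v' x = v x)) v A"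
    and estimate: "\<And>i j. i < j \<Longrightarrow> j \<le> length T \<Longrightarrow>
      (let g = apply_op w Sub (apply_op w Add (text_machine.gram_sum T X k i (j - k))
           (Fv (j - i) (card (text_machine.sym T ` {i..<j}))))
         (text_machine.gram_sum T X (k + 1) i (j - k)); x = real Q0 * wt (take (j - i) (drop i T))
       in g + cells T < 2 ^ w \<and> (\<bar>real g - x\<bar> \<le> real (cells T) \<or> 2 ^ (w - 2) \<le> g \<and> 2 ^ (w - 2) \<le> x + real (cells T)))"

definition implements ::
  "(nat \<Rightarrow> nat \<Rightarrow> real) \<Rightarrow> cmd \<Rightarrow> expr \<Rightarrow> expr \<Rightarrow> nat \<Rightarrow> nat \<Rightarrow> nat \<Rightarrow> real \<Rightarrow> nat \<Rightarrow> nat \<Rightarrow> nat list \<Rightarrow>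
    (nat list \<Rightarrow> real) \<Rightarrow> bool" where
  "implements F gi fe xe k H e \<eta> w \<sigma> T wt \<longleftrightarrow>
     (\<exists>X Fv Q0 G0 XB. implementation X Fv Q0 G0 XB F gi fe xe k H e \<eta> w \<sigma> T wt)"

lemma level_growth:
  assumes "0 < r" "r < p"
  shows "(real p / r) ^ c * level G N p r 0 \<le> level G N p r c"
proof (induction c)
  case (Suc c)
  have "(real p / r) ^ Suc c * level G N p r 0 \<le> real p / r * level G N p r c"
    using mult_left_mono[OF Suc, of "real p / r"] by (simp add: mult.assoc)
  also have "\<dots> \<le> real (level G N p r c * p div r) + 1"
    using floor_divide_of_nat_eq[of "level G N p r c * p" r, where ?'a = real] by (simp add: mult.commute) linarith
  finally show ?case by (simp add: level_def)
qed simp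

section \<open>Number of classes and length of words\<close>

locale classes_count =
  fixes G N n p r :: nat
  assumes N: "N = Suc n" and n: "1 \<le> n" and pr: "0 < r" "r < p"
begin

abbreviation "lev \<equiv> level G N p r"
abbreviation "\<rho> \<equiv> real p / r"

definition number :: nat where "number = (LEAST c. n * lev 0 \<le> previous lev c)"

lemma \<rho>_gt_1: "1 < \<rho>" using pr by simp

lemma level_0_pos: "0 < lev 0" using N by (simp add: level_def)

text \<open>The levels grow at least geometrically with ratio \<rho>, and the cap is only
  \<open>n\<close> times the first level. The summand 2 comes from rounding up and from the shift by
  one in \<open>previous\<close>.\<close>

lemma number_bounds:
  "n * lev 0 \<le> previous lev number" "\<And>c. c < number \<Longrightarrow> previous lev c < n * lev 0" "0 < number"
  "real number \<le> 2 + log \<rho> n"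
proof -
  have "\<exists>c. n * lev 0 \<le> previous lev c"
  proof -
    obtain c where "real n < \<rho> ^ c" using real_arch_pow[OF \<rho>_gt_1] by blast
    then have "n * real (lev 0) \<le> \<rho> ^ c * lev 0" by (intro mult_right_mono) auto
    also have "\<dots> \<le> lev c" using pr by (rule level_growth)
    finally have "n * lev 0 \<le> lev c" by (simp flip: of_nat_mult)
    then show ?thesis by (intro exI[of _ "Suc c"]) simp
  qed
  then show "n * lev 0 \<le> previous lev number" unfolding number_def by (rule LeastI_ex)
  show less: "previous lev c < n * lev 0" if "c < number" for c
    using not_less_Least[of c "\<lambda>c. n * lev 0 \<le> previous lev c"] that unfolding number_def by simp
  show "0 < number"
  proof (rule ccontr)
    assume "\<not> 0 < number"
    then have "n * lev 0 \<le> 0" using \<open>n * lev 0 \<le> previous lev number\<close> by simp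
    then show False using n level_0_pos by simp
  qed
  show "real number \<le> 2 + log \<rho> n"
  proof (cases "number \<le> 1")
    case True
    have "0 \<le> log \<rho> n" using \<rho>_gt_1 n by simp
    then show ?thesis using True by linarith
  next
    case False
    then obtain c where c: "number = Suc (Suc c)" by (metis One_nat_def Suc_le_D not_less_eq_eq)
    have "\<rho> ^ c * lev 0 \<le> lev c" using pr by (rule level_growth)
    also have "\<dots> < n * lev 0" using less[of "Suc c"] c by (simp flip: of_nat_mult)
    finally have "\<rho> ^ c < n" using level_0_pos by simp
    then have "real c \<le> log \<rho> n" using \<rho>_gt_1 n by (simp add: le_log_iff powr_realpow less_imp_le)
    then show ?thesis using c by simp
  qed
qed

lemma level_le:
  assumes "c < number" shows "lev c \<le> n * lev 0 * p + 1"
proof (cases c)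
  case 0
  have "lev 0 * 1 \<le> lev 0 * (n * p)" using n pr by (intro mult_le_mono2) (simp add: Suc_le_eq)
  also have "\<dots> = n * lev 0 * p" by (simp only: mult.assoc mult.left_commute)
  finally show ?thesis unfolding 0 by linarith
next
  case (Suc c')
  then have "lev c' < n * lev 0" using number_bounds(2)[OF assms] by simp
  then have "lev c' * p \<le> n * lev 0 * p" by simp
  then have "lev c' * p div r \<le> n * lev 0 * p" using div_le_dividend le_trans by blast
  then show ?thesis using Suc by (simp add: level_def)
qed

end

text \<open>A word has a fixed multiple of the bits of \<open>n + 1\<close>: part of the factor
  yields any fixed power of \<open>N\<close>, the rest any constant factor, since the number of bits
  is at least 1.\<close>

lemma word_length_bounds:
  fixes n d :: nat
  assumes "1 \<le> n"
  shows "Suc n ^ e * 2 ^ m \<le> (2::nat) ^ word_length (e + m) n" (is ?A)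
    and "b * nat \<lfloor>log 2 (real (Suc n))\<rfloor> < word_length (Suc b + m) n" (is ?B)
    and "m \<le> word_length m n"
proof -
  let ?l = "nat \<lceil>log 2 (real n + 1)\<rceil>"
  have l1: "1 \<le> log 2 (real n + 1)" using assms by (simp add: le_log_iff)
  then have l: "1 \<le> ?l" by linarith
  then show "m \<le> word_length m n" by (simp add: word_length_def)
  have "real (Suc n) = 2 powr log 2 (real n + 1)" by simp
  also have "\<dots> \<le> 2 powr real ?l" by (intro powr_mono) (auto simp: real_nat_ceiling_ge)
  also have "\<dots> = 2 ^ ?l" by (rule powr_realpow) simp
  finally have "Suc n \<le> 2 ^ ?l" by (metis of_nat_le_iff of_nat_numeral of_nat_power)
  then have "Suc n ^ e \<le> (2 ^ ?l) ^ e" by (rule power_mono) simp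
  moreover have "(2::nat) ^ m \<le> 2 ^ (m * ?l)" using l by (intro power_increasing) auto
  ultimately have "Suc n ^ e * 2 ^ m \<le> (2 ^ ?l) ^ e * 2 ^ (m * ?l)" by (rule mult_le_mono)
  also have "\<dots> = 2 ^ word_length (e + m) n"
    by (simp add: word_length_def power_mult[symmetric] power_add[symmetric] algebra_simps)
  finally show ?A .
  have "nat \<lfloor>log 2 (real (Suc n))\<rfloor> \<le> ?l" by (intro nat_mono) (simp add: add.commute floor_le_ceiling)
  then have "b * nat \<lfloor>log 2 (real (Suc n))\<rfloor> \<le> b * ?l" by simp
  also have "\<dots> < Suc b * ?l" using l unfolding mult_Suc by linarith
  also have "\<dots> \<le> word_length (Suc b + m) n" by (simp add: word_length_def)
  finally show ?B .
qed

lemma log_base_scale: "1 < q \<Longrightarrow> 0 < (x::real) \<Longrightarrow> log q x = 4 * log (q ^ 4) x"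
  by (simp add: log_base_pow)

lemma log2_le_sqrt: "0 < x \<Longrightarrow> log 2 x \<le> 4 * sqrt x"
proof -
  assume x: "0 < x"
  have "ln x = 2 * ln (sqrt x)" using x by (simp add: ln_sqrt)
  also have "\<dots> \<le> 2 * sqrt x" using ln_le_minus_one[of "sqrt x"] x by simp
  finally have "ln x \<le> 2 * sqrt x" .
  moreover have "1 / 2 \<le> ln (2::real)" using exp_half_le2 by (subst ln_ge_iff) simp_all
  then have "(4 * sqrt x) * (1 / 2) \<le> (4 * sqrt x) * ln 2" using x by (intro mult_left_mono) auto
  ultimately have "ln x \<le> (4 * sqrt x) * ln 2" by linarith
  then show ?thesis by (simp add: log_def divide_le_eq)
qed

lemma approximation_program:
  fixes q :: real
  assumes q: "1 < q" and times: "expr_time fe \<le> 40" "expr_time xe \<le> 40" "loopfree_time gi \<le> 100"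
    and inst: "\<And>w \<sigma> T. T \<noteq> [] \<Longrightarrow> set T \<subseteq> {..<\<sigma>} \<Longrightarrow> \<sigma> \<le> A * length T ^ a \<Longrightarrow> \<sigma> < 2 ^ w \<Longrightarrow>
      admissible (cst \<sigma>) T \<Longrightarrow> H * cells T ^ e \<le> 2 ^ w \<Longrightarrow> 7 \<le> w \<Longrightarrow>
      \<exists>wt. implements F gi fe xe k H e (q - 1) w \<sigma> T wt \<and>
        (\<forall>P. is_partition T P \<longrightarrow> partition_cost wt P \<le> q ^ 3 * min_partition_cost wt T \<longrightarrow>
          partition_cost (cst \<sigma>) P \<le> q ^ 4 * min_partition_cost (cst \<sigma>) T)"
  shows "\<exists>(P :: com) (d :: nat) (n\<^sub>0 :: nat).
      \<forall>(n :: nat) (\<sigma> :: nat) (T :: nat list).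
        n \<ge> 1 \<and> length T = n \<and> set T \<subseteq> {..<\<sigma>} \<and> \<sigma> \<le> A * n ^ a \<and> admissible (cst \<sigma>) T \<longrightarrow>
        (\<exists>M t s.
          run F (word_length d n) M P (input_state (word_length d n) \<sigma> T) t s \<and>
          output_in_memory M s \<and>
          is_partition T (output_partition T s) \<and>
          partition_cost (cst \<sigma>) (output_partition T s) \<le> q ^ 4 * min_partition_cost (cst \<sigma>) T \<and>
          (n \<ge> n\<^sub>0 \<longrightarrow>
            real t \<le> real (100000 * (k + 3) * (a + A + 1)) * (real n * log (q ^ 4) (real n)) \<and>
            real M \<le> real (100000 * (k + 3) * (a + A + 1)) * real n))"
proof -
  have "q < q ^ 2" using q power_strict_increasing[of 1 2 q] by simp
  \<comment> \<open>The ratio \<open>z = p / r\<close> of the classes is rational, so that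
    thresholds can be computed with integers. Its upper bound gives
    \<open>z * q \<le> q ^ 3\<close>. Its lower bound gives \<open>log z n \<le> log q n\<close>,
    which is 4 times the logarithm to base \<open>q ^ 4\<close>, so that the constant of the running
    time does not depend on \<open>q\<close>.\<close>
  then obtain z where z: "z \<in> \<rat>" "q < z" "z < q ^ 2" using Rats_dense_in_real by blast
  from z(1) obtain pi ri where pri: "ri > 0" "z = real_of_int pi / real_of_int ri" by (rule Rats_cases')
  define p r where "p = nat pi" and "r = nat ri"
  have "0 < pi" using pri z(2) q by (simp add: zero_less_divide_iff) (smt (verit) divide_nonpos_pos of_int_0_less_iff of_int_le_0_iff)
  then have z': "z = real p / r" "0 < r" using pri by (auto simp: p_def r_def)
  then have "q * r < p" using z(2) by (simp add: less_divide_eq)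
  moreover have "1 * real r < q * r" using q z'(2) by (intro mult_strict_right_mono) auto
  ultimately have pr: "r < p" by simp
  define D where "D = a + A"
  \<comment> \<open>For \<open>n \<ge> 4\<close> this makes the number of classes, at most
    \<open>2 + log z n\<close>, at most \<open>b * log 2 n\<close>. Packing
    \<open>b * log 2 N\<close> bits into a word then cancels the dependence of the space on
    \<open>z\<close>.\<close>
  define b where "b = nat \<lceil>1 + 1 / log 2 z\<rceil>"
  \<comment> \<open>Only for a crude bound on the number of classes, linear in \<open>N\<close>,
    which shows that all addresses fit into a word.\<close>
  define cL where "cL = nat \<lceil>1 / ln z\<rceil>"
  \<comment> \<open>All numbers that have to fit into a word are at most \<open>c * N ^ i\<close>
    with \<open>i \<le> E\<close> and \<open>c < Ka\<close>. The degree covers symbols below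
    \<open>N ^ D\<close>, thresholds of degree \<open>e + 2\<close> and addresses of degree 2. The
    term \<open>b\<close> in \<open>d\<close> leaves room for the packed bits.\<close>
  define E where "E = e + D + 3"
  define Ka where "Ka = 8 * ((H + 5) * p * p + (21 + 2 * cL) + (k + 4) * (D + 2) + 4 * H + 20)"
  define d where "d = E + (Ka + b + 8)"
  \<comment> \<open>The first summand makes \<open>2 * b * log 2 N \<le> N\<close>, so that the
    minimum in \<open>pack_bits\<close> is not attained at \<open>N\<close> alone. The second makes
    the logarithm to base \<open>q ^ 4\<close> at least 1, which absorbs additive constants, and the
    third makes \<open>log 2 n\<close> at least 2.\<close>
  define n0 where "n0 = 64 * b * b + nat \<lceil>q ^ 4\<rceil> + 4"
  have z1: "1 < z" using z q by linarith
  have lz: "0 < log 2 z" "0 < ln z" using z1 by auto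
  have b: "1 + 1 / log 2 z \<le> b" unfolding b_def by linarith
  then have b0: "0 < b" using lz by (smt (verit) divide_pos_pos of_nat_0_less_iff)
  have main: "(\<exists>M t s.
      run F (word_length d n) M (program_com gi xe fe k D b p r) (input_state (word_length d n) \<sigma> T) t s \<and>
      output_in_memory M s \<and> is_partition T (output_partition T s) \<and>
      partition_cost (cst \<sigma>) (output_partition T s) \<le> q ^ 4 * min_partition_cost (cst \<sigma>) T \<and>
      (n \<ge> n0 \<longrightarrow>
        real t \<le> real (100000 * (k + 3) * (a + A + 1)) * (real n * log (q ^ 4) (real n)) \<and>
        real M \<le> real (100000 * (k + 3) * (a + A + 1)) * real n))"
    if *: "n \<ge> 1" "length T = n" "set T \<subseteq> {..<\<sigma>}" "\<sigma> \<le> A * n ^ a" "admissible (cst \<sigma>) T" for n \<sigma> T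
  proof -
    define w where "w = word_length d n"
    define N where "N = cells T"
    have N: "N = Suc n" using *(2) by (simp add: N_def cells_def)
    have N2: "2 \<le> N" using N *(1) by simp
    have "Suc n ^ E * 2 ^ (Ka + b + 8) \<le> (2::nat) ^ w" unfolding w_def d_def by (rule word_length_bounds(1)) (rule *)
    moreover have "Ka \<le> 2 ^ (Ka + b + 8)"
      using less_exp[of "Ka + b + 8"] by linarith
    ultimately have big: "Ka * N ^ E \<le> 2 ^ w"
      unfolding N by (metis le_trans mult.commute mult_le_mono2)
    have poly: "c * N ^ i \<le> c * N ^ E" if "i \<le> E" for c i
      using that N2 by (intro mult_le_mono power_increasing) auto
    have pos: "0 < N ^ E" using N2 by simp
    have fits: "x < 2 ^ w" if "x \<le> c * N ^ E" "c < Ka" for x c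
    proof -
      have "c * N ^ E < Ka * N ^ E" using that(2) pos by simp
      then show ?thesis using that(1) big by linarith
    qed
    have fits': "x < 2 ^ w" if "x \<le> c * N ^ i" "i \<le> E" "c < Ka" for x c i
      using fits[of x c] that(1,3) poly[OF that(2), of c] by linarith
    have Ka: "4 * ((H + 5) * p * p) < Ka" "21 + 2 * cL < Ka" "(k + 4) * (D + 2) < Ka" "4 * H < Ka" "20 + k < Ka" "p < Ka"
    proof -
      have kk: "k + 4 \<le> (k + 4) * (D + 2)" by simp
      have "p \<le> (H + 5) * p * p" using pr by (metis (no_types) le_square le_trans mult.assoc mult.commute mult_le_mono1 mult_1 add_leD2 one_le_numeral)
      have *: "Ka = 8 * (x1 + x2 + x3 + 4 * H + 20) \<Longrightarrow> p \<le> x1 \<Longrightarrow> k + 4 \<le> x3 \<Longrightarrow>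
        4 * x1 < Ka \<and> x2 < Ka \<and> x3 < Ka \<and> 4 * H < Ka \<and> 20 + k < Ka \<and> p < Ka" for x1 x2 x3
        by auto
      show "4 * ((H + 5) * p * p) < Ka" "21 + 2 * cL < Ka" "(k + 4) * (D + 2) < Ka" "4 * H < Ka" "20 + k < Ka" "p < Ka"
        using *[OF Ka_def \<open>p \<le> (H + 5) * p * p\<close> kk] by blast+
    qed
    have ND: "N ^ D < 2 ^ w" by (rule fits'[of _ 1 D]) (use Ka in \<open>auto simp: E_def\<close>)
    have "\<sigma> \<le> N ^ D"
    proof -
      have "A \<le> 2 ^ A" using less_exp[of A] by simp
      also have "\<dots> \<le> N ^ A" using N2 by (rule power_mono) simp
      finally have "A * n ^ a \<le> N ^ A * N ^ a" using N by (intro mult_le_mono power_mono) auto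
      then show ?thesis using *(4) by (simp add: D_def power_add mult.commute)
    qed
    then have sig: "\<sigma> \<le> N ^ D" "\<sigma> < 2 ^ w" using ND by auto
    have w7: "7 \<le> w"
    proof -
      have "d \<le> w" unfolding w_def by (rule word_length_bounds(3)) (rule *)
      then show ?thesis by (simp add: d_def)
    qed
    have bw: "b * nat \<lfloor>log 2 (real N)\<rfloor> < w"
    proof -
      have "d = Suc b + (E + Ka + 7)" by (simp add: d_def)
      then show ?thesis unfolding w_def N using word_length_bounds(2)[OF *(1), of b "E + Ka + 7"] by simp
    qed
    have He: "H * N ^ e < 2 ^ w" by (rule fits'[of _ H e]) (use Ka in \<open>auto simp: E_def\<close>)
    have "\<exists>wt. implements F gi fe xe k H e (q - 1) w \<sigma> T wt \<and>
        (\<forall>P. is_partition T P \<longrightarrow> partition_cost wt P \<le> q ^ 3 * min_partition_cost wt T \<longrightarrow>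
          partition_cost (cst \<sigma>) P \<le> q ^ 4 * min_partition_cost (cst \<sigma>) T)"
      by (rule inst) (use * sig He w7 in \<open>auto simp: N_def\<close>)
    then obtain wt where im: "implements F gi fe xe k H e (q - 1) w \<sigma> T wt"
      and transfer: "\<And>P. is_partition T P \<Longrightarrow> partition_cost wt P \<le> q ^ 3 * min_partition_cost wt T \<Longrightarrow>
          partition_cost (cst \<sigma>) P \<le> q ^ 4 * min_partition_cost (cst \<sigma>) T" by blast
    from im obtain X Fv Q0 G0 XB where "implementation X Fv Q0 G0 XB F gi fe xe k H e (q - 1) w \<sigma> T wt"
      unfolding implements_def by (elim exE)
    note im = this
    note I = implementation.X0[OF im] implementation.X_le[OF im] implementation.XB_le[OF im] implementation.G0_le[OF im]
      implementation.Q0_pos[OF im] implementation.G0_large[OF im] implementation.wt_admissible[OF im]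
      implementation.wt_unit[OF im] implementation.fe[OF im] implementation.xe[OF im] implementation.gi[OF im]
      implementation.estimate[OF im]
    interpret classes_count G0 N n p r by unfold_locales (use N *(1) z' pr in auto)
    define L where "L = number"
    define M where "M = 17 * N + L * block_size n (pack_bits b N)"
    have Lreal: "real L \<le> 2 + log z n" using number_bounds(4) unfolding L_def z'(1) .
    have LN: "L \<le> (2 + cL) * N"
    proof -
      have "ln (real n) \<le> n" using ln_le_minus_one[of "real n"] *(1) by simp
      then have "log z n \<le> n * (1 / ln z)" using lz by (simp add: log_def divide_right_mono)
      also have "1 / ln z \<le> cL" unfolding cL_def by linarith
      finally have "real L \<le> 2 + n * cL" using Lreal by (simp add: mult_left_mono)
      then have "L \<le> 2 + n * cL" by (metis of_nat_add of_nat_le_iff of_nat_mult of_nat_numeral)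
      also have "\<dots> \<le> (2 + cL) * N" unfolding N by simp
      finally show ?thesis .
    qed
    have "M \<le> (21 + 2 * cL) * N ^ 2"
    proof -
      have "block_size n (pack_bits b N) \<le> 2 * N" unfolding block_size_def N
        using div_le_dividend[of "2 * n" "pack_bits b (Suc n)"] by simp
      then have "L * block_size n (pack_bits b N) \<le> (2 + cL) * N * (2 * N)" using LN by (intro mult_le_mono)
      moreover have "17 * N \<le> 17 * N ^ 2" by (simp add: power2_eq_square)
      ultimately have "M \<le> 17 * N ^ 2 + (2 + cL) * N * (2 * N)" unfolding M_def by linarith
      also have "\<dots> = (21 + 2 * cL) * N ^ 2" by (simp add: power2_eq_square algebra_simps)
      finally show ?thesis .
    qed
    then have Mw: "M < 2 ^ w"
      by (intro fits'[of _ "21 + 2 * cL" 2]) (use Ka in \<open>auto simp: E_def\<close>)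
    define U where "U = (H + 5) * p * p * N ^ E"
    have Ne: "N \<le> N ^ (e + 1)" by simp
    have lev0: "n * lev 0 \<le> (H + 3) * N ^ (e + 2)"
    proof -
      have "lev 0 = G0 + 3 * N" by (simp add: level_def)
      also have "\<dots> \<le> H * N ^ e + 3 * N ^ (e + 1)" using I(4) Ne unfolding N_def by linarith
      also have "H * N ^ e \<le> H * N ^ (e + 1)" using N2 by (intro mult_le_mono power_increasing) auto
      finally have "lev 0 \<le> (H + 3) * N ^ (e + 1)" by (simp add: algebra_simps)
      then have "n * lev 0 \<le> N * ((H + 3) * N ^ (e + 1))" using N by (intro mult_le_mono) auto
      then show ?thesis by (simp add: mult.left_commute)
    qed
    have one: "1 \<le> N ^ (e + 2)" using N2 by simp
    have p1: "1 \<le> p" using pr by simp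
    have levc: "lev c \<le> (H + 4) * p * N ^ (e + 2)" if "c < L" for c
    proof -
      have "lev c \<le> n * lev 0 * p + 1" using level_le that by (simp add: L_def)
      also have "\<dots> \<le> (H + 3) * N ^ (e + 2) * p + N ^ (e + 2) * p"
        using mult_le_mono1[OF lev0, of p] mult_le_mono[OF one p1] by linarith
      finally show ?thesis by (simp add: algebra_simps)
    qed
    have Ee: "N ^ (e + 2) \<le> N ^ E" using N2 by (intro power_increasing) (auto simp: E_def)
    have levU: "lev c * p + 1 \<le> U" "lev c \<le> U" if "c < L" for c
    proof -
      have "lev c * p + 1 \<le> (H + 4) * p * N ^ (e + 2) * p + p * N ^ (e + 2) * p"
        using mult_le_mono1[OF levc[OF that], of p] mult_le_mono[OF mult_le_mono[OF p1 one] p1] by linarith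
      also have "\<dots> = (H + 5) * p * p * N ^ (e + 2)" by (simp add: algebra_simps)
      also have "\<dots> \<le> U" unfolding U_def using Ee by (rule mult_le_mono2)
      finally show 1: "lev c * p + 1 \<le> U" .
      have "lev c \<le> lev c * p" using p1 by simp
      with 1 show "lev c \<le> U" by linarith
    qed
    have lev0U: "n * lev 0 \<le> U"
    proof -
      have "(H + 3) * 1 \<le> (H + 5) * (p * p)" using mult_le_mono[OF p1 p1] by (intro mult_le_mono) auto
      then have "(H + 3) * N ^ (e + 2) \<le> (H + 5) * p * p * N ^ E" using Ee by (intro mult_le_mono) (simp_all add: mult.assoc)
      then show ?thesis using lev0 unfolding U_def by linarith
    qed
    have "4 * U < 2 ^ w" unfolding U_def by (rule fits[of _ "4 * ((H + 5) * p * p)"]) (use Ka in auto)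
    moreover have "(2::nat) ^ w = 4 * 2 ^ (w - 2)"
    proof -
      have "(2::nat) ^ w = 2 ^ Suc (Suc (w - 2))" using w7 by (intro arg_cong[where f = "\<lambda>x. 2 ^ x"]) simp
      then show ?thesis by simp
    qed
    ultimately have Uw: "4 * U < 2 ^ w" "U < 2 ^ (w - 2)" by simp_all
    have small: "2 * N + k < 2 ^ w" "4 * N * XB < 2 ^ w" "1 + (k + 2) * (D * N) < 2 ^ w" "p < 2 ^ w" "N ^ D < 2 ^ w"
    proof -
      have "2 * N + k \<le> (2 + k) * N ^ 1" using N2 by simp
      then show "2 * N + k < 2 ^ w" by (intro fits'[of _ "2 + k" 1]) (use Ka in \<open>auto simp: E_def\<close>)
      have "4 * N * XB \<le> 4 * N * (H * N ^ e)" using I(3) by (simp add: N_def)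
      also have "\<dots> = 4 * H * N ^ (e + 1)" by simp
      finally show "4 * N * XB < 2 ^ w" by (intro fits'[of _ "4 * H" "e + 1"]) (use Ka in \<open>auto simp: E_def\<close>)
      have "1 + (k + 2) * (D * N) \<le> (k + 4) * (D + 2) * N ^ 1" using N2 by (simp add: algebra_simps)
      then show "1 + (k + 2) * (D * N) < 2 ^ w"
        by (intro fits'[of _ "(k + 4) * (D + 2)" 1]) (use Ka in \<open>auto simp: E_def\<close>)
      show "p < 2 ^ w" by (intro fits'[of _ p 0]) (use Ka in auto)
    qed (rule ND)
    interpret tm: text_machine F w M T k
      by unfold_locales (use Mw w7 * small in \<open>auto simp: M_def N_def\<close>)
    have Lp: "0 < L" using number_bounds(3) by (simp add: L_def)
    have rp: "r \<le> p" using pr by simp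
    interpret program F w M T k X Fv fe xe gi \<sigma> Q0 G0 XB b D p r L "2 ^ (w - 2)" wt
    proof unfold_locales
      show "level G0 (cells T) p r c < 2 ^ (w - 2)" if "c < L" for c
        using levU(2)[OF that] Uw by (simp add: N_def)
      show "M = 17 * cells T + L * block_size (length T) (pack_bits b (cells T))"
        using *(2) by (simp add: M_def N_def)
      show "previous (level G0 (cells T) p r) c < length T * level G0 (cells T) p r 0" if "c < L" for c
        using number_bounds(2)[of c] that *(2) by (simp add: L_def N_def)
      show "length T * level G0 (cells T) p r 0 \<le> previous (level G0 (cells T) p r) L"
        using number_bounds(1) *(2) by (simp add: L_def N_def)
      show "level G0 (cells T) p r c * p + 1 < 2 ^ w" if "c < L" for c
        using levU(1)[OF that] Uw by (simp add: N_def)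
      show "length T * level G0 (cells T) p r 0 + level G0 (cells T) p r c < 2 ^ w" if "c < L" for c
        using levU(2)[OF that] lev0U Uw *(2) by (simp add: N_def)
      show "let g = apply_op w Sub (apply_op w Add (tm.gram_sum X k i (j - k)) (Fv (j - i) (card (tm.sym ` {i..<j}))))
          (tm.gram_sum X (k + 1) i (j - k)); x = real Q0 * wt (take (j - i) (drop i T))
        in g + cells T < 2 ^ w \<and> (\<bar>real g - x\<bar> \<le> cells T \<or> 2 ^ (w - 2) \<le> g \<and> real (2 ^ (w - 2)) \<le> x + cells T)"
        if "i < j" "j \<le> length T" for i j using I(12)[OF that] by simp
      show "real G0 \<le> real Q0 * wt [x] \<and> real Q0 * wt [x] \<le> real (G0 + 1)" if "x \<in> set T" for x
        using I(8)[OF that] by simp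
    qed (assumption | rule I times b0 bw[unfolded N_def] sig[unfolded N_def] small[unfolded N_def] z'(2) rp Lp *(3) tm.machine_axioms)+
    from run_program obtain t s where run: "run F w M (program_com gi xe fe k D b p r) (input_state w \<sigma> T) t s"
      "t \<le> time_bound" "output_in_memory M s" "good_output (output_partition T s)" by blast
    have part: "is_partition T (output_partition T s)" using run(4) by (simp add: good_output_def)
    have "0 \<le> min_partition_cost wt T"
    proof -
      have "min_partition_cost wt T \<in> partition_cost wt ` {P. is_partition T P}"
        unfolding min_partition_cost_def using finite_partitions[of T] ex_partition[of T] by (intro Min_in) auto
      then obtain P where P: "is_partition T P" "min_partition_cost wt T = partition_cost wt P" by auto
      have "0 \<le> wt S" if "S \<in> set P" for S
      proof -
        from that obtain Y Y' where "P = Y @ S # Y'" by (meson split_list)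
        with P(1) that have "S \<noteq> []" "sublist S T" by (auto simp: is_partition_def sublist_def)
        then show ?thesis using I(7) unfolding admissible_def by blast
      qed
      then show ?thesis unfolding P(2) partition_cost_def by (intro sum_list_nonneg) auto
    qed
    moreover have "z * (1 + (q - 1)) \<le> q ^ 3"
      using z(3) q mult_right_mono[of z "q\<^sup>2" q] by (simp add: power2_eq_square power3_eq_cube)
    ultimately have "z * (1 + (q - 1)) * min_partition_cost wt T \<le> q ^ 3 * min_partition_cost wt T"
      by (intro mult_right_mono)
    moreover have "partition_cost wt (output_partition T s) \<le> z * (1 + (q - 1)) * min_partition_cost wt T"
      by (rule good_output_bound) (use z' q I(6) run(4) in auto)
    ultimately have "partition_cost (cst \<sigma>) (output_partition T s) \<le> q ^ 4 * min_partition_cost (cst \<sigma>) T"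
      using part by (intro transfer) auto
    moreover have "real t \<le> real (100000 * (k + 3) * (a + A + 1)) * (real n * log (q ^ 4) (real n)) \<and>
        real M \<le> real (100000 * (k + 3) * (a + A + 1)) * real n" if n0: "n0 \<le> n"
    proof
      have n: "64 * b * b \<le> n" "q ^ 4 \<le> n" "4 \<le> n" using n0 unfolding n0_def by linarith+
      have q4: "1 < q ^ 4" using q by (simp add: one_less_power)
      define l where "l = log (q ^ 4) n"
      have l1: "1 \<le> l" unfolding l_def using q4 n by (simp add: le_log_iff)
      have "log z n \<le> log q n"
      proof -
        have zq: "q \<le> z" by (rule less_imp_le, rule z(2))
        have qp: "0 < q" using q by linarith
        have 1: "ln q \<le> ln z" by (rule ln_mono[OF zq qp])
        have 2: "0 < ln q" by (rule ln_gt_zero[OF q])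
        have "1 \<le> real n" using n(3) by linarith
        then have 3: "0 \<le> ln (real n)" by (rule ln_ge_zero)
        show ?thesis unfolding log_def by (rule divide_left_mono[OF 1 3 mult_pos_pos[OF less_le_trans[OF 2 1] 2]])
      qed
      also have "\<dots> = 4 * l" unfolding l_def using q *(1) by (intro log_base_scale) simp_all
      finally have Ll: "real (L + 1) \<le> 7 * l" using Lreal l1 by simp
      let ?C = "(k + 3) * (a + A + 1)"
      have "real t \<le> real time_bound" using run(2) by simp
      also have "\<dots> = 4000 * real ?C * (real (L + 1) * real N)"
        unfolding time_bound_def by (simp add: D_def N_def algebra_simps)
      also have "\<dots> \<le> 4000 * real ?C * ((7 * l) * (2 * n))"
        using Ll N n l1 by (intro mult_left_mono mult_mono) auto
      also have "\<dots> = 56000 * (real ?C * (n * l))" by (simp only: mult.assoc mult.left_commute) simp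
      also have "\<dots> \<le> 100000 * (real ?C * (n * l))" using l1 by (intro mult_right_mono mult_nonneg_nonneg) linarith+
      also have "\<dots> = 100000 * real ?C * (n * l)" by (simp only: mult.assoc)
      finally show "real t \<le> real (100000 * (k + 3) * (a + A + 1)) * (real n * log (q ^ 4) (real n))"
        unfolding l_def by (simp only: of_nat_mult of_nat_numeral mult.assoc)
    next
      have n: "64 * b * b \<le> n" "4 \<le> n" using n0 unfolding n0_def by linarith+
      have sb: "8 * b \<le> sqrt n"
      proof (rule real_le_rsqrt)
        show "(real (8 * b))\<^sup>2 \<le> n" using n(1) by (simp add: power2_eq_square flip: of_nat_mult)
      qed
      let ?g = "log 2 (real n)"
      have g2: "2 \<le> ?g" using n(2) by (simp add: le_log_iff)
      have small': "2 * (b * log 2 x) \<le> x" if "real n \<le> x" for x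
      proof -
        have x: "0 < x" using that n(2) by linarith
        have "2 * (b * log 2 x) \<le> 2 * (b * (4 * sqrt x))" using log2_le_sqrt[OF x] by (intro mult_left_mono) auto
        also have "\<dots> = 8 * b * sqrt x" by simp
        also have "\<dots> \<le> sqrt x * sqrt x" using sb that by (intro mult_right_mono) (auto intro: order_trans)
        finally show ?thesis using x by simp
      qed
      let ?lg = "nat \<lfloor>log 2 (real N)\<rfloor>"
      have lgN: "?g \<le> log 2 (real N)" using N n(2) by simp
      have lg: "?g / 2 \<le> ?lg" "real ?lg \<le> log 2 N" using lgN g2 by linarith+
      have "b * ?lg \<le> N"
      proof -
        have "real b * ?lg \<le> b * log 2 N" using lg by (intro mult_left_mono) auto
        also have "\<dots> \<le> N" using small'[of N] N lgN g2 by (auto intro: order_trans[of _ "2 * (b * log 2 (real N))"])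
        finally show ?thesis by (metis of_nat_le_iff of_nat_mult)
      qed
      then have B: "pack_bits b N = b * ?lg" by (simp add: pack_bits_def)
      have Lb: "real L \<le> b * ?g"
      proof -
        have "log z n = ?g * (1 / log 2 z)" using lz z1 by (simp add: log_def)
        then have "real L \<le> ?g * (1 + 1 / log 2 z)" using Lreal g2 by (simp add: algebra_simps)
        also have "\<dots> \<le> ?g * b" using b g2 by (intro mult_left_mono) auto
        finally show ?thesis by (simp add: mult.commute)
      qed
      have Bg: "b * ?g / 2 \<le> real (pack_bits b N)" unfolding B using mult_left_mono[OF lg(1), of b] by simp
      have bg: "0 < b * ?g" using b0 g2 by simp
      have "real (2 * n div pack_bits b N) \<le> real (2 * n) / pack_bits b N" by (rule of_nat_div_le_of_nat)
      also have "\<dots> \<le> real (2 * n) / (b * ?g / 2)" using Bg bg by (intro divide_left_mono) auto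
      finally have dv: "real (2 * n div pack_bits b N) \<le> 4 * n / (b * ?g)" by simp
      \<comment> \<open>There are at most \<open>b * log 2 n\<close> blocks, and a word packs at
        least half as many bits. The blocks therefore take \<open>4 * n\<close> words plus two per
        class.\<close>
      have "real M = 17 * real N + L * (2 + real (2 * n div pack_bits b N))"
        by (simp add: M_def block_size_def distrib_left mult.commute)
      also have "\<dots> \<le> 17 * real N + (b * ?g) * (2 + 4 * n / (b * ?g))"
        using Lb dv bg by (intro add_left_mono mult_mono) auto
      also have "\<dots> = 17 * real N + 2 * (b * ?g) + 4 * n"
      proof -
        have "x * (2 + 4 * y / x) = 2 * x + 4 * y" if "0 < x" for x y :: real using that by (simp add: field_simps)
        from this[OF bg, of n] show ?thesis by simp
      qed
      also have "\<dots> \<le> 17 * real N + n + 4 * n" using small'[of n] by simp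
      also have "\<dots> \<le> 100 * real n" using N n by simp
      also have "\<dots> \<le> 100000 * real ((k + 3) * (a + A + 1)) * n"
      proof (rule mult_right_mono)
        have "1 \<le> (k + 3) * (a + A + 1)" by simp
        then have "1 \<le> real ((k + 3) * (a + A + 1))" by (metis of_nat_1 of_nat_mono)
        then show "100 \<le> 100000 * real ((k + 3) * (a + A + 1))" by linarith
      qed simp
      finally show "real M \<le> real (100000 * (k + 3) * (a + A + 1)) * real n"
        by (simp only: of_nat_mult of_nat_numeral mult.assoc)
    qed
    ultimately show ?thesis using run part unfolding w_def by blast
  qed
  show ?thesis by (rule exI[of _ "program_com gi xe fe k D b p r"], rule exI[of _ d], rule exI[of _ n0],
    intro allI impI, elim conjE, rule main)
qed

section \<open>The two kinds of estimates\<close>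

lemma poly_less:
  fixes H N :: nat
  assumes "H * N ^ e \<le> 2 ^ w" "0 < N" "x \<le> c * N ^ i" "i \<le> e" "c < H"
  shows "x < 2 ^ w"
proof -
  have "c * N ^ i \<le> c * N ^ e" using assms(2,4) by (intro mult_le_mono power_increasing) auto
  also have "\<dots> < H * N ^ e" using assms(2,5) by simp
  finally show ?thesis using assms(1,3) by linarith
qed

lemma signed_word_nonneg:
  assumes "0 \<le> x" "2 * nat \<lfloor>x\<rfloor> < 2 ^ w" "0 < w"
  shows "signed_word w x = nat \<lfloor>x\<rfloor>"
proof -
  obtain u where u: "w = Suc u" using assms(3) by (cases w) auto
  define z where "z = \<lfloor>x\<rfloor>"
  have z: "0 \<le> z" using assms(1) by (simp add: z_def)
  have "nat z < 2 ^ u" using assms(2) by (simp add: u z_def)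
  then have zu: "z < 2 ^ u" using z by (simp add: nat_less_iff)
  then have "max (- (2 ^ (w - 1))) (min (2 ^ (w - 1) - 1) z) = z" using z by (simp add: u max_def min_def)
  moreover have "z mod 2 ^ w = z" using z zu by (simp add: u)
  ultimately show ?thesis unfolding signed_word_def z_def by simp
qed

lemma signed_word_le: "0 \<le> x \<Longrightarrow> 0 < w \<Longrightarrow>
  signed_word w x = nat (min (2 ^ (w - 1) - 1) \<lfloor>x\<rfloor>)"
proof -
  assume x: "0 \<le> x" and w: "0 < w"
  obtain u where u: "w = Suc u" using w by (cases w) auto
  let ?z = "min (2 ^ u - 1) \<lfloor>x\<rfloor>"
  have p: "(1::int) \<le> 2 ^ u" by simp
  have z: "0 \<le> ?z" "?z < 2 ^ u" using x p by linarith+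
  then have "max (- (2 ^ u)) ?z = ?z" using p by linarith
  moreover have "?z mod 2 ^ w = ?z" using z unfolding u power_Suc by (intro mod_pos_pos_trivial) linarith+
  ultimately show ?thesis unfolding signed_word_def u by simp
qed

lemma admissible_unit_le:
  assumes "admissible c T" "S \<noteq> []" "sublist S T"
  shows "c [hd S] \<le> c S"
proof -
  have "S = [] @ [hd S] @ tl S" using assms(2) by simp
  then have "sublist [hd S] S" unfolding sublist_def by metis
  then show ?thesis using assms unfolding admissible_def by blast
qed

lemma window_implementation:
  assumes T: "T \<noteq> []" "set T \<subseteq> {..<\<sigma>}"
    and w: "7 \<le> w" "2 * cells T + k < 2 ^ w" "17 * cells T < 2 ^ w" "4 * (length T * XB) < 2 ^ w"
    and \<phi>: "\<phi> 0 = 0" "\<And>S. 0 \<le> block_entropy \<phi> \<sigma> k S"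
    and wt: "\<And>S. S \<noteq> [] \<Longrightarrow> wt S = block_entropy \<phi> \<sigma> k S + y (length S) (card (set S))"
    and X: "X 0 = 0" "\<And>m. m \<le> length T \<Longrightarrow> real (X m) \<le> real Q0 * \<phi> m \<and> real Q0 * \<phi> m \<le> real (X m + m)" "\<And>m. X m \<le> m * XB"
    and bounds: "XB \<le> H * cells T ^ e" "G0 \<le> H * cells T ^ e" "0 < Q0" "3 * real (cells T) \<le> \<eta> * real G0" "3 * cells T \<le> G0"
    and adm: "admissible wt T"
    and unit: "real G0 \<le> real Q0 * y 1 1" "real Q0 * y 1 1 \<le> real G0 + 1"
    and Fv: "\<And>l ds. 0 < l \<Longrightarrow> l \<le> length T \<Longrightarrow> Fv l ds = signed_word w (real Q0 * y l ds)"
    and progs: "\<And>M v A. machine w M (cells T) \<Longrightarrow> v vn = length T \<Longrightarrow> v vN = cells T \<Longrightarrow> v vQ = Q0 \<Longrightarrow>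
      v vG = G0 \<Longrightarrow> v vi \<le> v vj \<Longrightarrow> v vj < length T \<Longrightarrow>
      machine.ok F w M (cells T) fe v A \<and> machine.ev F w fe v A = Fv (Suc (v vj) - v vi) (v vds')"
      "\<And>M v A. machine w M (cells T) \<Longrightarrow> v vn = length T \<Longrightarrow> v vN = cells T \<Longrightarrow> v vQ = Q0 \<Longrightarrow>
      v vp \<le> length T \<Longrightarrow> v vacc = (if v vp = 0 then 0 else X (v vp - 1)) \<Longrightarrow>
      machine.ok F w M (cells T) xe v A \<and> machine.ev F w xe v A = X (v vp)"
      "\<And>M v A. machine w M (cells T) \<Longrightarrow> v vn = length T \<Longrightarrow> v vN = cells T \<Longrightarrow> v 1 = \<sigma> \<Longrightarrow>
      machine.wp F w M (cells T) gi (\<lambda>v' A'. A' = A \<and> v' vQ = Q0 \<and> v' vG = G0 \<and>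
        (\<forall>x. x \<notin> {vQ, vG, vx, vy} \<longrightarrow> v' x = v x)) v A"
  shows "implementation X Fv Q0 G0 XB F gi fe xe k H e \<eta> w \<sigma> T wt"
proof -
  \<comment> \<open>The claim does not refer to the memory size, so the least admissible one serves
    to obtain the lemmas about windows.\<close>
  interpret text_machine F w "17 * cells T" T k by unfold_locales (use T w in auto)
  have unit': "wt [x] = y 1 1" for x
    using wt[of "[x]"] block_entropy_single[of \<phi> \<sigma> k x] \<phi>(1) by simp
  show ?thesis
  proof (rule implementation.intro)
    fix i j assume ij: "i < j" "j \<le> length T"
    let ?S = "take (j - i) (drop i T)"
    have S: "?S \<noteq> []" "length ?S = j - i" using ij by auto
    have "sublist ?S T" by (meson sublist_drop sublist_order.order_trans sublist_take)
    from admissible_unit_le[OF adm S(1) this] have "y 1 1 \<le> wt ?S" by (simp only: unit')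
    then have "real Q0 * y 1 1 \<le> real Q0 * wt ?S" by (intro mult_left_mono) auto
    then have big: "3 * real N \<le> real Q0 * wt ?S" using bounds(5) unit(1) by linarith
    have e: "real Q0 * wt ?S = real Q0 * block_entropy \<phi> \<sigma> k ?S + real Q0 * y (j - i) (card (sym ` {i..<j}))"
      unfolding wt[OF S(1)] S(2) set_window[OF ij] by (simp only: distrib_left)
    have f: "Fv (j - i) (card (sym ` {i..<j})) = signed_word w (real Q0 * y (j - i) (card (sym ` {i..<j})))"
      by (rule Fv) (use ij in auto)
    have "16 * N \<le> 2 ^ w" using w(3) by linarith
    moreover have "0 \<le> real Q0 * block_entropy \<phi> \<sigma> k ?S" using \<phi>(2) by simp
    ultimately show "let g = apply_op w Sub (apply_op w Add (gram_sum X k i (j - k)) (Fv (j - i) (card (sym ` {i..<j}))))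
         (gram_sum X (k + 1) i (j - k)); x = real Q0 * wt ?S
       in g + cells T < 2 ^ w \<and> (\<bar>real g - x\<bar> \<le> real (cells T) \<or> 2 ^ (w - 2) \<le> g \<and> 2 ^ (w - 2) \<le> x + real (cells T))"
      unfolding Let_def f e
      using big[unfolded e]
      by (intro window_estimate[where \<phi> = \<phi> and X = X and Q = "real Q0", OF ij T(2) \<phi>(1) X(2) X(3) _ w(4)]) simp_all
  next
    show "real G0 \<le> real Q0 * wt [x] \<and> real Q0 * wt [x] \<le> real G0 + 1" for x using unit by (simp only: unit')
  qed (assumption | rule X bounds adm progs)+
qed

text \<open>The program may optimize another weight \<open>wt\<close>, as long as partitions within
  the factor \<open>q ^ 3\<close> for \<open>wt\<close> are within the factor \<open>q ^ 4\<close>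
  for the cost.\<close>

definition approximable :: "estimate \<Rightarrow> nat \<Rightarrow> real \<Rightarrow> bool" where
  "approximable est k q \<longleftrightarrow> (\<exists>gi fe xe H e. expr_time fe \<le> 40 \<and> expr_time xe \<le> 40 \<and> loopfree_time gi \<le> 100 \<and>
     (\<forall>w \<sigma> T. T \<noteq> [] \<longrightarrow> set T \<subseteq> {..<\<sigma>} \<longrightarrow> \<sigma> < 2 ^ w \<longrightarrow> admissible (cost \<sigma> k est) T \<longrightarrow>
        H * cells T ^ e \<le> 2 ^ w \<longrightarrow> 7 \<le> w \<longrightarrow>
        (\<exists>wt. implements (extra_term est) gi fe xe k H e (q - 1) w \<sigma> T wt \<and>
          (\<forall>P. is_partition T P \<longrightarrow> partition_cost wt P \<le> q ^ 3 * min_partition_cost wt T \<longrightarrow>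
            partition_cost (cost \<sigma> k est) P \<le> q ^ 4 * min_partition_cost (cost \<sigma> k est) T))))"

lemma sublist_piece: "is_partition T P \<Longrightarrow> S \<in> set P \<Longrightarrow> S \<noteq> [] \<and> sublist S T"
proof -
  assume P: "is_partition T P" and S: "S \<in> set P"
  from S obtain Y Z where "P = Y @ S # Z" by (meson split_list)
  then show ?thesis using P S by (auto simp: is_partition_def sublist_def)
qed

lemma min_partition_cost_attained: "\<exists>P. is_partition T P \<and> min_partition_cost c T = partition_cost c P"
proof -
  have "min_partition_cost c T \<in> partition_cost c ` {P. is_partition T P}"
    unfolding min_partition_cost_def using finite_partitions[of T] ex_partition[of T] by (intro Min_in) auto
  then show ?thesis by auto
qed

lemma min_partition_cost_le: "is_partition T P \<Longrightarrow> min_partition_cost c T \<le> partition_cost c P"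
  unfolding min_partition_cost_def using finite_partitions[of T] by (intro Min_le) auto

lemma min_partition_cost_nonneg:
  assumes "admissible c T"
  shows "0 \<le> min_partition_cost c T"
proof -
  obtain P where P: "is_partition T P" "min_partition_cost c T = partition_cost c P"
    using min_partition_cost_attained by blast
  have "0 \<le> c S" if "S \<in> set P" for S using sublist_piece[OF P(1) that] assms unfolding admissible_def by blast
  then show ?thesis unfolding P(2) partition_cost_def by (intro sum_list_nonneg) auto
qed

lemma same_cost_transfer:
  assumes "1 < q" "admissible c T" "partition_cost c P \<le> q ^ 3 * min_partition_cost c T"
  shows "partition_cost c P \<le> q ^ 4 * min_partition_cost c T"
proof -
  have "q ^ 3 * min_partition_cost c T \<le> q ^ 4 * min_partition_cost c T"
    using assms(1) min_partition_cost_nonneg[OF assms(2)] by (intro mult_right_mono power_increasing) auto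
  then show ?thesis using assms(3) by linarith
qed

lemma log_zero: "log b 0 = 0"
  by (simp add: log_def)

lemma log2_le_self: "log 2 (real m) \<le> m"
proof (cases "m = 0")
  case False
  have "real m \<le> 2 ^ m" using less_exp[of m] by (metis less_imp_le of_nat_le_iff of_nat_numeral of_nat_power)
  then have "log 2 (real m) \<le> log 2 (2 ^ m)" using False by (intro log_mono) auto
  then show ?thesis by simp
qed (simp add: log_zero)

text \<open>The cost \<open>f 1 1\<close> of a single symbol is a positive constant on which the
  program may depend. A constant multiple of \<open>N\<close> as scale then makes it dominate the
  rounding errors, and the weight can be the cost itself.\<close>

lemma approximable_positive:
  assumes q: "1 < q" and c: "0 < f 1 1"
  shows "approximable (NonAdaptive f) k q"
proof -
  define \<eta> where "\<eta> = q - 1"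
  define c0 where "c0 = f 1 1"
  define C where "C = nat \<lceil>c0\<rceil>"
  \<comment> \<open>The scaled cost of a symbol becomes at least
    \<open>(3 / \<eta> + 4) * N\<close>. Rounding it down loses at most \<open>N\<close>, and the
    rest pays for \<open>3 * N \<le> \<eta> * G0\<close> as well as
    \<open>3 * N \<le> G0\<close>.\<close>
  define Kq where "Kq = nat \<lceil>(3 / \<eta> + 4) / c0\<rceil> + 1"
  define H where "H = 4 * (Kq * C) + 4 * Kq + 100 + k"
  define gi where "gi = Set vQ (Bin Mul (K Kq) (V vN)) ;; Set vG (Ext (V vQ) (K 1) (K 1))"
  define fe where "fe = Ext (V vQ) (Bin Sub (plus1 (V vj)) (V vi)) (V vds')"
  define xe where "xe = Bin Log (V vp) (Bin Mul (V vQ) (V vp))"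
  have \<eta>: "0 < \<eta>" using q by (simp add: \<eta>_def)
  have c0: "0 < c0" "f (Suc 0) (Suc 0) = c0" using c by (simp_all add: c0_def)
  have F: "extra_term (NonAdaptive f) = f" by (intro ext) simp
  have C: "c0 \<le> C" unfolding C_def by linarith
  have "(3 / \<eta> + 4) / c0 \<le> Kq" unfolding Kq_def by linarith
  then have Kq: "3 / \<eta> + 4 \<le> Kq * c0" "0 < Kq" using c0(1) by (simp_all add: pos_divide_le_eq Kq_def)
  have main: "implements f gi fe xe k H 3 \<eta> w \<sigma> T (cost \<sigma> k (NonAdaptive f))"
    if T: "T \<noteq> []" "set T \<subseteq> {..<\<sigma>}" and adm: "admissible (cost \<sigma> k (NonAdaptive f)) T"
      and Hw: "H * cells T ^ 3 \<le> 2 ^ w" and w7: "7 \<le> w" for w \<sigma> T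
  proof -
    define N where "N = cells T"
    define Q0 where "Q0 = Kq * N"
    define G0 where "G0 = nat \<lfloor>Q0 * c0\<rfloor>"
    \<comment> \<open>The value 0 beyond the text makes the bound \<open>m * (Q0 * N)\<close> valid
      for all \<open>m\<close>.\<close>
    define X where "X m = (if m \<le> length T then nat \<lfloor>real (Q0 * m) * log 2 (real m)\<rfloor> else 0)" for m
    have N: "N = Suc (length T)" by (simp add: N_def cells_def)
    then have N0: "0 < N" by simp
    have w1: "(1::nat) < 2 ^ w" using w7 by (intro one_less_power) simp_all
    note fits = poly_less[OF Hw[folded N_def] N0]
    have Q0: "0 < Q0" using Kq N0 by (simp add: Q0_def)
    have log0: "0 \<le> log 2 (real m)" for m by (cases "m = 0") (simp_all add: log_zero)
    have Xr: "real (X m) \<le> real (Q0 * m) * log 2 (real m)" "m \<le> length T \<Longrightarrow> real (Q0 * m) * log 2 (real m) \<le> X m + 1" for m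
      using log0[of m] by (auto simp: X_def) linarith
    have XN: "X m \<le> m * (Q0 * N)" for m
    proof (cases "m \<le> length T")
      case True
      have "log 2 (real m) \<le> N" using log2_le_self[of m] True N by linarith
      then have "real (Q0 * m) * log 2 (real m) \<le> real (Q0 * m) * N" by (intro mult_left_mono) auto
      with Xr(1)[of m] have "real (X m) \<le> real (Q0 * m * N)" unfolding of_nat_mult by linarith
      then show ?thesis by (simp only: of_nat_le_iff mult.assoc mult.left_commute)
    qed (simp add: X_def)
    have Qc: "(3 / \<eta> + 4) * N \<le> Q0 * c0" using mult_right_mono[OF Kq(1), of "real N"] by (simp add: Q0_def mult.commute mult.left_commute)
    have G0r: "real G0 \<le> Q0 * c0" "Q0 * c0 \<le> G0 + 1" 
    proof -
      have "0 \<le> Q0 * c0" using c0(1) by simp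
      then show "real G0 \<le> Q0 * c0" "Q0 * c0 \<le> G0 + 1" unfolding G0_def by linarith+
    qed
    have Gl: "(3 / \<eta>) * N + 3 * N \<le> G0"
    proof -
      have "1 \<le> real N" using N by simp
      then show ?thesis using Qc G0r(2) by (simp add: distrib_right)
    qed
    have G0C: "G0 \<le> Kq * C * N"
    proof -
      have "Q0 * c0 \<le> real Q0 * C" using C by (intro mult_left_mono) auto
      then have "real G0 \<le> real (Q0 * C)" using G0r(1) by simp
      then have "G0 \<le> Q0 * C" by (simp only: of_nat_le_iff)
      then show ?thesis by (simp add: Q0_def ac_simps)
    qed
    have s2: "2 * G0 < 2 ^ w" by (rule fits[of _ "2 * (Kq * C)" 1]) (use G0C in \<open>auto simp: H_def\<close>)
    have sw: "signed_word w (real Q0 * c0) = G0" unfolding G0_def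
      by (rule signed_word_nonneg) (use s2 c0(1) w7 in \<open>auto simp: G0_def\<close>)
    have Kw: "Kq < 2 ^ w" by (rule fits[of _ Kq 0]) (auto simp: H_def)
    have Qw: "Kq * N < 2 ^ w" by (rule fits[of _ Kq 1]) (auto simp: H_def)
    have Nw: "2 * N + k < 2 ^ w" by (rule fits[of _ "2 + k" 1]) (use N0 in \<open>auto simp: H_def\<close>)
    have Nw': "17 * N < 2 ^ w" by (rule fits[of _ 17 1]) (auto simp: H_def)
    have QNN: "Q0 * N * N = Kq * N ^ 3" by (simp add: Q0_def power3_eq_cube)
    have XB4: "4 * (length T * (Q0 * N)) < 2 ^ w"
    proof (rule fits[of _ "4 * Kq" 3])
      have "length T * (Q0 * N) \<le> N * (Q0 * N)" using N by (intro mult_le_mono1) simp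
      then have "length T * (Q0 * N) \<le> Kq * N ^ 3" by (simp only: QNN mult.commute[of N "Q0 * N"])
      from mult_le_mono2[OF this, of 4] show "4 * (length T * (Q0 * N)) \<le> 4 * Kq * N ^ 3" by (simp only: mult.assoc)
    qed (use Kq(2) in \<open>auto simp: H_def\<close>)
    have "implementation X (\<lambda>l ds. signed_word w (real Q0 * f l ds)) Q0 G0 (Q0 * N) f gi fe xe k H 3 \<eta> w \<sigma> T
       (cost \<sigma> k (NonAdaptive f))"
    proof (rule window_implementation[where \<phi> = "\<lambda>m. m * log 2 m" and y = f, OF T w7 Nw[unfolded N_def] Nw'[unfolded N_def] XB4])
      show "0 \<le> block_entropy (\<lambda>m. real m * log 2 (real m)) \<sigma> k S" for S
      proof (cases "S = []")
        case True
        then have "following u S = []" for u by (simp add: following_def)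
        then show ?thesis by (simp add: block_entropy_def)
      next
        case False
        then show ?thesis using length_Hk[of S \<sigma> k] Hk_nonneg[of \<sigma> k S] by (metis mult_nonneg_nonneg of_nat_0_le_iff)
      qed
      show "cost \<sigma> k (NonAdaptive f) S = block_entropy (\<lambda>m. real m * log 2 (real m)) \<sigma> k S + f (length S) (card (set S))"
        if "S \<noteq> []" for S using length_Hk[OF that] by simp
      show "real (X m) \<le> real Q0 * (real m * log 2 (real m)) \<and> real Q0 * (real m * log 2 (real m)) \<le> real (X m + m)"
        if "m \<le> length T" for m
      proof (cases "m = 0")
        case False
        then have "1 \<le> real m" by simp
        then show ?thesis using Xr(1)[of m] Xr(2)[OF that] by (simp add: mult.assoc)
      qed (simp add: X_def)
      show "Q0 * N \<le> H * cells T ^ 3"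
      proof -
        have "Q0 * N * 1 \<le> Q0 * N * N" using N0 by (intro mult_le_mono2) simp
        also have "\<dots> \<le> H * N ^ 3" unfolding QNN by (intro mult_le_mono1) (simp add: H_def)
        finally show ?thesis by (simp add: N_def)
      qed
      show "G0 \<le> H * cells T ^ 3"
      proof -
        have "Kq * C * N \<le> H * N ^ 3" using N0 by (intro mult_le_mono) (auto simp: H_def power3_eq_cube)
        then show ?thesis using G0C by (simp add: N_def)
      qed
      show "3 * real (cells T) \<le> \<eta> * real G0"
      proof -
        have "3 / \<eta> * N \<le> G0" using Gl by simp
        then show ?thesis using \<eta> by (simp add: N_def field_simps)
      qed
      have "0 \<le> 3 / \<eta> * N" using \<eta> by simp
      then show "3 * cells T \<le> G0" using Gl unfolding N_def by linarith
      show "X 0 = 0" by (simp add: X_def)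
      show "X m \<le> m * (Q0 * N)" for m by (rule XN)
      show "real G0 \<le> real Q0 * f 1 1" "real Q0 * f 1 1 \<le> real G0 + 1" using G0r by (simp_all add: c0)
      fix M v A assume m: "machine w M (cells T)" and v: "v vn = length T" "v vN = cells T"
      interpret m: machine f w M "cells T" by (rule m)
      { assume "v vQ = Q0" "v vG = G0" "v vi \<le> v vj" "v vj < length T"
        moreover from this have "v vj + 1 < 2 ^ w" using Nw N by linarith
        moreover have "(1::nat) < 2 ^ w" by (rule w1)
        ultimately show "m.ok fe v A \<and> m.ev fe v A = signed_word w (real Q0 * f (Suc (v vj) - v vi) (v vds'))"
          by (simp add: fe_def)
      next
        assume p: "v vQ = Q0" "v vp \<le> length T"
        have "Q0 * N < 2 ^ w" by (rule fits[of _ Kq 2]) (auto simp: Q0_def H_def power2_eq_square)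
        moreover have "Q0 * v vp \<le> Q0 * N" using p(2) N by (intro mult_le_mono2) simp
        ultimately have 1: "Q0 * v vp < 2 ^ w" by (rule le_less_trans[rotated])
        have 2: "X (v vp) = nat \<lfloor>real (Q0 * v vp) * log 2 (real (v vp))\<rfloor>" using p(2) by (simp add: X_def)
        have "v vp * (Q0 * N) \<le> length T * (Q0 * N)" using p(2) by (rule mult_le_mono1)
        then have 3: "X (v vp) < 2 ^ w" using XN[of "v vp"] XB4 by linarith
        show "m.ok xe v A \<and> m.ev xe v A = X (v vp)"
          using 1 2 3 p(1) by (simp add: xe_def)
      next
        assume "v 1 = \<sigma>"
        show "m.wp gi (\<lambda>v' A'. A' = A \<and> v' vQ = Q0 \<and> v' vG = G0 \<and> (\<forall>x. x \<notin> {vQ, vG, vx, vy} \<longrightarrow> v' x = v x)) v A"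
          using v w1 Kw Qw w7 sw by (simp add: gi_def Q0_def N_def c0) 
      }
    qed (use Q0 adm in auto)
    then show ?thesis unfolding implements_def by blast
  qed
  have transfer: "\<exists>wt. implements f gi fe xe k H 3 (q - 1) w \<sigma> T wt \<and>
          (\<forall>P. is_partition T P \<longrightarrow> partition_cost wt P \<le> q ^ 3 * min_partition_cost wt T \<longrightarrow>
            partition_cost (cost \<sigma> k (NonAdaptive f)) P \<le> q ^ 4 * min_partition_cost (cost \<sigma> k (NonAdaptive f)) T)"
    if a: "T \<noteq> []" "set T \<subseteq> {..<\<sigma>}" "admissible (cost \<sigma> k (NonAdaptive f)) T" "H * cells T ^ 3 \<le> 2 ^ w" "7 \<le> w" for w \<sigma> T
    by (rule exI[of _ "cost \<sigma> k (NonAdaptive f)"], intro conjI allI impI, rule main[OF a, unfolded \<eta>_def],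
      rule same_cost_transfer[OF q a(3)])
  show ?thesis unfolding approximable_def F
    by (rule exI[of _ gi], rule exI[of _ fe], rule exI[of _ xe], rule exI[of _ H], rule exI[of _ 3],
      intro conjI allI impI, simp add: fe_def, simp add: xe_def, simp add: gi_def, rule transfer)
qed

lemma signed_word_nat: "2 * m < 2 ^ w \<Longrightarrow> 0 < w \<Longrightarrow> signed_word w (real m) = m"
  using signed_word_nonneg[of "real m" w] by simp

lemma single_cost: "cost \<sigma> k (NonAdaptive f) [x] = f 1 1" "cost \<sigma> k (Adaptive g) [x] = g \<sigma>"
proof -
  have "block_entropy (\<lambda>m. real m * log 2 (real m)) \<sigma> k [x] = 0" by (rule block_entropy_single) simp
  then show "cost \<sigma> k (NonAdaptive f) [x] = f 1 1" using length_Hk[of "[x]" \<sigma> k] by simp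
  have "block_entropy (\<lambda>m. log 2 (fact m)) \<sigma> k [x] = 0" by (rule block_entropy_single) simp
  then show "cost \<sigma> k (Adaptive g) [x] = g \<sigma>" using length_Hka[of "[x]" \<sigma> k] by simp
qed

text \<open>Single symbols then cost nothing, so that no scale makes their cost a large word. The partition into
  single symbols has cost 0, and the weight used here makes any other partition too expensive.\<close>

lemma approximable_nonpositive:
  assumes q: "1 < q" and c: "f 1 1 \<le> 0"
  shows "approximable (NonAdaptive f) k q"
proof -
  define \<eta> where "\<eta> = q - 1"
  \<comment> \<open>A piece of two or more symbols will weigh at least
    \<open>1 + \<kappa> * N\<close>. This exceeds \<open>q ^ 3\<close> times the weight of the
    single symbols, which is \<open>n\<close>.\<close>
  define \<kappa> where "\<kappa> = nat \<lceil>q ^ 3\<rceil> + 1"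
  define K1 where "K1 = nat \<lceil>3 / \<eta>\<rceil> + 3"
  define H where "H = 4 * (K1 * (\<kappa> + 1)) + 100 + k"
  define gi where "gi = Set vQ (Bin Mul (K K1) (V vN)) ;; Set vG (V vQ)"
  define fe where "fe = Bin Mul (V vG) (plus1 (Bin Mul (Bin Sub (V vj) (V vi)) (Bin Mul (K \<kappa>) (V vN))))"
  define xe where "xe = K 0"
  have \<eta>: "0 < \<eta>" using q by (simp add: \<eta>_def)
  have F: "extra_term (NonAdaptive f) = f" by (intro ext) simp
  have \<kappa>: "q ^ 3 \<le> \<kappa>" unfolding \<kappa>_def by linarith
  have K1: "3 / \<eta> \<le> K1" "3 \<le> K1" unfolding K1_def by linarith+
  have main: "\<exists>wt. implements f gi fe xe k H 3 \<eta> w \<sigma> T wt \<and>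
          (\<forall>P. is_partition T P \<longrightarrow> partition_cost wt P \<le> q ^ 3 * min_partition_cost wt T \<longrightarrow>
            partition_cost (cost \<sigma> k (NonAdaptive f)) P \<le> q ^ 4 * min_partition_cost (cost \<sigma> k (NonAdaptive f)) T)"
    if T: "T \<noteq> []" "set T \<subseteq> {..<\<sigma>}" and adm: "admissible (cost \<sigma> k (NonAdaptive f)) T"
      and Hw: "H * cells T ^ 3 \<le> 2 ^ w" and w7: "7 \<le> w" for w \<sigma> T
  proof -
    define N where "N = cells T"
    define Q0 where "Q0 = K1 * N"
    define y where "y = (\<lambda>l ds::nat. 1 + real (l - 1) * real (\<kappa> * N))"
    define wt where "wt S = y (length S) 0" for S :: "nat list"
    define Fv where "Fv = (\<lambda>l ds::nat. Q0 * ((l - 1) * (\<kappa> * N) + 1))"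
    have N: "N = Suc (length T)" by (simp add: N_def cells_def)
    then have N0: "0 < N" by simp
    have w1: "(1::nat) < 2 ^ w" using w7 by (intro one_less_power) simp_all
    note fits = poly_less[OF Hw[folded N_def] N0]
    have Q0: "0 < Q0" using K1 N0 by (simp add: Q0_def)
    have KK: "K1 \<le> K1 * (\<kappa> + 1)" "\<kappa> \<le> K1 * (\<kappa> + 1)"
      using K1(2) mult_le_mono[of 1 K1 \<kappa> "\<kappa> + 1"] by simp_all
    have Kw: "K1 < 2 ^ w" by (rule fits[of _ K1 0]) (use KK in \<open>auto simp: H_def\<close>)
    have \<kappa>w: "\<kappa> < 2 ^ w" by (rule fits[of _ \<kappa> 0]) (use KK in \<open>auto simp: H_def\<close>)
    have Qw: "K1 * N < 2 ^ w" by (rule fits[of _ K1 1]) (use KK in \<open>auto simp: H_def\<close>)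
    have \<kappa>N: "\<kappa> * N < 2 ^ w" by (rule fits[of _ \<kappa> 1]) (use KK in \<open>auto simp: H_def\<close>)
    have Nw: "2 * N + k < 2 ^ w" by (rule fits[of _ "2 + k" 1]) (use N0 in \<open>auto simp: H_def\<close>)
    have Nw': "17 * N < 2 ^ w" by (rule fits[of _ 17 1]) (auto simp: H_def)
    have inner: "(l - 1) * (\<kappa> * N) + 1 \<le> (\<kappa> + 1) * (N * N)" if "l \<le> N" for l
    proof -
      have "(l - 1) * (\<kappa> * N) \<le> N * (\<kappa> * N)" using that by (intro mult_le_mono1) simp
      moreover have "1 \<le> N * N" using N0 by simp
      moreover have "(\<kappa> + 1) * (N * N) = N * (\<kappa> * N) + N * N" by (simp add: algebra_simps)
      ultimately show ?thesis by linarith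
    qed
    have Fw: "2 * Fv l ds < 2 ^ w" if "l \<le> N" for l ds
    proof (rule fits[of _ "2 * (K1 * (\<kappa> + 1))" 3])
      have "Fv l ds \<le> K1 * N * ((\<kappa> + 1) * (N * N))" unfolding Fv_def Q0_def by (intro mult_le_mono2 inner that)
      also have "\<dots> = K1 * (\<kappa> + 1) * N ^ 3" by (simp only: power3_eq_cube ac_simps)
      finally have "Fv l ds \<le> K1 * (\<kappa> + 1) * N ^ 3" .
      from mult_le_mono2[OF this, of 2] show "2 * Fv l ds \<le> 2 * (K1 * (\<kappa> + 1)) * N ^ 3" by (simp only: mult.assoc)
    qed (auto simp: H_def)
    have Fr: "real (Fv l ds) = real Q0 * y l ds" for l ds
      unfolding Fv_def y_def of_nat_mult of_nat_add of_nat_1 by (simp only: add.commute)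
    have adm_wt: "admissible wt T" unfolding admissible_def
    proof (intro allI impI, elim conjE)
      fix S S' :: "nat list" assume "sublist S S'"
      then have "length S \<le> length S'" by (rule sublist_length_le)
      then have "real (length S - 1) * real (\<kappa> * N) \<le> real (length S' - 1) * real (\<kappa> * N)" by (intro mult_right_mono) auto
      then show "0 \<le> wt S \<and> wt S \<le> wt S'" unfolding wt_def y_def by simp
    qed
    have "implementation (\<lambda>_. 0) Fv Q0 Q0 0 f gi fe xe k H 3 \<eta> w \<sigma> T wt"
    proof (rule window_implementation[where \<phi> = "\<lambda>_. 0" and y = y, OF T w7 Nw[unfolded N_def] Nw'[unfolded N_def]])
      show "wt S = block_entropy (\<lambda>_. 0) \<sigma> k S + y (length S) (card (set S))" for S
        by (simp add: wt_def y_def block_entropy_def)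
      show "Q0 \<le> H * cells T ^ 3"
      proof -
        have "K1 * N \<le> H * N ^ 3" using N0 KK by (intro mult_le_mono) (auto simp: H_def power3_eq_cube)
        then show ?thesis by (simp add: N_def Q0_def)
      qed
      show "3 * real (cells T) \<le> \<eta> * real Q0"
      proof -
        have "3 \<le> \<eta> * K1" using K1(1) \<eta> by (simp add: pos_divide_le_eq mult.commute)
        from mult_right_mono[OF this, of "real N"] show ?thesis by (simp add: N_def Q0_def mult.assoc)
      qed
      show "3 * cells T \<le> Q0" using K1(2) by (simp add: Q0_def N_def)
      show "real Q0 \<le> real Q0 * y 1 1" "real Q0 * y 1 1 \<le> real Q0 + 1" by (simp_all add: y_def)
      show "Fv l ds = signed_word w (real Q0 * y l ds)" if "0 < l" "l \<le> length T" for l ds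
        unfolding Fr[symmetric] by (rule signed_word_nat[symmetric]) (use Fw[of l ds] that N w7 in auto)
      fix M v A assume m: "machine w M (cells T)" and v: "v vn = length T" "v vN = cells T"
      interpret m: machine f w M "cells T" by (rule m)
      { assume p: "v vQ = Q0" "v vG = Q0" "v vi \<le> v vj" "v vj < length T"
        let ?l = "Suc (v vj) - v vi"
        have l: "?l - 1 = v vj - v vi" "?l \<le> N" using p N by auto
        have F1: "Q0 * ((v vj - v vi) * (\<kappa> * N) + 1) < 2 ^ w" using Fw[OF l(2), of 0] unfolding Fv_def l(1) by linarith
        have "1 * ((v vj - v vi) * (\<kappa> * N) + 1) \<le> Q0 * ((v vj - v vi) * (\<kappa> * N) + 1)" using Q0 by (intro mult_le_mono1) simp
        from le_less_trans[OF this F1] have F2: "(v vj - v vi) * (\<kappa> * N) + 1 < 2 ^ w" by (simp only: mult_1)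
        have F3: "(v vj - v vi) * (\<kappa> * N) < 2 ^ w" by (rule less_trans[OF _ F2]) simp
        show "m.ok fe v A \<and> m.ev fe v A = Fv ?l (v vds')"
          using w1 p v \<kappa>w \<kappa>N F1 F2 F3 unfolding Fv_def l(1) by (simp add: fe_def N_def)
      next
        show "m.ok xe v A \<and> m.ev xe v A = 0" by (simp add: xe_def)
      next
        assume "v 1 = \<sigma>"
        show "m.wp gi (\<lambda>v' A'. A' = A \<and> v' vQ = Q0 \<and> v' vG = Q0 \<and> (\<forall>x. x \<notin> {vQ, vG, vx, vy} \<longrightarrow> v' x = v x)) v A"
          using v Kw Qw by (simp add: gi_def Q0_def N_def)
      }
    qed (use Q0 adm_wt in \<open>auto simp: block_entropy_def\<close>)
    then have "implements f gi fe xe k H 3 \<eta> w \<sigma> T wt" unfolding implements_def by blast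
    moreover have "partition_cost (cost \<sigma> k (NonAdaptive f)) P \<le> q ^ 4 * min_partition_cost (cost \<sigma> k (NonAdaptive f)) T"
      if P: "is_partition T P" and le: "partition_cost wt P \<le> q ^ 3 * min_partition_cost wt T" for P
    proof -
      have "is_partition T (map (\<lambda>x. [x]) T)" by (auto simp: is_partition_def)
      from min_partition_cost_le[OF this, of wt] have "min_partition_cost wt T \<le> length T"
        by (simp add: partition_cost_def wt_def y_def o_def sum_list_triv)
      then have "q ^ 3 * min_partition_cost wt T \<le> q ^ 3 * length T" using q by (intro mult_left_mono) auto
      also have "\<dots> \<le> real \<kappa> * real (length T)" using \<kappa> by (intro mult_right_mono) auto
      also have "\<dots> \<le> real (\<kappa> * N)" unfolding N by (simp add: mult_left_mono)
      finally have small: "partition_cost wt P \<le> real (\<kappa> * N)" using le by linarith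
      \<comment> \<open>The computed partition can only consist of single symbols. Each of them
        costs \<open>f 1 1 \<le> 0\<close>, while the optimum is not negative.\<close>
      have "cost \<sigma> k (NonAdaptive f) S \<le> 0" if S: "S \<in> set P" for S
      proof -
        have ne: "S \<noteq> []" using sublist_piece[OF P S] by blast
        obtain Y Z where YZ: "P = Y @ S # Z" using S by (meson split_list)
        have "0 \<le> sum_list (map wt Y)" "0 \<le> sum_list (map wt Z)" by (auto intro!: sum_list_nonneg simp: wt_def y_def)
        then have "wt S \<le> real (\<kappa> * N)" using small unfolding partition_cost_def YZ by simp
        moreover have "1 + real (\<kappa> * N) \<le> wt S" if "2 \<le> length S"
        proof -
          have "1 * real (\<kappa> * N) \<le> real (length S - 1) * real (\<kappa> * N)" using that by (intro mult_right_mono) auto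
          then show ?thesis by (simp add: wt_def y_def)
        qed
        ultimately have "length S < 2" by linarith
        then obtain x where "S = [x]" using ne by (cases S) auto
        then show ?thesis using c by (simp only: single_cost)
      qed
      then have "partition_cost (cost \<sigma> k (NonAdaptive f)) P \<le> sum_list (map (\<lambda>_. 0) P)"
        unfolding partition_cost_def by (intro sum_list_mono)
      moreover have "0 \<le> q ^ 4 * min_partition_cost (cost \<sigma> k (NonAdaptive f)) T"
        using q min_partition_cost_nonneg[OF adm] by simp
      ultimately show ?thesis by simp
    qed
    ultimately show ?thesis by blast
  qed
  show ?thesis unfolding approximable_def F
    by (rule exI[of _ gi], rule exI[of _ fe], rule exI[of _ xe], rule exI[of _ H], rule exI[of _ 3],
      intro conjI allI impI, simp add: fe_def, simp add: xe_def, simp add: gi_def, rule main[unfolded \<eta>_def])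
qed

text \<open>A saturated word equals \<open>2 ^ (w - 1) - 1\<close> and is larger than
  \<open>m\<close>. A word of at most \<open>m\<close> is thus the plain integer part.\<close>

lemma signed_word_bounds:
  assumes "0 \<le> x" "0 < w"
  shows "real (signed_word w x) \<le> x"
    and "2 * (m + 1) < 2 ^ w \<Longrightarrow> signed_word w x \<le> m \<Longrightarrow> x < real (signed_word w x) + 1"
proof -
  obtain u where u: "w = Suc u" using assms(2) by (cases w) auto
  define s where "s = min (2 ^ u - 1) \<lfloor>x\<rfloor>"
  have p: "(1::int) \<le> 2 ^ u" by simp
  have "signed_word w x = nat s" using signed_word_le[OF assms] by (simp add: u s_def)
  moreover have "0 \<le> s" using assms(1) p unfolding s_def by linarith
  ultimately have s: "int (signed_word w x) = s" by simp
  then have r: "real (signed_word w x) = real_of_int s" by (metis of_int_of_nat_eq)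
  show "real (signed_word w x) \<le> x" unfolding r s_def by linarith
  assume m: "2 * (m + 1) < 2 ^ w" "signed_word w x \<le> m"
  have "m + 1 < 2 ^ u" using m(1) by (simp add: u)
  then have "int (m + 1) < int (2 ^ u)" by (simp only: of_nat_less_iff)
  then have "s < 2 ^ u - 1" using m(2) s by simp
  then have "s = \<lfloor>x\<rfloor>" unfolding s_def by linarith
  then show "x < real (signed_word w x) + 1" unfolding r by linarith
qed

section \<open>Adaptive estimates with an extreme additive term\<close>

lemma (in text_machine) block_entropy_le:
  fixes b :: real
  assumes "set T \<subseteq> {..<\<sigma>}" "\<phi> 0 = 0" "\<And>m. 0 \<le> \<phi> m" "\<And>m. m \<le> n \<Longrightarrow> \<phi> m \<le> real m * b" "0 \<le> b"
  shows "block_entropy \<phi> \<sigma> k T \<le> n * b"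
proof -
  let ?c = "\<lambda>u. card {q. 0 \<le> q \<and> q < n - k \<and> gram k q = u}"
  have "block_entropy \<phi> \<sigma> k T = gram_val \<phi> k 0 (n - k) - gram_val \<phi> (k + 1) 0 (n - k)"
    using block_entropy_window[of 0 n \<sigma> \<phi>] n_pos assms(1,2) by simp
  moreover have "0 \<le> gram_val \<phi> (k + 1) 0 (n - k)" unfolding gram_val_def by (intro sum_nonneg assms)
  moreover have "gram_val \<phi> k 0 (n - k) \<le> (\<Sum>u\<in>gram k ` {0..<n - k}. real (?c u) * b)"
    unfolding gram_val_def
  proof (intro sum_mono assms(4))
    fix u
    have "?c u \<le> card {..<n - k}" by (intro card_mono) auto
    then show "?c u \<le> n" by simp
  qed
  moreover have "(\<Sum>u\<in>gram k ` {0..<n - k}. real (?c u) * b) = real (n - k - 0) * b"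
    by (simp only: sum_card_grams flip: sum_distrib_right of_nat_sum)
  moreover have "real (n - k - 0) * b \<le> n * b" using assms(5) by (intro mult_right_mono) auto
  ultimately show ?thesis by linarith
qed

lemma log2_fact_Suc: "log 2 (fact (Suc m)) = log 2 (real (Suc m)) + log 2 (fact m)"
  unfolding fact_Suc by (simp add: log_mult del: of_nat_Suc)

lemma log2_fact_nonneg: "0 \<le> log 2 (fact m)"
  by (subst zero_le_log_cancel_iff) (auto simp: fact_ge_1)

lemma log2_fact_le: "log 2 (fact m) \<le> real m * real m"
proof (induction m)
  case (Suc m)
  then show ?case unfolding log2_fact_Suc using log2_le_self[of "Suc m"] by (simp add: algebra_simps)
qed simp

lemma sum_list_gap:
  fixes h :: "'a \<Rightarrow> real"
  shows "(\<And>x. h x = 0 \<or> 1 \<le> h x) \<Longrightarrow> sum_list (map h xs) = 0 \<or> 1 \<le> sum_list (map h xs)"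
proof (induction xs)
  case (Cons a xs)
  then have "sum_list (map h xs) = 0 \<or> 1 \<le> sum_list (map h xs)" by blast
  then show ?case using Cons.prems[of a] by (elim disjE) simp_all
qed simp

text \<open>The additive term \<open>\<gamma>\<close> may be too small or too large for a word. It is then replaced by \<open>\<gamma>'\<close>: for small
  \<open>\<gamma>\<close> the number of pieces matters only between partitions of entropy 0, and for large \<open>\<gamma>\<close> the entropy
  does not matter.\<close>

lemma adaptive_transfer_low:
  fixes h h' p p' n :: real
  assumes "1 < q" "h' + p' * \<gamma>' \<le> q ^ 3 * (h + p * \<gamma>')" "0 \<le> \<gamma>" "\<gamma> \<le> \<gamma>'" "0 < \<gamma>'" "p \<le> n" "0 \<le> p" "0 \<le> p'"
    "n * \<gamma>' \<le> q - 1" "q ^ 3 * (n * \<gamma>') < 1" "h = 0 \<or> 1 \<le> h" "h' = 0 \<or> 1 \<le> h'"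
  shows "h' + p' * \<gamma> \<le> q ^ 4 * (h + p * \<gamma>)"
proof -
  have q3: "0 < q ^ 3" "q ^ 3 \<le> q ^ 4" using assms(1) by (simp_all add: power_increasing)
  have pn: "p * \<gamma>' \<le> n * \<gamma>'" using assms(5,6) by (intro mult_right_mono) auto
  have p\<gamma>: "0 \<le> p * \<gamma>" "p' * \<gamma> \<le> p' * \<gamma>'" using assms by (simp_all add: mult_left_mono)
  from assms(11) show ?thesis
  proof
    \<comment> \<open>A nonzero entropy is at least 1 and dominates the total additive term of
      \<open>n\<close> pieces, which is at most \<open>q - 1\<close>.\<close>
    assume h: "1 \<le> h"
    have "(q - 1) * 1 \<le> (q - 1) * h" using assms(1) h by (intro mult_left_mono) auto
    then have "h + p * \<gamma>' \<le> q * h" using pn assms(9) by (simp add: left_diff_distrib)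
    then have "q ^ 3 * (h + p * \<gamma>') \<le> q ^ 3 * (q * h)" using q3 by (intro mult_left_mono) auto
    also have "\<dots> = q ^ 4 * h" by (simp add: power3_eq_cube power4_eq_xxxx)
    also have "\<dots> \<le> q ^ 4 * (h + p * \<gamma>)" using p\<gamma>(1) q3 by (intro mult_left_mono) auto
    finally show ?thesis using assms(2) p\<gamma>(2) by linarith
  next
    \<comment> \<open>The whole bound is then below 1, and by the gap the entropy \<open>h'\<close>
      must vanish too. Only the numbers of pieces remain to be compared.\<close>
    assume h: "h = 0"
    have "q ^ 3 * (p * \<gamma>') \<le> q ^ 3 * (n * \<gamma>')" using pn q3 by (intro mult_left_mono) auto
    moreover have "0 \<le> p' * \<gamma>'" using assms by simp
    moreover have "h' + p' * \<gamma>' \<le> q ^ 3 * (p * \<gamma>')" using assms(2) by (simp add: h)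
    ultimately have "h' < 1" using assms(10) by linarith
    then have h': "h' = 0" using assms(12) by linarith
    have "p' * \<gamma>' \<le> (q ^ 3 * p) * \<gamma>'" using assms(2) unfolding h h' by simp
    then have "p' \<le> q ^ 3 * p" using assms(5) by simp
    then have "p' * \<gamma> \<le> (q ^ 3 * p) * \<gamma>" using assms(3) by (intro mult_right_mono)
    also have "\<dots> = q ^ 3 * (p * \<gamma>)" by simp
    also have "\<dots> \<le> q ^ 4 * (p * \<gamma>)" using q3 p\<gamma>(1) by (intro mult_right_mono) auto
    finally show ?thesis unfolding h h' by simp
  qed
qed

text \<open>As the entropy is at most \<open>(q - 1) * \<gamma>'\<close>, the assumption forces
  \<open>p' \<le> q ^ 4 * p\<close>. The surplus \<open>\<gamma> - \<gamma>'\<close> of each piece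
  is then paid at the same ratio.\<close>

lemma adaptive_transfer_high:
  fixes h h' p p' :: real
  assumes "1 < q" "h' + p' * \<gamma>' \<le> q ^ 3 * (h + p * \<gamma>')" "0 < \<gamma>'" "\<gamma>' \<le> \<gamma>" "1 \<le> p" "0 \<le> h'" "0 \<le> h" "h \<le> (q - 1) * \<gamma>'"
  shows "h' + p' * \<gamma> \<le> q ^ 4 * (h + p * \<gamma>)"
proof -
  have q3: "0 < q ^ 3" "q ^ 3 \<le> q ^ 4" using assms(1) by (simp_all add: power_increasing)
  have "(q - 1) * \<gamma>' * 1 \<le> (q - 1) * \<gamma>' * p" using assms by (intro mult_left_mono) auto
  then have "h + p * \<gamma>' \<le> q * (p * \<gamma>')" using assms(8) by (simp add: algebra_simps)
  then have "q ^ 3 * (h + p * \<gamma>') \<le> q ^ 3 * (q * (p * \<gamma>'))" using q3 by (intro mult_left_mono) auto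
  also have "\<dots> = (q ^ 4 * p) * \<gamma>'" by (simp add: power3_eq_cube power4_eq_xxxx)
  finally have "p' * \<gamma>' \<le> (q ^ 4 * p) * \<gamma>'" using assms(2,6) by linarith
  then have "p' \<le> q ^ 4 * p" using assms(3) by simp
  then have "p' * (\<gamma> - \<gamma>') \<le> (q ^ 4 * p) * (\<gamma> - \<gamma>')" using assms(4) by (intro mult_right_mono) auto
  moreover have "q ^ 3 * (h + p * \<gamma>') \<le> q ^ 4 * (h + p * \<gamma>')" using assms q3 by (intro mult_right_mono) auto
  ultimately show ?thesis using assms(2) by (simp add: algebra_simps)
qed

lemma approximable_adaptive:
  assumes q: "1 < q"
  shows "approximable (Adaptive g) k q"
proof -
  define \<eta> where "\<eta> = q - 1"
  \<comment> \<open>The least scaled additive term that is used is \<open>Gl = K1 * N\<close>, just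
    enough for \<open>3 * N \<le> \<eta> * Gl\<close> and \<open>3 * N \<le> Gl\<close>.\<close>
  define K1 where "K1 = nat \<lceil>3 / \<eta>\<rceil> + 3"
  \<comment> \<open>With the scale \<open>K2 * N\<^sup>2\<close>, raising a small term to
    \<open>Gl\<close> means \<open>\<gamma>' = K1 / (K2 * N)\<close>. Then
    \<open>N * \<gamma>'\<close> is at most \<eta>, and below 1 even after multiplication by
    \<open>q ^ 3\<close>.\<close>
  define K2 where "K2 = nat \<lceil>q ^ 3 * K1 + K1 / \<eta>\<rceil> + 1"
  \<comment> \<open>A large term is lowered to \<open>\<gamma>' = K3 * N ^ 3\<close>. The pieces of
    a partition have total entropy at most \<open>N ^ 3\<close>, hence at most
    \<open>(q - 1) * \<gamma>'\<close>.\<close>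
  define K3 where "K3 = nat \<lceil>1 / \<eta>\<rceil> + 1"
  define H where "H = 4 * K1 + 4 * (K2 * K3) + 4 * K2 + 4 * K3 + 100 + k"
  \<comment> \<open>The scaled additive term is clamped to the interval from \<open>Gl\<close> to
    \<open>Gh\<close>. A saturated word lies above \<open>Gh\<close> and is lowered as well, so its
    inaccuracy does not matter.\<close>
  define gi where "gi = Set vQ (Bin Mul (K K2) (Bin Mul (V vN) (V vN))) ;; Set vG (Ext (V vQ) (V 1) (V 1)) ;;
     If (Lt (V vG) (Bin Mul (K K1) (V vN))) (Set vG (Bin Mul (K K1) (V vN))) NOP ;;
     Set vx (Bin Mul (V vQ) (Bin Mul (K K3) (Bin Mul (V vN) (Bin Mul (V vN) (V vN))))) ;;
     If (Lt (V vx) (V vG)) (Set vG (V vx)) NOP"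
  define fe where "fe = V vG"
  define xe where "xe = Bin Add (V vacc) (Bin Log (V vp) (V vQ))"
  let ?\<phi> = "\<lambda>m::nat. log 2 (fact m :: real)"
  have \<eta>: "0 < \<eta>" using q by (simp add: \<eta>_def)
  have F: "extra_term (Adaptive g) = (\<lambda>x y. g x)" by (intro ext) simp
  have K1: "3 / \<eta> \<le> K1" "3 \<le> K1" unfolding K1_def by linarith+
  have q1: "1 \<le> q ^ 3" using q by simp
  have "q ^ 3 * K1 + K1 / \<eta> + 1 \<le> K2" unfolding K2_def by linarith
  moreover have "0 \<le> K1 / \<eta>" "0 \<le> q ^ 3 * K1" using \<eta> q by simp_all
  ultimately have K2: "q ^ 3 * K1 < K2" "K1 / \<eta> \<le> K2" by linarith+
  have "1 * real K1 \<le> q ^ 3 * K1" using q1 by (intro mult_right_mono) auto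
  then have K12: "K1 \<le> K2" using K2(1) by simp
  have K3: "1 / \<eta> \<le> K3" "1 \<le> K3" unfolding K3_def by linarith+
  have main: "\<exists>wt. implements (\<lambda>x y. g x) gi fe xe k H 5 \<eta> w \<sigma> T wt \<and>
          (\<forall>P. is_partition T P \<longrightarrow> partition_cost wt P \<le> q ^ 3 * min_partition_cost wt T \<longrightarrow>
            partition_cost (cost \<sigma> k (Adaptive g)) P \<le> q ^ 4 * min_partition_cost (cost \<sigma> k (Adaptive g)) T)"
    if T: "T \<noteq> []" "set T \<subseteq> {..<\<sigma>}" and adm: "admissible (cost \<sigma> k (Adaptive g)) T"
      and Hw: "H * cells T ^ 5 \<le> 2 ^ w" and w7: "7 \<le> w" for w \<sigma> T
  proof -
    define N where "N = cells T"
    define Q0 where "Q0 = K2 * (N * N)"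
    define Gl where "Gl = K1 * N"
    define Gh where "Gh = Q0 * (K3 * (N * (N * N)))"
    define \<gamma> where "\<gamma> = g \<sigma>"
    define s where "s = signed_word w (real Q0 * \<gamma>)"
    define s1 where "s1 = (if s < Gl then Gl else s)"
    define G0 where "G0 = (if Gh < s1 then Gh else s1)"
    define \<gamma>' where "\<gamma>' = (if s < Gl then Gl / Q0 else if Gh < s then Gh / Q0 else \<gamma>)"
    \<comment> \<open>Each summand is rounded down, so the error at \<open>m\<close> is at most
      \<open>m\<close>. The summand at 0 vanishes because \<open>log 2 0 = 0\<close>.\<close>
    define Y where "Y m = (\<Sum>l\<le>m. nat \<lfloor>real Q0 * log 2 (real l)\<rfloor>)" for m
    define X where "X m = (if m \<le> length T then Y m else 0)" for m
    let ?h = "block_entropy ?\<phi> \<sigma> k"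
    let ?c = "cost \<sigma> k (Adaptive (\<lambda>_. \<gamma>'))" and ?c' = "cost \<sigma> k (Adaptive g)"
    have N: "N = Suc (length T)" by (simp add: N_def cells_def)
    then have N0: "0 < N" by simp
    have w1: "(1::nat) < 2 ^ w" using w7 by (intro one_less_power) simp_all
    note fits = poly_less[OF Hw[folded N_def] N0]
    have KK: "K2 \<le> K2 * K3" "K3 \<le> K2 * K3" "0 < K2" using K3(2) K12 K1(2) by simp_all
    have Q0: "0 < Q0" using KK N0 by (simp add: Q0_def)
    have Gh5: "Gh = K2 * K3 * N ^ 5" by (simp add: Gh_def Q0_def numeral_eq_Suc ac_simps)
    have K2w: "K2 < 2 ^ w" by (rule fits[of _ K2 0]) (auto simp: H_def)
    have K1w: "K1 < 2 ^ w" by (rule fits[of _ K1 0]) (auto simp: H_def)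
    have K3w: "K3 < 2 ^ w" by (rule fits[of _ K3 0]) (auto simp: H_def)
    have NN: "N * N < 2 ^ w" by (rule fits[of _ 1 2]) (auto simp: H_def power2_eq_square)
    have NNN: "N * (N * N) < 2 ^ w" by (rule fits[of _ 1 3]) (auto simp: H_def power3_eq_cube)
    have Qw: "K2 * (N * N) < 2 ^ w" by (rule fits[of _ K2 2]) (auto simp: H_def power2_eq_square)
    have Glw: "K1 * N < 2 ^ w" by (rule fits[of _ K1 1]) (auto simp: H_def)
    have K3N: "K3 * (N * (N * N)) < 2 ^ w" by (rule fits[of _ K3 3]) (auto simp: H_def power3_eq_cube)
    have Ghw: "2 * (Gh + 1) < 2 ^ w"
    proof (rule fits[of _ "2 * (K2 * K3 + 1)" 5])
      have "1 \<le> N ^ 5" using N0 by simp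
      then show "2 * (Gh + 1) \<le> 2 * (K2 * K3 + 1) * N ^ 5" unfolding Gh5 by (simp add: distrib_right)
    qed (auto simp: H_def)
    have Ghw': "Gh < 2 ^ w" by (rule le_less_trans[OF _ Ghw]) simp
    have Nw: "2 * N + k < 2 ^ w" by (rule fits[of _ "2 + k" 1]) (use N0 in \<open>auto simp: H_def\<close>)
    have Nw': "17 * N < 2 ^ w" by (rule fits[of _ 17 1]) (auto simp: H_def)
    have XB4: "4 * (length T * (Q0 * N)) < 2 ^ w"
    proof (rule fits[of _ "4 * K2" 4])
      have "length T * (Q0 * N) \<le> N * (Q0 * N)" using N by (intro mult_le_mono1) simp
      also have "\<dots> = K2 * N ^ 4" by (simp add: Q0_def power4_eq_xxxx ac_simps)
      finally have "length T * (Q0 * N) \<le> K2 * N ^ 4" .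
      from mult_le_mono2[OF this, of 4] show "4 * (length T * (Q0 * N)) \<le> 4 * K2 * N ^ 4" by (simp only: mult.assoc)
    qed (auto simp: H_def)
    have GlGh: "Gl \<le> Gh"
    proof -
      have "K1 * N \<le> (K2 * K3) * N ^ 5" using N0 by (intro mult_le_mono le_trans[OF K12 KK(1)] self_le_power) auto
      then show ?thesis by (simp add: Gl_def Gh5)
    qed
    have cost: "cost \<sigma> k (Adaptive g') S = ?h S + g' \<sigma>" if "S \<noteq> []" for S g' using length_Hka[OF that] by simp
    have h: "0 \<le> ?h S" for S using adaptive_entropy_gap[of \<sigma> k S] by linarith
    \<comment> \<open>Costs are not negative, and a single symbol costs exactly \<gamma>.\<close>
    have "sublist [hd T] T" using T(1) sublist_appendI[of "[hd T]" "[]" "tl T"] by simp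
    then have "0 \<le> ?c' [hd T]" using adm unfolding admissible_def by blast
    then have \<gamma>: "0 \<le> \<gamma>" by (simp only: single_cost \<gamma>_def)
    have w0: "0 < w" using w7 by simp
    have Q\<gamma>: "0 \<le> real Q0 * \<gamma>" using \<gamma> by simp
    have s_le: "s \<le> real Q0 * \<gamma>" and s_ge: "s \<le> Gh \<Longrightarrow> real Q0 * \<gamma> < real s + 1"
      unfolding s_def using signed_word_bounds[OF Q\<gamma> w0] Ghw by blast+
    have G0: "real G0 \<le> real Q0 * \<gamma>'" "real Q0 * \<gamma>' \<le> real G0 + 1" "G0 = signed_word w (real Q0 * \<gamma>')"
      "Gl \<le> G0" "G0 \<le> Gh"
    proof -
      have Gh2: "2 * Gh < 2 ^ w" by (rule le_less_trans[OF _ Ghw]) simp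
      have Gl2: "2 * Gl < 2 ^ w" by (rule le_less_trans[OF _ Gh2]) (use GlGh in simp)
      note sl = signed_word_nat[OF Gl2 w0] signed_word_nat[OF Gh2 w0]
      consider "s < Gl" | "Gl \<le> s" "Gh < s" | "Gl \<le> s" "s \<le> Gh" by linarith
      then have "real G0 \<le> real Q0 * \<gamma>' \<and> real Q0 * \<gamma>' \<le> real G0 + 1 \<and> G0 = signed_word w (real Q0 * \<gamma>') \<and> Gl \<le> G0 \<and> G0 \<le> Gh"
      proof cases
        case 1
        then have "G0 = Gl" "real Q0 * \<gamma>' = real Gl" using GlGh Q0 by (simp_all add: G0_def s1_def \<gamma>'_def)
        then show ?thesis using sl GlGh by simp
      next
        case 2
        then have "G0 = Gh" "real Q0 * \<gamma>' = real Gh" using GlGh Q0 by (simp_all add: G0_def s1_def \<gamma>'_def)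
        then show ?thesis using sl GlGh by simp
      next
        case 3
        then have "G0 = s" "\<gamma>' = \<gamma>" by (simp_all add: G0_def s1_def \<gamma>'_def)
        then show ?thesis using 3 s_le s_ge s_def by simp
      qed
      then show "real G0 \<le> real Q0 * \<gamma>'" "real Q0 * \<gamma>' \<le> real G0 + 1" "G0 = signed_word w (real Q0 * \<gamma>')"
        "Gl \<le> G0" "G0 \<le> Gh" by blast+
    qed
    have "0 < Gl" using K1 N0 by (simp add: Gl_def)
    then have "0 < real Q0 * \<gamma>'" using G0(1,4) by linarith
    then have \<gamma>': "0 < \<gamma>'" using Q0 by (simp add: zero_less_mult_iff)
    \<comment> \<open>The additive term of the adaptive estimate is the same for all pieces.
      Monotonicity of the cost is therefore monotonicity of the entropy, and survives the change of
      the term.\<close>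
    have adm': "admissible ?c T" unfolding admissible_def
    proof (intro allI impI, elim conjE)
      fix S S' assume S: "S \<noteq> []" "sublist S S'" "sublist S' T"
      then have "?c' S \<le> ?c' S'" using adm unfolding admissible_def by blast
      moreover have S': "S' \<noteq> []" using S(1,2) by auto
      ultimately have "?h S \<le> ?h S'" unfolding cost[OF S(1)] cost[OF S'] by simp
      then show "0 \<le> ?c S \<and> ?c S \<le> ?c S'" unfolding cost[OF S(1)] cost[OF S'] using h[of S] \<gamma>' by simp
    qed
    have Y: "real (Y m) \<le> real Q0 * ?\<phi> m \<and> real Q0 * ?\<phi> m \<le> real (Y m + m)" for m
    proof (induction m)
      case 0
      then show ?case by (simp add: Y_def log_zero)
    next
      case (Suc m)
      define z where "z = real Q0 * log 2 (real (Suc m))"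
      have "0 \<le> z" by (simp add: z_def)
      then have "real (nat \<lfloor>z\<rfloor>) \<le> z" "z \<le> real (nat \<lfloor>z\<rfloor>) + 1" by linarith+
      moreover have "Y (Suc m) = Y m + nat \<lfloor>z\<rfloor>" by (simp only: Y_def z_def sum.atMost_Suc)
      moreover have "real Q0 * ?\<phi> (Suc m) = z + real Q0 * ?\<phi> m" unfolding log2_fact_Suc z_def by (simp only: distrib_left)
      ultimately show ?case using Suc unfolding of_nat_add of_nat_Suc by linarith
    qed
    have YN: "Y m \<le> m * (Q0 * N)" if "m \<le> length T" for m
      using that
    proof (induction m)
      case 0
      then show ?case by (simp add: Y_def log_zero)
    next
      case (Suc m)
      have "log 2 (real (Suc m)) \<le> N" using log2_le_self[of "Suc m"] Suc.prems N by linarith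
      then have "real Q0 * log 2 (real (Suc m)) \<le> real Q0 * N" by (intro mult_left_mono) auto
      then have "nat \<lfloor>real Q0 * log 2 (real (Suc m))\<rfloor> \<le> Q0 * N" by (simp add: nat_le_iff floor_le_iff)
      then show ?case using Suc by (simp add: Y_def)
    qed
    have "implementation X (\<lambda>_ _. G0) Q0 G0 (Q0 * N) (\<lambda>x y. g x) gi fe xe k H 5 \<eta> w \<sigma> T ?c"
    proof (rule window_implementation[where \<phi> = ?\<phi> and y = "\<lambda>_ _. \<gamma>'", OF T w7 Nw[unfolded N_def] Nw'[unfolded N_def] XB4])
      show "?c S = ?h S + \<gamma>'" if "S \<noteq> []" for S by (rule cost[OF that])
      show "0 \<le> ?h S" for S by (rule h)
      show "X 0 = 0" by (simp add: X_def Y_def log_zero)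
      show "real (X m) \<le> real Q0 * ?\<phi> m \<and> real Q0 * ?\<phi> m \<le> real (X m + m)" if "m \<le> length T" for m
        using Y[of m] that by (simp add: X_def)
      show "X m \<le> m * (Q0 * N)" for m using YN[of m] by (simp add: X_def)
      show "Q0 * N \<le> H * cells T ^ 5"
      proof -
        have "Q0 * N = K2 * N ^ 3" by (simp add: Q0_def power3_eq_cube)
        also have "\<dots> \<le> H * N ^ 5" using N0 by (intro mult_le_mono power_increasing) (auto simp: H_def)
        finally show ?thesis by (simp add: N_def)
      qed
      show "G0 \<le> H * cells T ^ 5"
      proof -
        have "K2 * K3 * N ^ 5 \<le> H * N ^ 5" by (intro mult_le_mono1) (simp add: H_def)
        then show ?thesis using G0(5) unfolding Gh5 N_def by linarith
      qed
      show "3 * real (cells T) \<le> \<eta> * real G0"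
      proof -
        have "3 \<le> \<eta> * K1" using K1(1) \<eta> by (simp add: pos_divide_le_eq mult.commute)
        from mult_right_mono[OF this, of "real N"] have "3 * real N \<le> \<eta> * real Gl" by (simp add: Gl_def mult.assoc)
        also have "\<dots> \<le> \<eta> * G0" using G0(4) \<eta> by (intro mult_left_mono) auto
        finally show ?thesis by (simp add: N_def)
      qed
      have "3 * N \<le> Gl" using K1(2) by (simp add: Gl_def)
      then show "3 * cells T \<le> G0" using G0(4) unfolding N_def by linarith
      fix M v A assume m: "machine w M (cells T)" and v: "v vn = length T" "v vN = cells T"
      interpret m: machine "\<lambda>x y. g x" w M "cells T" by (rule m)
      { assume "v vG = G0"
        then show "m.ok fe v A \<and> m.ev fe v A = G0" by (simp add: fe_def)
      next
        assume p: "v vQ = Q0" "v vp \<le> length T" "v vacc = (if v vp = 0 then 0 else X (v vp - 1))"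
        let ?z = "nat \<lfloor>real Q0 * log 2 (real (v vp))\<rfloor>"
        have e: "v vacc + ?z = X (v vp)" using p(2,3) by (cases "v vp") (auto simp: X_def Y_def log_zero)
        have "length T * (Q0 * N) < 2 ^ w" by (rule le_less_trans[OF _ XB4]) simp
        moreover have "Y (v vp) \<le> length T * (Q0 * N)" by (rule le_trans[OF YN[OF p(2)] mult_le_mono1[OF p(2)]])
        ultimately have Xw: "X (v vp) < 2 ^ w" using p(2) by (simp add: X_def)
        have zw: "?z < 2 ^ w" by (rule le_less_trans[OF _ Xw]) (use e in linarith)
        show "m.ok xe v A \<and> m.ev xe v A = X (v vp)" using e Xw zw p(1) by (simp add: xe_def)
      next
        assume v1: "v 1 = \<sigma>"
        have "signed_word w (real (K2 * (N * N)) * g (v 1)) = s" by (simp only: s_def Q0_def \<gamma>_def v1)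
        then show "m.wp gi (\<lambda>v' A'. A' = A \<and> v' vQ = Q0 \<and> v' vG = G0 \<and> (\<forall>x. x \<notin> {vQ, vG, vx, vy} \<longrightarrow> v' x = v x)) v A"
          using N0 v K1w K2w K3w NN NNN Qw Glw K3N Ghw'
          by (cases "s < K1 * N") (simp_all add: gi_def G0_def s1_def Gl_def Gh_def Q0_def N_def)
      }
    qed (use Q0 adm' G0 in auto)
    then have "implements (\<lambda>x y. g x) gi fe xe k H 5 \<eta> w \<sigma> T ?c" unfolding implements_def by blast
    moreover have "partition_cost ?c' P \<le> q ^ 4 * min_partition_cost ?c' T"
      if P: "is_partition T P" and le: "partition_cost ?c P \<le> q ^ 3 * min_partition_cost ?c T" for P
    proof -
      define hs where "hs P = sum_list (map ?h P)" for P
      have pc: "partition_cost (cost \<sigma> k (Adaptive g')) P = hs P + real (length P) * g' \<sigma>" if "is_partition T P" for P g'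
      proof -
        have "partition_cost (cost \<sigma> k (Adaptive g')) P = sum_list (map (\<lambda>S. ?h S + g' \<sigma>) P)"
          unfolding partition_cost_def using sublist_piece[OF that] cost by (intro arg_cong[where f = sum_list] map_cong) auto
        then show ?thesis by (simp add: sum_list_addf sum_list_triv hs_def)
      qed
      obtain R where R: "is_partition T R" "min_partition_cost ?c' T = partition_cost ?c' R"
        using min_partition_cost_attained by blast
      have "q ^ 3 * min_partition_cost ?c T \<le> q ^ 3 * partition_cost ?c R"
        using q min_partition_cost_le[OF R(1)] by (intro mult_left_mono) auto
      with le have le': "hs P + length P * \<gamma>' \<le> q ^ 3 * (hs R + length R * \<gamma>')" unfolding pc[OF P] pc[OF R(1)] by linarith
      have Rn: "length R \<le> length T" using R(1) length_le_length_concat[of R] by (auto simp: is_partition_def)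
      have R1: "1 \<le> real (length R)" using R(1) T(1) by (cases R) (auto simp: is_partition_def)
      have gap: "hs P = 0 \<or> 1 \<le> hs P" for P unfolding hs_def by (rule sum_list_gap, rule adaptive_entropy_gap)
      then have hs0: "0 \<le> hs P" for P by (rule disjE[of "hs P = 0" "1 \<le> hs P"]) auto
      consider "s < Gl" | "Gl \<le> s" "Gh < s" | "Gl \<le> s" "s \<le> Gh" by linarith
      then have "hs P + length P * \<gamma> \<le> q ^ 4 * (hs R + length R * \<gamma>)"
      proof cases
        case 1
        then have Q\<gamma>': "real Q0 * \<gamma>' = real Gl" using Q0 by (simp add: \<gamma>'_def)
        have "real Q0 * \<gamma> < real Gl" using s_ge 1 GlGh by linarith
        then have "real Q0 * \<gamma> \<le> real Q0 * \<gamma>'" unfolding Q\<gamma>' by simp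
        then have \<gamma>\<gamma>': "\<gamma> \<le> \<gamma>'" using Q0 by simp
        have "real K2 * (real N * \<gamma>') * N = real K1 * N" using Q\<gamma>' by (simp add: Q0_def Gl_def ac_simps)
        then have N\<gamma>: "real K2 * (real N * \<gamma>') = K1" using N0 by simp
        have nN: "real (length T) * \<gamma>' \<le> real N * \<gamma>'" using N \<gamma>' by (intro mult_right_mono) auto
        have "real K1 \<le> \<eta> * K2" using K2(2) \<eta> by (simp add: pos_divide_le_eq mult.commute)
        then have "real K2 * (real N * \<gamma>') \<le> real K2 * \<eta>" unfolding N\<gamma> by (simp add: mult.commute)
        then have a1: "real N * \<gamma>' \<le> \<eta>" using KK(3) by simp
        have e: "real K2 * (q ^ 3 * (real N * \<gamma>')) = q ^ 3 * K1" unfolding N\<gamma>[symmetric] by simp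
        have "real K2 * (q ^ 3 * (real N * \<gamma>')) < real K2 * 1" unfolding e mult_1_right by (rule K2(1))
        then have a2: "q ^ 3 * (real N * \<gamma>') < 1" using KK(3) by (simp only: mult_less_cancel_left_pos of_nat_0_less_iff)
        have "q ^ 3 * (real (length T) * \<gamma>') \<le> q ^ 3 * (real N * \<gamma>')" using nN q by (intro mult_left_mono) auto
        then have a3: "q ^ 3 * (real (length T) * \<gamma>') < 1" using a2 by linarith
        have a4: "real (length T) * \<gamma>' \<le> q - 1" using nN a1 by (simp add: \<eta>_def)
        show ?thesis
          by (rule adaptive_transfer_low[OF q le' \<gamma> \<gamma>\<gamma>' \<gamma>' _ _ _ a4 a3 gap gap]) (use Rn in auto)
      next
        case 2
        then have "\<gamma>' = Gh / Q0" by (simp add: \<gamma>'_def)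
        then have g3: "\<gamma>' = real (K3 * (N * (N * N)))" using Q0 by (simp add: Gh_def)
        have "real Q0 * \<gamma>' \<le> real Q0 * \<gamma>"
        proof -
          have "real Q0 * \<gamma>' = real Gh" using \<open>\<gamma>' = Gh / Q0\<close> Q0 by simp
          then show ?thesis using s_le 2(2) by linarith
        qed
        then have \<gamma>\<gamma>': "\<gamma>' \<le> \<gamma>" using Q0 by simp
        have hT: "?h T \<le> real (length T) * N"
        proof -
          interpret tm: text_machine "\<lambda>x y. g x" w "17 * cells T" T k
            by unfold_locales (use T w7 Nw Nw' in \<open>auto simp: N_def\<close>)
          show ?thesis
          proof (rule tm.block_entropy_le[where b = "real N", OF T(2)])
            fix m assume "m \<le> length T"
            then have "real m * real m \<le> real m * real N" using N by (intro mult_left_mono) auto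
            then show "?\<phi> m \<le> real m * real N" using log2_fact_le[of m] by linarith
          qed (simp_all add: log2_fact_nonneg)
        qed
        \<comment> \<open>The additive term cancels in the monotonicity of the cost, so no piece has
          more entropy than the whole text.\<close>
        have "?h S \<le> ?h T" if "S \<in> set R" for S
        proof -
          have S: "S \<noteq> []" "sublist S T" using sublist_piece[OF R(1) that] by auto
          then have "?c' S \<le> ?c' T" using adm unfolding admissible_def by blast
          then show ?thesis unfolding cost[OF S(1)] cost[OF T(1)] by simp
        qed
        then have "hs R \<le> sum_list (map (\<lambda>_. ?h T) R)" unfolding hs_def by (intro sum_list_mono)
        also have "\<dots> = real (length R) * ?h T" by (simp add: sum_list_triv)
        also have "\<dots> \<le> real N * (real N * real N)"
        proof (rule mult_mono)
          show "?h T \<le> real N * real N" 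
            by (rule order_trans[OF hT], rule mult_right_mono) (use N in auto)
        qed (use Rn N h in auto)
        also have "\<dots> \<le> (q - 1) * \<gamma>'"
        proof -
          have "1 \<le> \<eta> * K3" using K3(1) \<eta> by (simp add: pos_divide_le_eq mult.commute)
          then have "1 * (real N * (real N * real N)) \<le> (\<eta> * K3) * (real N * (real N * real N))" by (intro mult_right_mono) auto
          also have "\<dots> = (q - 1) * \<gamma>'" unfolding g3 \<eta>_def of_nat_mult by (simp only: mult.assoc)
          finally show ?thesis by simp
        qed
        finally have hR: "hs R \<le> (q - 1) * \<gamma>'" .
        show ?thesis by (rule adaptive_transfer_high[OF q le' \<gamma>' \<gamma>\<gamma>' R1 hs0 hs0 hR])
      next
        case 3
        then have e: "\<gamma>' = \<gamma>" by (simp add: \<gamma>'_def)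
        have "q ^ 3 * (hs R + length R * \<gamma>) \<le> q ^ 4 * (hs R + length R * \<gamma>)"
          using q hs0[of R] \<gamma> by (intro mult_right_mono power_increasing) auto
        then show ?thesis using le' unfolding e by linarith
      qed
      then show ?thesis unfolding R(2) pc[OF P] pc[OF R(1)] \<gamma>_def .
    qed
    ultimately show ?thesis by blast
  qed
  show ?thesis unfolding approximable_def F
    by (rule exI[of _ gi], rule exI[of _ fe], rule exI[of _ xe], rule exI[of _ H], rule exI[of _ 5],
      intro conjI allI impI, simp add: fe_def, simp add: xe_def, simp add: gi_def, rule main[unfolded \<eta>_def])
qed

lemma approximable: "1 < q \<Longrightarrow> approximable est k q"
proof (cases est)
  case (NonAdaptive f)
  then show "1 < q \<Longrightarrow> approximable est k q"
    using approximable_positive[of q f k] approximable_nonpositive[of q f k] by (cases "0 < f 1 1") auto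
qed (simp add: approximable_adaptive)

theorem theorem4:
  fixes k A a :: nat and est :: estimate
  shows "\<exists>C::real. \<forall>\<epsilon>::real. \<epsilon> > 0 \<longrightarrow>
    (\<exists>(P :: com) (d :: nat) (n\<^sub>0 :: nat).
      \<forall>(n :: nat) (\<sigma> :: nat) (T :: nat list).
        n \<ge> 1 \<and> length T = n \<and> set T \<subseteq> {..<\<sigma>} \<and> \<sigma> \<le> A * n ^ a \<and>
        admissible (cost \<sigma> k est) T \<longrightarrow>
        (\<exists>M t s.
          run (extra_term est) (word_length d n) M P (input_state (word_length d n) \<sigma> T) t s \<and>
          output_in_memory M s \<and>
          is_partition T (output_partition T s) \<and>
          partition_cost (cost \<sigma> k est) (output_partition T s)
            \<le> (1 + \<epsilon>) * min_partition_cost (cost \<sigma> k est) T \<and>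
          (n \<ge> n\<^sub>0 \<longrightarrow>
            real t \<le> C * (real n * log (1 + \<epsilon>) (real n)) \<and>
            real M \<le> C * real n)))"
proof (rule exI[of _ "real (100000 * (k + 3) * (a + A + 1))"], intro allI impI)
  fix \<epsilon> :: real assume \<epsilon>: "0 < \<epsilon>"
  define q where "q = root 4 (1 + \<epsilon>)"
  have q: "1 < q" using \<epsilon> by (simp add: q_def)
  have q4: "q ^ 4 = 1 + \<epsilon>" using \<epsilon> by (simp add: q_def)
  obtain gi fe xe H e where times: "expr_time fe \<le> 40" "expr_time xe \<le> 40" "loopfree_time gi \<le> 100"
    and inst: "\<And>w \<sigma> T. T \<noteq> [] \<Longrightarrow> set T \<subseteq> {..<\<sigma>} \<Longrightarrow> \<sigma> < 2 ^ w \<Longrightarrow> admissible (cost \<sigma> k est) T \<Longrightarrow>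
        H * cells T ^ e \<le> 2 ^ w \<Longrightarrow> 7 \<le> w \<Longrightarrow>
        (\<exists>wt. implements (extra_term est) gi fe xe k H e (q - 1) w \<sigma> T wt \<and>
          (\<forall>P. is_partition T P \<longrightarrow> partition_cost wt P \<le> q ^ 3 * min_partition_cost wt T \<longrightarrow>
            partition_cost (cost \<sigma> k est) P \<le> q ^ 4 * min_partition_cost (cost \<sigma> k est) T))"
    using approximable[OF q, of est k] unfolding approximable_def by meson
  show "\<exists>(P :: com) (d :: nat) (n\<^sub>0 :: nat).
      \<forall>(n :: nat) (\<sigma> :: nat) (T :: nat list).
        n \<ge> 1 \<and> length T = n \<and> set T \<subseteq> {..<\<sigma>} \<and> \<sigma> \<le> A * n ^ a \<and>
        admissible (cost \<sigma> k est) T \<longrightarrow>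
        (\<exists>M t s.
          run (extra_term est) (word_length d n) M P (input_state (word_length d n) \<sigma> T) t s \<and>
          output_in_memory M s \<and>
          is_partition T (output_partition T s) \<and>
          partition_cost (cost \<sigma> k est) (output_partition T s)
            \<le> (1 + \<epsilon>) * min_partition_cost (cost \<sigma> k est) T \<and>
          (n \<ge> n\<^sub>0 \<longrightarrow>
            real t \<le> real (100000 * (k + 3) * (a + A + 1)) * (real n * log (1 + \<epsilon>) (real n)) \<and>
            real M \<le> real (100000 * (k + 3) * (a + A + 1)) * real n))"
    unfolding q4[symmetric]
    by (rule approximation_program[where cst = "\<lambda>\<sigma>. cost \<sigma> k est", OF q times]) (rule inst; assumption)
qed

end
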